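(* Let $T>0$ and let $B_1=(\nabla^{\perp}\psi_1,Z_1)$ and $B_2=(\nabla^{\perp}\psi_2,Z_2)$ be weak solutions on $[0,T]$ of the system $$\psi_t-\Delta\psi=[\psi,Z],\qquad Z_t-\Delta Z=[\Delta\psi,\psi]\qquad\text{on }\mathbb{R}^2,$$ with the same initial data $(\nabla\psi_0,Z_0)\in L^2(\mathbb{R}^2)$. Suppose that $$(\Delta\psi_2,\nabla Z_2)\in L^{q}\big([0,T];L^{p}(\mathbb{R}^2)\big)\quad\text{for some } p,q \text{ with }\ \frac1p+\frac1q=\frac12,\quad 2\le q<\infty .$$ (Here $q$ is the time exponent and $p$ the space exponent; $p=\infty$ when $q=2$.) Then $B_1=B_2$ on $[0,T]$.
   Context: For functions on $\mathbb{R}^2$, $[f,g]=f_xg_y-f_yg_x$ and $\nabla^{\perp}f=(-f_y,f_x)$. A weak solution on $[0,T]$ with initial data $(\nabla\psi_0,Z_0)\in L^2$ is a pair $(\psi,Z)$ with $(\nabla\psi,Z)\in L^\infty(0,T;L^2)$ and $(\Delta\psi,\nabla Z)\in L^2(0,T;L^2)$, satisfying the equations in the sense of distributions (with $[\Delta\psi,\psi]$ understood as $\partial_x(\Delta\psi\,\psi_y)-\partial_y(\Delta\psi\,\psi_x)$), attaining the initial data, and satisfying the energy inequality $$\|\nabla\psi(t)\|_{L^2}^2+\|Z(t)\|_{L^2}^2+2\int_0^t\big(\|\Delta\psi(s)\|_{L^2}^2+\|\nabla Z(s)\|_{L^2}^2\big)ds\le\|\nabla\psi_0\|_{L^2}^2+\|Z_0\|_{L^2}^2$$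 for $t\in(0,T]$. *)

theory Defs
  imports "HOL-Analysis.Analysis" "HOL-Probability.Essential_Supremum"
begin

section \<open>Test functions\<close>

definition dir_deriv :: "'a::euclidean_space \<Rightarrow> ('a \<Rightarrow> real) \<Rightarrow> 'a \<Rightarrow> real" where
  "dir_deriv b \<phi> z = frechet_derivative \<phi> (at z) b"

primrec Ck :: "nat \<Rightarrow> ('a::euclidean_space \<Rightarrow> real) \<Rightarrow> bool" where
  "Ck 0 \<phi> \<longleftrightarrow> continuous_on UNIV \<phi>"
| "Ck (Suc k) \<phi> \<longleftrightarrow> (\<forall>z. \<phi> differentiable (at z)) \<and> (\<forall>b\<in>Basis. Ck k (dir_deriv b \<phi>))"

definition test_functions :: "'a::euclidean_space set \<Rightarrow> ('a \<Rightarrow> real) set" where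
  "test_functions \<Omega> = {\<phi>. (\<forall>k. Ck k \<phi>) \<and> compact (closure {z. \<phi> z \<noteq> 0}) \<and> closure {z. \<phi> z \<noteq> 0} \<subseteq> \<Omega>}"


section \<open>Weak derivatives\<close>

definition loc_integrable ::
    "'a::euclidean_space set \<Rightarrow> ('a \<Rightarrow> 'b::{banach, second_countable_topology}) \<Rightarrow> bool" where
  "loc_integrable \<Omega> u \<longleftrightarrow> (\<forall>K. compact K \<and> K \<subseteq> \<Omega> \<longrightarrow> set_integrable lborel K u)"

definition has_weak_deriv ::
    "'a::euclidean_space set \<Rightarrow> 'a \<Rightarrow> ('a \<Rightarrow> real) \<Rightarrow> ('a \<Rightarrow> real) \<Rightarrow> bool" where
  "has_weak_deriv \<Omega> b u v \<longleftrightarrow> loc_integrable \<Omega> u \<and> loc_integrable \<Omega> v \<and>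
     (\<forall>\<phi>\<in>test_functions \<Omega>.
        (\<integral>z. u z * dir_deriv b \<phi> z \<partial>lborel) = - (\<integral>z. v z * \<phi> z \<partial>lborel))"

text \<open>A weak derivative is determined only up to a null set of \<open>\<Omega>\<close>; \<open>weak_deriv\<close> picks a
  representative, so everything below is insensitive to changes on null sets.
  Its value is meaningful only if a weak derivative exists.\<close>

definition weak_deriv :: "'a::euclidean_space set \<Rightarrow> 'a \<Rightarrow> ('a \<Rightarrow> real) \<Rightarrow> 'a \<Rightarrow> real" where
  "weak_deriv \<Omega> b u = (SOME v. has_weak_deriv \<Omega> b u v)"

definition slab :: "real \<Rightarrow> (real \<times> (real^2)) set" where
  "slab T = {0<..<T} \<times> UNIV"

definition e_t :: "real \<times> (real^2)" where
  "e_t = (1, 0)"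

definition e_x :: "2 \<Rightarrow> real \<times> (real^2)" where
  "e_x i = (0, axis i 1)"

definition laplacian :: "(real \<times> (real^2) \<Rightarrow> real) \<Rightarrow> real \<times> (real^2) \<Rightarrow> real" where
  "laplacian \<phi> z = (\<Sum>i\<in>UNIV. dir_deriv (e_x i) (dir_deriv (e_x i) \<phi>) z)"

definition has_gradient :: "real \<Rightarrow> (real \<times> (real^2) \<Rightarrow> real) \<Rightarrow> bool" where
  "has_gradient T u \<longleftrightarrow> (\<forall>i. \<exists>v. has_weak_deriv (slab T) (e_x i) u v)"

definition gradient :: "real \<Rightarrow> (real \<times> (real^2) \<Rightarrow> real) \<Rightarrow> real \<times> (real^2) \<Rightarrow> real^2" where
  "gradient T u z = (\<chi> i. weak_deriv (slab T) (e_x i) u z)"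

definition has_weak_laplacian ::
    "real \<Rightarrow> (real \<times> (real^2) \<Rightarrow> real) \<Rightarrow> (real \<times> (real^2) \<Rightarrow> real) \<Rightarrow> bool" where
  "has_weak_laplacian T u v \<longleftrightarrow> loc_integrable (slab T) u \<and> loc_integrable (slab T) v \<and>
     (\<forall>\<phi>\<in>test_functions (slab T).
        (\<integral>z. u z * laplacian \<phi> z \<partial>lborel) = (\<integral>z. v z * \<phi> z \<partial>lborel))"

definition weak_laplacian :: "real \<Rightarrow> (real \<times> (real^2) \<Rightarrow> real) \<Rightarrow> real \<times> (real^2) \<Rightarrow> real" where
  "weak_laplacian T u = (SOME v. has_weak_laplacian T u v)"

definition has_gradient0 :: "(real^2 \<Rightarrow> real) \<Rightarrow> bool" where
  "has_gradient0 u \<longleftrightarrow> (\<forall>i. \<exists>v. has_weak_deriv UNIV (axis i 1) u v)"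

definition gradient0 :: "(real^2 \<Rightarrow> real) \<Rightarrow> real^2 \<Rightarrow> real^2" where
  "gradient0 u x = (\<chi> i. weak_deriv UNIV (axis i 1) u x)"


section \<open>Lebesgue and Bochner norms\<close>

definition ennreal_pow :: "ennreal \<Rightarrow> real \<Rightarrow> ennreal" where
  "ennreal_pow a r = (if a = \<infinity> then \<infinity> else ennreal (enn2real a powr r))"

definition Lp_ennorm :: "ennreal \<Rightarrow> 'a measure \<Rightarrow> ('a \<Rightarrow> ennreal) \<Rightarrow> ennreal" where
  "Lp_ennorm p M g =
     (if p = \<infinity> then esssup M g
      else ennreal_pow (\<integral>\<^sup>+x. ennreal_pow (g x) (enn2real p) \<partial>M) (1 / enn2real p))"

definition Lp_norm :: "ennreal \<Rightarrow> 'a measure \<Rightarrow> ('a \<Rightarrow> 'b::real_normed_vector) \<Rightarrow> ennreal" where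
  "Lp_norm p M f = Lp_ennorm p M (\<lambda>x. ennreal (norm (f x)))"

definition in_Lp ::
    "ennreal \<Rightarrow> 'a measure \<Rightarrow> ('a \<Rightarrow> 'b::{real_normed_vector, second_countable_topology}) \<Rightarrow> bool" where
  "in_Lp p M f \<longleftrightarrow> f \<in> borel_measurable M \<and> Lp_norm p M f < \<infinity>"

text \<open>\<open>f \<in> L\<^sup>q(0,T; L\<^sup>p(\<real>\<^sup>2))\<close>: the first exponent is the one in time.\<close>

definition in_LqLp ::
    "ennreal \<Rightarrow> ennreal \<Rightarrow> real \<Rightarrow>
     (real \<times> (real^2) \<Rightarrow> 'b::{real_normed_vector, second_countable_topology}) \<Rightarrow> bool" where
  "in_LqLp q p T f \<longleftrightarrow> set_borel_measurable lborel (slab T) f \<and>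
     Lp_ennorm q (restrict_space lborel {0<..<T}) (\<lambda>t. Lp_norm p lborel (\<lambda>x. f (t, x))) < \<infinity>"


section \<open>Weak solutions\<close>

definition perp :: "real^2 \<Rightarrow> real^2" where
  "perp v = vector [- v $ 2, v $ 1]"

text \<open>The bracket \<open>[f,g] = f\<^sub>x g\<^sub>y - f\<^sub>y g\<^sub>x\<close> as a function of \<open>\<nabla>f\<close> and \<open>\<nabla>g\<close>.\<close>

definition bracket :: "real^2 \<Rightarrow> real^2 \<Rightarrow> real" where
  "bracket a b = a $ 1 * b $ 2 - a $ 2 * b $ 1"

definition solves_psi_eq ::
    "real \<Rightarrow> (real \<times> (real^2) \<Rightarrow> real) \<Rightarrow> (real \<times> (real^2) \<Rightarrow> real) \<Rightarrow> bool" where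
  "solves_psi_eq T \<psi> Z \<longleftrightarrow> (\<forall>\<phi>\<in>test_functions (slab T).
     (\<integral>z. \<psi> z * (- dir_deriv e_t \<phi> z - laplacian \<phi> z) \<partial>lborel) =
     (\<integral>z. bracket (gradient T \<psi> z) (gradient T Z z) * \<phi> z \<partial>lborel))"

text \<open>The right-hand side is \<open>\<partial>\<^sub>x(\<Delta>\<psi> \<psi>\<^sub>y) - \<partial>\<^sub>y(\<Delta>\<psi> \<psi>\<^sub>x)\<close>, paired with \<open>\<phi>\<close>.\<close>

definition solves_Z_eq ::
    "real \<Rightarrow> (real \<times> (real^2) \<Rightarrow> real) \<Rightarrow> (real \<times> (real^2) \<Rightarrow> real) \<Rightarrow> bool" where
  "solves_Z_eq T \<psi> Z \<longleftrightarrow> (\<forall>\<phi>\<in>test_functions (slab T).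
     (\<integral>z. Z z * (- dir_deriv e_t \<phi> z - laplacian \<phi> z) \<partial>lborel) =
     - (\<integral>z. (weak_laplacian T \<psi> z * gradient T \<psi> z $ 2) * dir_deriv (e_x 1) \<phi> z \<partial>lborel)
     + (\<integral>z. (weak_laplacian T \<psi> z * gradient T \<psi> z $ 1) * dir_deriv (e_x 2) \<phi> z \<partial>lborel))"

text \<open>Solutions are classes of functions modulo null sets, so time slices are defined for almost
  every \<open>t\<close> only: the initial data are attained as the weak \<open>L\<^sup>2\<close> limit for \<open>t \<down> 0\<close>
  outside some null set of times, and the energy inequality is required for almost every \<open>t\<close>.
  (For the representative that is weakly continuous in time, it then holds for every \<open>t\<close>
  by lower semicontinuity.)\<close>

definition attains_initial_data ::
    "real \<Rightarrow> (real^2 \<Rightarrow> real) \<Rightarrow> (real^2 \<Rightarrow> real) \<Rightarrow>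
     (real \<times> (real^2) \<Rightarrow> real) \<Rightarrow> (real \<times> (real^2) \<Rightarrow> real) \<Rightarrow> bool" where
  "attains_initial_data T \<psi>0 Z0 \<psi> Z \<longleftrightarrow> (\<exists>N\<in>null_sets lborel. \<forall>w :: real^2 \<Rightarrow> (real^2) \<times> real.
     in_Lp 2 lborel w \<longrightarrow>
     ((\<lambda>t. \<integral>x. (gradient T \<psi> (t, x), Z (t, x)) \<bullet> w x \<partial>lborel) \<longlongrightarrow>
       (\<integral>x. (gradient0 \<psi>0 x, Z0 x) \<bullet> w x \<partial>lborel)) (at 0 within {0<..T} - N))"

definition energy_inequality ::
    "real \<Rightarrow> (real^2 \<Rightarrow> real) \<Rightarrow> (real^2 \<Rightarrow> real) \<Rightarrow>
     (real \<times> (real^2) \<Rightarrow> real) \<Rightarrow> (real \<times> (real^2) \<Rightarrow> real) \<Rightarrow> bool" where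
  "energy_inequality T \<psi>0 Z0 \<psi> Z \<longleftrightarrow> (AE t in lborel. t \<in> {0<..T} \<longrightarrow>
     (Lp_norm 2 lborel (\<lambda>x. gradient T \<psi> (t, x)))\<^sup>2 + (Lp_norm 2 lborel (\<lambda>x. Z (t, x)))\<^sup>2
     + 2 * (\<integral>\<^sup>+s\<in>{0..t}. ((Lp_norm 2 lborel (\<lambda>x. weak_laplacian T \<psi> (s, x)))\<^sup>2
                          + (Lp_norm 2 lborel (\<lambda>x. gradient T Z (s, x)))\<^sup>2) \<partial>lborel)
     \<le> (Lp_norm 2 lborel (gradient0 \<psi>0))\<^sup>2 + (Lp_norm 2 lborel Z0)\<^sup>2)"

definition initial_data :: "(real^2 \<Rightarrow> real) \<Rightarrow> (real^2 \<Rightarrow> real) \<Rightarrow> bool" where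
  "initial_data \<psi>0 Z0 \<longleftrightarrow> has_gradient0 \<psi>0 \<and> in_Lp 2 lborel (\<lambda>x. (gradient0 \<psi>0 x, Z0 x))"

definition weak_solution ::
    "real \<Rightarrow> (real^2 \<Rightarrow> real) \<Rightarrow> (real^2 \<Rightarrow> real) \<Rightarrow>
     (real \<times> (real^2) \<Rightarrow> real) \<Rightarrow> (real \<times> (real^2) \<Rightarrow> real) \<Rightarrow> bool" where
  "weak_solution T \<psi>0 Z0 \<psi> Z \<longleftrightarrow>
     has_gradient T \<psi> \<and> (\<exists>v. has_weak_laplacian T \<psi> v) \<and> has_gradient T Z \<and>
     in_LqLp \<infinity> 2 T (\<lambda>z. (gradient T \<psi> z, Z z)) \<and>
     in_LqLp 2 2 T (\<lambda>z. (weak_laplacian T \<psi> z, gradient T Z z)) \<and>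
     solves_psi_eq T \<psi> Z \<and> solves_Z_eq T \<psi> Z \<and>
     attains_initial_data T \<psi>0 Z0 \<psi> Z \<and>
     energy_inequality T \<psi>0 Z0 \<psi> Z"

definition magnetic_field ::
    "real \<Rightarrow> (real \<times> (real^2) \<Rightarrow> real) \<Rightarrow> (real \<times> (real^2) \<Rightarrow> real) \<Rightarrow> real \<times> (real^2) \<Rightarrow> (real^2) \<times> real" where
  "magnetic_field T \<psi> Z z = (perp (gradient T \<psi> z), Z z)"

end

theory Submission imports Defs
begin

text \<open>The argument is the weak-strong uniqueness argument of Leray and Serrin for \<open>(\<nabla>\<psi>, Z)\<close>.
  An identity for the time derivative of the inner product of the two solutions, combined with the
  two energy inequalities, bounds the energy \<open>E\<close> of their difference: the remaining trilinear term
  is absorbed by the dissipation up to \<open>\<integral>|a|\<^sup>2 V\<close>, where \<open>a\<close> is the difference of the gradients and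
  \<open>V = (\<Delta>\<psi>\<^sub>2)\<^sup>2 + |\<nabla>Z\<^sub>2|\<^sup>2\<close>. By the Gagliardo-Nirenberg inequality,
  \<open>\<integral>|a|\<^sup>2 V \<le> \<delta> \<integral>(div a)\<^sup>2 + c(\<delta>) \<integral>|a|\<^sup>2\<close> for curl-free \<open>a\<close>, and the Serrin condition
  makes \<open>c(1)\<close> integrable in time, so that \<open>E = 0\<close> by Gronwall's lemma.

  The products in the equations of the first solution are merely integrable in space and cannot be
  tested directly with the second solution. Both solutions are therefore mollified in space. A
  mollified pairing depends on the kernel only through its autocorrelation, so passing to the limit
  needs only the continuity at \<open>h = 0\<close> of correlations such as \<open>\<integral>a(y + h) p(y + h) e(y) dy\<close>, which
  the form bound for \<open>e\<^sup>2 \<le> V\<close> provides.\<close>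

section \<open>Square integrable functions\<close>

text \<open>Let \<open>a\<close>, \<open>l\<close>, \<open>d\<close> be the differences of
  \<nabla>\<psi>, \<Delta>\<psi>, \<nabla>Z and \<open>M\<close>, \<open>W\<close> the values of
  \<Delta>\<psi>, \<nabla>Z for the second solution. The cubic terms of the identity collapse to M
  (a x d) - l (a x W), with x the planar cross product: the derivatives of the first solution
  survive only inside differences, hence the condition on one solution only. Energy balance provides
  two copies of |l|^2 + |d|^2. Completing squares spends one and leaves |a|^2 V; the l-part of the
  other pays for the form bound at \<delta> = 1. So only c(1) has to be integrable in time, whereas
  small \<delta> serves the continuity of correlations. Exponents: with g^2 = V and s = p/2, c(1) is
  of order (1 + \<integral>g^p)^(1/(s-1)), and 1/(s-1) = q/p by the Serrin relation, which gives the
  time integrand |g|_p^q. No representative continuous in time is constructed: every identity is a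
  primitive of an integrable function, valid for almost all times, with an unknown constant. As the
  data are attained weakly only, that constant is not computed but bounded below by the initial
  energy, which is the direction required.\<close>

definition L2 :: "'a measure \<Rightarrow> ('a \<Rightarrow> real) set" where
  "L2 M = {f \<in> borel_measurable M. integrable M (\<lambda>x. (f x)\<^sup>2)}"

lemma L2D:
  assumes "f \<in> L2 M"
  shows L2_measurable: "f \<in> borel_measurable M" and L2_integrable: "integrable M (\<lambda>x. (f x)\<^sup>2)"
  using assms by (auto simp: L2_def)

lemma abs_mult_le_half_squares: "\<bar>a * b\<bar> \<le> (a\<^sup>2 + b\<^sup>2) / 2" for a b :: real
  using zero_le_power2[of "\<bar>a\<bar> - \<bar>b\<bar>"] by (simp add: power2_diff abs_mult)

lemma square_add_le: "(a + b)\<^sup>2 \<le> 2 * a\<^sup>2 + 2 * b\<^sup>2" for a b :: real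
  using zero_le_power2[of "a - b"] by (simp add: power2_diff power2_sum)

lemma L2_mult_integrable:
  assumes "f \<in> L2 M" "g \<in> L2 M"
  shows "integrable M (\<lambda>x. f x * g x)"
proof (rule Bochner_Integration.integrable_bound)
  show "integrable M (\<lambda>x. ((f x)\<^sup>2 + (g x)\<^sup>2) / 2)"
    using assms by (auto simp: L2_def)
  show "(\<lambda>x. f x * g x) \<in> borel_measurable M"
    using assms by (auto simp: L2_def)
  show "AE x in M. norm (f x * g x) \<le> norm (((f x)\<^sup>2 + (g x)\<^sup>2) / 2)"
  proof (rule AE_I2)
    fix x show "norm (f x * g x) \<le> norm (((f x)\<^sup>2 + (g x)\<^sup>2) / 2)"
      using abs_mult_le_half_squares[of "f x" "g x"] by simp
  qed
qed

lemma L2_bound: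
  assumes "g \<in> L2 M" "f \<in> borel_measurable M" "AE x in M. \<bar>f x\<bar> \<le> \<bar>g x\<bar>"
  shows "f \<in> L2 M"
  unfolding L2_def
proof (intro CollectI conjI assms(2))
  have [measurable]: "f \<in> borel_measurable M" by fact
  show "integrable M (\<lambda>x. (f x)\<^sup>2)"
    by (rule Bochner_Integration.integrable_bound[OF L2_integrable[OF assms(1)]])
       (use assms(3) in \<open>auto simp: abs_le_square_iff elim!: AE_mp intro!: AE_I2\<close>)
qed

lemma L2_add:
  assumes "f \<in> L2 M" "g \<in> L2 M"
  shows "(\<lambda>x. f x + g x) \<in> L2 M"
  unfolding L2_def
proof (intro CollectI conjI)
  have [measurable]: "f \<in> borel_measurable M" "g \<in> borel_measurable M" using assms by (auto simp: L2_def)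
  show "(\<lambda>x. f x + g x) \<in> borel_measurable M" by measurable
  show "integrable M (\<lambda>x. (f x + g x)\<^sup>2)"
    unfolding power2_sum using assms
    by (intro Bochner_Integration.integrable_add L2_integrable)
       (auto simp: mult.assoc intro!: integrable_mult_right L2_mult_integrable)
qed

lemma L2_cmult: "f \<in> L2 M \<Longrightarrow> (\<lambda>x. c * f x) \<in> L2 M"
  by (auto simp: L2_def power_mult_distrib)

lemma L2_diff: "f \<in> L2 M \<Longrightarrow> g \<in> L2 M \<Longrightarrow> (\<lambda>x. f x - g x) \<in> L2 M"
  using L2_add[of f M "\<lambda>x. (-1) * g x"] L2_cmult[of g M "-1"] by simp

lemma L2_abs: "f \<in> L2 M \<Longrightarrow> (\<lambda>x. \<bar>f x\<bar>) \<in> L2 M"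
  by (auto simp: L2_def)

lemma L2_Cauchy_Schwarz:
  assumes f: "f \<in> L2 M" and g: "g \<in> L2 M"
  shows "(\<integral>x. f x * g x \<partial>M)\<^sup>2 \<le> (\<integral>x. (f x)\<^sup>2 \<partial>M) * (\<integral>x. (g x)\<^sup>2 \<partial>M)"
proof -
  define F G I where "F = (\<integral>x. (f x)\<^sup>2 \<partial>M)" and "G = (\<integral>x. (g x)\<^sup>2 \<partial>M)" and "I = (\<integral>x. f x * g x \<partial>M)"
  note int = L2_integrable[OF f] L2_integrable[OF g] L2_mult_integrable[OF f g]
  have q: "0 \<le> F - 2 * r * I + r\<^sup>2 * G" for r
  proof -
    have "0 \<le> (\<integral>x. (f x - r * g x)\<^sup>2 \<partial>M)" by simp
    also have "(\<lambda>x. (f x - r * g x)\<^sup>2) = (\<lambda>x. (f x)\<^sup>2 - 2 * r * (f x * g x) + r\<^sup>2 * (g x)\<^sup>2)"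
      by (auto simp: power2_diff power_mult_distrib)
    also have "(\<integral>x. \<dots> x \<partial>M) = F - 2 * r * I + r\<^sup>2 * G"
      unfolding F_def G_def I_def using int by simp
    finally show ?thesis .
  qed
  have "I\<^sup>2 \<le> F * G"
  proof (cases "G = 0")
    case True
    show ?thesis
    proof (cases "I = 0")
      case False
      \<comment> \<open>For \<open>G = 0\<close> the quadratic is affine in \<open>r\<close>, and
        this \<open>r\<close> would give it the value -1.\<close>
      have "F - 2 * ((F + 1) / (2 * I)) * I \<ge> 0" using q[of "(F + 1) / (2 * I)"] True by simp
      then show ?thesis using False by (simp add: field_simps)
    qed (simp add: True)
  next
    case False
    have "G \<ge> 0" by (simp add: G_def)
    with False have "G > 0" by simp
    then show ?thesis using q[of "I / G"]
      by (simp add: field_simps power2_eq_square)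
  qed
  then show ?thesis by (simp add: F_def G_def I_def)
qed

lemma L2_Cauchy_Schwarz_abs:
  assumes f: "f \<in> L2 M" and g: "g \<in> L2 M"
  shows "(\<integral>x. \<bar>f x * g x\<bar> \<partial>M) \<le> sqrt (\<integral>x. (f x)\<^sup>2 \<partial>M) * sqrt (\<integral>x. (g x)\<^sup>2 \<partial>M)"
proof -
  have "(\<integral>x. \<bar>f x\<bar> * \<bar>g x\<bar> \<partial>M)\<^sup>2 \<le> (\<integral>x. (f x)\<^sup>2 \<partial>M) * (\<integral>x. (g x)\<^sup>2 \<partial>M)"
    using L2_Cauchy_Schwarz[OF L2_abs[OF f] L2_abs[OF g]] by simp
  then have "sqrt ((\<integral>x. \<bar>f x\<bar> * \<bar>g x\<bar> \<partial>M)\<^sup>2) \<le> sqrt ((\<integral>x. (f x)\<^sup>2 \<partial>M) * (\<integral>x. (g x)\<^sup>2 \<partial>M))"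
    by (rule real_sqrt_le_mono)
  then show ?thesis
    by (simp add: real_sqrt_mult abs_mult)
qed

lemma nn_integral_square_L2:
  "f \<in> L2 M \<Longrightarrow> (\<integral>\<^sup>+x. ennreal ((f x)\<^sup>2) \<partial>M) = ennreal (\<integral>x. (f x)\<^sup>2 \<partial>M)"
  by (intro nn_integral_eq_integral) (auto simp: L2_def)

lemma L2I_nn:
  assumes "f \<in> borel_measurable M" "(\<integral>\<^sup>+x. ennreal ((f x)\<^sup>2) \<partial>M) < \<infinity>"
  shows "f \<in> L2 M"
  using assms by (auto simp: L2_def intro!: integrableI_nonneg)

text \<open>Carries bounds proved in extended reals, where integrability need not be known
  beforehand, over to Bochner integrals.\<close>

lemma integral_le_nn:
  assumes [measurable]: "f \<in> borel_measurable M" and "AE x in M. 0 \<le> f x"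
    and "(\<integral>\<^sup>+x. ennreal (f x) \<partial>M) \<le> ennreal c" "0 \<le> c"
  shows "(\<integral>x. f x \<partial>M) \<le> c"
  using assms by (simp add: integral_eq_nn_integral enn2real_leI)


section \<open>Invariance of Lebesgue measure and continuity of translations\<close>

lemma lborel_distr_reflect: "distr lborel borel (\<lambda>x. z - x) = (lborel :: 'a::euclidean_space measure)"
  using lborel_affine[of "-1" z] by (simp add: density_1)

lemma lborel_distr_shift: "distr lborel borel (\<lambda>x. x + h) = (lborel :: 'a::euclidean_space measure)"
proof -
  have "(\<lambda>x. x + h) = (+) h" by (auto simp: add.commute)
  then show ?thesis by (simp add: lborel_distr_plus)
qed

context
  fixes f :: "'a::euclidean_space \<Rightarrow> real"
  assumes f[measurable]: "f \<in> borel_measurable borel"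
begin

lemma integral_shift: "(LBINT x. f (x + h)) = (LBINT x. f x)"
  by (subst (2) lborel_distr_shift[symmetric, of h]) (simp add: integral_distr)

lemma integral_reflect: "(LBINT x. f (z - x)) = (LBINT x. f x)"
  by (subst (2) lborel_distr_reflect[symmetric, of z]) (simp add: integral_distr)

lemma integrable_shift: "integrable lborel (\<lambda>x. f (x + h)) \<longleftrightarrow> integrable lborel f"
  by (subst (2) lborel_distr_shift[symmetric, of h]) (simp add: integrable_distr_eq)

lemma integrable_reflect: "integrable lborel (\<lambda>x. f (z - x)) \<longleftrightarrow> integrable lborel f"
  by (subst (2) lborel_distr_reflect[symmetric, of z]) (simp add: integrable_distr_eq)

end

lemma nn_integral_shift:
  fixes f :: "'a::euclidean_space \<Rightarrow> ennreal"
  assumes [measurable]: "f \<in> borel_measurable borel"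
  shows "(\<integral>\<^sup>+x. f (x + h) \<partial>lborel) = (\<integral>\<^sup>+x. f x \<partial>lborel)"
  by (subst (2) lborel_distr_shift[symmetric, of h]) (simp add: nn_integral_distr)

lemma AE_shift:
  fixes P :: "'a::euclidean_space \<Rightarrow> bool"
  assumes "AE x in lborel. P x"
  shows "AE x in lborel. P (x + h)"
proof -
  have "AE x in distr lborel borel (\<lambda>x. x + h). P x" unfolding lborel_distr_shift by (rule assms)
  then show ?thesis by (rule AE_distrD[rotated]) simp
qed

lemma L2_shift:
  fixes f :: "'a::euclidean_space \<Rightarrow> real"
  assumes "f \<in> L2 lborel"
  shows "(\<lambda>x. f (x + h)) \<in> L2 lborel"
proof -
  have [measurable]: "f \<in> borel_measurable borel" using assms by (simp add: L2_def)
  show ?thesis using assms integrable_shift[of "\<lambda>x. (f x)\<^sup>2" h] by (simp add: L2_def)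
qed


text \<open>The absolute difference of two indicators is their sum minus twice their product. The
  integral of the sum does not depend on the shift, and for open \<open>U\<close> the product
  converges to the indicator of \<open>U\<close> pointwise, dominated by it.\<close>

lemma L1_translation_continuous_open:
  fixes U :: "'a::euclidean_space set"
  assumes U: "open U" "emeasure lborel U < \<infinity>" and h: "h \<longlonglongrightarrow> 0"
  shows "(\<lambda>n. LBINT x. \<bar>indicat_real U (x + h n) - indicat_real U x\<bar>) \<longlonglongrightarrow> 0"
proof -
  have [measurable]: "U \<in> sets borel" using U(1) by simp
  have i0: "integrable lborel (indicat_real U)" using U by simp
  have ih: "integrable lborel (\<lambda>x. indicat_real U (x + h n))" for n
    using i0 by (simp add: integrable_shift)
  have ip: "integrable lborel (\<lambda>x. indicat_real U (x + h n) * indicat_real U x)" for n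
    by (rule Bochner_Integration.integrable_bound[OF i0]) (auto simp: indicator_def)
  have eq: "(LBINT x. \<bar>indicat_real U (x + h n) - indicat_real U x\<bar>)
    = 2 * (LBINT x. indicat_real U x) - 2 * (LBINT x. indicat_real U (x + h n) * indicat_real U x)" for n
  proof -
    have "(LBINT x. \<bar>indicat_real U (x + h n) - indicat_real U x\<bar>)
      = (LBINT x. indicat_real U (x + h n) + indicat_real U x - 2 * (indicat_real U (x + h n) * indicat_real U x))"
      by (intro Bochner_Integration.integral_cong) (auto simp: indicator_def)
    also have "\<dots> = (LBINT x. indicat_real U (x + h n)) + (LBINT x. indicat_real U x)
        - 2 * (LBINT x. indicat_real U (x + h n) * indicat_real U x)"
      using i0 ih ip by simp
    also have "(LBINT x. indicat_real U (x + h n)) = (LBINT x. indicat_real U x)"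
      by (rule integral_shift) simp
    finally show ?thesis by simp
  qed
  have "(\<lambda>n. LBINT x. indicat_real U (x + h n) * indicat_real U x) \<longlonglongrightarrow> (LBINT x. indicat_real U x)"
  proof (rule integral_dominated_convergence[OF _ _ i0])
    show "AE x in lborel. (\<lambda>n. indicat_real U (x + h n) * indicat_real U x) \<longlonglongrightarrow> indicat_real U x"
    proof (rule AE_I2)
      fix x
      show "(\<lambda>n. indicat_real U (x + h n) * indicat_real U x) \<longlonglongrightarrow> indicat_real U x"
      proof (cases "x \<in> U")
        case True
        have "(\<lambda>n. x + h n) \<longlonglongrightarrow> x" using tendsto_add[OF tendsto_const h, of x] by simp
        then have "eventually (\<lambda>n. x + h n \<in> U) sequentially" using U(1) True by (rule topological_tendstoD)
        then show ?thesis by (intro tendsto_eventually) (auto elim!: eventually_mono simp: True)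
      qed simp
    qed
  qed (auto simp: indicator_def)
  from tendsto_diff[OF tendsto_const tendsto_mult[OF tendsto_const this], of "2 * (LBINT x. indicat_real U x)" 2]
  show ?thesis unfolding eq by simp
qed

text \<open>Induction over integrable functions: a measurable set is approximated from outside by an
  open one, sums follow from the triangle inequality, and limits from a three-term estimate in which
  translation invariance makes the two outer errors equal.\<close>

lemma L1_translation_continuous:
  fixes f :: "'a::euclidean_space \<Rightarrow> real"
  assumes "integrable lborel f" and h: "h \<longlonglongrightarrow> 0"
  shows "(\<lambda>n. LBINT x. \<bar>f (x + h n) - f x\<bar>) \<longlonglongrightarrow> 0"
  using assms(1)
proof (induct rule: integrable_induct)
  case (base A c)
  have [measurable]: "A \<in> sets borel" using base by simp
  show ?case
  proof (rule LIMSEQ_I)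
    fix e :: real assume e: "e > 0"
    \<comment> \<open>Three errors below \<open>e'\<close> add up to three quarters of
      \<open>e\<close>; the added 1 covers \<open>c = 0\<close>.\<close>
    define e' where "e' = e / (4 * (\<bar>c\<bar> + 1))"
    have e': "e' > 0" using e by (simp add: e'_def)
    obtain U where U: "open U" "A \<subseteq> U" "emeasure lborel (U - A) < ennreal e'"
      using outer_regular_lborel[of A e'] e' by auto
    have [measurable]: "U \<in> sets borel" using U by simp
    have UA: "emeasure lborel (U - A) < \<infinity>" using U(3) by (metis ennreal_less_top infinity_ennreal_def less_trans)
    have "emeasure lborel U \<le> emeasure lborel A + emeasure lborel (U - A)"
      using emeasure_subadditive[of A lborel "U - A"] U(2) by (simp add: Un_absorb1)
    also have "\<dots> < \<infinity>" using base UA by (simp add: ennreal_add_less_top)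
    finally have fU: "emeasure lborel U < \<infinity>" .
    have iU: "integrable lborel (indicat_real U)" and iA: "integrable lborel (indicat_real A)"
      and iD: "integrable lborel (indicat_real (U - A))" using fU base UA by auto
    have iUh: "integrable lborel (\<lambda>x. indicat_real U (x + h n))"
      and iAh: "integrable lborel (\<lambda>x. indicat_real A (x + h n))"
      and iDh: "integrable lborel (\<lambda>x. indicat_real (U - A) (x + h n))" for n
      using iU iA iD by (simp_all add: integrable_shift)
    have mD: "(LBINT x. indicat_real (U - A) x) < e'"
      using U(3) UA e' by (simp add: measure_def enn2real_less_iff)
    from LIMSEQ_D[OF L1_translation_continuous_open[OF U(1) fU h] e'] obtain N where
      N: "\<And>n. n \<ge> N \<Longrightarrow> (LBINT x. \<bar>indicat_real U (x + h n) - indicat_real U x\<bar>) < e'" by auto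
    show "\<exists>N. \<forall>n\<ge>N. norm ((LBINT x. \<bar>indicat_real A (x + h n) *\<^sub>R c - indicat_real A x *\<^sub>R c\<bar>) - 0) < e"
    proof (intro exI allI impI)
      fix n assume n: "n \<ge> N"
      have "(LBINT x. \<bar>indicat_real A (x + h n) - indicat_real A x\<bar>) \<le>
        (LBINT x. \<bar>indicat_real U (x + h n) - indicat_real U x\<bar> + indicat_real (U - A) (x + h n) + indicat_real (U - A) x)"
      proof (rule integral_mono)
        show "\<bar>indicat_real A (x + h n) - indicat_real A x\<bar> \<le>
          \<bar>indicat_real U (x + h n) - indicat_real U x\<bar> + indicat_real (U - A) (x + h n) + indicat_real (U - A) x" for x
          using U(2) by (auto simp: indicator_def)
      qed (use iU iA iD iUh iAh iDh in simp_all)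
      also have "\<dots> = (LBINT x. \<bar>indicat_real U (x + h n) - indicat_real U x\<bar>)
         + (LBINT x. indicat_real (U - A) (x + h n)) + (LBINT x. indicat_real (U - A) x)"
        using iU iA iD iUh iAh iDh by simp
      also have "(LBINT x. indicat_real (U - A) (x + h n)) = (LBINT x. indicat_real (U - A) x)"
        by (rule integral_shift) simp
      also have "(LBINT x. \<bar>indicat_real U (x + h n) - indicat_real U x\<bar>)
         + (LBINT x. indicat_real (U - A) x) + (LBINT x. indicat_real (U - A) x) < 3 * e'"
        using N[OF n] mD by simp
      finally have *: "(LBINT x. \<bar>indicat_real A (x + h n) - indicat_real A x\<bar>) < 3 * e'" .
      have "(LBINT x. \<bar>indicat_real A (x + h n) *\<^sub>R c - indicat_real A x *\<^sub>R c\<bar>)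
         = \<bar>c\<bar> * (LBINT x. \<bar>indicat_real A (x + h n) - indicat_real A x\<bar>)"
      proof -
        have "(\<lambda>x. \<bar>indicat_real A (x + h n) *\<^sub>R c - indicat_real A x *\<^sub>R c\<bar>)
          = (\<lambda>x. \<bar>c\<bar> * \<bar>indicat_real A (x + h n) - indicat_real A x\<bar>)"
          by (auto simp: abs_mult[symmetric] algebra_simps)
        then show ?thesis by simp
      qed
      also have "\<dots> \<le> (\<bar>c\<bar> + 1) * (3 * e')"
        using * by (intro mult_mono) auto
      also have "\<dots> = 3 / 4 * e"
      proof -
        define k where "k = \<bar>c\<bar> + 1"
        have "k \<noteq> 0" by (simp add: k_def)
        then show ?thesis unfolding e'_def k_def[symmetric] by simp
      qed
      also have "\<dots> < e" using e by simp
      finally show "norm ((LBINT x. \<bar>indicat_real A (x + h n) *\<^sub>R c - indicat_real A x *\<^sub>R c\<bar>) - 0) < e"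
        by simp
    qed
  qed
next
  case (add f g)
  have [measurable]: "f \<in> borel_measurable borel" "g \<in> borel_measurable borel"
    using add(1,3) by (auto dest: borel_measurable_integrable)
  have i: "integrable lborel (\<lambda>x. f (x + h n))" "integrable lborel (\<lambda>x. g (x + h n))" for n
    using add(1,3) by (simp_all add: integrable_shift)
  show ?case
  proof (rule tendsto_sandwich[OF _ _ tendsto_const])
    show "(\<lambda>n. (LBINT x. \<bar>f (x + h n) - f x\<bar>) + (LBINT x. \<bar>g (x + h n) - g x\<bar>)) \<longlonglongrightarrow> 0"
      using tendsto_add[OF add(2,4)] by simp
    show "\<forall>\<^sub>F n in sequentially. (LBINT x. \<bar>f (x + h n) + g (x + h n) - (f x + g x)\<bar>)
      \<le> (LBINT x. \<bar>f (x + h n) - f x\<bar>) + (LBINT x. \<bar>g (x + h n) - g x\<bar>)"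
    proof (intro always_eventually allI)
      fix n
      have "(LBINT x. \<bar>f (x + h n) + g (x + h n) - (f x + g x)\<bar>)
        \<le> (LBINT x. \<bar>f (x + h n) - f x\<bar> + \<bar>g (x + h n) - g x\<bar>)"
        using i add(1,3) by (intro integral_mono) auto
      also have "\<dots> = (LBINT x. \<bar>f (x + h n) - f x\<bar>) + (LBINT x. \<bar>g (x + h n) - g x\<bar>)"
        using i add(1,3) by simp
      finally show "(LBINT x. \<bar>f (x + h n) + g (x + h n) - (f x + g x)\<bar>)
        \<le> (LBINT x. \<bar>f (x + h n) - f x\<bar>) + (LBINT x. \<bar>g (x + h n) - g x\<bar>)" .
    qed
  qed simp
next
  case (lim f s)
  have [measurable]: "f \<in> borel_measurable borel" "\<And>i. s i \<in> borel_measurable borel"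
    using lim by (auto dest: borel_measurable_integrable)
  have i: "integrable lborel (\<lambda>x. f (x + h n))" "integrable lborel (\<lambda>x. s i (x + h n))" for n i
    using lim by (simp_all add: integrable_shift)
  have sf: "(\<lambda>i. LBINT x. \<bar>s i x - f x\<bar>) \<longlonglongrightarrow> 0"
  proof -
    have "(\<lambda>i. LBINT x. \<bar>s i x - f x\<bar>) \<longlonglongrightarrow> (\<integral>x. 0 \<partial>(lborel :: 'a measure))"
    proof (rule integral_dominated_convergence)
      show "integrable lborel (\<lambda>x. 3 * \<bar>f x\<bar>)" using lim by simp
      show "AE x in lborel. (\<lambda>i. \<bar>s i x - f x\<bar>) \<longlonglongrightarrow> 0"
        using lim by (auto intro!: AE_I2 tendsto_rabs_zero simp: LIM_zero)
      show "AE x in lborel. norm \<bar>s i x - f x\<bar> \<le> 3 * \<bar>f x\<bar>" for i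
      proof (rule AE_I2)
        fix x
        have "norm (s i x) \<le> 2 * norm (f x)" using lim by simp
        then show "norm \<bar>s i x - f x\<bar> \<le> 3 * \<bar>f x\<bar>" by simp
      qed
    qed auto
    then show ?thesis by simp
  qed
  show ?case
  proof (rule LIMSEQ_I)
    fix e :: real assume e: "e > 0"
    then obtain i0 where i0: "(LBINT x. \<bar>s i0 x - f x\<bar>) < e / 3"
      using LIMSEQ_D[OF sf, of "e/3"] by auto
    obtain N where N: "\<And>n. n \<ge> N \<Longrightarrow> (LBINT x. \<bar>s i0 (x + h n) - s i0 x\<bar>) < e / 3"
      using LIMSEQ_D[OF lim(2)[of i0], of "e/3"] e by auto
    show "\<exists>N. \<forall>n\<ge>N. norm ((LBINT x. \<bar>f (x + h n) - f x\<bar>) - 0) < e"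
    proof (intro exI allI impI)
      fix n assume n: "n \<ge> N"
      have "(LBINT x. \<bar>f (x + h n) - f x\<bar>) \<le>
        (LBINT x. \<bar>s i0 (x + h n) - f (x + h n)\<bar> + \<bar>s i0 (x + h n) - s i0 x\<bar> + \<bar>s i0 x - f x\<bar>)"
        using i lim by (intro integral_mono) (auto)
      also have "\<dots> = (LBINT x. \<bar>s i0 (x + h n) - f (x + h n)\<bar>) + (LBINT x. \<bar>s i0 (x + h n) - s i0 x\<bar>)
         + (LBINT x. \<bar>s i0 x - f x\<bar>)"
        using i lim by simp
      also have "(LBINT x. \<bar>s i0 (x + h n) - f (x + h n)\<bar>) = (LBINT x. \<bar>s i0 x - f x\<bar>)"
        by (rule integral_shift) simp
      finally show "norm ((LBINT x. \<bar>f (x + h n) - f x\<bar>) - 0) < e"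
        using N[OF n] i0 by simp
    qed
  qed
qed

text \<open>Reduction to the integrable case through the signed square
  \<open>f x * \<bar>f x\<bar>\<close>, whose increments dominate the squared increments of
  \<open>f\<close> up to a factor 2.\<close>

lemma L2_translation_continuous:
  fixes f :: "'a::euclidean_space \<Rightarrow> real"
  assumes f: "f \<in> L2 lborel" and h: "h \<longlonglongrightarrow> 0"
  shows "(\<lambda>n. LBINT x. (f (x + h n) - f x)\<^sup>2) \<longlonglongrightarrow> 0"
proof -
  have [measurable]: "f \<in> borel_measurable borel" using f by (simp add: L2_def)
  define g where "g x = f x * \<bar>f x\<bar>" for x
  have [measurable]: "g \<in> borel_measurable borel" unfolding g_def by measurable
  have g: "integrable lborel g"
    unfolding g_def by (intro L2_mult_integrable f L2_abs)
  have gh: "integrable lborel (\<lambda>x. g (x + h n))" for n using g by (simp add: integrable_shift)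
  have key: "(a - b)\<^sup>2 \<le> 2 * \<bar>a * \<bar>a\<bar> - b * \<bar>b\<bar>\<bar>" for a b :: real
  proof -
    have *: "(c - d)\<^sup>2 \<le> 2 * \<bar>c * c - d * d\<bar>" if "0 \<le> c" "0 \<le> d" for c d :: real
    proof -
      have "(c - d)\<^sup>2 = \<bar>c - d\<bar> * \<bar>c - d\<bar>" by (simp add: power2_eq_square)
      also have "\<dots> \<le> \<bar>c - d\<bar> * (c + d)" using that by (intro mult_left_mono) auto
      also have "\<dots> = \<bar>c * c - d * d\<bar>" using that by (simp add: square_diff_square_factored abs_mult)
      also have "\<dots> \<le> 2 * \<bar>c * c - d * d\<bar>" by (simp only: mult_2 le_add_same_cancel1 abs_ge_zero)
      finally show ?thesis .
    qed
    \<comment> \<open>For equal signs the right-hand side is a difference of squares that factors;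
      for opposite signs it becomes 2 (a^2 + b^2).\<close>
    consider "a \<ge> 0" "b \<ge> 0" | "a \<ge> 0" "b \<le> 0" | "a \<le> 0" "b \<ge> 0" | "a \<le> 0" "b \<le> 0" by linarith
    then show ?thesis
    proof cases
      case 1 then show ?thesis using *[of a b] by simp
    next
      case 2 then show ?thesis using square_add_le[of a "-b"] by (simp add: power2_eq_square)
    next
      case 3 then show ?thesis using square_add_le[of a "-b"] by (simp add: power2_eq_square)
    next
      case 4 then show ?thesis using *[of "-b" "-a"] by (simp add: power2_eq_square algebra_simps)
    qed
  qed
  have "(\<lambda>n. 2 * (LBINT x. \<bar>g (x + h n) - g x\<bar>)) \<longlonglongrightarrow> 0"
    using tendsto_mult[OF tendsto_const L1_translation_continuous[OF g h], of 2] by simp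
  then show ?thesis
  proof (rule tendsto_sandwich[OF _ _ tendsto_const, rotated 2])
    have "(LBINT x. (f (x + h n) - f x)\<^sup>2) \<le> (LBINT x. 2 * \<bar>g (x + h n) - g x\<bar>)" for n
    proof (rule integral_mono)
      show "integrable lborel (\<lambda>x. 2 * \<bar>g (x + h n) - g x\<bar>)" using g gh by simp
      show "(f (x + h n) - f x)\<^sup>2 \<le> 2 * \<bar>g (x + h n) - g x\<bar>" for x
        using key[of "f (x + h n)" "f x"] by (simp add: g_def)
    qed (rule L2_integrable[OF L2_diff[OF L2_shift[OF f] f]])
    then show "\<forall>\<^sub>F n in sequentially. (LBINT x. (f (x + h n) - f x)\<^sup>2) \<le> 2 * (LBINT x. \<bar>g (x + h n) - g x\<bar>)"
      by simp
  qed simp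
qed

section \<open>Mollification\<close>

text \<open>With \<open>z\<close> outermost, \<open>fin\<close> is exactly the absolute
  integrability of the triple product, so that the integral over \<open>z\<close> may be taken
  first. For a product of two convolutions this leaves inside either the autocorrelation of the
  kernels or the correlation of the functions.\<close>

lemma triple_Fubini:
  fixes \<phi> :: "'a::euclidean_space \<Rightarrow> 'b::euclidean_space \<Rightarrow> real" and \<psi> :: "'a \<Rightarrow> 'c::euclidean_space \<Rightarrow> real"
  assumes m[measurable]: "case_prod \<phi> \<in> borel_measurable (borel \<Otimes>\<^sub>M borel)" "case_prod \<psi> \<in> borel_measurable (borel \<Otimes>\<^sub>M borel)"
    and i: "\<And>z. integrable lborel (\<phi> z)" "\<And>z. integrable lborel (\<psi> z)"
    and fin: "(\<integral>\<^sup>+z. (\<integral>\<^sup>+x. \<bar>\<phi> z x\<bar> \<partial>lborel) * (\<integral>\<^sup>+y. \<bar>\<psi> z y\<bar> \<partial>lborel) \<partial>lborel) < \<infinity>"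
  shows "integrable lborel (\<lambda>z. (LBINT x. \<phi> z x) * (LBINT y. \<psi> z y))" (is ?A)
    and "(LBINT z. (LBINT x. \<phi> z x) * (LBINT y. \<psi> z y))
      = (\<integral>w. (LBINT z. \<phi> z (fst w) * \<psi> z (snd w)) \<partial>(lborel \<Otimes>\<^sub>M lborel))" (is ?B)
    and "integrable (lborel \<Otimes>\<^sub>M lborel) (\<lambda>w. (LBINT z. \<phi> z (fst w) * \<psi> z (snd w)))" (is ?C)
proof -
  define \<Phi> where "\<Phi> z w = \<phi> z (fst w) * \<psi> z (snd w)" for z w
  have [measurable]: "case_prod \<Phi> \<in> borel_measurable (lborel \<Otimes>\<^sub>M (lborel \<Otimes>\<^sub>M lborel))"
    unfolding \<Phi>_def by measurable
  interpret P: pair_sigma_finite "lborel :: 'a measure" "lborel \<Otimes>\<^sub>M lborel :: ('b \<times> 'c) measure" ..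
  have sf: "sigma_finite_measure (lborel \<Otimes>\<^sub>M lborel :: ('b \<times> 'c) measure)"
    unfolding lborel_prod by (rule sigma_finite_lborel)
  have inner: "(\<integral>\<^sup>+w. ennreal (norm (\<Phi> z w)) \<partial>(lborel \<Otimes>\<^sub>M lborel))
      = (\<integral>\<^sup>+x. \<bar>\<phi> z x\<bar> \<partial>lborel) * (\<integral>\<^sup>+y. \<bar>\<psi> z y\<bar> \<partial>lborel)" for z
  proof -
    have "(\<integral>\<^sup>+w. ennreal (norm (\<Phi> z w)) \<partial>(lborel \<Otimes>\<^sub>M lborel))
      = (\<integral>\<^sup>+x. \<integral>\<^sup>+y. ennreal (norm (\<Phi> z (x, y))) \<partial>lborel \<partial>lborel)"
      by (rule lborel.nn_integral_fst[symmetric]) measurable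
    also have "\<dots> = (\<integral>\<^sup>+x. \<integral>\<^sup>+y. ennreal \<bar>\<phi> z x\<bar> * ennreal \<bar>\<psi> z y\<bar> \<partial>lborel \<partial>lborel)"
      by (simp add: \<Phi>_def abs_mult ennreal_mult)
    also have "\<dots> = (\<integral>\<^sup>+x. \<bar>\<phi> z x\<bar> \<partial>lborel) * (\<integral>\<^sup>+y. \<bar>\<psi> z y\<bar> \<partial>lborel)"
      by (simp add: nn_integral_cmult nn_integral_multc)
    finally show ?thesis .
  qed
  have I: "integrable (lborel \<Otimes>\<^sub>M (lborel \<Otimes>\<^sub>M lborel)) (case_prod \<Phi>)"
  proof (rule integrableI_bounded)
    have "(\<integral>\<^sup>+p. ennreal (norm (case_prod \<Phi> p)) \<partial>(lborel \<Otimes>\<^sub>M (lborel \<Otimes>\<^sub>M lborel)))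
      = (\<integral>\<^sup>+z. (\<integral>\<^sup>+w. ennreal (norm (\<Phi> z w)) \<partial>(lborel \<Otimes>\<^sub>M lborel)) \<partial>lborel)"
      by (subst sigma_finite_measure.nn_integral_fst[OF sf, symmetric]) auto
    also have "\<dots> < \<infinity>" unfolding inner by (rule fin)
    finally show "(\<integral>\<^sup>+p. ennreal (norm (case_prod \<Phi> p)) \<partial>(lborel \<Otimes>\<^sub>M (lborel \<Otimes>\<^sub>M lborel))) < \<infinity>" .
  qed simp
  have pm: "(\<integral>w. \<Phi> z w \<partial>(lborel \<Otimes>\<^sub>M lborel)) = (LBINT x. \<phi> z x) * (LBINT y. \<psi> z y)" for z
  proof -
    have "integrable (lborel \<Otimes>\<^sub>M lborel) (\<Phi> z)"
    proof (rule integrableI_bounded)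
      show "(\<integral>\<^sup>+w. ennreal (norm (\<Phi> z w)) \<partial>(lborel \<Otimes>\<^sub>M lborel)) < \<infinity>"
        unfolding inner using i by (auto simp: integrable_iff_bounded ennreal_mult_less_top)
    qed measurable
    from lborel_pair.integral_fst'[OF this]
    have "(\<integral>w. \<Phi> z w \<partial>(lborel \<Otimes>\<^sub>M lborel)) = (LBINT x. \<integral>y. \<Phi> z (x, y) \<partial>lborel)" by (rule sym)
    then show ?thesis by (simp add: \<Phi>_def)
  qed
  show ?A using P.integrable_fst[OF I] by (simp add: pm)
  show ?B using P.Fubini_integral[OF I] by (simp add: pm) (simp add: \<Phi>_def)
  show ?C using P.integrable_snd[OF I] by (simp add: \<Phi>_def)
qed

section \<open>Convolution with bounded kernels of bounded support\<close>

definition kern :: "('a::euclidean_space \<Rightarrow> real) \<Rightarrow> bool" where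
  "kern \<alpha> \<longleftrightarrow> \<alpha> \<in> borel_measurable borel \<and> (\<exists>C R. \<forall>x. \<bar>\<alpha> x\<bar> \<le> C * indicator (cball 0 R) x)"

text \<open>The convolution of \<open>f\<close> and \<open>\<alpha>\<close> at \<open>z\<close>,
  with the Bochner convention that it is 0 where the integrand is not integrable.\<close>

definition cv :: "('a::euclidean_space \<Rightarrow> real) \<Rightarrow> ('a \<Rightarrow> real) \<Rightarrow> 'a \<Rightarrow> real" where
  "cv \<alpha> f z = (LBINT x. f x * \<alpha> (z - x))"

lemma kern_bounded:
  assumes "kern \<alpha>"
  obtains C where "0 \<le> C" "\<And>x. \<bar>\<alpha> x\<bar> \<le> C"
proof -
  obtain C R where C: "\<And>x. \<bar>\<alpha> x\<bar> \<le> C * indicator (cball 0 R) x" using assms by (auto simp: kern_def)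
  have "\<bar>\<alpha> x\<bar> \<le> \<bar>C\<bar>" for x
    using C[of x] by (cases "x \<in> cball 0 R") (auto simp: indicator_def)
  then show ?thesis by (intro that[of "\<bar>C\<bar>"]) auto
qed

text \<open>Majorants of pairings are convolutions with the absolute value of a kernel; a class of
  smooth kernels would not be closed under it.\<close>

lemma kern_abs: "kern \<alpha> \<Longrightarrow> kern (\<lambda>x. \<bar>\<alpha> x\<bar>)"
  by (auto simp: kern_def)

lemma kern_L2: assumes "kern \<alpha>" shows "\<alpha> \<in> L2 lborel" and kern_integrable: "integrable lborel \<alpha>"
proof -
  obtain C R where C: "\<And>x. \<bar>\<alpha> x\<bar> \<le> C * indicator (cball 0 R) x" and [measurable]: "\<alpha> \<in> borel_measurable borel"
    using assms by (auto simp: kern_def)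
  have i: "integrable lborel (\<lambda>x::'a. C * indicat_real (cball 0 R) x)"
    using emeasure_lborel_cball_finite[of "0::'a" R] by (simp add: less_top)
  have i2: "(\<lambda>x::'a. C * indicat_real (cball 0 R) x) \<in> L2 lborel"
  proof -
    have "(\<lambda>x::'a. (C * indicat_real (cball 0 R) x)\<^sup>2) = (\<lambda>x. C * (C * indicat_real (cball 0 R) x))"
      by (auto simp: indicator_def power2_eq_square)
    then show ?thesis using integrable_mult_right[OF i, of C] borel_measurable_integrable[OF i]
      by (simp add: L2_def)
  qed
  have le: "AE x in lborel. \<bar>\<alpha> x\<bar> \<le> \<bar>C * indicat_real (cball 0 R) x\<bar>"
    using C by (intro AE_I2) (rule order_trans[OF _ abs_ge_self])
  show "\<alpha> \<in> L2 lborel" by (rule L2_bound[OF i2 _ le]) simp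
  show "integrable lborel \<alpha>" by (rule Bochner_Integration.integrable_bound[OF i]) (use le in auto)
qed

lemma kern_reflect_L2: 
  assumes "kern \<alpha>" shows "(\<lambda>x. \<alpha> (z - x)) \<in> L2 lborel"
proof -
  have [measurable]: "\<alpha> \<in> borel_measurable borel" using assms by (simp add: kern_def)
  show ?thesis using kern_L2[OF assms] integrable_reflect[of "\<lambda>x. (\<alpha> x)\<^sup>2" z] by (simp add: L2_def)
qed

lemma cv_integrable_L2: "f \<in> L2 lborel \<Longrightarrow> kern \<alpha> \<Longrightarrow> integrable lborel (\<lambda>x. f x * \<alpha> (z - x))"
  by (intro L2_mult_integrable kern_reflect_L2)

lemma cv_integrable_L1:
  assumes f: "integrable lborel f" and k: "kern \<alpha>" shows "integrable lborel (\<lambda>x. f x * \<alpha> (z - x))"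
proof -
  have [measurable]: "\<alpha> \<in> borel_measurable borel" "f \<in> borel_measurable borel"
    using f k by (auto simp: kern_def dest: borel_measurable_integrable)
  obtain C where C: "0 \<le> C" "\<And>x. \<bar>\<alpha> x\<bar> \<le> C" using kern_bounded[OF k] by blast
  show ?thesis
    by (rule Bochner_Integration.integrable_bound[OF integrable_mult_right[OF f, of C]])
       (auto simp: abs_mult mult.commute[of "\<bar>f _\<bar>"] C intro!: mult_right_mono)
qed

lemma cv_measurable[measurable]:
  assumes [measurable]: "f \<in> borel_measurable borel" "\<alpha> \<in> borel_measurable borel"
  shows "cv \<alpha> f \<in> borel_measurable borel"
  unfolding cv_def by measurable

lemma cv_slice_measurable[measurable]:
  fixes H :: "'b::euclidean_space \<times> 'a::euclidean_space \<Rightarrow> real"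
  assumes [measurable]: "H \<in> borel_measurable borel" "\<alpha> \<in> borel_measurable borel"
  shows "(\<lambda>(t, z). cv \<alpha> (\<lambda>x. H (t, x)) z) \<in> borel_measurable (borel \<Otimes>\<^sub>M borel)"
  unfolding cv_def by measurable

lemma cv_alt:
  assumes [measurable]: "f \<in> borel_measurable borel" "\<alpha> \<in> borel_measurable borel"
  shows "cv \<alpha> f z = (LBINT v. f (z - v) * \<alpha> v)"
  using integral_reflect[of "\<lambda>v. f (z - v) * \<alpha> v" z] by (simp add: cv_def)

text \<open>Cauchy-Schwarz with weight \<open>\<bar>\<alpha> v\<bar>\<close>, its square root being
  distributed over the two factors. For a probability kernel this is Jensen's inequality for the
  square.\<close>

lemma kernel_Cauchy_Schwarz:
  fixes F \<alpha> :: "'a \<Rightarrow> real"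
  assumes [measurable]: "F \<in> borel_measurable M" "\<alpha> \<in> borel_measurable M"
  shows "ennreal ((\<integral>v. F v * \<alpha> v \<partial>M)\<^sup>2) \<le> (\<integral>\<^sup>+v. \<bar>\<alpha> v\<bar> \<partial>M) * (\<integral>\<^sup>+v. ennreal ((F v)\<^sup>2) * \<bar>\<alpha> v\<bar> \<partial>M)"
proof -
  \<comment> \<open>If the product is not integrable, its integral is 0 by convention and the bound
    is trivial.\<close>
  have "ennreal \<bar>\<integral>v. F v * \<alpha> v \<partial>M\<bar> \<le> (\<integral>\<^sup>+v. ennreal \<bar>F v * \<alpha> v\<bar> \<partial>M)"
  proof (cases "integrable M (\<lambda>v. F v * \<alpha> v)")
    case True then show ?thesis using integral_norm_bound_ennreal[OF True] by simp
  qed (simp add: not_integrable_integral_eq)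
  also have "\<dots> = (\<integral>\<^sup>+v. ennreal (sqrt \<bar>\<alpha> v\<bar>) * ennreal (\<bar>F v\<bar> * sqrt \<bar>\<alpha> v\<bar>) \<partial>M)"
    by (intro nn_integral_cong) (auto simp: abs_mult ennreal_mult[symmetric])
  finally have "(ennreal \<bar>\<integral>v. F v * \<alpha> v \<partial>M\<bar>)\<^sup>2
      \<le> (\<integral>\<^sup>+v. ennreal (sqrt \<bar>\<alpha> v\<bar>) * ennreal (\<bar>F v\<bar> * sqrt \<bar>\<alpha> v\<bar>) \<partial>M)\<^sup>2"
    by (intro power_mono) auto
  also have "\<dots> \<le> (\<integral>\<^sup>+v. (ennreal (sqrt \<bar>\<alpha> v\<bar>))\<^sup>2 \<partial>M) * (\<integral>\<^sup>+v. (ennreal (\<bar>F v\<bar> * sqrt \<bar>\<alpha> v\<bar>))\<^sup>2 \<partial>M)"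
    by (rule Cauchy_Schwarz_nn_integral) measurable
  also have "\<dots> = (\<integral>\<^sup>+v. \<bar>\<alpha> v\<bar> \<partial>M) * (\<integral>\<^sup>+v. ennreal ((F v)\<^sup>2) * \<bar>\<alpha> v\<bar> \<partial>M)"
    by (simp add: ennreal_power power_mult_distrib ennreal_mult[symmetric])
  finally show ?thesis by (simp add: ennreal_power)
qed

text \<open>Young's inequality for an integrable kernel acting on square integrable functions, in
  extended reals so that it also yields membership in \<open>L2\<close>.\<close>

lemma cv_nn_square_le:
  assumes [measurable]: "f \<in> borel_measurable borel" "\<alpha> \<in> borel_measurable borel"
  shows "(\<integral>\<^sup>+z. ennreal ((cv \<alpha> f z)\<^sup>2) \<partial>lborel) \<le> (\<integral>\<^sup>+v. \<bar>\<alpha> v\<bar> \<partial>lborel)\<^sup>2 * (\<integral>\<^sup>+x. ennreal ((f x)\<^sup>2) \<partial>lborel)"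
proof -
  let ?A = "\<integral>\<^sup>+v. \<bar>\<alpha> v\<bar> \<partial>lborel" and ?F = "\<integral>\<^sup>+x. ennreal ((f x)\<^sup>2) \<partial>lborel"
  have "(\<integral>\<^sup>+z. ennreal ((cv \<alpha> f z)\<^sup>2) \<partial>lborel) \<le>
    (\<integral>\<^sup>+z. ?A * (\<integral>\<^sup>+v. ennreal ((f (z - v))\<^sup>2) * \<bar>\<alpha> v\<bar> \<partial>lborel) \<partial>lborel)"
    by (intro nn_integral_mono) (auto simp: cv_alt intro!: kernel_Cauchy_Schwarz)
  also have "\<dots> = ?A * (\<integral>\<^sup>+z. (\<integral>\<^sup>+v. ennreal ((f (z - v))\<^sup>2) * \<bar>\<alpha> v\<bar> \<partial>lborel) \<partial>lborel)"
    by (intro nn_integral_cmult) measurable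
  also have "(\<integral>\<^sup>+z. (\<integral>\<^sup>+v. ennreal ((f (z - v))\<^sup>2) * \<bar>\<alpha> v\<bar> \<partial>lborel) \<partial>lborel)
    = (\<integral>\<^sup>+v. (\<integral>\<^sup>+z. ennreal ((f (z - v))\<^sup>2) * \<bar>\<alpha> v\<bar> \<partial>lborel) \<partial>lborel)"
    by (intro lborel_pair.Fubini') measurable
  also have "\<dots> = (\<integral>\<^sup>+v. ?F * \<bar>\<alpha> v\<bar> \<partial>lborel)"
  proof (intro nn_integral_cong)
    fix v
    show "(\<integral>\<^sup>+z. ennreal ((f (z - v))\<^sup>2) * \<bar>\<alpha> v\<bar> \<partial>lborel) = ?F * \<bar>\<alpha> v\<bar>"
      using nn_integral_shift[of "\<lambda>x. ennreal ((f x)\<^sup>2)" "- v"] by (simp add: nn_integral_multc)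
  qed
  also have "\<dots> = ?F * ?A" by (simp add: nn_integral_cmult)
  finally show ?thesis by (simp add: power2_eq_square ac_simps)
qed

lemma nn_integral_kern_finite: "kern \<alpha> \<Longrightarrow> (\<integral>\<^sup>+v. \<bar>\<alpha> v\<bar> \<partial>lborel) < \<infinity>"
  using kern_integrable by (auto simp: integrable_iff_bounded)

lemma cv_L2:
  assumes f: "f \<in> L2 lborel" and k: "kern \<alpha>"
  shows "cv \<alpha> f \<in> L2 lborel"
proof (rule L2I_nn)
  have [measurable]: "f \<in> borel_measurable borel" "\<alpha> \<in> borel_measurable borel"
    using f k by (auto simp: L2_def kern_def)
  show "cv \<alpha> f \<in> borel_measurable lborel" by simp
  show "(\<integral>\<^sup>+z. ennreal ((cv \<alpha> f z)\<^sup>2) \<partial>lborel) < \<infinity>"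
    by (rule le_less_trans[OF cv_nn_square_le])
       (use nn_integral_kern_finite[OF k] nn_integral_square_L2[OF f] in
         \<open>auto simp: ennreal_mult_less_top power2_eq_square\<close>)
qed

lemma cv_nn_le:
  assumes [measurable]: "f \<in> borel_measurable borel" "\<alpha> \<in> borel_measurable borel"
  shows "(\<integral>\<^sup>+z. ennreal \<bar>cv \<alpha> f z\<bar> \<partial>lborel) \<le> (\<integral>\<^sup>+v. \<bar>\<alpha> v\<bar> \<partial>lborel) * (\<integral>\<^sup>+x. ennreal \<bar>f x\<bar> \<partial>lborel)"
proof -
  let ?A = "\<integral>\<^sup>+v. \<bar>\<alpha> v\<bar> \<partial>lborel"
  have "(\<integral>\<^sup>+z. ennreal \<bar>cv \<alpha> f z\<bar> \<partial>lborel) \<le> (\<integral>\<^sup>+z. (\<integral>\<^sup>+x. ennreal (\<bar>f x\<bar> * \<bar>\<alpha> (z - x)\<bar>) \<partial>lborel) \<partial>lborel)"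
  proof (intro nn_integral_mono)
    fix z
    show "ennreal \<bar>cv \<alpha> f z\<bar> \<le> (\<integral>\<^sup>+x. ennreal (\<bar>f x\<bar> * \<bar>\<alpha> (z - x)\<bar>) \<partial>lborel)"
    proof (cases "integrable lborel (\<lambda>x. f x * \<alpha> (z - x))")
      case True then show ?thesis using integral_norm_bound_ennreal[OF True] by (simp add: cv_def abs_mult)
    qed (simp add: not_integrable_integral_eq cv_def)
  qed
  also have "\<dots> = (\<integral>\<^sup>+x. (\<integral>\<^sup>+z. ennreal (\<bar>f x\<bar> * \<bar>\<alpha> (z - x)\<bar>) \<partial>lborel) \<partial>lborel)"
    by (intro lborel_pair.Fubini') measurable
  also have "\<dots> = (\<integral>\<^sup>+x. ?A * ennreal \<bar>f x\<bar> \<partial>lborel)"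
  proof (intro nn_integral_cong)
    fix x
    have "(\<integral>\<^sup>+z. ennreal (\<bar>f x\<bar> * \<bar>\<alpha> (z - x)\<bar>) \<partial>lborel) = ennreal \<bar>f x\<bar> * (\<integral>\<^sup>+z. ennreal \<bar>\<alpha> (z - x)\<bar> \<partial>lborel)"
      by (simp add: ennreal_mult nn_integral_cmult)
    then show "(\<integral>\<^sup>+z. ennreal (\<bar>f x\<bar> * \<bar>\<alpha> (z - x)\<bar>) \<partial>lborel) = ?A * ennreal \<bar>f x\<bar>"
      using nn_integral_shift[of "\<lambda>v. ennreal \<bar>\<alpha> v\<bar>" "- x"] by (simp add: mult.commute)
  qed
  also have "\<dots> = ?A * (\<integral>\<^sup>+x. ennreal \<bar>f x\<bar> \<partial>lborel)" by (simp add: nn_integral_cmult)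
  finally show ?thesis .
qed

lemma cv_L1:
  assumes f: "integrable lborel f" and k: "kern \<alpha>"
  shows "integrable lborel (cv \<alpha> f)"
proof (rule integrableI_bounded)
  have [measurable]: "f \<in> borel_measurable borel" "\<alpha> \<in> borel_measurable borel"
    using f k by (auto simp: kern_def dest: borel_measurable_integrable)
  show "cv \<alpha> f \<in> borel_measurable lborel" by simp
  have "(\<integral>\<^sup>+z. ennreal \<bar>cv \<alpha> f z\<bar> \<partial>lborel) \<le> (\<integral>\<^sup>+v. \<bar>\<alpha> v\<bar> \<partial>lborel) * (\<integral>\<^sup>+x. ennreal \<bar>f x\<bar> \<partial>lborel)"
    by (rule cv_nn_le) auto
  also have "\<dots> < \<infinity>" 
    using nn_integral_kern_finite[OF k] f by (auto simp: integrable_iff_bounded ennreal_mult_less_top)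
  finally show "(\<integral>\<^sup>+z. ennreal (norm (cv \<alpha> f z)) \<partial>lborel) < \<infinity>" by simp
qed

lemma abs_cv_le:
  "\<bar>cv \<alpha> f z\<bar> \<le> cv (\<lambda>x. \<bar>\<alpha> x\<bar>) (\<lambda>x. \<bar>f x\<bar>) z"
  unfolding cv_def using integral_abs_bound[of lborel "\<lambda>x. f x * \<alpha> (z - x)"] by (simp add: abs_mult)

text \<open>A pointwise bound, which is what allows a pairing with a convolution that is merely
  integrable.\<close>

lemma cv_L2_bounded:
  assumes f: "f \<in> L2 lborel" and k: "kern \<alpha>"
  shows "\<bar>cv \<alpha> f z\<bar> \<le> sqrt (LBINT x. (f x)\<^sup>2) * sqrt (LBINT x. (\<alpha> x)\<^sup>2)"
proof -
  have [measurable]: "\<alpha> \<in> borel_measurable borel" using k by (simp add: kern_def)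
  have "\<bar>cv \<alpha> f z\<bar> \<le> (LBINT x. \<bar>f x * \<alpha> (z - x)\<bar>)" unfolding cv_def by (rule integral_abs_bound)
  also have "\<dots> \<le> sqrt (LBINT x. (f x)\<^sup>2) * sqrt (LBINT x. (\<alpha> (z - x))\<^sup>2)"
    by (rule L2_Cauchy_Schwarz_abs[OF f kern_reflect_L2[OF k]])
  also have "(LBINT x. (\<alpha> (z - x))\<^sup>2) = (LBINT x. (\<alpha> x)\<^sup>2)"
    by (rule integral_reflect) simp
  finally show ?thesis .
qed

lemma cv_add:
  assumes "\<And>z. integrable lborel (\<lambda>x. f x * \<alpha> (z - x))" "\<And>z. integrable lborel (\<lambda>x. g x * \<alpha> (z - x))"
  shows "cv \<alpha> (\<lambda>x. f x + g x) z = cv \<alpha> f z + cv \<alpha> g z"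
  unfolding cv_def using assms by (simp add: distrib_right)

lemma cv_diff:
  assumes "\<And>z. integrable lborel (\<lambda>x. f x * \<alpha> (z - x))" "\<And>z. integrable lborel (\<lambda>x. g x * \<alpha> (z - x))"
  shows "cv \<alpha> (\<lambda>x. f x - g x) z = cv \<alpha> f z - cv \<alpha> g z"
  unfolding cv_def using assms by (simp add: left_diff_distrib)

lemma cv_shift:
  assumes [measurable]: "f \<in> borel_measurable borel" "\<alpha> \<in> borel_measurable borel"
  shows "cv \<alpha> (\<lambda>x. f (x + h)) z = cv \<alpha> f (z + h)"
  using integral_shift[of "\<lambda>x. f x * \<alpha> (z + h - x)" h] by (simp add: cv_def algebra_simps)

text \<open>Moving derivatives between the two factors only changes the autocorrelation of the kernels.\<close>

lemma cv_pairing: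
  fixes f g :: "'a::euclidean_space \<Rightarrow> real"
  assumes [measurable]: "f \<in> borel_measurable borel" "g \<in> borel_measurable borel"
    and k: "kern \<alpha>" "kern \<beta>"
    and i: "\<And>z. integrable lborel (\<lambda>x. f x * \<alpha> (z - x))" "\<And>z. integrable lborel (\<lambda>x. g x * \<beta> (z - x))"
    and fin: "integrable lborel (\<lambda>z. cv (\<lambda>x. \<bar>\<alpha> x\<bar>) (\<lambda>x. \<bar>f x\<bar>) z * cv (\<lambda>x. \<bar>\<beta> x\<bar>) (\<lambda>x. \<bar>g x\<bar>) z)"
  shows "(LBINT z. cv \<alpha> f z * cv \<beta> g z)
    = (\<integral>w. f (fst w) * g (snd w) * (LBINT z. \<alpha> (z - fst w) * \<beta> (z - snd w)) \<partial>(lborel \<Otimes>\<^sub>M lborel))"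
proof -
  have [measurable]: "\<alpha> \<in> borel_measurable borel" "\<beta> \<in> borel_measurable borel" using k by (auto simp: kern_def)
  have fin': "(\<integral>\<^sup>+z. (\<integral>\<^sup>+x. \<bar>f x * \<alpha> (z - x)\<bar> \<partial>lborel) * (\<integral>\<^sup>+y. \<bar>g y * \<beta> (z - y)\<bar> \<partial>lborel) \<partial>lborel) < \<infinity>"
  proof -
    have "(\<integral>\<^sup>+x. \<bar>f x * \<alpha> (z - x)\<bar> \<partial>lborel) = ennreal (cv (\<lambda>x. \<bar>\<alpha> x\<bar>) (\<lambda>x. \<bar>f x\<bar>) z)" for z
      unfolding cv_def abs_mult[symmetric] using i by (intro nn_integral_eq_integral) auto
    moreover have "(\<integral>\<^sup>+x. \<bar>g x * \<beta> (z - x)\<bar> \<partial>lborel) = ennreal (cv (\<lambda>x. \<bar>\<beta> x\<bar>) (\<lambda>x. \<bar>g x\<bar>) z)" for z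
      unfolding cv_def abs_mult[symmetric] using i by (intro nn_integral_eq_integral) auto
    moreover have "0 \<le> cv (\<lambda>x. \<bar>\<alpha> x\<bar>) (\<lambda>x. \<bar>f x\<bar>) z" "0 \<le> cv (\<lambda>x. \<bar>\<beta> x\<bar>) (\<lambda>x. \<bar>g x\<bar>) z" for z
      by (auto simp: cv_def)
    ultimately show ?thesis
      using fin by (simp add: ennreal_mult[symmetric] integrable_iff_bounded)
  qed
  show ?thesis
    using triple_Fubini(2)[of "\<lambda>z x. f x * \<alpha> (z - x)" "\<lambda>z x. g x * \<beta> (z - x)", OF _ _ i fin']
    by (simp add: cv_def ac_simps flip: integral_mult_right_zero)
qed


section \<open>Mollifiers and correlations\<close>

definition mollifier :: "real \<Rightarrow> ('a::euclidean_space \<Rightarrow> real) \<Rightarrow> bool" where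
  "mollifier r \<rho> \<longleftrightarrow> kern \<rho> \<and> (\<forall>x. 0 \<le> \<rho> x) \<and> (LBINT x. \<rho> x) = 1 \<and> (\<forall>x. r < norm x \<longrightarrow> \<rho> x = 0)"

lemma mollifier_nn_integral: "mollifier r \<rho> \<Longrightarrow> (\<integral>\<^sup>+x. ennreal (\<rho> x) \<partial>lborel) = 1"
  by (subst nn_integral_eq_integral) (auto simp: mollifier_def kern_integrable)

lemma mollifier_prod:
  assumes "mollifier r \<rho>"
  shows "integrable (lborel \<Otimes>\<^sub>M lborel) (\<lambda>w. \<rho> (fst w) * \<rho> (snd w))"
    and "(\<integral>w. \<rho> (fst w) * \<rho> (snd w) \<partial>(lborel \<Otimes>\<^sub>M lborel)) = 1"
proof -
  have [measurable]: "\<rho> \<in> borel_measurable borel" using assms by (simp add: mollifier_def kern_def)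
  have i: "integrable lborel \<rho>" using assms by (simp add: mollifier_def kern_integrable)
  have pos: "0 \<le> \<rho> x" for x using assms by (simp add: mollifier_def)
  show I: "integrable (lborel \<Otimes>\<^sub>M lborel) (\<lambda>w. \<rho> (fst w) * \<rho> (snd w))"
  proof (rule integrableI_bounded)
    have "(\<integral>\<^sup>+w. ennreal (norm (\<rho> (fst w) * \<rho> (snd w))) \<partial>(lborel \<Otimes>\<^sub>M lborel))
      = (\<integral>\<^sup>+v. \<integral>\<^sup>+w. ennreal (\<rho> v) * ennreal (\<rho> w) \<partial>lborel \<partial>lborel)"
      by (subst lborel.nn_integral_fst[symmetric]) (auto simp: abs_mult pos ennreal_mult)
    also have "\<dots> = 1" by (simp add: nn_integral_cmult mollifier_nn_integral[OF assms])
    finally show "(\<integral>\<^sup>+w. ennreal (norm (\<rho> (fst w) * \<rho> (snd w))) \<partial>(lborel \<Otimes>\<^sub>M lborel)) < \<infinity>" by simp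
  qed measurable
  show "(\<integral>w. \<rho> (fst w) * \<rho> (snd w) \<partial>(lborel \<Otimes>\<^sub>M lborel)) = 1"
    using lborel_pair.integral_fst'[OF I] assms by (simp add: mollifier_def)
qed

lemma cv_correlation:
  fixes f g :: "'a::euclidean_space \<Rightarrow> real"
  assumes [measurable]: "f \<in> borel_measurable borel" "g \<in> borel_measurable borel"
    and \<rho>: "mollifier r \<rho>"
    and i: "\<And>z. integrable lborel (\<lambda>x. f x * \<rho> (z - x))" "\<And>z. integrable lborel (\<lambda>x. g x * \<rho> (z - x))"
    and C: "\<And>h. integrable lborel (\<lambda>y. f (y + h) * g y)" "\<And>h. (LBINT y. \<bar>f (y + h) * g y\<bar>) \<le> M"
  shows "integrable lborel (\<lambda>z. cv \<rho> f z * cv \<rho> g z)"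
    and "integrable (lborel \<Otimes>\<^sub>M lborel) (\<lambda>w. \<rho> (fst w) * \<rho> (snd w) * (LBINT y. f (y + (snd w - fst w)) * g y))"
    and "(LBINT z. cv \<rho> f z * cv \<rho> g z)
     = (\<integral>w. \<rho> (fst w) * \<rho> (snd w) * (LBINT y. f (y + (snd w - fst w)) * g y) \<partial>(lborel \<Otimes>\<^sub>M lborel))"
proof -
  have k: "kern \<rho>" and pos: "\<And>x. 0 \<le> \<rho> x" and one: "(LBINT x. \<rho> x) = 1"
    and supp: "\<And>x. r < norm x \<Longrightarrow> \<rho> x = 0" using \<rho> by (auto simp: mollifier_def)
  have [measurable]: "\<rho> \<in> borel_measurable borel" using k by (simp add: kern_def)
  have n1: "(\<integral>\<^sup>+x. ennreal (\<rho> x) \<partial>lborel) = 1" by (rule mollifier_nn_integral[OF \<rho>])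
  let ?\<phi> = "\<lambda>z v. f (z - v) * \<rho> v" and ?\<psi> = "\<lambda>z v. g (z - v) * \<rho> v"
  have i': "integrable lborel (?\<phi> z)" "integrable lborel (?\<psi> z)" for z
    using i[of z] integrable_reflect[of "?\<phi> z" z] integrable_reflect[of "?\<psi> z" z] by simp_all
  have sub: "f (z - v) * g (z - w) = (\<lambda>y. f (y + (w - v)) * g y) (z + - w)" for z v w
    by (simp add: algebra_simps)
  have inner: "(\<integral>\<^sup>+z. ennreal (\<bar>?\<phi> z v\<bar> * \<bar>?\<psi> z w\<bar>) \<partial>lborel) \<le> ennreal M * ennreal (\<rho> v) * ennreal (\<rho> w)" for v w
  proof -
    have "(\<integral>\<^sup>+z. ennreal (\<bar>?\<phi> z v\<bar> * \<bar>?\<psi> z w\<bar>) \<partial>lborel)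
       = (\<integral>\<^sup>+z. ennreal (\<bar>(\<lambda>y. f (y + (w - v)) * g y) (z + - w)\<bar> * (\<rho> v * \<rho> w)) \<partial>lborel)"
      unfolding sub[symmetric] by (intro nn_integral_cong) (simp add: abs_mult pos ac_simps)
    also have "\<dots> = (\<integral>\<^sup>+z. ennreal (\<bar>(\<lambda>y. f (y + (w - v)) * g y) z\<bar> * (\<rho> v * \<rho> w)) \<partial>lborel)"
      by (rule nn_integral_shift) measurable
    also have "\<dots> = (\<integral>\<^sup>+z. ennreal \<bar>f (z + (w - v)) * g z\<bar> \<partial>lborel) * (ennreal (\<rho> v) * ennreal (\<rho> w))"
      by (simp add: ennreal_mult pos nn_integral_multc)
    also have "(\<integral>\<^sup>+z. ennreal \<bar>f (z + (w - v)) * g z\<bar> \<partial>lborel) = ennreal (LBINT y. \<bar>f (y + (w - v)) * g y\<bar>)"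
      using C(1) by (intro nn_integral_eq_integral) auto
    also have "\<dots> * (ennreal (\<rho> v) * ennreal (\<rho> w)) \<le> ennreal M * (ennreal (\<rho> v) * ennreal (\<rho> w))"
      using C(2) by (intro mult_right_mono ennreal_leI) auto
    finally show ?thesis by (simp add: mult.assoc)
  qed
  have "(\<integral>\<^sup>+z. (\<integral>\<^sup>+v. \<bar>?\<phi> z v\<bar> \<partial>lborel) * (\<integral>\<^sup>+w. \<bar>?\<psi> z w\<bar> \<partial>lborel) \<partial>lborel)
    = (\<integral>\<^sup>+z. \<integral>\<^sup>+v. \<integral>\<^sup>+w. ennreal (\<bar>?\<phi> z v\<bar> * \<bar>?\<psi> z w\<bar>) \<partial>lborel \<partial>lborel \<partial>lborel)"
    by (simp add: ennreal_mult nn_integral_cmult nn_integral_multc)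
  also have "\<dots> = (\<integral>\<^sup>+v. \<integral>\<^sup>+z. \<integral>\<^sup>+w. ennreal (\<bar>?\<phi> z v\<bar> * \<bar>?\<psi> z w\<bar>) \<partial>lborel \<partial>lborel \<partial>lborel)"
    by (intro lborel_pair.Fubini') measurable
  also have "\<dots> = (\<integral>\<^sup>+v. \<integral>\<^sup>+w. \<integral>\<^sup>+z. ennreal (\<bar>?\<phi> z v\<bar> * \<bar>?\<psi> z w\<bar>) \<partial>lborel \<partial>lborel \<partial>lborel)"
    by (intro nn_integral_cong lborel_pair.Fubini') measurable
  also have "\<dots> \<le> (\<integral>\<^sup>+v. \<integral>\<^sup>+w. ennreal M * ennreal (\<rho> v) * ennreal (\<rho> w) \<partial>lborel \<partial>lborel)"
    by (intro nn_integral_mono inner)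
  also have "\<dots> = ennreal M" by (simp add: nn_integral_cmult n1)
  also have "\<dots> < \<infinity>" by simp
  finally have fin: "(\<integral>\<^sup>+z. (\<integral>\<^sup>+v. \<bar>?\<phi> z v\<bar> \<partial>lborel) * (\<integral>\<^sup>+w. \<bar>?\<psi> z w\<bar> \<partial>lborel) \<partial>lborel) < \<infinity>" .
  have alt: "(LBINT v. ?\<phi> z v) = cv \<rho> f z" "(LBINT v. ?\<psi> z v) = cv \<rho> g z" for z
    by (simp_all add: cv_alt)
  have eq: "(LBINT z. ?\<phi> z v * ?\<psi> z w) = \<rho> v * \<rho> w * (LBINT y. f (y + (w - v)) * g y)" for v w
  proof -
    have "(LBINT z. ?\<phi> z v * ?\<psi> z w) = (LBINT z. \<rho> v * \<rho> w * (\<lambda>y. f (y + (w - v)) * g y) (z + - w))"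
      unfolding sub[symmetric] by (intro Bochner_Integration.integral_cong) (auto simp: ac_simps)
    also have "\<dots> = \<rho> v * \<rho> w * (LBINT z. (\<lambda>y. f (y + (w - v)) * g y) (z + - w))" by simp
    also have "(LBINT z. (\<lambda>y. f (y + (w - v)) * g y) (z + - w)) = (LBINT y. f (y + (w - v)) * g y)"
      by (rule integral_shift) measurable
    finally show ?thesis .
  qed
  have mm: "case_prod ?\<phi> \<in> borel_measurable (borel \<Otimes>\<^sub>M borel)" "case_prod ?\<psi> \<in> borel_measurable (borel \<Otimes>\<^sub>M borel)"
    by measurable
  note tf = triple_Fubini[OF mm i' fin, unfolded alt eq]
  show "integrable lborel (\<lambda>z. cv \<rho> f z * cv \<rho> g z)"
    and "integrable (lborel \<Otimes>\<^sub>M lborel) (\<lambda>w. \<rho> (fst w) * \<rho> (snd w) * (LBINT y. f (y + (snd w - fst w)) * g y))"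
    and "(LBINT z. cv \<rho> f z * cv \<rho> g z)
     = (\<integral>w. \<rho> (fst w) * \<rho> (snd w) * (LBINT y. f (y + (snd w - fst w)) * g y) \<partial>(lborel \<Otimes>\<^sub>M lborel))"
    by (fact tf)+
qed

text \<open>By \<open>cv_correlation\<close> the mollified pairing is an average of correlations
  with the probability density \<open>\<rho> v * \<rho> w\<close>, over shifts w - v of length at
  most 2 r.\<close>

lemma mollified_correlation_close:
  fixes f g :: "'a::euclidean_space \<Rightarrow> real"
  assumes [measurable]: "f \<in> borel_measurable borel" "g \<in> borel_measurable borel"
    and \<rho>: "mollifier r \<rho>"
    and i: "\<And>z. integrable lborel (\<lambda>x. f x * \<rho> (z - x))" "\<And>z. integrable lborel (\<lambda>x. g x * \<rho> (z - x))"
    and C: "\<And>h. integrable lborel (\<lambda>y. f (y + h) * g y)" "\<And>h. (LBINT y. \<bar>f (y + h) * g y\<bar>) \<le> M"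
    and e: "\<And>h. norm h \<le> 2 * r \<Longrightarrow> \<bar>(LBINT y. f (y + h) * g y) - c\<bar> \<le> e"
  shows "\<bar>(LBINT z. cv \<rho> f z * cv \<rho> g z) - c\<bar> \<le> e"
proof -
  let ?C = "\<lambda>w. LBINT y. f (y + (snd w - fst w)) * g y"
  let ?r = "\<lambda>w. \<rho> (fst w) * \<rho> (snd w)"
  note cc = cv_correlation[OF assms(1,2) \<rho> i C]
  note mp = mollifier_prod[OF \<rho>]
  have pos: "0 \<le> \<rho> x" and supp: "r < norm x \<Longrightarrow> \<rho> x = 0" for x using \<rho> by (auto simp: mollifier_def)
  have "(LBINT z. cv \<rho> f z * cv \<rho> g z) - c = (\<integral>w. ?r w * ?C w \<partial>(lborel \<Otimes>\<^sub>M lborel)) - (\<integral>w. c * ?r w \<partial>(lborel \<Otimes>\<^sub>M lborel))"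
    by (simp add: cc(3) mp)
  also have "\<dots> = (\<integral>w. ?r w * (?C w - c) \<partial>(lborel \<Otimes>\<^sub>M lborel))"
    using cc(2) integrable_mult_right[OF mp(1), of c]
    by (subst Bochner_Integration.integral_diff[symmetric]) (auto simp: algebra_simps)
  also have "\<bar>\<dots>\<bar> \<le> (\<integral>w. \<bar>?r w * (?C w - c)\<bar> \<partial>(lborel \<Otimes>\<^sub>M lborel))" by (rule integral_abs_bound)
  also have "\<dots> \<le> (\<integral>w. e * ?r w \<partial>(lborel \<Otimes>\<^sub>M lborel))"
  proof (rule integral_mono)
    show "integrable (lborel \<Otimes>\<^sub>M lborel) (\<lambda>w. \<bar>?r w * (?C w - c)\<bar>)"
      using Bochner_Integration.integrable_diff[OF cc(2) integrable_mult_right[OF mp(1), of c]]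
      by (intro integrable_abs) (simp add: algebra_simps)
    show "integrable (lborel \<Otimes>\<^sub>M lborel) (\<lambda>w. e * ?r w)" using mp by simp
    show "\<bar>?r w * (?C w - c)\<bar> \<le> e * ?r w" for w
    proof (cases "norm (fst w) \<le> r \<and> norm (snd w) \<le> r")
      case True
      then have "norm (snd w - fst w) \<le> 2 * r" using norm_triangle_ineq4[of "snd w" "fst w"] by linarith
      from mult_left_mono[OF e[OF this], of "?r w"] show ?thesis by (simp add: abs_mult pos ac_simps)
    next
      case False
      then have "?r w = 0" using supp by (auto simp: not_le)
      then show ?thesis by (simp only: mult_zero_left mult_zero_right abs_zero order_refl)
    qed
  qed
  also have "\<dots> = e" using mp by simp
  finally show ?thesis .
qed

lemma mollified_correlation_bound:
  fixes f g :: "'a::euclidean_space \<Rightarrow> real"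
  assumes "f \<in> borel_measurable borel" "g \<in> borel_measurable borel"
    and \<rho>: "mollifier r \<rho>"
    and i: "\<And>z. integrable lborel (\<lambda>x. f x * \<rho> (z - x))" "\<And>z. integrable lborel (\<lambda>x. g x * \<rho> (z - x))"
    and C: "\<And>h. integrable lborel (\<lambda>y. f (y + h) * g y)" "\<And>h. (LBINT y. \<bar>f (y + h) * g y\<bar>) \<le> M"
  shows "\<bar>\<integral>z. cv \<rho> f z * cv \<rho> g z \<partial>lborel\<bar> \<le> M"
proof -
  have "\<bar>\<integral>y. f (y + h) * g y \<partial>lborel\<bar> \<le> M" for h
    using C(2)[of h] integral_abs_bound[of lborel "\<lambda>y. f (y + h) * g y"] by linarith
  with mollified_correlation_close[OF assms, of 0 M] show ?thesis by simp
qed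

text \<open>The average runs over all short shifts at once; sequential continuity of the correlation
  at 0 is therefore converted into a bound on a ball.\<close>

lemma mollified_correlation_tendsto:
  fixes f g :: "'a::euclidean_space \<Rightarrow> real" and \<rho> :: "nat \<Rightarrow> 'a \<Rightarrow> real"
  assumes m: "f \<in> borel_measurable borel" "g \<in> borel_measurable borel"
    and \<rho>: "\<And>n. mollifier (r n) (\<rho> n)" and r: "r \<longlonglongrightarrow> 0"
    and i: "\<And>n z. integrable lborel (\<lambda>x. f x * \<rho> n (z - x))" "\<And>n z. integrable lborel (\<lambda>x. g x * \<rho> n (z - x))"
    and C: "\<And>h. integrable lborel (\<lambda>y. f (y + h) * g y)" "\<And>h. (LBINT y. \<bar>f (y + h) * g y\<bar>) \<le> M"
    and lim: "\<And>h. h \<longlonglongrightarrow> 0 \<Longrightarrow> (\<lambda>n. LBINT y. f (y + h n) * g y) \<longlonglongrightarrow> (LBINT y. f y * g y)"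
  shows "(\<lambda>n. LBINT z. cv (\<rho> n) f z * cv (\<rho> n) g z) \<longlonglongrightarrow> (LBINT y. f y * g y)"
proof -
  define c where "c h = (LBINT y. f (y + h) * g y)" for h
  have "continuous (at 0) c"
    unfolding continuous_at_sequentially c_def using lim by (auto simp: o_def)
  show ?thesis
  proof (rule LIMSEQ_I)
    fix e :: real assume "e > 0"
    then obtain d where d: "d > 0" "\<And>h. dist h 0 < d \<Longrightarrow> dist (c h) (c 0) < e / 2"
      using \<open>continuous (at 0) c\<close> unfolding continuous_at_eps_delta by (metis half_gt_zero)
    obtain N where N: "\<And>n. n \<ge> N \<Longrightarrow> norm (r n - 0) < d / 2"
      using LIMSEQ_D[OF r, of "d/2"] d by auto
    show "\<exists>N. \<forall>n\<ge>N. norm ((LBINT z. cv (\<rho> n) f z * cv (\<rho> n) g z) - (LBINT y. f y * g y)) < e"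
    proof (intro exI allI impI)
      fix n assume "n \<ge> N"
      then have rn: "\<bar>r n\<bar> < d / 2" using N by simp
      have "\<bar>(LBINT z. cv (\<rho> n) f z * cv (\<rho> n) g z) - c 0\<bar> \<le> e / 2"
      proof (rule mollified_correlation_close[OF m \<rho> i C])
        fix h :: 'a assume "norm h \<le> 2 * r n"
        then have "dist h 0 < d" using rn by simp
        from d(2)[OF this] show "\<bar>(LBINT y. f (y + h) * g y) - c 0\<bar> \<le> e / 2"
          by (simp add: c_def dist_real_def)
      qed
      then show "norm ((LBINT z. cv (\<rho> n) f z * cv (\<rho> n) g z) - (LBINT y. f y * g y)) < e"
        using \<open>e > 0\<close> by (simp add: c_def)
    qed
  qed
qed

lemma L2_correlation:
  fixes f g :: "'a::euclidean_space \<Rightarrow> real"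
  assumes f: "f \<in> L2 lborel" and g: "g \<in> L2 lborel"
  shows "integrable lborel (\<lambda>y. f (y + h) * g y)"
    and "(LBINT y. \<bar>f (y + h) * g y\<bar>) \<le> sqrt (LBINT y. (f y)\<^sup>2) * sqrt (LBINT y. (g y)\<^sup>2)"
    and "h' \<longlonglongrightarrow> 0 \<Longrightarrow> (\<lambda>n. LBINT y. f (y + h' n) * g y) \<longlonglongrightarrow> (LBINT y. f y * g y)"
proof -
  have [measurable]: "f \<in> borel_measurable borel" using f by (simp add: L2_def)
  show I: "integrable lborel (\<lambda>y. f (y + h) * g y)" for h by (intro L2_mult_integrable L2_shift f g)
  show "(LBINT y. \<bar>f (y + h) * g y\<bar>) \<le> sqrt (LBINT y. (f y)\<^sup>2) * sqrt (LBINT y. (g y)\<^sup>2)"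
    using L2_Cauchy_Schwarz_abs[OF L2_shift[OF f, of h] g] integral_shift[of "\<lambda>y. (f y)\<^sup>2" h] by simp
  assume h': "h' \<longlonglongrightarrow> 0"
  have "(\<lambda>n. sqrt (LBINT y. (f (y + h' n) - f y)\<^sup>2) * sqrt (LBINT y. (g y)\<^sup>2)) \<longlonglongrightarrow> sqrt 0 * sqrt (LBINT y. (g y)\<^sup>2)"
    by (intro tendsto_intros L2_translation_continuous f h')
  then have lim: "(\<lambda>n. sqrt (LBINT y. (f (y + h' n) - f y)\<^sup>2) * sqrt (LBINT y. (g y)\<^sup>2)) \<longlonglongrightarrow> 0" by simp
  have "(\<lambda>n. (LBINT y. f (y + h' n) * g y) - (LBINT y. f y * g y)) \<longlonglongrightarrow> 0"
  proof (rule Lim_null_comparison[OF _ lim], intro always_eventually allI)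
    fix n
    have "(LBINT y. f (y + h' n) * g y) - (LBINT y. f y * g y) = (LBINT y. (f (y + h' n) - f y) * g y)"
      using I L2_mult_integrable[OF f g] by (simp add: left_diff_distrib)
    also have "norm \<dots> \<le> (LBINT y. \<bar>(f (y + h' n) - f y) * g y\<bar>)"
      using integral_abs_bound by simp
    also have "\<dots> \<le> sqrt (LBINT y. (f (y + h' n) - f y)\<^sup>2) * sqrt (LBINT y. (g y)\<^sup>2)"
      by (intro L2_Cauchy_Schwarz_abs L2_diff L2_shift f g)
    finally show "norm ((LBINT y. f (y + h' n) * g y) - (LBINT y. f y * g y))
      \<le> sqrt (LBINT y. (f (y + h' n) - f y)\<^sup>2) * sqrt (LBINT y. (g y)\<^sup>2)" .
  qed
  then show "(\<lambda>n. LBINT y. f (y + h' n) * g y) \<longlonglongrightarrow> (LBINT y. f y * g y)"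
    by (rule LIM_zero_cancel)
qed

lemma mollified_inner_tendsto:
  fixes f g :: "'a::euclidean_space \<Rightarrow> real"
  assumes f: "f \<in> L2 lborel" and g: "g \<in> L2 lborel"
    and \<rho>: "\<And>n. mollifier (r n) (\<rho> n)" and r: "r \<longlonglongrightarrow> 0"
  shows "(\<lambda>n. LBINT z. cv (\<rho> n) f z * cv (\<rho> n) g z) \<longlonglongrightarrow> (LBINT y. f y * g y)"
  using f g \<rho> by (intro mollified_correlation_tendsto[OF _ _ \<rho> r _ _ L2_correlation[OF f g]])
    (auto simp: L2_measurable[of _ lborel, simplified] mollifier_def intro!: cv_integrable_L2)

lemma mollified_inner_bound:
  fixes f g :: "'a::euclidean_space \<Rightarrow> real"
  assumes f: "f \<in> L2 lborel" and g: "g \<in> L2 lborel" and \<rho>: "mollifier r \<rho>"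
  shows "\<bar>\<integral>z. cv \<rho> f z * cv \<rho> g z \<partial>lborel\<bar> \<le> sqrt (LBINT y. (f y)\<^sup>2) * sqrt (LBINT y. (g y)\<^sup>2)"
  using f g \<rho> by (intro mollified_correlation_bound[OF _ _ \<rho> _ _ L2_correlation(1,2)[OF f g]])
    (auto simp: L2_measurable[of _ lborel, simplified] mollifier_def intro!: cv_integrable_L2)

text \<open>Jensen's inequality bounds the squared distance of \<open>cv (\<rho> n) f\<close> from
  \<open>f\<close> by the average, with weight \<open>\<rho> n v\<close>, of the squared distances
  between \<open>f\<close> and its translates by -v, which are small on the support of the
  kernel.\<close>

lemma mollify_L2_tendsto:
  fixes f :: "'a::euclidean_space \<Rightarrow> real"
  assumes f: "f \<in> L2 lborel" and \<rho>: "\<And>n. mollifier (r n) (\<rho> n)" and r: "r \<longlonglongrightarrow> 0"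
  shows "(\<lambda>n. LBINT z. (cv (\<rho> n) f z - f z)\<^sup>2) \<longlonglongrightarrow> 0"
proof -
  have [measurable]: "f \<in> borel_measurable borel" using f by (simp add: L2_def)
  define c where "c h = (LBINT y. (f (y + h) - f y)\<^sup>2)" for h
  have c0: "c 0 = 0" by (simp add: c_def)
  have "continuous (at 0) c"
    unfolding continuous_at_sequentially c_def using L2_translation_continuous[OF f] by (auto simp: o_def)
  show ?thesis
  proof (rule LIMSEQ_I)
    fix e :: real assume "e > 0"
    then obtain d where d: "d > 0" "\<And>h. dist h 0 < d \<Longrightarrow> dist (c h) (c 0) < e / 2"
      using \<open>continuous (at 0) c\<close> unfolding continuous_at_eps_delta by (metis half_gt_zero)
    obtain N where N: "\<And>n. n \<ge> N \<Longrightarrow> norm (r n - 0) < d"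
      using LIMSEQ_D[OF r, of d] d by auto
    show "\<exists>N. \<forall>n\<ge>N. norm ((LBINT z. (cv (\<rho> n) f z - f z)\<^sup>2) - 0) < e"
    proof (intro exI allI impI)
      fix n assume "n \<ge> N"
      then have rn: "\<bar>r n\<bar> < d" using N by simp
      have k: "kern (\<rho> n)" and pos: "\<And>x. 0 \<le> \<rho> n x" and one: "(LBINT x. \<rho> n x) = 1"
        and supp: "\<And>x. r n < norm x \<Longrightarrow> \<rho> n x = 0" using \<rho>[of n] by (auto simp: mollifier_def)
      have [measurable]: "\<rho> n \<in> borel_measurable borel" using k by (simp add: kern_def)
      note n1 = mollifier_nn_integral[OF \<rho>[of n]]
      have eq: "cv (\<rho> n) f z - f z = (LBINT v. (f (z - v) - f z) * \<rho> n v)" for z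
      proof -
        have "integrable lborel (\<lambda>v. f (z - v) * \<rho> n v)"
          using cv_integrable_L2[OF f k, of z] integrable_reflect[of "\<lambda>v. f (z - v) * \<rho> n v" z] by simp
        then show ?thesis using kern_integrable[OF k] by (simp add: cv_alt left_diff_distrib one)
      qed
      have "(\<integral>\<^sup>+z. ennreal ((cv (\<rho> n) f z - f z)\<^sup>2) \<partial>lborel) \<le>
         (\<integral>\<^sup>+z. 1 * (\<integral>\<^sup>+v. ennreal ((f (z - v) - f z)\<^sup>2) * \<bar>\<rho> n v\<bar> \<partial>lborel) \<partial>lborel)"
        unfolding eq using n1 pos kernel_Cauchy_Schwarz[of "\<lambda>v. f (_ - v) - f _" lborel "\<rho> n"]
        by (intro nn_integral_mono) simp
      also have "\<dots> = (\<integral>\<^sup>+v. (\<integral>\<^sup>+z. ennreal ((f (z - v) - f z)\<^sup>2) * \<bar>\<rho> n v\<bar> \<partial>lborel) \<partial>lborel)"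
        by (simp, intro lborel_pair.Fubini') measurable
      also have "\<dots> = (\<integral>\<^sup>+v. ennreal (c (- v)) * ennreal (\<rho> n v) \<partial>lborel)"
      proof (intro nn_integral_cong)
        fix v
        show "(\<integral>\<^sup>+z. ennreal ((f (z - v) - f z)\<^sup>2) * \<bar>\<rho> n v\<bar> \<partial>lborel) = ennreal (c (- v)) * ennreal (\<rho> n v)"
          using nn_integral_square_L2[OF L2_diff[OF L2_shift[OF f, of "-v"] f]]
          by (simp add: nn_integral_multc pos c_def)
      qed
      also have "\<dots> \<le> (\<integral>\<^sup>+v. ennreal (e / 2) * ennreal (\<rho> n v) \<partial>lborel)"
      proof (intro nn_integral_mono)
        fix v
        show "ennreal (c (- v)) * ennreal (\<rho> n v) \<le> ennreal (e / 2) * ennreal (\<rho> n v)"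
        proof (cases "norm v \<le> r n")
          case True
          then have "dist (- v) 0 < d" using rn by simp
          from d(2)[OF this] show ?thesis
            by (intro mult_right_mono ennreal_leI) (auto simp: c0)
        qed (simp add: supp)
      qed
      also have "\<dots> = ennreal (e / 2)" by (simp add: nn_integral_cmult n1)
      finally have "(LBINT z. (cv (\<rho> n) f z - f z)\<^sup>2) \<le> e / 2"
        using \<open>e > 0\<close> by (intro integral_le_nn) auto
      then show "norm ((LBINT z. (cv (\<rho> n) f z - f z)\<^sup>2) - 0) < e"
        using \<open>e > 0\<close> by simp
    qed
  qed
qed

text \<open>The same averaging with absolute values. It serves functions of time, which are only
  integrable in \<open>du_Bois_Reymond\<close>.\<close>

lemma mollify_L1_tendsto:
  fixes f :: "'a::euclidean_space \<Rightarrow> real"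
  assumes f: "integrable lborel f" and \<rho>: "\<And>n. mollifier (r n) (\<rho> n)" and r: "r \<longlonglongrightarrow> 0"
  shows "(\<lambda>n. LBINT z. \<bar>cv (\<rho> n) f z - f z\<bar>) \<longlonglongrightarrow> 0"
proof -
  have [measurable]: "f \<in> borel_measurable borel" using f by (auto dest: borel_measurable_integrable)
  define c where "c h = (LBINT y. \<bar>f (y + h) - f y\<bar>)" for h
  have c0: "c 0 = 0" by (simp add: c_def)
  have "continuous (at 0) c"
    unfolding continuous_at_sequentially c_def using L1_translation_continuous[OF f] by (auto simp: o_def)
  show ?thesis
  proof (rule LIMSEQ_I)
    fix e :: real assume "e > 0"
    then obtain d where d: "d > 0" "\<And>h. dist h 0 < d \<Longrightarrow> dist (c h) (c 0) < e / 2"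
      using \<open>continuous (at 0) c\<close> unfolding continuous_at_eps_delta by (metis half_gt_zero)
    obtain N where N: "\<And>n. n \<ge> N \<Longrightarrow> norm (r n - 0) < d"
      using LIMSEQ_D[OF r, of d] d by auto
    show "\<exists>N. \<forall>n\<ge>N. norm ((LBINT z. \<bar>cv (\<rho> n) f z - f z\<bar>) - 0) < e"
    proof (intro exI allI impI)
      fix n assume "n \<ge> N"
      then have rn: "\<bar>r n\<bar> < d" using N by simp
      have k: "kern (\<rho> n)" and pos: "\<And>x. 0 \<le> \<rho> n x" and one: "(LBINT x. \<rho> n x) = 1"
        and supp: "\<And>x. r n < norm x \<Longrightarrow> \<rho> n x = 0" using \<rho>[of n] by (auto simp: mollifier_def)
      have [measurable]: "\<rho> n \<in> borel_measurable borel" using k by (simp add: kern_def)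
      note n1 = mollifier_nn_integral[OF \<rho>[of n]]
      have I: "integrable lborel (\<lambda>v. (f (z - v) - f z) * \<rho> n v)"
       and eq: "cv (\<rho> n) f z - f z = (LBINT v. (f (z - v) - f z) * \<rho> n v)" for z
      proof -
        have "integrable lborel (\<lambda>v. f (z - v) * \<rho> n v)"
          using cv_integrable_L1[OF f k, of z] integrable_reflect[of "\<lambda>v. f (z - v) * \<rho> n v" z] by simp
        then show "cv (\<rho> n) f z - f z = (LBINT v. (f (z - v) - f z) * \<rho> n v)"
          "integrable lborel (\<lambda>v. (f (z - v) - f z) * \<rho> n v)"
          using kern_integrable[OF k] by (simp_all add: cv_alt left_diff_distrib one)
      qed
      have "(\<integral>\<^sup>+z. ennreal \<bar>cv (\<rho> n) f z - f z\<bar> \<partial>lborel) \<le>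
         (\<integral>\<^sup>+z. (\<integral>\<^sup>+v. ennreal \<bar>f (z - v) - f z\<bar> * ennreal (\<rho> n v) \<partial>lborel) \<partial>lborel)"
        unfolding eq using integral_norm_bound_ennreal[OF I]
        by (intro nn_integral_mono) (simp add: abs_mult pos ennreal_mult)
      also have "\<dots> = (\<integral>\<^sup>+v. (\<integral>\<^sup>+z. ennreal \<bar>f (z - v) - f z\<bar> * ennreal (\<rho> n v) \<partial>lborel) \<partial>lborel)"
        by (intro lborel_pair.Fubini') measurable
      also have "\<dots> = (\<integral>\<^sup>+v. ennreal (c (- v)) * ennreal (\<rho> n v) \<partial>lborel)"
      proof (intro nn_integral_cong)
        fix v
        have "integrable lborel (\<lambda>z. \<bar>f (z + - v) - f z\<bar>)"
          using f integrable_shift[of f "-v"] by (intro integrable_abs Bochner_Integration.integrable_diff) auto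
        from nn_integral_eq_integral[OF this]
        show "(\<integral>\<^sup>+z. ennreal \<bar>f (z - v) - f z\<bar> * ennreal (\<rho> n v) \<partial>lborel) = ennreal (c (- v)) * ennreal (\<rho> n v)"
          by (simp add: nn_integral_multc pos c_def)
      qed
      also have "\<dots> \<le> (\<integral>\<^sup>+v. ennreal (e / 2) * ennreal (\<rho> n v) \<partial>lborel)"
      proof (intro nn_integral_mono)
        fix v
        show "ennreal (c (- v)) * ennreal (\<rho> n v) \<le> ennreal (e / 2) * ennreal (\<rho> n v)"
        proof (cases "norm v \<le> r n")
          case True
          then have "dist (- v) 0 < d" using rn by simp
          from d(2)[OF this] show ?thesis
            by (intro mult_right_mono ennreal_leI) (auto simp: c0)
        qed (simp add: supp)
      qed
      also have "\<dots> = ennreal (e / 2)" by (simp add: nn_integral_cmult n1)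
      finally have "(LBINT z. \<bar>cv (\<rho> n) f z - f z\<bar>) \<le> e / 2"
        using \<open>e > 0\<close> by (intro integral_le_nn) auto
      then show "norm ((LBINT z. \<bar>cv (\<rho> n) f z - f z\<bar>) - 0) < e"
        using \<open>e > 0\<close> by simp
    qed
  qed
qed

section \<open>Test functions\<close>

text \<open>Smoothness on the line, the raw material for products satisfying \<open>Ck\<close>.
  Asking for some derivative \<open>f'\<close> lets closure proofs exhibit it without evaluating
  \<open>deriv\<close>.\<close>

primrec sm :: "nat \<Rightarrow> (real \<Rightarrow> real) \<Rightarrow> bool" where
  "sm 0 f \<longleftrightarrow> continuous_on UNIV f"
| "sm (Suc k) f \<longleftrightarrow> (\<exists>f'. (\<forall>x. (f has_real_derivative f' x) (at x)) \<and> sm k f')"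

definition smooth :: "(real \<Rightarrow> real) \<Rightarrow> bool" where
  "smooth f \<longleftrightarrow> (\<forall>k. sm k f)"

lemma sm_SucI:
  assumes "\<And>x. (f has_real_derivative f' x) (at x)" "sm k f'"
  shows "sm (Suc k) f"
  unfolding sm.simps by (intro exI[of _ f'] conjI allI assms)

lemma sm_Suc: "sm (Suc k) f \<Longrightarrow> sm k f"
proof (induction k arbitrary: f)
  case 0
  then obtain f' where "\<And>x. (f has_real_derivative f' x) (at x)" by auto
  then have "isCont f x" for x by (rule DERIV_isCont)
  then show ?case by (simp add: continuous_at_imp_continuous_on)
next
  case (Suc k)
  from Suc.prems obtain f' where "\<And>x. (f has_real_derivative f' x) (at x)" "sm (Suc k) f'"
    unfolding sm.simps(2)[of "Suc k"] by blast
  with Suc.IH show ?case by auto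
qed

lemma sm_add: "sm k f \<Longrightarrow> sm k g \<Longrightarrow> sm k (\<lambda>x. f x + g x)"
proof (induction k arbitrary: f g)
  case (Suc k)
  then obtain f' g' where *: "\<And>x. (f has_real_derivative f' x) (at x)" "sm k f'"
     "\<And>x. (g has_real_derivative g' x) (at x)" "sm k g'" by auto
  have "((\<lambda>x. f x + g x) has_real_derivative f' x + g' x) (at x)" for x by (intro DERIV_add *)
  moreover have "sm k (\<lambda>x. f' x + g' x)" by (intro Suc.IH *)
  ultimately show ?case by (rule sm_SucI)
qed (auto intro: continuous_intros)

lemma sm_mult: "sm k f \<Longrightarrow> sm k g \<Longrightarrow> sm k (\<lambda>x. f x * g x)"
proof (induction k arbitrary: f g)
  case (Suc k)
  from Suc.prems obtain f' g' where *: "\<And>x. (f has_real_derivative f' x) (at x)" "sm k f'"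
     "\<And>x. (g has_real_derivative g' x) (at x)" "sm k g'" by auto
  have **: "sm k f" "sm k g" by (rule sm_Suc[OF Suc.prems(1)], rule sm_Suc[OF Suc.prems(2)])
  have "((\<lambda>x. f x * g x) has_real_derivative f' x * g x + g' x * f x) (at x)" for x by (intro DERIV_mult *)
  moreover have "sm k (\<lambda>x. f' x * g x + g' x * f x)" by (intro sm_add Suc.IH * **)
  ultimately show ?case by (rule sm_SucI)
qed (auto intro: continuous_intros)

lemma sm_const: "sm k (\<lambda>x. c)"
proof (induction k arbitrary: c)
  case (Suc k)
  have "((\<lambda>x. c) has_real_derivative 0) (at x)" for x by (rule DERIV_const)
  then show ?case using Suc[of 0] by (rule sm_SucI)
qed simp

lemma sm_affine: "sm k f \<Longrightarrow> sm k (\<lambda>x. f (a * x + b))"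
proof (induction k arbitrary: f)
  case 0
  have "continuous_on UNIV (\<lambda>x::real. a * x + b)" by (intro continuous_intros)
  from 0 have "continuous_on UNIV f" by (simp only: sm.simps)
  from continuous_on_compose2[OF this \<open>continuous_on UNIV (\<lambda>x::real. a * x + b)\<close> subset_UNIV]
  show ?case by (simp only: sm.simps)
next
  case (Suc k)
  from Suc.prems obtain f' where f': "\<And>x. (f has_real_derivative f' x) (at x)" "sm k f'"
    unfolding sm.simps by blast
  have "((\<lambda>x. f (a * x + b)) has_real_derivative f' (a * x + b) * a) (at x)" for x
  proof -
    have "((\<lambda>x. a * x + b) has_real_derivative a) (at x)"
      using DERIV_add[OF DERIV_cmult_Id[of a x UNIV] DERIV_const[of b]] by simp
    from DERIV_chain'[OF this f'(1)] show ?thesis by simp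
  qed
  moreover have "sm k (\<lambda>x. f' (a * x + b) * a)"
    by (rule sm_mult[OF Suc.IH[OF f'(2)] sm_const])
  ultimately show ?case by (rule sm_SucI)
qed

lemma smooth_add: "smooth f \<Longrightarrow> smooth g \<Longrightarrow> smooth (\<lambda>x. f x + g x)"
  and smooth_mult: "smooth f \<Longrightarrow> smooth g \<Longrightarrow> smooth (\<lambda>x. f x * g x)"
  and smooth_const: "smooth (\<lambda>x. c)"
  and smooth_affine: "smooth f \<Longrightarrow> smooth (\<lambda>x. f (a * x + b))"
  by (auto simp: smooth_def intro: sm_add sm_mult sm_const sm_affine)

lemma smooth_DERIV: 
  assumes "smooth f" shows "(f has_real_derivative deriv f x) (at x)"
proof -
  have "sm (Suc 0) f" using assms by (simp add: smooth_def del: sm.simps)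
  then obtain f' where "(f has_real_derivative f' x) (at x)" by auto
  then show ?thesis using DERIV_imp_deriv by metis
qed

lemma smooth_deriv: assumes "smooth f" shows "smooth (deriv f)"
  unfolding smooth_def
proof
  fix k
  have "sm (Suc k) f" using assms by (simp add: smooth_def del: sm.simps)
  then obtain f' where "\<forall>x. (f has_real_derivative f' x) (at x)" "sm k f'" by auto
  moreover from this have "f' = deriv f" by (intro ext) (metis DERIV_imp_deriv)
  ultimately show "sm k (deriv f)" by simp
qed

lemma smooth_continuous: "smooth f \<Longrightarrow> continuous_on UNIV f"
  unfolding smooth_def by (metis sm.simps(1))

lemma smooth_measurable: "smooth f \<Longrightarrow> f \<in> borel_measurable borel"
  by (rule borel_measurable_continuous_onI[OF smooth_continuous])

lemma smooth_primitive:
  assumes "\<And>x. (F has_real_derivative f x) (at x)" "smooth f"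
  shows "smooth F"
  unfolding smooth_def
proof
  fix k
  have "sm (Suc k) F" using assms by (auto simp: smooth_def)
  then show "sm k F" by (rule sm_Suc)
qed

text \<open>The free power \<open>y ^ n\<close> makes the induction on coefficients work: a
  polynomial with constant term \<open>a\<close> is a + y p(y), and the factor y is absorbed by
  \<open>n\<close>.\<close>

lemma poly_exp_tendsto_0: "((\<lambda>y. y ^ n * poly p y * exp (- y)) \<longlongrightarrow> (0::real)) at_top"
proof (induction p arbitrary: n)
  case (pCons a p)
  have "((\<lambda>y. a * (y ^ n / exp y) + y ^ Suc n * poly p y * exp (- y)) \<longlongrightarrow> a * 0 + 0) at_top"
    by (intro tendsto_intros pCons.IH tendsto_power_div_exp_0)
  then show ?case by (simp add: algebra_simps exp_minus field_simps)
qed simp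

text \<open>The functions p(1/x) exp(-1/x), continued by 0: a family that contains exp(-1/x) and is
  closed under differentiation.\<close>

definition exp_bump :: "real poly \<Rightarrow> real \<Rightarrow> real" where
  "exp_bump p x = (if x > 0 then poly p (1 / x) * exp (- (1 / x)) else 0)"

text \<open>In the variable y = 1/x the derivative is -y^2 d/dy, which sends p exp(-y) to y^2 (p -
  p') exp(-y); \<open>[:0, 0, 1:]\<close> is y^2.\<close>

lemma exp_bump_DERIV: "(exp_bump p has_real_derivative exp_bump ([:0, 0, 1:] * (p - pderiv p)) x) (at x)"
proof -
  consider "x > 0" | "x < 0" | "x = 0" by linarith
  then show ?thesis
  proof cases
    case 1
    have "((\<lambda>x. poly p (1 / x) * exp (- (1 / x))) has_real_derivative
        poly ([:0, 0, 1:] * (p - pderiv p)) (1 / x) * exp (- (1 / x))) (at x)"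
    proof -
      have d: "((\<lambda>x. 1 / x) has_real_derivative - (1 / x * (1 / x))) (at x)"
        using DERIV_inverse[of x UNIV] 1 by (simp add: inverse_eq_divide power2_eq_square)
      have "((\<lambda>x. exp (- (1 / x))) has_real_derivative exp (- (1 / x)) * (1 / x * (1 / x))) (at x)"
        using DERIV_chain2[OF DERIV_exp DERIV_minus[OF d]] by simp
      from DERIV_mult[OF DERIV_chain2[OF poly_DERIV d] this] show ?thesis
        by (simp add: algebra_simps)
    qed
    then have "(exp_bump p has_real_derivative
        poly ([:0, 0, 1:] * (p - pderiv p)) (1 / x) * exp (- (1 / x))) (at x)"
      by (rule DERIV_cong_ev[THEN iffD1, rotated 3])
         (use 1 in \<open>auto simp: exp_bump_def intro!: eventually_mono[OF eventually_nhds_in_open[of "{0<..}" x]]\<close>)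
    then show ?thesis using 1 by (simp add: exp_bump_def)
  next
    case 2
    have "(exp_bump p has_real_derivative 0) (at x)"
      by (rule DERIV_cong_ev[THEN iffD1, OF refl _ refl DERIV_const[of 0]])
         (use 2 in \<open>auto simp: exp_bump_def intro!: eventually_mono[OF eventually_nhds_in_open[of "{..<0}" x]]\<close>)
    then show ?thesis using 2 by (simp add: exp_bump_def)
  next
    case 3
    have "((\<lambda>y. exp_bump p y / y) \<longlongrightarrow> 0) (at 0)"
    proof (rule filterlim_split_at)
      show "((\<lambda>y. exp_bump p y / y) \<longlongrightarrow> 0) (at_left 0)"
        by (rule tendsto_eventually) (auto simp: eventually_at_filter exp_bump_def)
      \<comment> \<open>Division by \<open>y\<close> in the difference quotient at 0 contributes one
        more power of 1/y, hence the exponent 1.\<close>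
      have "((\<lambda>y. (inverse y) ^ 1 * poly p (inverse y) * exp (- inverse y)) \<longlongrightarrow> 0) (at_right (0::real))"
        by (rule filterlim_compose[OF poly_exp_tendsto_0 filterlim_inverse_at_top_right])
      then show "((\<lambda>y. exp_bump p y / y) \<longlongrightarrow> 0) (at_right 0)"
        by (rule Lim_transform_eventually) 
           (auto simp: eventually_at_filter exp_bump_def field_simps)
    qed
    then show ?thesis using 3 by (simp add: has_field_derivative_iff exp_bump_def)
  qed
qed

lemma exp_bump_smooth: "smooth (exp_bump p)"
  unfolding smooth_def
proof
  fix k show "sm k (exp_bump p)"
  proof (induction k arbitrary: p)
    case 0
    show ?case using DERIV_isCont[OF exp_bump_DERIV] by (simp add: continuous_at_imp_continuous_on)
  next
    case (Suc k)
    show ?case by (rule sm_SucI[OF exp_bump_DERIV Suc])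
  qed
qed

section \<open>Bumps on the line and the unit kernel\<close>

definition bump :: "real \<Rightarrow> real \<Rightarrow> (real \<Rightarrow> real) \<Rightarrow> bool" where
  "bump a b f \<longleftrightarrow> smooth f \<and> (\<forall>x. x \<notin> {a..b} \<longrightarrow> f x = 0)"

lemma bump_DERIV: "bump a b f \<Longrightarrow> (f has_real_derivative deriv f x) (at x)"
  by (simp add: bump_def smooth_DERIV)

lemma bump_deriv: assumes "bump a b f" shows "bump a b (deriv f)"
  unfolding bump_def
proof (intro conjI allI impI)
  show "smooth (deriv f)" using assms by (simp add: bump_def smooth_deriv)
  fix x assume x: "x \<notin> {a..b}"
  have "open (- {a..b})" by auto
  then have "eventually (\<lambda>y. y \<in> - {a..b}) (nhds x)" using x by (intro eventually_nhds_in_open) auto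
  then have ev: "eventually (\<lambda>y. f y = 0) (nhds x)"
    by eventually_elim (use assms in \<open>auto simp: bump_def\<close>)
  have "(f has_real_derivative 0) (at x)"
    by (rule DERIV_cong_ev[THEN iffD2, OF refl ev refl DERIV_const])
  then show "deriv f x = 0" by (rule DERIV_imp_deriv)
qed

lemma bump_mult: "bump a b f \<Longrightarrow> smooth g \<Longrightarrow> bump a b (\<lambda>x. f x * g x)"
  by (auto simp: bump_def smooth_mult)

lemma bump_bounded:
  assumes "bump a b f" obtains C where "\<And>x. \<bar>f x\<bar> \<le> C * indicator {a..b} x" "0 \<le> C"
proof -
  have "bounded (f ` {a..b})"
    by (intro compact_imp_bounded compact_continuous_image continuous_on_subset[OF smooth_continuous])
       (use assms in \<open>auto simp: bump_def\<close>)
  then obtain C where "\<forall>y\<in>f ` {a..b}. norm y \<le> C" unfolding bounded_iff by blast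
  then have C: "\<And>x. x \<in> {a..b} \<Longrightarrow> \<bar>f x\<bar> \<le> C" by auto
  have "\<bar>f x\<bar> \<le> \<bar>C\<bar> * indicator {a..b} x" for x
    using C[of x] assms by (cases "x \<in> {a..b}") (auto simp: bump_def)
  then show ?thesis by (intro that) auto
qed

lemma bump_measurable: "bump a b f \<Longrightarrow> f \<in> borel_measurable borel"
  by (simp add: bump_def smooth_measurable)

lemma bump_integrable:
  assumes "bump a b f" shows "integrable lborel f"
proof -
  obtain C where C: "\<And>x. \<bar>f x\<bar> \<le> C * indicator {a..b} x" "0 \<le> C" using bump_bounded[OF assms] by blast
  show ?thesis
  proof (rule Bochner_Integration.integrable_bound)
    show "integrable lborel (\<lambda>x. C * indicat_real {a..b} x)"
      using emeasure_lborel_Icc_eq[of a b] by (intro integrable_mult_right integrable_real_indicator) (auto split: if_splits)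
    show "AE x in lborel. norm (f x) \<le> norm (C * indicat_real {a..b} x)"
      using C by (auto intro!: AE_I2 order_trans[OF _ abs_ge_self])
  qed (use bump_measurable[OF assms] in simp)
qed

lemma bump_integral_deriv:
  assumes "bump a b f" shows "(LBINT x. deriv f x) = 0"
proof (cases "a \<le> b")
  case True
  \<comment> \<open>The interval is enlarged by 1 because the definition of \<open>bump\<close>
    gives the value 0 only strictly outside \<open>{a..b}\<close>.\<close>
  have "has_bochner_integral lborel (\<lambda>x. indicator {a - 1..b + 1} x *\<^sub>R deriv f x) (f (b + 1) - f (a - 1))"
  proof (rule has_bochner_integral_FTC_Icc)
    show "continuous_on {a - 1..b + 1} (deriv f)"
      by (rule continuous_on_subset[OF smooth_continuous]) (use bump_deriv[OF assms] in \<open>auto simp: bump_def\<close>)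
    show "(f has_vector_derivative deriv f x) (at x within {a - 1..b + 1})" for x
      using bump_DERIV[OF assms, of x] unfolding has_real_derivative_iff_has_vector_derivative
      by (rule has_vector_derivative_at_within)
  qed (use True in auto)
  moreover have "(\<lambda>x. indicator {a - 1..b + 1} x *\<^sub>R deriv f x) = deriv f"
  proof
    fix x show "indicator {a - 1..b + 1} x *\<^sub>R deriv f x = deriv f x"
      using bump_deriv[OF assms] by (cases "x \<in> {a - 1..b + 1}") (auto simp: bump_def)
  qed
  moreover have "f (b + 1) = 0" "f (a - 1) = 0" using assms by (auto simp: bump_def)
  ultimately show ?thesis by (simp add: has_bochner_integral_iff)
next
  case False
  then have "deriv f x = 0" for x using bump_deriv[OF assms] by (auto simp: bump_def)
  then show ?thesis by simp
qed

lemma bump_by_parts: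
  assumes f: "bump a b f" and g: "smooth g"
  shows "(LBINT x. deriv f x * g x) = - (LBINT x. f x * deriv g x)"
proof -
  have b: "bump a b (\<lambda>x. f x * g x)" by (rule bump_mult[OF f g])
  have "deriv (\<lambda>x. f x * g x) x = deriv f x * g x + f x * deriv g x" for x
    using DERIV_mult[OF bump_DERIV[OF f] smooth_DERIV[OF g], of x] by (auto dest!: DERIV_imp_deriv simp: ac_simps)
  with bump_integral_deriv[OF b] have "(LBINT x. deriv f x * g x + f x * deriv g x) = 0" by simp
  moreover have "integrable lborel (\<lambda>x. deriv f x * g x)" "integrable lborel (\<lambda>x. f x * deriv g x)"
    using bump_integrable[OF bump_mult[OF bump_deriv[OF f] g]] bump_integrable[OF bump_mult[OF f smooth_deriv[OF g]]]
    by auto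
  ultimately show ?thesis by simp
qed

lemma bump_affine:
  assumes f: "bump a b f"
  shows "bump (z - b) (z - a) (\<lambda>x. f (z - x))" and "deriv (\<lambda>x. f (z - x)) = (\<lambda>x. - deriv f (z - x))"
proof -
  show "bump (z - b) (z - a) (\<lambda>x. f (z - x))"
    using smooth_affine[of f "-1" z] f by (auto simp: bump_def)
  have "((\<lambda>x. f (z - x)) has_real_derivative - deriv f (z - x)) (at x)" for x
  proof -
    have "((\<lambda>x. z - x) has_real_derivative -1) (at x)"
      using DERIV_diff[OF DERIV_const[of z] DERIV_ident] by simp
    from DERIV_chain'[OF this bump_DERIV[OF f]] show ?thesis by simp
  qed
  then show "deriv (\<lambda>x. f (z - x)) = (\<lambda>x. - deriv f (z - x))" by (auto intro!: DERIV_imp_deriv)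
qed

lemma ex_unit_bump: "\<exists>\<kappa>. bump (-1) 1 \<kappa> \<and> (\<forall>x. 0 \<le> \<kappa> x) \<and> (LBINT x. \<kappa> x) = 1"
proof -
  \<comment> \<open>The product of exp(-1/(1 + x)) and exp(-1/(1 - x)), positive exactly on (-1, 1);
    this interval is not a null set, so the integral is positive and can be normalised to 1.\<close>
  define \<kappa>0 where "\<kappa>0 x = exp_bump 1 (1 * x + 1) * exp_bump 1 (-1 * x + 1)" for x
  have s: "smooth \<kappa>0" unfolding \<kappa>0_def
    by (rule smooth_mult[OF smooth_affine[OF exp_bump_smooth] smooth_affine[OF exp_bump_smooth]])
  have b: "bump (-1) 1 \<kappa>0" using s by (auto simp: bump_def \<kappa>0_def exp_bump_def)
  have pos: "0 \<le> \<kappa>0 x" for x by (auto simp: \<kappa>0_def exp_bump_def)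
  have i: "integrable lborel \<kappa>0" by (rule bump_integrable[OF b])
  define c where "c = (LBINT x. \<kappa>0 x)"
  have "c \<noteq> 0"
  proof
    assume "c = 0"
    then have "AE x in lborel. \<kappa>0 x = 0"
      using integral_nonneg_eq_0_iff_AE[OF i] pos by (simp add: c_def)
    then have "AE x in lborel. x \<notin> {-1<..<1::real}"
      by (rule AE_mp) (auto intro!: AE_I2 simp: \<kappa>0_def exp_bump_def)
    then have "emeasure lborel {-1<..<1::real} = 0"
      by (subst (asm) AE_iff_measurable[where N = "{-1<..<1::real}"]) auto
    then show False by simp
  qed
  moreover have "c \<ge> 0" unfolding c_def using pos by simp
  ultimately have c: "c > 0" by simp
  have "bump (-1) 1 (\<lambda>x. \<kappa>0 x * inverse c)" by (intro bump_mult b smooth_const)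
  moreover have "(LBINT x. \<kappa>0 x * inverse c) = 1" using c by (simp add: c_def[symmetric])
  ultimately show ?thesis using pos c by (intro exI[of _ "\<lambda>x. \<kappa>0 x * inverse c"]) auto
qed

definition unit_bump :: "real \<Rightarrow> real" where
  "unit_bump = (SOME \<kappa>. bump (-1) 1 \<kappa> \<and> (\<forall>x. 0 \<le> \<kappa> x) \<and> (LBINT x. \<kappa> x) = 1)"

definition moll1 :: "nat \<Rightarrow> real \<Rightarrow> real" where
  "moll1 n x = real (Suc n) * unit_bump (real (Suc n) * x)"

lemma moll1:
  shows moll1_bump: "bump (- (1 / Suc n)) (1 / Suc n) (moll1 n)"
    and moll1_nonneg: "0 \<le> moll1 n x"
    and moll1_integral: "(LBINT x. moll1 n x) = 1"
proof -
  have u: "bump (-1) 1 unit_bump" "\<And>x. 0 \<le> unit_bump x" "(LBINT x. unit_bump x) = 1"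
    using someI_ex[OF ex_unit_bump] unfolding unit_bump_def[symmetric] by auto
  have "smooth (\<lambda>x. real (Suc n) * unit_bump (real (Suc n) * x + 0))"
    using u(1) by (intro smooth_mult[OF smooth_const smooth_affine]) (simp add: bump_def)
  moreover have "moll1 n x = 0" if "x \<notin> {- (1 / Suc n)..1 / Suc n}" for x
  proof -
    have "real (Suc n) * x \<notin> {-1..1}" using that by (auto simp: field_simps)
    then show ?thesis using u(1) by (simp add: bump_def moll1_def)
  qed
  ultimately show "bump (- (1 / Suc n)) (1 / Suc n) (moll1 n)"
    by (simp add: bump_def moll1_def[abs_def])
  show "0 \<le> moll1 n x" using u(2) by (simp add: moll1_def)
  show "(LBINT x. moll1 n x) = 1"
    using lborel_integral_real_affine[of "real (Suc n)" unit_bump 0] u(3)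
    by (simp add: moll1_def)
qed


section \<open>Products as test functions in space-time\<close>

definition tens :: "(real \<Rightarrow> real) \<Rightarrow> (real \<Rightarrow> real) \<Rightarrow> (real \<Rightarrow> real) \<Rightarrow> real \<times> (real^2) \<Rightarrow> real" where
  "tens \<theta> \<alpha> \<beta> z = \<theta> (fst z) * (\<alpha> (snd z $ 1) * \<beta> (snd z $ 2))"

lemma tens_has_derivative:
  assumes "smooth \<theta>" "smooth \<alpha>" "smooth \<beta>"
  shows "(tens \<theta> \<alpha> \<beta> has_derivative (\<lambda>h. fst h * tens (deriv \<theta>) \<alpha> \<beta> z
     + snd h $ 1 * tens \<theta> (deriv \<alpha>) \<beta> z + snd h $ 2 * tens \<theta> \<alpha> (deriv \<beta>) z)) (at z)"
proof -
  have f: "(fst has_derivative fst) (at z)" for z :: "real \<times> (real^2)"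
    by (rule bounded_linear_imp_has_derivative[OF bounded_linear_fst])
  have s: "((\<lambda>z. snd z $ i) has_derivative (\<lambda>h. snd h $ i)) (at z)" for z :: "real \<times> (real^2)" and i
    by (rule bounded_linear_imp_has_derivative[OF bounded_linear_compose[OF bounded_linear_vec_nth bounded_linear_snd]])
  show ?thesis unfolding tens_def[abs_def]
    by (rule has_derivative_eq_rhs, rule has_derivative_mult[OF 
         DERIV_compose_FDERIV[OF smooth_DERIV[OF assms(1)] f] has_derivative_mult[OF
         DERIV_compose_FDERIV[OF smooth_DERIV[OF assms(2)] s]
         DERIV_compose_FDERIV[OF smooth_DERIV[OF assms(3)] s]]])
       (auto simp: algebra_simps)
qed

lemma dir_deriv_tens:
  assumes "smooth \<theta>" "smooth \<alpha>" "smooth \<beta>"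
  shows "dir_deriv e_t (tens \<theta> \<alpha> \<beta>) = tens (deriv \<theta>) \<alpha> \<beta>"
    and "dir_deriv (e_x 1) (tens \<theta> \<alpha> \<beta>) = tens \<theta> (deriv \<alpha>) \<beta>"
    and "dir_deriv (e_x 2) (tens \<theta> \<alpha> \<beta>) = tens \<theta> \<alpha> (deriv \<beta>)"
  unfolding dir_deriv_def frechet_derivative_at[OF tens_has_derivative[OF assms], symmetric] e_t_def e_x_def
  by (auto simp: axis_def)

lemma laplacian_tens:
  assumes "smooth \<theta>" "smooth \<alpha>" "smooth \<beta>"
  shows "laplacian (tens \<theta> \<alpha> \<beta>) z = tens \<theta> (deriv (deriv \<alpha>)) \<beta> z + tens \<theta> \<alpha> (deriv (deriv \<beta>)) z"
  using assms by (simp add: laplacian_def sum_2 dir_deriv_tens smooth_deriv)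

lemma Basis_space_time: "(Basis :: (real \<times> (real^2)) set) = {e_t, e_x 1, e_x 2}"
proof -
  have "(Basis :: (real^2) set) = {axis 1 1, axis 2 1}"
    by (auto simp: Basis_vec_def UNIV_2)
  then show ?thesis by (auto simp: Basis_prod_def e_t_def e_x_def)
qed

text \<open>Each coordinate derivative replaces one factor by its derivative, so that the statement
  for arbitrary factors reproduces itself.\<close>

lemma Ck_tens:
  "smooth \<theta> \<Longrightarrow> smooth \<alpha> \<Longrightarrow> smooth \<beta> \<Longrightarrow> Ck k (tens \<theta> \<alpha> \<beta>)"
proof (induction k arbitrary: \<theta> \<alpha> \<beta>)
  case 0
  have "(tens \<theta> \<alpha> \<beta>) differentiable (at z)" for z
    unfolding differentiable_def using tens_has_derivative[OF 0] by blast
  then show ?case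
    by (auto intro!: continuous_at_imp_continuous_on differentiable_imp_continuous_within)
next
  case (Suc k)
  have "(tens \<theta> \<alpha> \<beta>) differentiable (at z)" for z
    unfolding differentiable_def using tens_has_derivative[OF Suc.prems] by blast
  then show ?case
    by (simp add: Basis_space_time dir_deriv_tens[OF Suc.prems] Suc.IH Suc.prems smooth_deriv)
qed

lemma tens_test_function:
  assumes t: "bump a b \<theta>" "0 < a" "b < T" and al: "bump c d \<alpha>" and be: "bump c' d' \<beta>"
  shows "tens \<theta> \<alpha> \<beta> \<in> test_functions (slab T)"
proof -
  define K where "K = {a..b} \<times> cbox (vector [c, c'] :: real^2) (vector [d, d'])"
  have K: "compact K" unfolding K_def by (intro compact_Times compact_cbox) auto
  have "{z. tens \<theta> \<alpha> \<beta> z \<noteq> 0} \<subseteq> K"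
    using assms by (auto simp: tens_def K_def bump_def mem_box_cart forall_2 simp del: atLeastAtMost_iff)
      (auto)
  then have sub: "closure {z. tens \<theta> \<alpha> \<beta> z \<noteq> 0} \<subseteq> K"
    by (rule closure_minimal) (simp add: compact_imp_closed K)
  then have "compact (closure {z. tens \<theta> \<alpha> \<beta> z \<noteq> 0})"
    using compact_Int_closed[OF K closed_closure] by (metis inf.absorb2)
  moreover have "K \<subseteq> slab T" using t(2,3) by (auto simp: K_def slab_def)
  ultimately show ?thesis using sub Ck_tens[of \<theta> \<alpha> \<beta>] assms
    by (auto simp: test_functions_def bump_def)
qed

section \<open>Functions on the line\<close>

text \<open>A Bochner integral with an indicator instead of an oriented interval integral: Fubini
  and dominated convergence apply directly, and the value is 0 for negative
  \<open>t\<close>.\<close>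

definition prim :: "(real \<Rightarrow> real) \<Rightarrow> real \<Rightarrow> real" where
  "prim g t = (LBINT s. indicator {0..t} s * g s)"

text \<open>Absolute continuity on \<open>{0..T}\<close> in integrated form, with density
  \<open>g\<close>.\<close>

definition AC :: "real \<Rightarrow> (real \<Rightarrow> real) \<Rightarrow> (real \<Rightarrow> real) \<Rightarrow> bool" where
  "AC T F g \<longleftrightarrow> integrable lborel (\<lambda>s. indicator {0..T} s * g s) \<and> (\<forall>t\<in>{0..T}. F t = F 0 + prim g t)"

lemma integrable_pair_mult:
  fixes f :: "'a::euclidean_space \<Rightarrow> real" and g :: "'b::euclidean_space \<Rightarrow> real"
  assumes "integrable lborel f" "integrable lborel g"
  shows "integrable (lborel \<Otimes>\<^sub>M lborel) (\<lambda>w. f (fst w) * g (snd w))"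
proof (rule lborel_pair.Fubini_integrable)
  have [measurable]: "f \<in> borel_measurable borel" "g \<in> borel_measurable borel" using assms by auto
  show "(\<lambda>w. f (fst w) * g (snd w)) \<in> borel_measurable (lborel \<Otimes>\<^sub>M lborel)" by measurable
  show "integrable lborel (\<lambda>x. LBINT y. norm (f (fst (x, y)) * g (snd (x, y))))"
    using assms by (simp add: abs_mult)
  show "AE x in lborel. integrable lborel (\<lambda>y. f (fst (x, y)) * g (snd (x, y)))"
    using assms by simp
qed

lemma integral_pair_mult:
  fixes f :: "'a::euclidean_space \<Rightarrow> real" and g :: "'b::euclidean_space \<Rightarrow> real"
  assumes "integrable lborel f" "integrable lborel g"
  shows "(\<integral>w. f (fst w) * g (snd w) \<partial>(lborel \<Otimes>\<^sub>M lborel)) = (LBINT x. f x) * (LBINT y. g y)"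
  using lborel_pair.integral_fst'[OF integrable_pair_mult[OF assms], symmetric] by simp

lemma prim_measurable[measurable]:
  assumes [measurable]: "g \<in> borel_measurable borel" shows "prim g \<in> borel_measurable borel"
  unfolding prim_def atLeastAtMost_def atLeast_def atMost_def Int_def mem_Collect_eq indicator_def by measurable

lemma prim_cong_indicator:
  assumes "0 \<le> t" "t \<le> T"
  shows "prim (\<lambda>s. indicator {0..T} s * g s) t = prim g t"
  unfolding prim_def using assms by (intro Bochner_Integration.integral_cong) (auto simp: indicator_def)

text \<open>The product of the two integrals is an integral over the square \<open>{0..T}\<close> x
  \<open>{0..T}\<close>. Cutting the square along the diagonal and integrating each half along its
  inner variable gives the product rule for merely integrable densities.\<close>

lemma prim_mult:
  assumes T: "0 \<le> T" and f: "integrable lborel f" and g: "integrable lborel g"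
  shows "prim f T * prim g T = prim (\<lambda>s. f s * prim g s + prim f s * g s) T"
    and "integrable lborel (\<lambda>s. indicator {0..T} s * (f s * prim g s + prim f s * g s))"
proof -
  have [measurable]: "f \<in> borel_measurable borel" "g \<in> borel_measurable borel" using f g by auto
  let ?I = "\<lambda>s. indicat_real {0..T} s"
  have If: "integrable lborel (\<lambda>s. ?I s * f s)" and Ig: "integrable lborel (\<lambda>s. ?I s * g s)"
    using f g integrable_mult_indicator[of "{0..T}" lborel f] integrable_mult_indicator[of "{0..T}" lborel g] by auto
  let ?H = "\<lambda>w. ?I (fst w) * f (fst w) * (?I (snd w) * g (snd w))"
  have H: "integrable (lborel \<Otimes>\<^sub>M lborel) ?H" by (rule integrable_pair_mult[OF If Ig])
  let ?A = "\<lambda>r s. ?H (r, s) * of_bool (s \<le> r)" and ?B = "\<lambda>r s. ?H (r, s) * of_bool (r < s)"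
  have A: "integrable (lborel \<Otimes>\<^sub>M lborel) (case_prod ?A)" 
    by (rule Bochner_Integration.integrable_bound[OF H]) (auto simp: split_beta' abs_mult)
  have B: "integrable (lborel \<Otimes>\<^sub>M lborel) (case_prod ?B)"
    by (rule Bochner_Integration.integrable_bound[OF H]) (auto simp: split_beta' abs_mult)
  have iA: "(LBINT s. ?A r s) = ?I r * (f r * prim g r)" for r
  proof -
    have "(LBINT s. ?A r s) = (LBINT s. ?I r * f r * (indicator {0..r} s * g s))"
      by (intro Bochner_Integration.integral_cong) (auto simp: indicator_def)
    then show ?thesis by (simp add: prim_def)
  qed
  have iB: "(LBINT r. ?B r s) = ?I s * (prim f s * g s)" for s
  proof -
    have "(LBINT r. ?B r s) = (LBINT r. ?I s * g s * (indicator {0..s} r * f r))"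
    proof (rule integral_cong_AE)
      \<comment> \<open>The half \<open>?B\<close> excludes the diagonal, whereas
        \<open>prim f s\<close> includes the point \<open>s\<close>.\<close>
      have "AE r in lborel. r \<noteq> s" by (rule AE_lborel_singleton)
      then show "AE r in lborel. ?B r s = ?I s * g s * (indicator {0..s} r * f r)"
        by eventually_elim (auto simp: indicator_def)
    qed auto
    then show ?thesis by (simp add: prim_def)
  qed
  have "integrable lborel (\<lambda>r. ?I r * (f r * prim g r))"
    using lborel_pair.integrable_fst[OF A] unfolding iA .
  moreover have "integrable lborel (\<lambda>r. ?I r * (prim f r * g r))"
    using lborel_pair.integrable_snd[OF B] unfolding iB .
  ultimately have i: "integrable lborel (\<lambda>s. ?I s * (f s * prim g s))" "integrable lborel (\<lambda>s. ?I s * (prim f s * g s))"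
    by auto
  then show "integrable lborel (\<lambda>s. ?I s * (f s * prim g s + prim f s * g s))"
    by (simp add: distrib_left)
  have "prim f T * prim g T = (\<integral>w. ?H w \<partial>(lborel \<Otimes>\<^sub>M lborel))"
    unfolding prim_def by (rule integral_pair_mult[OF If Ig, symmetric])
  also have "\<dots> = (\<integral>w. case_prod ?A w + case_prod ?B w \<partial>(lborel \<Otimes>\<^sub>M lborel))"
    by (intro Bochner_Integration.integral_cong) (auto simp: split_beta')
  also have "\<dots> = (\<integral>w. case_prod ?A w \<partial>(lborel \<Otimes>\<^sub>M lborel)) + (\<integral>w. case_prod ?B w \<partial>(lborel \<Otimes>\<^sub>M lborel))"
    by (rule Bochner_Integration.integral_add[OF A B])
  also have "(\<integral>w. case_prod ?A w \<partial>(lborel \<Otimes>\<^sub>M lborel)) = (LBINT r. ?I r * (f r * prim g r))"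
    using lborel_pair.integral_fst[OF A] unfolding iA by simp
  also have "(\<integral>w. case_prod ?B w \<partial>(lborel \<Otimes>\<^sub>M lborel)) = (LBINT s. ?I s * (prim f s * g s))"
    using lborel_pair.integral_snd[OF B] unfolding iB by simp
  finally show "prim f T * prim g T = prim (\<lambda>s. f s * prim g s + prim f s * g s) T"
    unfolding prim_def[of "\<lambda>s. f s * prim g s + prim f s * g s"] using i by (simp add: distrib_left)
qed

lemma prim_add:
  "integrable lborel (\<lambda>s. indicator {0..t} s * f s) \<Longrightarrow> integrable lborel (\<lambda>s. indicator {0..t} s * g s) \<Longrightarrow>
   prim (\<lambda>s. f s + g s) t = prim f t + prim g t"
  by (simp add: prim_def distrib_left)

lemma prim_cmult: "prim (\<lambda>s. c * f s) t = c * prim f t"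
  by (simp add: prim_def mult.left_commute)

lemma AC_mult:
  assumes F: "AC T F f" and G: "AC T G g"
  shows "AC T (\<lambda>t. F t * G t) (\<lambda>t. f t * G t + F t * g t)"
proof -
  let ?f = "\<lambda>s. indicator {0..T} s * f s" and ?g = "\<lambda>s. indicator {0..T} s * g s"
  have f: "integrable lborel ?f" and g: "integrable lborel ?g" using F G unfolding AC_def by blast+
  have Fe: "F t = F 0 + prim ?f t" and Ge: "G t = G 0 + prim ?g t" if "t \<in> {0..T}" for t
  proof -
    have t: "0 \<le> t" "t \<le> T" using that by auto
    show "F t = F 0 + prim ?f t" unfolding prim_cong_indicator[OF t] using F that unfolding AC_def by blast
    show "G t = G 0 + prim ?g t" unfolding prim_cong_indicator[OF t] using G that unfolding AC_def by blast
  qed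
  have split: "indicator {0..t} s * (f s * G s + F s * g s) =
     G 0 * (indicator {0..t} s * ?f s) + F 0 * (indicator {0..t} s * ?g s) + indicator {0..t} s * (?f s * prim ?g s + prim ?f s * ?g s)"
    if "t \<in> {0..T}" for s t
  proof (cases "s \<in> {0..t}")
    case True
    then have "s \<in> {0..T}" using that by simp
    then show ?thesis using True unfolding Fe[OF \<open>s \<in> {0..T}\<close>] Ge[OF \<open>s \<in> {0..T}\<close>] by (simp add: algebra_simps)
  qed simp
  have i: "integrable lborel (\<lambda>s. indicator {0..t} s * ?f s)" "integrable lborel (\<lambda>s. indicator {0..t} s * ?g s)" for t
    using f g integrable_mult_indicator[of "{0..t}" lborel ?f] integrable_mult_indicator[of "{0..t}" lborel ?g] by auto
  have 1: "integrable lborel (\<lambda>s. indicator {0..t} s * (f s * G s + F s * g s))"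
    and 2: "F t * G t = F 0 * G 0 + prim (\<lambda>s. f s * G s + F s * g s) t" if t: "t \<in> {0..T}" for t
  proof -
    have t0: "0 \<le> t" using t by simp
    note pm = prim_mult[OF t0 f g]
    show "integrable lborel (\<lambda>s. indicator {0..t} s * (f s * G s + F s * g s))"
      unfolding split[OF t] by (intro Bochner_Integration.integrable_add integrable_mult_right i pm(2))
    have "prim (\<lambda>s. f s * G s + F s * g s) t = G 0 * prim ?f t + F 0 * prim ?g t + prim ?f t * prim ?g t"
      unfolding pm(1) unfolding prim_def[of _ t] split[OF t] using i pm(2) by simp
    then show "F t * G t = F 0 * G 0 + prim (\<lambda>s. f s * G s + F s * g s) t"
      unfolding Fe[OF t] Ge[OF t] by (simp add: algebra_simps)
  qed
  have "integrable lborel (\<lambda>s. indicator {0..T} s * (f s * G s + F s * g s))"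
  proof (cases "T < 0")
    case False then show ?thesis by (intro 1) simp
  qed simp
  then show ?thesis unfolding AC_def by (intro conjI ballI 2)
qed

lemma AC_power:
  assumes "AC T F f" shows "AC T (\<lambda>t. F t ^ n) (\<lambda>t. real n * F t ^ (n - 1) * f t)"
proof (induction n)
  case 0
  show ?case by (simp add: AC_def prim_def)
next
  case (Suc n)
  from AC_mult[OF assms Suc] have "AC T (\<lambda>t. F t * F t ^ n) (\<lambda>t. f t * F t ^ n + F t * (real n * F t ^ (n - 1) * f t))" .
  moreover have "(\<lambda>t. f t * F t ^ n + F t * (real n * F t ^ (n - 1) * f t)) = (\<lambda>t. real (Suc n) * F t ^ (Suc n - 1) * f t)"
  proof
    fix t show "f t * F t ^ n + F t * (real n * F t ^ (n - 1) * f t) = real (Suc n) * F t ^ (Suc n - 1) * f t"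
      by (cases n) (auto simp: algebra_simps)
  qed
  ultimately show ?case by simp
qed


section \<open>Smooth steps and the lemma of du Bois-Reymond\<close>

lemma kern_bump: "bump a b f \<Longrightarrow> kern f"
proof -
  assume b: "bump a b f"
  obtain C where C: "\<And>x. \<bar>f x\<bar> \<le> C * indicator {a..b} x" "0 \<le> C" using bump_bounded[OF b] by blast
  have "\<bar>f x\<bar> \<le> C * indicator (cball 0 (max \<bar>a\<bar> \<bar>b\<bar>)) x" for x
    by (rule order_trans[OF C(1)]) (auto intro!: mult_left_mono C(2) simp: indicator_def)
  then show "kern f" using bump_measurable[OF b] by (auto simp: kern_def)
qed

text \<open>Reflected because \<open>cv\<close> evaluates its kernel at z - x: convolving
  \<open>f\<close> at \<open>s\<close> with the reflected kernel means testing \<open>f\<close>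
  against \<open>moll1 n (x - s)\<close>, which is what the derivative of a smooth step at
  \<open>s\<close> does.\<close>

lemma moll1_mollifier: "mollifier (1 / real (Suc n)) (\<lambda>x. moll1 n (- x))"
proof -
  have "bump (0 - 1 / Suc n) (0 - - (1 / Suc n)) (\<lambda>x. moll1 n (0 - x))"
    by (rule bump_affine(1)[OF moll1_bump])
  then have "kern (\<lambda>x. moll1 n (- x))" by (simp add: kern_bump)
  moreover have "(LBINT x. moll1 n (- x)) = 1"
    using integral_reflect[of "moll1 n" 0] bump_measurable[OF moll1_bump] moll1_integral by simp
  moreover have "moll1 n (- x) = 0" if "1 / real (Suc n) < norm x" for x
  proof -
    have "- x \<notin> {- (1 / Suc n)..1 / Suc n}" using that by auto
    then show ?thesis using moll1_bump[of n] unfolding bump_def by blast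
  qed
  ultimately show ?thesis by (simp add: mollifier_def moll1_nonneg)
qed

text \<open>A smooth step from 0 to 1. Differences of rescaled copies approximate the indicator of
  an interval, and their derivatives are differences of two mollifiers.\<close>

lemma ex_unit_step:
  obtains K where "smooth K" "\<And>x. (K has_real_derivative unit_bump x) (at x)"
    "\<And>x. x \<le> -1 \<Longrightarrow> K x = 0" "\<And>x. 1 \<le> x \<Longrightarrow> K x = 1" "\<And>x. 0 \<le> K x" "\<And>x. K x \<le> 1"
proof -
  have u: "bump (-1) 1 unit_bump" "\<And>x. 0 \<le> unit_bump x" "(LBINT x. unit_bump x) = 1"
    using someI_ex[OF ex_unit_bump] unfolding unit_bump_def[symmetric] by auto
  have sm: "smooth unit_bump" using u by (simp add: bump_def)
  have cont: "isCont unit_bump x" for x using smooth_continuous[OF sm] by (simp add: continuous_on_eq_continuous_at)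
  obtain F where F: "\<And>x. (F has_vector_derivative unit_bump x) (at x)"
    using einterval_antiderivative[of "-\<infinity>" "\<infinity>" unit_bump] cont by auto
  define K where "K x = F x - F (-1)" for x
  have K: "(K has_real_derivative unit_bump x) (at x)" for x
    using DERIV_diff[OF F[of x, folded has_real_derivative_iff_has_vector_derivative] DERIV_const[of "F (-1)"]]
    by (simp add: K_def[abs_def])
  have contK: "continuous_on A K" for A
    using DERIV_isCont[OF K] by (simp add: continuous_at_imp_continuous_on)
  have mono: "K x \<le> K y" if "x \<le> y" for x y
    by (rule DERIV_nonneg_imp_nondecreasing[OF that]) (use K u(2) in blast)
  have zero: "K x = 0" if "x \<le> -1" for x
  proof (cases "x = -1")
    case False
    have lt: "x < -1" using that False by simp
    have "(K has_real_derivative 0) (at y)" if "x < y" "y < -1" for y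
      using K[of y] u(1) that by (simp add: bump_def)
    from DERIV_isconst_end[OF lt contK this] have "K x = K (-1)" by simp
    then show ?thesis by (simp add: K_def)
  qed (simp add: K_def)
  have K1: "K 1 = 1"
  proof -
    have "has_bochner_integral lborel (\<lambda>x. indicator {-1..1} x *\<^sub>R unit_bump x) (K 1 - K (-1))"
    proof (rule has_bochner_integral_FTC_Icc)
      show "continuous_on {-1..1} unit_bump" by (rule continuous_on_subset[OF smooth_continuous[OF sm] subset_UNIV])
      show "(K has_vector_derivative unit_bump x) (at x within {-1..1})" for x
        using K[of x] unfolding has_real_derivative_iff_has_vector_derivative by (rule has_vector_derivative_at_within)
    qed simp
    moreover have "(\<lambda>x. indicator {-1..1} x *\<^sub>R unit_bump x) = unit_bump"
    proof
      fix x show "indicator {-1..1} x *\<^sub>R unit_bump x = unit_bump x"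
        using u(1) by (cases "x \<in> {-1..1}") (auto simp: bump_def)
    qed
    ultimately show ?thesis using u(3) zero[of "-1"] by (simp add: has_bochner_integral_iff)
  qed
  have one: "K x = 1" if "1 \<le> x" for x
  proof (cases "x = 1")
    case False
    have lt: "1 < x" using that False by simp
    have "(K has_real_derivative 0) (at y)" if "1 < y" "y < x" for y
      using K[of y] u(1) that by (simp add: bump_def)
    from DERIV_isconst_end[OF lt contK this] have "K x = K 1" by simp
    then show ?thesis by (simp add: K1)
  qed (simp add: K1)
  have "0 \<le> K x" for x using mono[of "min x (-1)" x] zero[of "min x (-1)"] by (simp del: min_less_iff_conj)
  moreover have "K x \<le> 1" for x using mono[of x "max x 1"] one[of "max x 1"] by simp
  ultimately show ?thesis using that[OF smooth_primitive[OF K sm] K zero one] by blast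
qed

text \<open>The equation is tested with smoothed indicators of an interval from \<open>s\<close> to
  \<open>t\<close>. The left-hand side is then the difference of the mollifications of
  \<open>f\<close> at \<open>s\<close> and at \<open>t\<close>, the right-hand side tends to minus
  the integral of \<open>g\<close> between them. This determines f t - f s at all points where the
  mollifications converge along one subsequence, hence almost everywhere.\<close>

lemma du_Bois_Reymond:
  assumes f: "integrable lborel f" and g: "integrable lborel g"
    and w: "\<And>\<theta> a b. bump a b \<theta> \<Longrightarrow> 0 < a \<Longrightarrow> b < T \<Longrightarrow>
       (LBINT t. deriv \<theta> t * f t) = - (LBINT t. \<theta> t * g t)"
  shows "\<exists>c. AE t in lborel. t \<in> {0<..<T} \<longrightarrow> f t = c + prim g t"
proof -
  have [measurable]: "f \<in> borel_measurable borel" "g \<in> borel_measurable borel" using f g by auto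
  define \<rho> where "\<rho> n x = moll1 n (- x)" for n x
  have \<rho>: "mollifier (1 / real (Suc n)) (\<rho> n)" for n unfolding \<rho>_def by (rule moll1_mollifier)
  have k\<rho>: "kern (\<rho> n)" for n using \<rho> by (auto simp: mollifier_def)
  have r0: "(\<lambda>n. 1 / real (Suc n)) \<longlonglongrightarrow> 0" using LIMSEQ_inverse_real_of_nat by (simp add: inverse_eq_divide)
  have lim: "(\<lambda>n. LBINT z. norm (cv (\<rho> n) f z - f z)) \<longlonglongrightarrow> 0"
    using mollify_L1_tendsto[OF f \<rho> r0] by simp
  have int: "integrable lborel (\<lambda>z. cv (\<rho> n) f z - f z)" for n
    using cv_L1[OF f k\<rho>] f by auto
  \<comment> \<open>Convergence in mean yields almost everywhere convergence along a subsequence;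
    one subsequence serves all pairs of points.\<close>
  obtain r where r: "strict_mono r" "AE z in lborel. (\<lambda>n. cv (\<rho> (r n)) f z - f z) \<longlonglongrightarrow> 0"
    using tendsto_L1_AE_subseq[OF int lim] by auto
  obtain K where K: "smooth K" "\<And>x. (K has_real_derivative unit_bump x) (at x)"
    "\<And>x. x \<le> -1 \<Longrightarrow> K x = 0" "\<And>x. 1 \<le> x \<Longrightarrow> K x = 1" "\<And>x. 0 \<le> K x" "\<And>x. K x \<le> 1"
    using ex_unit_step by metis
  define good where "good t \<longleftrightarrow> t \<in> {0<..<T} \<and> (\<lambda>n. cv (\<rho> (r n)) f t - f t) \<longlonglongrightarrow> 0" for t
  have key: "f t - f s = prim g t - prim g s" if gs: "good s" and gt: "good t" and st: "s < t" for s t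
  proof -
    have s: "0 < s" and t: "t < T" using gs gt by (auto simp: good_def)
    \<comment> \<open>A smoothed indicator of the interval from \<open>s\<close> to
      \<open>t\<close>, written in the shape a x + b for \<open>smooth_affine\<close>;
      \<open>ext\<close> is the readable form.\<close>
    define \<theta> where "\<theta> n x = K (real (Suc n) * x + - (real (Suc n) * s)) + (-1) * K (real (Suc n) * x + - (real (Suc n) * t))" for n x
    have sm\<theta>: "smooth (\<theta> n)" for n
      unfolding \<theta>_def by (rule smooth_add[OF smooth_affine[OF K(1)] smooth_mult[OF smooth_const smooth_affine[OF K(1)]]])
    have ext: "\<theta> n x = K (real (Suc n) * (x - s)) - K (real (Suc n) * (x - t))" for n x
      by (simp add: \<theta>_def algebra_simps)
    have supp: "\<theta> n x = 0" if "x \<notin> {s - 1 / real (Suc n)..t + 1 / real (Suc n)}" for n x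
    proof -
      consider "x < s - 1 / real (Suc n)" | "x > t + 1 / real (Suc n)" using \<open>x \<notin> _\<close> by force
      then show ?thesis
      proof cases
        case 1
        then have "real (Suc n) * (x - s) \<le> -1" by (simp add: field_simps)
        moreover have "real (Suc n) * (x - t) \<le> real (Suc n) * (x - s)" using st by (intro mult_left_mono) auto
        ultimately have "K (real (Suc n) * (x - s)) = 0" "K (real (Suc n) * (x - t)) = 0"
          by (intro K(3); linarith)+
        then show ?thesis unfolding ext by (simp only: diff_self)
      next
        case 2
        then have "1 \<le> real (Suc n) * (x - t)" by (simp add: field_simps)
        moreover have "real (Suc n) * (x - t) \<le> real (Suc n) * (x - s)" using st by (intro mult_left_mono) auto
        ultimately have "K (real (Suc n) * (x - s)) = 1" "K (real (Suc n) * (x - t)) = 1"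
          by (intro K(4); linarith)+
        then show ?thesis unfolding ext by (simp only: diff_self)
      qed
    qed
    have b: "bump (s - 1 / real (Suc n)) (t + 1 / real (Suc n)) (\<theta> n)" for n
      using sm\<theta> supp by (simp add: bump_def)
    have d: "deriv (\<theta> n) x = moll1 n (x - s) - moll1 n (x - t)" for n x
    proof -
      have "((\<lambda>x. K (real (Suc n) * (x - s)) - K (real (Suc n) * (x - t))) has_real_derivative
         unit_bump (real (Suc n) * (x - s)) * real (Suc n) - unit_bump (real (Suc n) * (x - t)) * real (Suc n)) (at x)"
      proof -
        have l: "((\<lambda>x. real (Suc n) * (x - c)) has_real_derivative real (Suc n)) (at x)" for c
          using DERIV_cmult[OF DERIV_diff[OF DERIV_ident DERIV_const[of c]], where c = "real (Suc n)" and x = x] by simp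
        show ?thesis by (intro DERIV_diff DERIV_chain'[OF l K(2)])
      qed
      then have "(\<theta> n has_real_derivative moll1 n (x - s) - moll1 n (x - t)) (at x)"
        by (simp add: ext[abs_def] moll1_def mult.commute)
      then show ?thesis by (rule DERIV_imp_deriv)
    qed
    \<comment> \<open>Only for large \<open>n\<close> does the support of \<open>\<theta> n\<close>,
      which overshoots by 1/(n + 1) on either side, lie inside the open interval (0, T).\<close>
    have I1: "eventually (\<lambda>n. cv (\<rho> n) f s - cv (\<rho> n) f t = - (LBINT x. \<theta> n x * g x)) sequentially"
    proof -
      have "eventually (\<lambda>n. 1 / real (Suc n) < min s (T - t)) sequentially"
        using r0 s t by (intro order_tendstoD) auto
      then show ?thesis
      proof eventually_elim
        case (elim n)
        have "(LBINT x. deriv (\<theta> n) x * f x) = - (LBINT x. \<theta> n x * g x)"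
          using elim by (intro w[OF b]) auto
        also have "(LBINT x. deriv (\<theta> n) x * f x) = (LBINT x. f x * \<rho> n (s - x) - f x * \<rho> n (t - x))"
          by (intro Bochner_Integration.integral_cong) (auto simp: d \<rho>_def algebra_simps)
        also have "\<dots> = cv (\<rho> n) f s - cv (\<rho> n) f t"
          unfolding cv_def by (intro Bochner_Integration.integral_diff cv_integrable_L1 f k\<rho>)
        finally show ?case .
      qed
    qed
    have I2: "(\<lambda>n. LBINT x. \<theta> n x * g x) \<longlonglongrightarrow> (LBINT x. indicator {s<..<t} x * g x)"
    proof (rule integral_dominated_convergence)
      show "integrable lborel (\<lambda>x. \<bar>g x\<bar>)" using g by simp
      have "AE x in lborel. x \<noteq> s \<and> x \<noteq> t" using AE_lborel_singleton[of s] AE_lborel_singleton[of t] by simp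
      then show "AE x in lborel. (\<lambda>n. \<theta> n x * g x) \<longlonglongrightarrow> indicator {s<..<t} x * g x"
      proof eventually_elim
        case (elim x)
        then have ne: "x \<noteq> s" "x \<noteq> t" by auto
        have large: "eventually (\<lambda>n. 1 / real (Suc n) < e) sequentially" if "e > 0" for e
          using r0 that by (intro order_tendstoD) auto
        have "eventually (\<lambda>n. \<theta> n x = indicator {s<..<t} x) sequentially"
        proof -
          \<comment> \<open>At distance more than 1/(n + 1) from \<open>s\<close> and
            \<open>t\<close> both steps have reached their final values, so that
            \<open>\<theta> n\<close> equals the indicator there.\<close>
          have "eventually (\<lambda>n. 1 / real (Suc n) < min \<bar>x - s\<bar> \<bar>x - t\<bar>) sequentially"
            using elim by (intro large) auto
          then show ?thesis
          proof eventually_elim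
            case (elim n)
            have 1: "K (real (Suc n) * y) = (if y > 0 then 1 else 0)" if "1 / real (Suc n) < \<bar>y\<bar>" for y
            proof (cases "y > 0")
              case True
              then have "1 \<le> real (Suc n) * y" using that by (simp add: field_simps)
              then show ?thesis using True K(4) by simp
            next
              case False
              then have "real (Suc n) * y \<le> -1" using that by (simp add: field_simps)
              then show ?thesis using False K(3) by simp
            qed
            show ?case using ne unfolding ext using elim st by (subst (1 2) 1) (auto simp: indicator_def)
          qed
        qed
        then show ?case by (intro tendsto_mult tendsto_const tendsto_eventually)
      qed
      show "AE x in lborel. norm (\<theta> n x * g x) \<le> \<bar>g x\<bar>" for n
      proof (rule AE_I2)
        fix x
        have "\<bar>\<theta> n x\<bar> \<le> 1" unfolding ext using K(5)[of "real (Suc n) * (x - s)"] K(6)[of "real (Suc n) * (x - s)"]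
            K(5)[of "real (Suc n) * (x - t)"] K(6)[of "real (Suc n) * (x - t)"] by (simp only: abs_le_iff) linarith
        then show "norm (\<theta> n x * g x) \<le> \<bar>g x\<bar>" by (simp add: abs_mult mult_left_le_one_le)
      qed
      show "(\<lambda>x. \<theta> n x * g x) \<in> borel_measurable lborel" for n
        using smooth_measurable[OF sm\<theta>[of n]] by simp
    qed simp
    have gp: "prim g t - prim g s = (LBINT x. indicator {s<..<t} x * g x)"
    proof -
      have "integrable lborel (\<lambda>x. indicator A x * g x)" if "A \<in> sets borel" for A
        using integrable_mult_indicator[of A lborel g] that g by simp
      then have "prim g t - prim g s = (LBINT x. indicator {0..t} x * g x - indicator {0..s} x * g x)"
        unfolding prim_def by simp
      also have "\<dots> = (LBINT x. indicator {s<..<t} x * g x)"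
      proof (rule integral_cong_AE)
        show "AE x in lborel. indicator {0..t} x * g x - indicator {0..s} x * g x = indicator {s<..<t} x * g x"
          using AE_lborel_singleton[of t] by eventually_elim (use s st in \<open>auto simp: indicator_def\<close>)
      qed auto
      finally show ?thesis .
    qed
    have "(\<lambda>n. cv (\<rho> n) f s - cv (\<rho> n) f t) \<longlonglongrightarrow> - (LBINT x. indicator {s<..<t} x * g x)"
      using tendsto_minus[OF I2] by (rule Lim_transform_eventually) (use I1 in \<open>simp add: eq_commute\<close>)
    from LIMSEQ_subseq_LIMSEQ[OF this r(1)]
    have L1: "(\<lambda>n. cv (\<rho> (r n)) f s - cv (\<rho> (r n)) f t) \<longlonglongrightarrow> - (prim g t - prim g s)" by (simp add: o_def gp)
    have "(\<lambda>n. cv (\<rho> (r n)) f s - f s - (cv (\<rho> (r n)) f t - f t)) \<longlonglongrightarrow> 0 - 0"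
      using gs gt unfolding good_def by (intro tendsto_diff) auto
    from tendsto_diff[OF L1 this]
    have "(\<lambda>n. f s - f t) \<longlonglongrightarrow> - (prim g t - prim g s)" by simp
    then show ?thesis using LIMSEQ_unique[OF _ tendsto_const, of "\<lambda>n. f s - f t"] by (simp add: LIMSEQ_const_iff)
  qed
  have ae: "AE t in lborel. t \<in> {0<..<T} \<longrightarrow> good t" using r(2) by eventually_elim (simp add: good_def)
  show ?thesis
  proof (cases "\<exists>t0. good t0")
    case False
    from ae have "AE t in lborel. t \<in> {0<..<T} \<longrightarrow> f t = 0 + prim g t"
      by eventually_elim (use False in blast)
    then show ?thesis by blast
  next
    case True
    then obtain t0 where t0: "good t0" by blast
    have "f t = (f t0 - prim g t0) + prim g t" if "good t" for t
      using key[OF that t0] key[OF t0 that] by (cases t t0 rule: linorder_cases) simp_all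
    then show ?thesis using ae by (intro exI[of _ "f t0 - prim g t0"]) (simp add: eventually_mono)
  qed
qed

lemma fundamental_lemma_1D:
  assumes g: "integrable lborel g"
    and w: "\<And>\<theta> a b. bump a b \<theta> \<Longrightarrow> 0 < a \<Longrightarrow> b < T \<Longrightarrow> (LBINT t. \<theta> t * g t) = 0"
  shows "AE t in lborel. t \<in> {0<..<T} \<longrightarrow> g t = 0"
proof (cases "T > 0")
  case True
  \<comment> \<open>The hypothesis is applied to \<open>deriv \<theta>\<close>, again a bump:
    \<open>g\<close> has weak derivative 0 and is constant.\<close>
  have "\<exists>c. AE t in lborel. t \<in> {0<..<T} \<longrightarrow> g t = c + prim (\<lambda>t. 0) t"
    by (rule du_Bois_Reymond[OF g]) (use w[OF bump_deriv] in auto)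
  then obtain c where c: "AE t in lborel. t \<in> {0<..<T} \<longrightarrow> g t = c" by (auto simp: prim_def)
  obtain n where n: "1 / real (Suc n) < T / 2" using nat_approx_posE[of "T/2"] True by auto
  \<comment> \<open>A kernel of mass 1 centred at T/2 and supported in (0, T); testing with it
    returns the constant, which must be 0.\<close>
  have b: "bump (T / 2 - 1 / Suc n) (T / 2 - - (1 / Suc n)) (\<lambda>x. moll1 n (T / 2 - x))"
    by (rule bump_affine(1)[OF moll1_bump])
  have "0 = (LBINT t. moll1 n (T / 2 - t) * g t)"
    by (rule w[OF b, symmetric]) (use n in \<open>auto simp: field_simps\<close>)
  also have "\<dots> = (LBINT t. moll1 n (T / 2 - t) * c)"
  proof (rule integral_cong_AE)
    show "AE t in lborel. moll1 n (T / 2 - t) * g t = moll1 n (T / 2 - t) * c"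
      using c
    proof eventually_elim
      case (elim t)
      show ?case
      proof (cases "t \<in> {0<..<T}")
        case False
        then have "t \<notin> {T / 2 - 1 / Suc n..T / 2 - - (1 / Suc n)}" using n by auto
        then have "moll1 n (T / 2 - t) = 0" using b unfolding bump_def by blast
        then show ?thesis by simp
      qed (use elim in simp)
    qed
  qed (use g bump_measurable[OF b] in auto)
  also have "\<dots> = c" using integral_reflect[of "moll1 n" "T/2"] bump_measurable[OF moll1_bump] moll1_integral by simp
  finally show ?thesis using c by simp
next
  case False
  then show ?thesis by simp
qed

section \<open>A form bound in the plane\<close>

definition vec2 :: "real \<Rightarrow> real \<Rightarrow> real^2" where
  "vec2 s t = vector [s, t]"

lemma vec2_nth[simp]: "vec2 s t $ 1 = s" "vec2 s t $ 2 = t"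
  by (simp_all add: vec2_def)

lemma vec2_add_axis: "vec2 s t + r *\<^sub>R axis 1 1 = vec2 (s + r) t" "vec2 s t + r *\<^sub>R axis 2 1 = vec2 s (t + r)"
  by (simp_all add: vec_eq_iff forall_2 axis_def)

lemma Basis_plane: "(Basis :: (real^2) set) = {axis 1 1, axis 2 1}"
  by (auto simp: Basis_vec_def UNIV_2)

lemma axis_ne: "(axis 1 1 :: real^2) \<noteq> axis 2 1"
  by (simp add: axis_eq_axis)

lemma vec2_continuous: "continuous_on UNIV (\<lambda>w. vec2 (fst w) (snd w))"
proof -
  have eq: "(\<lambda>w. vec2 (fst w) (snd w)) = (\<lambda>w. fst w *\<^sub>R axis 1 1 + snd w *\<^sub>R axis 2 1)"
    by (auto simp: vec_eq_iff forall_2 axis_def)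
  show ?thesis unfolding eq by (intro continuous_intros)
qed

lemma vec2_measurable[measurable]: "(\<lambda>w. vec2 (fst w) (snd w)) \<in> borel_measurable (borel \<Otimes>\<^sub>M borel)"
  unfolding borel_prod by (rule borel_measurable_continuous_onI[OF vec2_continuous])

lemma vec2_measurable'[measurable (raw)]:
  "f \<in> borel_measurable M \<Longrightarrow> g \<in> borel_measurable M \<Longrightarrow> (\<lambda>x. vec2 (f x) (g x)) \<in> borel_measurable M"
  using measurable_compose[OF measurable_Pair[of f M borel g borel] vec2_measurable] by simp

text \<open>\<open>real^2\<close> is not a product type; comparing the measures of boxes identifies
  its Lebesgue measure with the product measure and makes iterated integration in coordinates
  available.\<close>

lemma lborel_plane: "distr (lborel \<Otimes>\<^sub>M lborel) borel (\<lambda>w. vec2 (fst w) (snd w)) = lborel"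
proof (rule lborel_eqI[symmetric])
  fix l u :: "real^2" assume lu: "\<And>b. b \<in> Basis \<Longrightarrow> l \<bullet> b \<le> u \<bullet> b"
  have lu': "l $ 1 \<le> u $ 1" "l $ 2 \<le> u $ 2"
    using lu[of "axis 1 1"] lu[of "axis 2 1"] by (auto simp: Basis_plane inner_axis)
  have vim: "(\<lambda>w. vec2 (fst w) (snd w)) -` box l u \<inter> space (lborel \<Otimes>\<^sub>M lborel) = {l $ 1<..<u $ 1} \<times> {l $ 2<..<u $ 2}"
    by (auto simp: mem_box_cart forall_2 space_pair_measure)
  have "emeasure (distr (lborel \<Otimes>\<^sub>M lborel) borel (\<lambda>w. vec2 (fst w) (snd w))) (box l u)
     = emeasure (lborel \<Otimes>\<^sub>M lborel) ({l $ 1<..<u $ 1} \<times> {l $ 2<..<u $ 2})"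
    by (subst emeasure_distr) (auto simp: vim)
  also have "\<dots> = ennreal (u $ 1 - l $ 1) * ennreal (u $ 2 - l $ 2)"
    using lu' by (subst lborel.emeasure_pair_measure_Times) auto
  also have "\<dots> = ennreal (\<Prod>b\<in>Basis. (u - l) \<bullet> b)"
    using lu' by (simp add: Basis_plane axis_ne inner_axis ennreal_mult)
  finally show "emeasure (distr (lborel \<Otimes>\<^sub>M lborel) borel (\<lambda>w. vec2 (fst w) (snd w))) (box l u)
    = ennreal (\<Prod>b\<in>Basis. (u - l) \<bullet> b)" .
qed simp

lemma nn_integral_plane:
  fixes f :: "real^2 \<Rightarrow> ennreal"
  assumes [measurable]: "f \<in> borel_measurable borel"
  shows "(\<integral>\<^sup>+x. f x \<partial>lborel) = (\<integral>\<^sup>+s. \<integral>\<^sup>+t. f (vec2 s t) \<partial>lborel \<partial>lborel)"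
    and "(\<integral>\<^sup>+x. f x \<partial>lborel) = (\<integral>\<^sup>+t. \<integral>\<^sup>+s. f (vec2 s t) \<partial>lborel \<partial>lborel)"
proof -
  have "(\<integral>\<^sup>+x. f x \<partial>lborel) = (\<integral>\<^sup>+w. f (vec2 (fst w) (snd w)) \<partial>(lborel \<Otimes>\<^sub>M lborel))"
    by (subst lborel_plane[symmetric], subst nn_integral_distr) auto
  also have "\<dots> = (\<integral>\<^sup>+s. \<integral>\<^sup>+t. f (vec2 s t) \<partial>lborel \<partial>lborel)"
    by (subst lborel.nn_integral_fst[symmetric]) auto
  finally show "(\<integral>\<^sup>+x. f x \<partial>lborel) = (\<integral>\<^sup>+s. \<integral>\<^sup>+t. f (vec2 s t) \<partial>lborel \<partial>lborel)" .
  also have "\<dots> = (\<integral>\<^sup>+t. \<integral>\<^sup>+s. f (vec2 s t) \<partial>lborel \<partial>lborel)"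
    by (intro lborel_pair.Fubini') measurable
  finally show "(\<integral>\<^sup>+x. f x \<partial>lborel) = (\<integral>\<^sup>+t. \<integral>\<^sup>+s. f (vec2 s t) \<partial>lborel \<partial>lborel)" .
qed

lemma integral_plane_mult:
  fixes \<alpha> \<beta> :: "real \<Rightarrow> real"
  assumes "integrable lborel \<alpha>" "integrable lborel \<beta>"
  shows "(\<integral>x. \<alpha> (x $ 1) * \<beta> (x $ 2) \<partial>(lborel :: (real^2) measure)) = (LBINT s. \<alpha> s) * (LBINT t. \<beta> t)"
proof -
  have [measurable]: "\<alpha> \<in> borel_measurable borel" "\<beta> \<in> borel_measurable borel" using assms by auto
  show ?thesis
    by (subst lborel_plane[symmetric], subst integral_distr) (auto simp: integral_pair_mult[OF assms])
qed

lemma kern_plane: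
  assumes a: "bump a b \<alpha>" and b: "bump c d \<beta>"
  shows "kern (\<lambda>x::real^2. \<alpha> (x $ 1) * \<beta> (x $ 2))"
proof -
  obtain C where C: "\<And>x. \<bar>\<alpha> x\<bar> \<le> C * indicator {a..b} x" "0 \<le> C" using bump_bounded[OF a] by blast
  obtain D where D: "\<And>x. \<bar>\<beta> x\<bar> \<le> D * indicator {c..d} x" "0 \<le> D" using bump_bounded[OF b] by blast
  let ?R = "(\<bar>a\<bar> + \<bar>b\<bar>) + (\<bar>c\<bar> + \<bar>d\<bar>)"
  have [measurable]: "\<alpha> \<in> borel_measurable borel" "\<beta> \<in> borel_measurable borel"
    using bump_measurable a b by blast+
  have "\<bar>\<alpha> (x $ 1) * \<beta> (x $ 2)\<bar> \<le> (C * D) * indicator (cball 0 ?R) x" for x :: "real^2"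
  proof (cases "x $ 1 \<in> {a..b} \<and> x $ 2 \<in> {c..d}")
    case True
    have "norm x \<le> \<bar>x $ 1\<bar> + \<bar>x $ 2\<bar>" using norm_le_l1_cart[of x] by (simp add: sum_2)
    then have "norm x \<le> ?R" using True by auto
    moreover have "\<bar>\<alpha> (x $ 1)\<bar> \<le> C" "\<bar>\<beta> (x $ 2)\<bar> \<le> D" using C(1)[of "x $ 1"] D(1)[of "x $ 2"] True by auto
    ultimately show ?thesis using C(2) D(2) by (simp add: abs_mult mult_mono)
  next
    case False
    then have "\<alpha> (x $ 1) = 0 \<or> \<beta> (x $ 2) = 0" using a b unfolding bump_def by blast
    then have "\<alpha> (x $ 1) * \<beta> (x $ 2) = 0" by simp
    then show ?thesis using C(2) D(2) by (simp only: abs_zero) simp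
  qed
  moreover have "(\<lambda>x::real^2. \<alpha> (x $ 1) * \<beta> (x $ 2)) \<in> borel_measurable borel" by measurable
  ultimately show ?thesis unfolding kern_def by blast
qed

definition rho :: "nat \<Rightarrow> real^2 \<Rightarrow> real" where
  "rho n x = moll1 n (x $ 1) * moll1 n (x $ 2)"

text \<open>The first partial derivative of \<open>rho n\<close>, so that
  \<open>cv (rho1 n) f\<close> is that of the mollified function. With derivatives encoded as
  kernels, no convolution has to be differentiated.\<close>

definition rho1 :: "nat \<Rightarrow> real^2 \<Rightarrow> real" where
  "rho1 n x = deriv (moll1 n) (x $ 1) * moll1 n (x $ 2)"

definition rho2 :: "nat \<Rightarrow> real^2 \<Rightarrow> real" where
  "rho2 n x = moll1 n (x $ 1) * deriv (moll1 n) (x $ 2)"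

lemma kern_rho: "kern (rho n)" "kern (rho1 n)" "kern (rho2 n)"
  unfolding rho_def[abs_def] rho1_def[abs_def] rho2_def[abs_def]
  by (rule kern_plane[OF moll1_bump moll1_bump] kern_plane[OF bump_deriv[OF moll1_bump] moll1_bump]
      kern_plane[OF moll1_bump bump_deriv[OF moll1_bump]])+

lemma rho_mollifier: "mollifier (2 / real (Suc n)) (rho n)"
  unfolding mollifier_def
proof (intro conjI allI impI)
  show "kern (rho n)" by (rule kern_rho)
  show "0 \<le> rho n x" for x by (simp add: rho_def moll1_nonneg)
  show "(LBINT x. rho n x) = 1"
    unfolding rho_def using integral_plane_mult[OF bump_integrable[OF moll1_bump[of n]] bump_integrable[OF moll1_bump[of n]]]
    by (simp add: moll1_integral)
  fix x :: "real^2" assume x: "2 / real (Suc n) < norm x"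
  \<comment> \<open>If the sum exceeds 2/(n + 1), one coordinate exceeds 1/(n + 1) and its factor
    vanishes; this is the origin of the radius.\<close>
  have "norm x \<le> \<bar>x $ 1\<bar> + \<bar>x $ 2\<bar>" using norm_le_l1_cart[of x] by (simp add: sum_2)
  then have "1 / real (Suc n) < \<bar>x $ 1\<bar> \<or> 1 / real (Suc n) < \<bar>x $ 2\<bar>" using x add_divide_distrib[of 1 1 "real (Suc n)"] by linarith
  then have "x $ 1 \<notin> {- (1 / Suc n)..1 / Suc n} \<or> x $ 2 \<notin> {- (1 / Suc n)..1 / Suc n}" by auto
  then have "moll1 n (x $ 1) = 0 \<or> moll1 n (x $ 2) = 0" using moll1_bump[of n] unfolding bump_def by blast
  then show "rho n x = 0" by (auto simp: rho_def)
qed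

lemma rho_radius: "(\<lambda>n. 2 / real (Suc n)) \<longlonglongrightarrow> 0"
  using tendsto_mult[OF tendsto_const LIMSEQ_inverse_real_of_nat, of 2] by (simp add: inverse_eq_divide)

text \<open>Product kernels make the autocorrelation factor over the coordinates, which reduces
  integration by parts in the plane to one variable.\<close>

lemma plane_autocorrelation:
  assumes "bump a b \<alpha>" "bump a b \<alpha>'" "bump a b \<beta>" "bump a b \<beta>'"
  shows "(\<integral>z. (\<alpha> ((z - x) $ 1) * \<beta> ((z - x) $ 2)) * (\<alpha>' ((z - y) $ 1) * \<beta>' ((z - y) $ 2)) \<partial>(lborel :: (real^2) measure))
    = (LBINT s. \<alpha> (s - x $ 1) * \<alpha>' (s - y $ 1)) * (LBINT s. \<beta> (s - x $ 2) * \<beta>' (s - y $ 2))"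
proof -
  have i: "integrable lborel (\<lambda>s. f (s - p) * g (s - q))" if "bump a b f" "bump a b g" for f g p q
  proof -
    have "bump (a + p) (b + p) (\<lambda>s. f (1 * s + - p))"
      using that(1) smooth_affine[of f 1 "-p"] by (auto simp: bump_def)
    from bump_integrable[OF bump_mult[OF this smooth_affine[of g 1 "-q"]]] that(2)
    show ?thesis by (simp add: bump_def)
  qed
  show ?thesis
    using integral_plane_mult[OF i[OF assms(1,2), of "x $ 1" "y $ 1"] i[OF assms(3,4), of "x $ 2" "y $ 2"]]
    by (simp add: ac_simps)
qed

lemma autocorrelation_by_parts:
  assumes f: "bump a b f" and g: "bump a b g"
  shows "(LBINT s. deriv f (s - p) * g (s - q)) = - (LBINT s. f (s - p) * deriv g (s - q))"
proof -
  have d: "deriv (\<lambda>s. h (s - r)) = (\<lambda>s. deriv h (s - r))" if "bump a b h" for h r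
  proof
    fix s
    have "((\<lambda>s. s - r) has_real_derivative 1) (at s)"
      using DERIV_diff[OF DERIV_ident DERIV_const[of r], of s] by simp
    from DERIV_chain'[OF this bump_DERIV[OF that]]
    show "deriv (\<lambda>s. h (s - r)) s = deriv h (s - r)" by (intro DERIV_imp_deriv) simp
  qed
  have "bump (a + p) (b + p) (\<lambda>s. f (1 * s + - p))"
    using f smooth_affine[of f 1 "-p"] by (auto simp: bump_def)
  moreover have "smooth (\<lambda>s. g (1 * s + - q))" using g by (intro smooth_affine) (simp add: bump_def)
  ultimately show ?thesis using bump_by_parts[of "a + p" "b + p" "\<lambda>s. f (s - p)" "\<lambda>s. g (s - q)"]
    by (simp add: d[OF f] d[OF g])
qed

text \<open>By \<open>cv_pairing\<close>, integration by parts for mollified functions amounts to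
  these identities between kernels. The third comes from integrating by parts once in each variable,
  with two signs that cancel.\<close>

lemma rho_autocorrelation:
  shows "(LBINT z. rho1 n (z - x) * rho n (z - y)) = - (LBINT z. rho n (z - x) * rho1 n (z - y))"
    and "(LBINT z. rho2 n (z - x) * rho n (z - y)) = - (LBINT z. rho n (z - x) * rho2 n (z - y))"
    and "(LBINT z. rho1 n (z - x) * rho2 n (z - y)) = (LBINT z. rho2 n (z - x) * rho1 n (z - y))"
proof -
  note b = moll1_bump[of n] and d = bump_deriv[OF moll1_bump[of n]]
  note ac = plane_autocorrelation[OF b b b b] plane_autocorrelation[OF d b b b] plane_autocorrelation[OF b d b b]
    plane_autocorrelation[OF b b d b] plane_autocorrelation[OF b b b d] plane_autocorrelation[OF d b b d] plane_autocorrelation[OF b d d b]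
  note p = autocorrelation_by_parts[OF b b]
  show "(LBINT z. rho1 n (z - x) * rho n (z - y)) = - (LBINT z. rho n (z - x) * rho1 n (z - y))"
    unfolding rho_def rho1_def ac p by simp
  show "(LBINT z. rho2 n (z - x) * rho n (z - y)) = - (LBINT z. rho n (z - x) * rho2 n (z - y))"
    unfolding rho_def rho2_def ac p by simp
  show "(LBINT z. rho1 n (z - x) * rho2 n (z - y)) = (LBINT z. rho2 n (z - x) * rho1 n (z - y))"
    unfolding rho1_def rho2_def ac p by simp
qed

text \<open>The fundamental theorem for the kernel along the direction \<open>e\<close> is
  integrated against \<open>f\<close> by Fubini. The result holds on every line, not just on almost
  every one.\<close>

lemma AC_cv:
  fixes f :: "'a::euclidean_space \<Rightarrow> real"
  assumes f: "f \<in> L2 lborel" and k: "kern k" "kern k'"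
    and d: "\<And>x s. 0 \<le> s \<Longrightarrow> k (x + s *\<^sub>R e) = k x + (LBINT r. indicator {0..s} r * k' (x + r *\<^sub>R e))"
  shows "AC T (\<lambda>s. cv k f (x + s *\<^sub>R e)) (\<lambda>s. cv k' f (x + s *\<^sub>R e))"
proof -
  have [measurable]: "f \<in> borel_measurable borel" "k \<in> borel_measurable borel" "k' \<in> borel_measurable borel"
    using f k by (auto simp: L2_def kern_def)
  have bnd: "integrable lborel (\<lambda>r. indicator {0..s} r * cv j f' (x + r *\<^sub>R e))" if j: "kern j" and f': "f' \<in> L2 lborel" for s j f'
  proof (rule Bochner_Integration.integrable_bound)
    have [measurable]: "f' \<in> borel_measurable borel" "j \<in> borel_measurable borel"
      using f' j by (auto simp: L2_def kern_def)
    let ?K = "sqrt (LBINT x. (f' x)\<^sup>2) * sqrt (LBINT x. (j x)\<^sup>2)"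
    show "integrable lborel (\<lambda>r. ?K * indicat_real {0..s} r)"
      using emeasure_lborel_Icc_eq[of 0 s] by (intro integrable_mult_right integrable_real_indicator) (auto split: if_splits)
    show "(\<lambda>r. indicator {0..s} r * cv j f' (x + r *\<^sub>R e)) \<in> borel_measurable lborel" by measurable
    show "AE r in lborel. norm (indicator {0..s} r * cv j f' (x + r *\<^sub>R e)) \<le> norm (?K * indicat_real {0..s} r)"
    proof (rule AE_I2)
      fix r
      have "\<bar>cv j f' (x + r *\<^sub>R e)\<bar> \<le> ?K" by (rule cv_L2_bounded[OF f' j])
      also have "\<dots> \<le> \<bar>?K\<bar>" by (rule abs_ge_self)
      finally show "norm (indicator {0..s} r * cv j f' (x + r *\<^sub>R e)) \<le> norm (?K * indicat_real {0..s} r)"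
        by (cases "r \<in> {0..s}") auto
    qed
  qed
  have "cv k f (x + s *\<^sub>R e) = cv k f x + prim (\<lambda>s. cv k' f (x + s *\<^sub>R e)) s" if s: "0 \<le> s" for s
  proof -
    let ?H = "\<lambda>r w. indicator {0..s} r * (f w * k' (x + r *\<^sub>R e - w))"
    have I: "integrable (lborel \<Otimes>\<^sub>M lborel) (case_prod ?H)"
    proof (rule lborel_pair.Fubini_integrable)
      show "integrable lborel (\<lambda>r. LBINT w. norm (case_prod ?H (r, w)))"
        using bnd[OF kern_abs[OF k(2)] L2_abs[OF f], of s] by (simp add: abs_mult cv_def)
      show "AE r in lborel. integrable lborel (\<lambda>w. case_prod ?H (r, w))"
        using cv_integrable_L2[OF f k(2)] by simp
    qed measurable
    have "cv k f (x + s *\<^sub>R e) - cv k f x = (LBINT w. f w * k (x + s *\<^sub>R e - w) - f w * k (x - w))"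
      unfolding cv_def by (intro Bochner_Integration.integral_diff[symmetric] cv_integrable_L2 f k)
    also have "\<dots> = (LBINT w. (LBINT r. ?H r w))"
    proof (intro Bochner_Integration.integral_cong refl)
      fix w
      have "k (x + s *\<^sub>R e - w) - k (x - w) = (LBINT r. indicator {0..s} r * k' (x + r *\<^sub>R e - w))"
        using d[OF s, of "x - w"] by (simp add: algebra_simps)
      moreover have "(LBINT r. ?H r w) = (LBINT r. f w * (indicator {0..s} r * k' (x + r *\<^sub>R e - w)))"
        by (intro Bochner_Integration.integral_cong) auto
      ultimately show "f w * k (x + s *\<^sub>R e - w) - f w * k (x - w) = (LBINT r. ?H r w)"
        by (simp add: right_diff_distrib[symmetric])
    qed
    also have "\<dots> = (LBINT r. (LBINT w. ?H r w))"
      by (rule lborel_pair.Fubini_integral[OF I])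
    also have "\<dots> = prim (\<lambda>s. cv k' f (x + s *\<^sub>R e)) s"
      by (simp add: prim_def cv_def)
    finally show ?thesis by simp
  qed
  then show ?thesis unfolding AC_def using bnd[OF k(2) f] by auto
qed

lemma bump_FTC:
  assumes "bump a b \<alpha>" "0 \<le> s"
  shows "\<alpha> (y + s) = \<alpha> y + (LBINT r. indicator {0..s} r * deriv \<alpha> (y + r))"
proof -
  have "has_bochner_integral lborel (\<lambda>r. indicator {0..s} r *\<^sub>R deriv \<alpha> (y + r)) (\<alpha> (y + s) - \<alpha> (y + 0))"
  proof (rule has_bochner_integral_FTC_Icc)
    have "smooth (\<lambda>r. deriv \<alpha> (1 * r + y))"
      using smooth_affine[OF smooth_deriv[of \<alpha>], of 1 y] assms by (simp add: bump_def)
    from continuous_on_subset[OF smooth_continuous[OF this] subset_UNIV]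
    show "continuous_on {0..s} (\<lambda>r. deriv \<alpha> (y + r))" by (simp add: add.commute)
    fix r
    have "((\<lambda>r. y + r) has_real_derivative 1) (at r within {0..s})"
      using DERIV_add[OF DERIV_const[of y] DERIV_ident, of r "{0..s}"] by simp
    from DERIV_chain'[OF this bump_DERIV[OF assms(1)]]
    show "((\<lambda>r. \<alpha> (y + r)) has_vector_derivative deriv \<alpha> (y + r)) (at r within {0..s})"
      by (simp add: has_real_derivative_iff_has_vector_derivative)
  qed fact
  then show ?thesis by (simp add: has_bochner_integral_iff)
qed

lemma AC_mollified:
  assumes f: "f \<in> L2 lborel"
  shows "AC T (\<lambda>s. cv (rho n) f (x + s *\<^sub>R axis 1 1)) (\<lambda>s. cv (rho1 n) f (x + s *\<^sub>R axis 1 1))"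
    and "AC T (\<lambda>s. cv (rho n) f (x + s *\<^sub>R axis 2 1)) (\<lambda>s. cv (rho2 n) f (x + s *\<^sub>R axis 2 1))"
proof -
  have "rho n (x + s *\<^sub>R axis 1 1) = rho n x + (LBINT r. indicator {0..s} r * rho1 n (x + r *\<^sub>R axis 1 1))" if "0 \<le> s" for x s
    using bump_FTC[OF moll1_bump[of n] that, of "x $ 1"]
    by (simp add: rho_def rho1_def axis_def distrib_right mult.assoc[symmetric])
  then show "AC T (\<lambda>s. cv (rho n) f (x + s *\<^sub>R axis 1 1)) (\<lambda>s. cv (rho1 n) f (x + s *\<^sub>R axis 1 1))"
    by (rule AC_cv[OF f kern_rho(1,2)])
  have "rho n (x + s *\<^sub>R axis 2 1) = rho n x + (LBINT r. indicator {0..s} r * rho2 n (x + r *\<^sub>R axis 2 1))" if "0 \<le> s" for x s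
    using bump_FTC[OF moll1_bump[of n] that, of "x $ 2"]
    by (simp add: rho_def rho2_def axis_def distrib_left mult.left_commute[of "indicat_real _ _"])
  then show "AC T (\<lambda>s. cv (rho n) f (x + s *\<^sub>R axis 2 1)) (\<lambda>s. cv (rho2 n) f (x + s *\<^sub>R axis 2 1))"
    by (rule AC_cv[OF f kern_rho(1,3)])
qed

section \<open>The div-curl bound for mollified fields\<close>

lemma L2_pairing_fin:
  assumes f: "f \<in> L2 lborel" and g: "g \<in> L2 lborel" and k: "kern \<alpha>" "kern \<beta>"
  shows "integrable lborel (\<lambda>z. cv (\<lambda>x. \<bar>\<alpha> x\<bar>) (\<lambda>x. \<bar>f x\<bar>) z * cv (\<lambda>x. \<bar>\<beta> x\<bar>) (\<lambda>x. \<bar>g x\<bar>) z)"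
  by (intro L2_mult_integrable cv_L2 L2_abs kern_abs f g k)

lemma L1_L2_pairing_fin:
  assumes f: "integrable lborel f" and g: "g \<in> L2 lborel" and k: "kern \<alpha>" "kern \<beta>"
  shows "integrable lborel (\<lambda>z. cv (\<lambda>x. \<bar>\<alpha> x\<bar>) (\<lambda>x. \<bar>f x\<bar>) z * cv (\<lambda>x. \<bar>\<beta> x\<bar>) (\<lambda>x. \<bar>g x\<bar>) z)"
proof -
  let ?F = "cv (\<lambda>x. \<bar>\<alpha> x\<bar>) (\<lambda>x. \<bar>f x\<bar>)" and ?G = "cv (\<lambda>x. \<bar>\<beta> x\<bar>) (\<lambda>x. \<bar>g x\<bar>)"
  have [measurable]: "\<alpha> \<in> borel_measurable borel" "\<beta> \<in> borel_measurable borel" "f \<in> borel_measurable borel" "g \<in> borel_measurable borel"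
    using f g k by (auto simp: L2_def kern_def)
  let ?K = "sqrt (LBINT x. (\<bar>g x\<bar>)\<^sup>2) * sqrt (LBINT x. (\<bar>\<beta> x\<bar>)\<^sup>2)"
  have F: "integrable lborel ?F" by (intro cv_L1 kern_abs k integrable_abs f)
  show ?thesis
  proof (rule Bochner_Integration.integrable_bound)
    show "integrable lborel (\<lambda>z. ?K * ?F z)" using F by simp
    show "AE z in lborel. norm (?F z * ?G z) \<le> norm (?K * ?F z)"
    proof (rule AE_I2)
      fix z
      have "\<bar>?G z\<bar> \<le> ?K" by (rule cv_L2_bounded[OF L2_abs[OF g] kern_abs[OF k(2)]])
      also have "\<dots> \<le> \<bar>?K\<bar>" by (rule abs_ge_self)
      finally show "norm (?F z * ?G z) \<le> norm (?K * ?F z)"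
        by (simp only: real_norm_def abs_mult mult.commute[of "\<bar>?F z\<bar>"]) (intro mult_right_mono, auto)
    qed
  qed measurable
qed

text \<open>The squared gradient of a planar field equals its squared divergence plus its squared
  curl, up to twice the difference of \<partial>1 a1 \<partial>2 a2 and \<partial>2 a1 \<partial>1
  a2, whose integrals agree. For a curl-free field the divergence alone controls the gradient, with
  constant 1.\<close>

lemma mollified_gradient_bound:
  assumes a: "a1 \<in> L2 lborel" "a2 \<in> L2 lborel" "L \<in> L2 lborel"
    and div: "AE z in lborel. cv (rho1 n) a1 z + cv (rho2 n) a2 z = cv (rho n) L z"
    and curl: "AE z in lborel. cv (rho2 n) a1 z = cv (rho1 n) a2 z"
  shows "(LBINT z. (cv (rho1 n) a1 z)\<^sup>2) + (LBINT z. (cv (rho2 n) a1 z)\<^sup>2)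
    + (LBINT z. (cv (rho1 n) a2 z)\<^sup>2) + (LBINT z. (cv (rho2 n) a2 z)\<^sup>2) \<le> (LBINT z. (L z)\<^sup>2)"
proof -
  have [measurable]: "a1 \<in> borel_measurable borel" "a2 \<in> borel_measurable borel" "L \<in> borel_measurable borel"
    "rho n \<in> borel_measurable borel" "rho1 n \<in> borel_measurable borel" "rho2 n \<in> borel_measurable borel"
    using a kern_rho[of n] by (auto simp: L2_def kern_def)
  let ?p = "cv (rho1 n) a1" and ?q = "cv (rho2 n) a2" and ?r = "cv (rho2 n) a1" and ?s = "cv (rho1 n) a2"
  have l2: "?p \<in> L2 lborel" "?q \<in> L2 lborel" "?r \<in> L2 lborel" "?s \<in> L2 lborel" "cv (rho n) L \<in> L2 lborel"
    by (intro cv_L2 a kern_rho)+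
  note i = l2[THEN L2_integrable] L2_mult_integrable[OF l2(1,2)] L2_mult_integrable[OF l2(3,4)]
  \<comment> \<open>By \<open>cv_pairing\<close> both sides depend on their kernels only through an
    autocorrelation, and these coincide by symmetry of the mixed derivatives.\<close>
  have "(LBINT z. ?p z * ?q z) = (LBINT z. ?r z * ?s z)"
    using a by (subst (1 2) cv_pairing) (auto intro!: cv_integrable_L2 L2_pairing_fin kern_rho simp: rho_autocorrelation)
  then have "(LBINT z. (?p z)\<^sup>2) + (LBINT z. (?r z)\<^sup>2) + (LBINT z. (?s z)\<^sup>2) + (LBINT z. (?q z)\<^sup>2)
    = (LBINT z. (?p z)\<^sup>2 + (?q z)\<^sup>2 + 2 * (?p z * ?q z) + ((?r z)\<^sup>2 + (?s z)\<^sup>2 - 2 * (?r z * ?s z)))"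
    using i by simp
  also have "\<dots> = (LBINT z. (cv (rho n) L z)\<^sup>2)"
  proof (rule integral_cong_AE)
    show "AE z in lborel. (?p z)\<^sup>2 + (?q z)\<^sup>2 + 2 * (?p z * ?q z) + ((?r z)\<^sup>2 + (?s z)\<^sup>2 - 2 * (?r z * ?s z))
      = (cv (rho n) L z)\<^sup>2"
      using div curl
    proof eventually_elim
      case (elim z)
      show ?case unfolding elim(1)[symmetric] elim(2) by (simp add: power2_eq_square algebra_simps)
    qed
  qed measurable
  also have "\<dots> \<le> (LBINT z. (L z)\<^sup>2)"
  proof (rule integral_le_nn)
    have "(\<integral>\<^sup>+v. \<bar>rho n v\<bar> \<partial>lborel) = 1"
      using mollifier_nn_integral[OF rho_mollifier[of n]] rho_mollifier[of n] by (simp add: mollifier_def)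
    then show "(\<integral>\<^sup>+z. ennreal ((cv (rho n) L z)\<^sup>2) \<partial>lborel) \<le> ennreal (LBINT z. (L z)\<^sup>2)"
      using cv_nn_square_le[of L "rho n"] nn_integral_square_L2[OF a(3)] by simp
  qed auto
  finally show ?thesis .
qed

text \<open>A square integrable function is small somewhere to the left of every point, so the
  fundamental theorem of calculus bounds its powers by the integral of their derivative.\<close>

lemma power_le_line_integral:
  fixes u v :: "real \<Rightarrow> real"
  assumes [measurable]: "u \<in> borel_measurable borel" "v \<in> borel_measurable borel"
    and ac: "\<And>y T. AC T (\<lambda>s. u (y + s)) (\<lambda>s. v (y + s))"
    and fin: "(\<integral>\<^sup>+s. ennreal ((u s)\<^sup>2) \<partial>lborel) < \<infinity>" and k: "0 < k"
  shows "ennreal (\<bar>u x\<bar> ^ k) \<le> (\<integral>\<^sup>+s. ennreal (real k * \<bar>u s\<bar> ^ (k - 1) * \<bar>v s\<bar>) \<partial>lborel)" (is "_ \<le> ?P")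
proof (rule ennreal_le_epsilon)
  fix e :: real assume e: "0 < e"
  \<comment> \<open>At a point where \<bar>u\<bar> is at most \<open>d\<close>, the boundary term in
    the fundamental theorem costs at most \<open>e\<close>.\<close>
  define d where "d = root k e"
  have d: "d > 0" "d ^ k = e" using e k by (auto simp: d_def)
  \<comment> \<open>Otherwise u^2 would exceed a positive constant on a half-line, contradicting
    \<open>fin\<close>.\<close>
  have "\<exists>y<x. (u y)\<^sup>2 \<le> d\<^sup>2"
  proof (rule ccontr)
    assume "\<not> ?thesis"
    then have *: "\<And>y. y < x \<Longrightarrow> d\<^sup>2 \<le> (u y)\<^sup>2" by (auto simp: not_le less_imp_le)
    have "(\<integral>\<^sup>+s. ennreal (d\<^sup>2) * indicator {..<x} s \<partial>lborel) \<le> (\<integral>\<^sup>+s. ennreal ((u s)\<^sup>2) \<partial>lborel)"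
      by (intro nn_integral_mono) (auto simp: indicator_def * ennreal_leI)
    moreover have "(\<integral>\<^sup>+s. ennreal (d\<^sup>2) * indicator {..<x} s \<partial>lborel) = \<infinity>"
    proof -
      have "emeasure lborel {..<x} = \<infinity>"
      proof -
        have "ennreal (real n) \<le> emeasure lborel {..<x}" for n
        proof -
          have "emeasure lborel {x - real n <..< x} \<le> emeasure lborel {..<x}" by (intro emeasure_mono) auto
          then show ?thesis by simp
        qed
        then show ?thesis using ennreal_Ex_less_of_nat[of "emeasure lborel {..<x}"]
          by (auto simp: less_top[symmetric] not_less ennreal_of_nat_eq_real_of_nat leD)
      qed
      then show ?thesis using d(1) by (simp add: nn_integral_cmult ennreal_mult_eq_top_iff)
    qed
    ultimately show False using fin by (simp add: top_unique)
  qed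
  then obtain y where y: "y < x" "\<bar>u y\<bar> \<le> d" using d(1) abs_le_square_iff[of "u _" d] by auto
  define w where "w s = real k * u (y + s) ^ (k - 1) * v (y + s)" for s
  have "AC (x - y) (\<lambda>s. u (y + s) ^ k) w"
    unfolding w_def by (rule AC_power[OF ac])
  then have I: "integrable lborel (\<lambda>s. indicator {0..x - y} s * w s)" and eq: "u x ^ k = u y ^ k + prim w (x - y)"
  proof -
    show "integrable lborel (\<lambda>s. indicator {0..x - y} s * w s)"
      using \<open>AC (x - y) (\<lambda>s. u (y + s) ^ k) w\<close> unfolding AC_def by blast
    have "x - y \<in> {0..x - y}" using y(1) by simp
    then have "u (y + (x - y)) ^ k = u (y + 0) ^ k + prim w (x - y)"
      using \<open>AC (x - y) (\<lambda>s. u (y + s) ^ k) w\<close> unfolding AC_def by blast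
    then show "u x ^ k = u y ^ k + prim w (x - y)" by simp
  qed
  have "ennreal \<bar>prim w (x - y)\<bar> \<le> (\<integral>\<^sup>+s. ennreal \<bar>indicator {0..x - y} s * w s\<bar> \<partial>lborel)"
    unfolding prim_def using integral_norm_bound_ennreal[OF I] by simp
  also have "\<dots> \<le> (\<integral>\<^sup>+s. ennreal \<bar>w s\<bar> \<partial>lborel)"
    by (intro nn_integral_mono ennreal_leI) (auto simp: indicator_def)
  also have "\<dots> = (\<integral>\<^sup>+s. (\<lambda>s. ennreal (real k * \<bar>u s\<bar> ^ (k - 1) * \<bar>v s\<bar>)) (s + y) \<partial>lborel)"
    by (simp add: w_def abs_mult power_abs add.commute)
  also have "\<dots> = ?P" by (rule nn_integral_shift) measurable
  finally have p: "ennreal \<bar>prim w (x - y)\<bar> \<le> ?P" .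
  have "\<bar>u x\<bar> ^ k = \<bar>u x ^ k\<bar>" by (simp add: power_abs)
  also have "\<dots> \<le> \<bar>u y ^ k\<bar> + \<bar>prim w (x - y)\<bar>" unfolding eq by (rule abs_triangle_ineq)
  also have "\<bar>u y ^ k\<bar> \<le> d ^ k" unfolding power_abs by (intro power_mono y) simp
  finally have "\<bar>u x\<bar> ^ k \<le> \<bar>prim w (x - y)\<bar> + e" using d by simp
  then have "ennreal (\<bar>u x\<bar> ^ k) \<le> ennreal \<bar>prim w (x - y)\<bar> + ennreal e"
    using e by (simp add: ennreal_plus[symmetric] ennreal_leI del: ennreal_plus)
  also have "\<dots> \<le> ?P + ennreal e" using p by (intro add_right_mono)
  finally show "ennreal (\<bar>u x\<bar> ^ k) \<le> ?P + ennreal e" .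
qed

section \<open>Gagliardo-Nirenberg inequality and the scalar form bound\<close>

lemma ennreal_mult_le_sum_squares: "x * y \<le> x\<^sup>2 + y\<^sup>2" for x y :: ennreal
proof (cases "x \<le> y")
  case True
  then have "x * y \<le> y\<^sup>2" by (simp add: power2_eq_square mult_right_mono)
  then show ?thesis by (simp add: add_increasing)
next
  case False
  then have "x * y \<le> x\<^sup>2" by (simp add: power2_eq_square mult_left_mono)
  then show ?thesis by (simp add: add_increasing2)
qed

text \<open>(v1, v2) is the gradient of \<open>u\<close> in the sense of absolute continuity on
  every line parallel to an axis, the form in which mollified functions provide it.\<close>

locale plane_gradient =
  fixes u v1 v2 :: "real^2 \<Rightarrow> real"
  assumes u: "u \<in> L2 lborel" and v: "v1 \<in> L2 lborel" "v2 \<in> L2 lborel"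
    and ac1: "\<And>x T. AC T (\<lambda>s. u (x + s *\<^sub>R axis 1 1)) (\<lambda>s. v1 (x + s *\<^sub>R axis 1 1))"
    and ac2: "\<And>x T. AC T (\<lambda>s. u (x + s *\<^sub>R axis 2 1)) (\<lambda>s. v2 (x + s *\<^sub>R axis 2 1))"
begin

lemma measurable_uv[measurable]:
  "u \<in> borel_measurable borel" "v1 \<in> borel_measurable borel" "v2 \<in> borel_measurable borel"
  using u v by (auto simp: L2_def)

text \<open>Gagliardo's argument for \<bar>u\<bar>^k: it is bounded by the integral of its
  derivative along the horizontal and along the vertical line through the point. Each bound depends
  on one coordinate only, so the integral of their product factors. Cauchy-Schwarz then separates
  the gradient from the remaining power of \<open>u\<close>.\<close>

lemma sobolev_step:
  assumes k: "0 < k"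
  shows "(\<integral>\<^sup>+x. ennreal (u x ^ (2 * k)) \<partial>lborel)
    \<le> ennreal ((real k)\<^sup>2 * ((LBINT x. (v1 x)\<^sup>2) + (LBINT x. (v2 x)\<^sup>2))) * (\<integral>\<^sup>+x. ennreal (u x ^ (2 * (k - 1))) \<partial>lborel)"
proof -
  let ?w1 = "\<lambda>x. ennreal (real k * \<bar>u x\<bar> ^ (k - 1) * \<bar>v1 x\<bar>)" and ?w2 = "\<lambda>x. ennreal (real k * \<bar>u x\<bar> ^ (k - 1) * \<bar>v2 x\<bar>)"
  define P1 where "P1 t = (\<integral>\<^sup>+s. ?w1 (vec2 s t) \<partial>lborel)" for t
  define P2 where "P2 s = (\<integral>\<^sup>+t. ?w2 (vec2 s t) \<partial>lborel)" for s
  have [measurable]: "P1 \<in> borel_measurable borel" "P2 \<in> borel_measurable borel"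
    unfolding P1_def P2_def by measurable
  have ufin: "(\<integral>\<^sup>+x. ennreal ((u x)\<^sup>2) \<partial>lborel) \<noteq> \<infinity>" using nn_integral_square_L2[OF u] by simp
  \<comment> \<open>By Fubini the restriction of \<open>u\<close> to almost every horizontal line is
    square integrable, as \<open>power_le_line_integral\<close> requires.\<close>
  have "AE t in lborel. (\<integral>\<^sup>+s. ennreal ((u (vec2 s t))\<^sup>2) \<partial>lborel) \<noteq> \<infinity>"
    using ufin by (intro nn_integral_PInf_AE) (auto simp: nn_integral_plane(2))
  then have AE1: "AE t in lborel. \<forall>s. ennreal (\<bar>u (vec2 s t)\<bar> ^ k) \<le> P1 t"
  proof eventually_elim
    case (elim t)
    show ?case unfolding P1_def
    proof
      fix s show "ennreal (\<bar>u (vec2 s t)\<bar> ^ k) \<le> (\<integral>\<^sup>+s. ?w1 (vec2 s t) \<partial>lborel)"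
        using elim ac1[of _ "vec2 _ t"] by (intro power_le_line_integral k) (auto simp: vec2_add_axis less_top)
    qed
  qed
  have "AE s in lborel. (\<integral>\<^sup>+t. ennreal ((u (vec2 s t))\<^sup>2) \<partial>lborel) \<noteq> \<infinity>"
    using ufin by (intro nn_integral_PInf_AE) (auto simp: nn_integral_plane(1))
  then have AE2: "AE s in lborel. \<forall>t. ennreal (\<bar>u (vec2 s t)\<bar> ^ k) \<le> P2 s"
  proof eventually_elim
    case (elim s)
    show ?case unfolding P2_def
    proof
      fix t show "ennreal (\<bar>u (vec2 s t)\<bar> ^ k) \<le> (\<integral>\<^sup>+t. ?w2 (vec2 s t) \<partial>lborel)"
        using elim ac2[of _ "vec2 s _"] by (intro power_le_line_integral k) (auto simp: vec2_add_axis less_top)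
    qed
  qed
  have "(\<integral>\<^sup>+x. ennreal (u x ^ (2 * k)) \<partial>lborel) = (\<integral>\<^sup>+t. \<integral>\<^sup>+s. ennreal (u (vec2 s t) ^ (2 * k)) \<partial>lborel \<partial>lborel)"
    by (rule nn_integral_plane(2)) measurable
  also have "\<dots> \<le> (\<integral>\<^sup>+t. \<integral>\<^sup>+s. P1 t * P2 s \<partial>lborel \<partial>lborel)"
  proof (rule nn_integral_mono_AE)
    show "AE t in lborel. (\<integral>\<^sup>+s. ennreal (u (vec2 s t) ^ (2 * k)) \<partial>lborel) \<le> (\<integral>\<^sup>+s. P1 t * P2 s \<partial>lborel)"
      using AE1
    proof eventually_elim
      case (elim t)
      show ?case
      proof (rule nn_integral_mono_AE)
        show "AE s in lborel. ennreal (u (vec2 s t) ^ (2 * k)) \<le> P1 t * P2 s"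
          using AE2
        proof eventually_elim
          case (elim s)
          have "ennreal (u (vec2 s t) ^ (2 * k)) = ennreal (\<bar>u (vec2 s t)\<bar> ^ k) * ennreal (\<bar>u (vec2 s t)\<bar> ^ k)"
            by (simp add: ennreal_mult[symmetric] power_mult power2_eq_square abs_mult flip: power_mult_distrib)
          also have "\<dots> \<le> P1 t * P2 s"
            using elim \<open>\<forall>s. ennreal (\<bar>u (vec2 s t)\<bar> ^ k) \<le> P1 t\<close> by (intro mult_mono) auto
          finally show ?case .
        qed
      qed
    qed
  qed
  also have "\<dots> = (\<integral>\<^sup>+t. P1 t \<partial>lborel) * (\<integral>\<^sup>+s. P2 s \<partial>lborel)"
    by (simp add: nn_integral_cmult nn_integral_multc)
  \<comment> \<open>Passing to the sum of squares is what turns the two directional derivatives into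
    the norm of the full gradient.\<close>
  also have "\<dots> \<le> (\<integral>\<^sup>+t. P1 t \<partial>lborel)\<^sup>2 + (\<integral>\<^sup>+s. P2 s \<partial>lborel)\<^sup>2"
    by (rule ennreal_mult_le_sum_squares)
  also have "(\<integral>\<^sup>+t. P1 t \<partial>lborel) = (\<integral>\<^sup>+x. ?w1 x \<partial>lborel)"
    unfolding P1_def by (rule nn_integral_plane(2)[symmetric]) measurable
  also have "(\<integral>\<^sup>+s. P2 s \<partial>lborel) = (\<integral>\<^sup>+x. ?w2 x \<partial>lborel)"
    unfolding P2_def by (rule nn_integral_plane(1)[symmetric]) measurable
  finally have 1: "(\<integral>\<^sup>+x. ennreal (u x ^ (2 * k)) \<partial>lborel) \<le> (\<integral>\<^sup>+x. ?w1 x \<partial>lborel)\<^sup>2 + (\<integral>\<^sup>+x. ?w2 x \<partial>lborel)\<^sup>2" .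
  have cs: "(\<integral>\<^sup>+x. ennreal (real k * \<bar>u x\<bar> ^ (k - 1) * \<bar>w x\<bar>) \<partial>lborel)\<^sup>2 \<le>
     ennreal ((real k)\<^sup>2 * (LBINT x. (w x)\<^sup>2)) * (\<integral>\<^sup>+x. ennreal (u x ^ (2 * (k - 1))) \<partial>lborel)"
    if w: "w \<in> L2 lborel" for w
  proof -
    have [measurable]: "w \<in> borel_measurable borel" using w by (simp add: L2_def)
    have "(\<integral>\<^sup>+x. ennreal (real k * \<bar>u x\<bar> ^ (k - 1) * \<bar>w x\<bar>) \<partial>lborel)\<^sup>2
      = (\<integral>\<^sup>+x. ennreal (\<bar>u x\<bar> ^ (k - 1)) * ennreal (real k * \<bar>w x\<bar>) \<partial>lborel)\<^sup>2"
      by (simp add: ennreal_mult[symmetric] ac_simps)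
    also have "\<dots> \<le> (\<integral>\<^sup>+x. (ennreal (\<bar>u x\<bar> ^ (k - 1)))\<^sup>2 \<partial>lborel) * (\<integral>\<^sup>+x. (ennreal (real k * \<bar>w x\<bar>))\<^sup>2 \<partial>lborel)"
      by (rule Cauchy_Schwarz_nn_integral) measurable
    also have "(\<integral>\<^sup>+x. (ennreal (\<bar>u x\<bar> ^ (k - 1)))\<^sup>2 \<partial>lborel) = (\<integral>\<^sup>+x. ennreal (u x ^ (2 * (k - 1))) \<partial>lborel)"
    proof -
      have "(\<bar>y\<bar> ^ (k - 1))\<^sup>2 = y ^ (2 * (k - 1))" for y :: real
      proof -
        have "(\<bar>y\<bar> ^ (k - 1))\<^sup>2 = (\<bar>y\<bar>\<^sup>2) ^ (k - 1)" by (simp only: power_mult[symmetric] mult.commute)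
        then show ?thesis by (simp add: power_mult)
      qed
      then show ?thesis by (simp add: ennreal_power)
    qed
    also have "(\<integral>\<^sup>+x. (ennreal (real k * \<bar>w x\<bar>))\<^sup>2 \<partial>lborel) = ennreal ((real k)\<^sup>2 * (LBINT x. (w x)\<^sup>2))"
      by (simp add: ennreal_power power_mult_distrib ennreal_mult nn_integral_cmult nn_integral_square_L2[OF w])
    finally show ?thesis by (simp only: mult.commute)
  qed
  have "(\<integral>\<^sup>+x. ?w1 x \<partial>lborel)\<^sup>2 + (\<integral>\<^sup>+x. ?w2 x \<partial>lborel)\<^sup>2 \<le>
     ennreal ((real k)\<^sup>2 * (LBINT x. (v1 x)\<^sup>2)) * (\<integral>\<^sup>+x. ennreal (u x ^ (2 * (k - 1))) \<partial>lborel)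
   + ennreal ((real k)\<^sup>2 * (LBINT x. (v2 x)\<^sup>2)) * (\<integral>\<^sup>+x. ennreal (u x ^ (2 * (k - 1))) \<partial>lborel)"
    by (intro add_mono cs v)
  also have "\<dots> = ennreal ((real k)\<^sup>2 * ((LBINT x. (v1 x)\<^sup>2) + (LBINT x. (v2 x)\<^sup>2))) * (\<integral>\<^sup>+x. ennreal (u x ^ (2 * (k - 1))) \<partial>lborel)"
    by (simp add: distrib_left distrib_right[symmetric] ennreal_plus[symmetric] del: ennreal_plus)
  finally show ?thesis using 1 by (rule order_trans[rotated])
qed

text \<open>Starting from the exponent 2, every application of \<open>sobolev_step\<close> raises
  the exponent by 2 and costs the gradient norm times a squared integer; these integers multiply to
  the squared factorial.\<close>

lemma gagliardo_nirenberg_even: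
  "(\<integral>\<^sup>+x. ennreal (u x ^ (2 * Suc k)) \<partial>lborel)
    \<le> ennreal ((fact (Suc k))\<^sup>2 * ((LBINT x. (v1 x)\<^sup>2) + (LBINT x. (v2 x)\<^sup>2)) ^ k * (LBINT x. (u x)\<^sup>2))"
proof (induction k)
  case 0
  show ?case using nn_integral_square_L2[OF u] by simp
next
  case (Suc k)
  let ?N = "(LBINT x. (v1 x)\<^sup>2) + (LBINT x. (v2 x)\<^sup>2)"
  have N: "0 \<le> ?N" by simp
  have "(\<integral>\<^sup>+x. ennreal (u x ^ (2 * Suc (Suc k))) \<partial>lborel) \<le>
    ennreal ((real (Suc (Suc k)))\<^sup>2 * ?N) * (\<integral>\<^sup>+x. ennreal (u x ^ (2 * Suc k)) \<partial>lborel)"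
    using sobolev_step[of "Suc (Suc k)"] by (simp only: diff_Suc_1 zero_less_Suc simp_thms)
  also have "\<dots> \<le> ennreal ((real (Suc (Suc k)))\<^sup>2 * ?N) * ennreal ((fact (Suc k))\<^sup>2 * ?N ^ k * (LBINT x. (u x)\<^sup>2))"
    by (intro mult_left_mono Suc) simp
  also have "\<dots> = ennreal ((real (Suc (Suc k)))\<^sup>2 * ?N * ((fact (Suc k))\<^sup>2 * ?N ^ k * (LBINT x. (u x)\<^sup>2)))"
    using N by (intro ennreal_mult[symmetric] mult_nonneg_nonneg) auto
  also have "(real (Suc (Suc k)))\<^sup>2 * ?N * ((fact (Suc k))\<^sup>2 * ?N ^ k * (LBINT x. (u x)\<^sup>2))
    = (fact (Suc (Suc k)))\<^sup>2 * ?N ^ Suc k * (LBINT x. (u x)\<^sup>2)"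
    by (simp only: fact_Suc[of "Suc k"] power_mult_distrib power_Suc of_nat_id of_nat_mult) (simp only: ac_simps)
  finally show ?case .
qed

text \<open>The pointwise splitting of \<open>u\<^sup>2 V\<close> uses the Gagliardo-Nirenberg inequality for one even exponent
  only, so that no interpolation with real exponents is needed.\<close>

lemma form_bound_scalar:
  assumes [measurable]: "V \<in> borel_measurable borel" and V0: "\<And>x. 0 \<le> V x"
    and s: "1 < s" and X: "(\<integral>\<^sup>+x. ennreal (V x powr s) \<partial>lborel) \<le> ennreal X" "0 \<le> X"
    and k: "0 < k" "real (Suc k) / real k \<le> s" and \<delta>: "0 < \<delta>" and \<Lambda>: "0 < \<Lambda>" "X \<le> \<delta> * \<Lambda> powr (s - 1)"
  shows "(\<integral>\<^sup>+x. ennreal ((u x)\<^sup>2 * V x) \<partial>lborel)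
     \<le> ennreal (\<delta> * ((LBINT x. (v1 x)\<^sup>2) + (LBINT x. (v2 x)\<^sup>2))
        + (1 + (fact (Suc k))\<^sup>2 + \<delta>) * \<Lambda> * (LBINT x. (u x)\<^sup>2))"
proof -
  define N where "N = (LBINT x. (v1 x)\<^sup>2) + (LBINT x. (v2 x)\<^sup>2)"
  define a where "a = (LBINT x. (u x)\<^sup>2)"
  define c :: real where "c = (fact (Suc k))\<^sup>2"
  have N0: "0 \<le> N" and a0: "0 \<le> a" and c0: "0 \<le> c" by (auto simp: N_def a_def c_def)
  show ?thesis
  proof (cases "a = 0")
    case True
    have "AE x in lborel. (u x)\<^sup>2 = 0"
      using True integral_nonneg_eq_0_iff_AE[OF L2_integrable[OF u]] by (simp add: a_def)
    then have "(\<integral>\<^sup>+x. ennreal ((u x)\<^sup>2 * V x) \<partial>lborel) = 0"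
      by (subst nn_integral_0_iff_AE) (auto elim!: eventually_mono)
    then show ?thesis by simp
  next
    case False
    \<comment> \<open>The threshold between large and small u^2. It dominates \<open>N\<close>, so
      N^k / \<beta>^k is at most 1 in the Gagliardo-Nirenberg term, and it is itself of the form of
      the bound, so the term \<delta> \<beta> may remain. Positivity is the reason for treating
      \<open>a = 0\<close> apart.\<close>
    define \<beta> where "\<beta> = N + \<Lambda> * a"
    have \<beta>: "0 < \<beta>" using False a0 N0 \<Lambda>(1) by (auto simp: \<beta>_def intro!: add_nonneg_pos)
    have pw: "(u x)\<^sup>2 * V x \<le> \<Lambda> * (u x)\<^sup>2 + \<Lambda> / \<beta> ^ k * u x ^ (2 * Suc k) + \<Lambda> * \<beta> * \<Lambda> powr - s * V x powr s" for x
    proof -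
      define y where "y = (u x)\<^sup>2"
      define Y where "Y = V x / \<Lambda>"
      have y0: "0 \<le> y" and Y0: "0 \<le> Y" using V0[of x] \<Lambda>(1) by (auto simp: y_def Y_def)
      have uy: "u x ^ (2 * Suc k) = y ^ Suc k" by (simp only: y_def power_mult)
      have Ys: "Y powr s = \<Lambda> powr - s * V x powr s"
        using \<Lambda>(1) V0[of x] by (simp add: Y_def powr_divide powr_minus field_simps)
      have nn: "0 \<le> y ^ Suc k / \<beta> ^ k" "0 \<le> \<beta> * Y powr s" using y0 \<beta> by auto
      \<comment> \<open>Each summand covers one regime. If Y is at most 1, y suffices. If y is at
        most \<beta> Y^(1/k), then y Y is at most \<beta> Y^(1 + 1/k), and 1 + 1/k is at most s.
        Otherwise Y is below (y / \<beta>)^k.\<close>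
      have "y * Y \<le> y + y ^ Suc k / \<beta> ^ k + \<beta> * Y powr s"
      proof (cases "Y \<le> 1")
        case True
        then have "y * Y \<le> y" using y0 by (simp add: mult_left_le)
        then show ?thesis using nn by linarith
      next
        case Y1: False
        show ?thesis
        proof (cases "y \<le> \<beta> * Y powr (1 / real k)")
          case True
          have "y * Y \<le> \<beta> * Y powr (1 / real k) * Y" using True Y0 by (rule mult_right_mono)
          also have "\<dots> = \<beta> * Y powr (1 / real k + 1)" using Y1 by (simp add: powr_add)
          also have "1 / real k + 1 = real (Suc k) / real k" using k(1) by (simp add: field_simps)
          also have "\<beta> * Y powr (real (Suc k) / real k) \<le> \<beta> * Y powr s"
            using Y1 k(2) \<beta> by (intro mult_left_mono powr_mono) auto
          finally show ?thesis using nn y0 by linarith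
        next
          case False
          then have "Y powr (1 / real k) \<le> y / \<beta>" using \<beta> by (simp add: field_simps)
          then have "(Y powr (1 / real k)) ^ k \<le> (y / \<beta>) ^ k" by (intro power_mono) auto
          moreover have "(Y powr (1 / real k)) ^ k = Y"
            using Y1 k(1) by (simp add: powr_realpow[symmetric] powr_powr)
          ultimately have "Y \<le> y ^ k / \<beta> ^ k" by (simp add: power_divide)
          then have "y * Y \<le> y * (y ^ k / \<beta> ^ k)" using y0 by (rule mult_left_mono)
          then have "y * Y \<le> y ^ Suc k / \<beta> ^ k" by simp
          then show ?thesis using nn y0 by linarith
        qed
      qed
      then have "\<Lambda> * (y * Y) \<le> \<Lambda> * (y + y ^ Suc k / \<beta> ^ k + \<beta> * Y powr s)" using \<Lambda>(1) by (intro mult_left_mono) auto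
      moreover have "\<Lambda> * (y * Y) = y * V x" using \<Lambda>(1) by (simp add: Y_def)
      ultimately show ?thesis unfolding uy Ys y_def[symmetric] by (simp add: distrib_left mult.assoc)
    qed
    have "(\<integral>\<^sup>+x. ennreal ((u x)\<^sup>2 * V x) \<partial>lborel) \<le>
      (\<integral>\<^sup>+x. ennreal \<Lambda> * ennreal ((u x)\<^sup>2) + ennreal (\<Lambda> / \<beta> ^ k) * ennreal (u x ^ (2 * Suc k))
         + ennreal (\<Lambda> * \<beta> * \<Lambda> powr - s) * ennreal (V x powr s) \<partial>lborel)"
    proof (intro nn_integral_mono)
      fix x
      have nn: "0 \<le> \<Lambda> / \<beta> ^ k" "0 \<le> \<Lambda> * \<beta> * \<Lambda> powr - s" "0 \<le> u x ^ (2 * Suc k)"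
        using \<Lambda>(1) \<beta> by (auto simp del: power_Suc mult_Suc_right intro: zero_le_even_power)
      have "ennreal ((u x)\<^sup>2 * V x) \<le> ennreal (\<Lambda> * (u x)\<^sup>2 + \<Lambda> / \<beta> ^ k * u x ^ (2 * Suc k) + \<Lambda> * \<beta> * \<Lambda> powr - s * V x powr s)"
        by (intro ennreal_leI pw)
      also have "\<dots> = ennreal (\<Lambda> * (u x)\<^sup>2) + ennreal (\<Lambda> / \<beta> ^ k * u x ^ (2 * Suc k)) + ennreal (\<Lambda> * \<beta> * \<Lambda> powr - s * V x powr s)"
      proof -
        have A: "0 \<le> \<Lambda> * (u x)\<^sup>2" using \<Lambda>(1) by simp
        have B: "0 \<le> \<Lambda> / \<beta> ^ k * u x ^ (2 * Suc k)" by (rule mult_nonneg_nonneg[OF nn(1,3)])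
        have C: "0 \<le> \<Lambda> * \<beta> * \<Lambda> powr - s * V x powr s" by (rule mult_nonneg_nonneg[OF nn(2) powr_ge_zero])
        show ?thesis unfolding ennreal_plus[OF add_nonneg_nonneg[OF A B] C] ennreal_plus[OF A B] ..
      qed
      finally show "ennreal ((u x)\<^sup>2 * V x) \<le> ennreal \<Lambda> * ennreal ((u x)\<^sup>2) + ennreal (\<Lambda> / \<beta> ^ k) * ennreal (u x ^ (2 * Suc k))
         + ennreal (\<Lambda> * \<beta> * \<Lambda> powr - s) * ennreal (V x powr s)"
        using \<Lambda>(1) nn by (simp only: ennreal_mult less_imp_le zero_le_power2 powr_ge_zero)
    qed
    also have "\<dots> = ennreal \<Lambda> * (\<integral>\<^sup>+x. ennreal ((u x)\<^sup>2) \<partial>lborel) + ennreal (\<Lambda> / \<beta> ^ k) * (\<integral>\<^sup>+x. ennreal (u x ^ (2 * Suc k)) \<partial>lborel)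
       + ennreal (\<Lambda> * \<beta> * \<Lambda> powr - s) * (\<integral>\<^sup>+x. ennreal (V x powr s) \<partial>lborel)"
      by (simp add: nn_integral_add nn_integral_cmult del: power_Suc mult_Suc_right)
    also have "\<dots> \<le> ennreal \<Lambda> * ennreal a + ennreal (\<Lambda> / \<beta> ^ k) * ennreal (c * N ^ k * a)
       + ennreal (\<Lambda> * \<beta> * \<Lambda> powr - s) * ennreal X"
      using gagliardo_nirenberg_even[of k] X(1) nn_integral_square_L2[OF u]
      unfolding a_def[symmetric] N_def[symmetric] c_def[symmetric]
      by (intro add_mono mult_left_mono) auto
    also have "\<dots> = ennreal (\<Lambda> * a + \<Lambda> / \<beta> ^ k * (c * N ^ k * a) + \<Lambda> * \<beta> * \<Lambda> powr - s * X)"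
      using \<Lambda>(1) \<beta> a0 N0 c0 X(2) by (simp add: ennreal_mult[symmetric] ennreal_plus[symmetric] del: ennreal_plus)
    also have "\<dots> \<le> ennreal (\<delta> * N + (1 + c + \<delta>) * \<Lambda> * a)"
    proof (rule ennreal_leI)
      have "N ^ k \<le> \<beta> ^ k" using N0 \<Lambda>(1) a0 by (intro power_mono) (auto simp: \<beta>_def)
      then have "N ^ k / \<beta> ^ k \<le> 1" using \<beta> by (simp add: divide_le_eq_1)
      then have "\<Lambda> * c * a * (N ^ k / \<beta> ^ k) \<le> \<Lambda> * c * a" using \<Lambda>(1) c0 a0 by (intro mult_left_le) auto
      moreover have "\<Lambda> / \<beta> ^ k * (c * N ^ k * a) = \<Lambda> * c * a * (N ^ k / \<beta> ^ k)" by simp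
      moreover have "\<Lambda> * \<beta> * \<Lambda> powr - s * X \<le> \<delta> * \<beta>"
      proof -
        \<comment> \<open>The powers of \<Lambda> cancel, so the hypothesis on \<open>X\<close>
          bounds the last term by \<delta> \<beta>, that is, by \<delta> N plus \<delta> \<Lambda>
          a.\<close>
        have e: "\<Lambda> * \<Lambda> powr - s * \<Lambda> powr (s - 1) = 1"
          using \<Lambda>(1) powr_add[of \<Lambda> 1 "- s"] powr_add[of \<Lambda> "1 - s" "s - 1"] by simp
        have "\<Lambda> * \<beta> * \<Lambda> powr - s * X \<le> \<Lambda> * \<beta> * \<Lambda> powr - s * (\<delta> * \<Lambda> powr (s - 1))"
          using \<Lambda> \<beta> by (intro mult_left_mono) auto
        also have "\<dots> = \<delta> * \<beta> * (\<Lambda> * \<Lambda> powr - s * \<Lambda> powr (s - 1))" by (simp only: ac_simps)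
        finally show ?thesis by (simp add: e)
      qed
      ultimately show "\<Lambda> * a + \<Lambda> / \<beta> ^ k * (c * N ^ k * a) + \<Lambda> * \<beta> * \<Lambda> powr - s * X \<le> \<delta> * N + (1 + c + \<delta>) * \<Lambda> * a"
        unfolding \<beta>_def by (simp add: algebra_simps)
    qed
    finally show ?thesis unfolding N_def a_def c_def .
  qed
qed

end

text \<open>A curl-free field with divergence \<open>L\<close>, expressed through the kernels
  \<open>rho n\<close> at almost every point. Countably many kernels and almost every
  \<open>z\<close> is what the space-time equations yield on a fixed time slice after exchanging
  null sets.\<close>

definition gradlike :: "(real^2 \<Rightarrow> real) \<Rightarrow> (real^2 \<Rightarrow> real) \<Rightarrow> (real^2 \<Rightarrow> real) \<Rightarrow> bool" where
  "gradlike a1 a2 L \<longleftrightarrow> a1 \<in> L2 lborel \<and> a2 \<in> L2 lborel \<and> L \<in> L2 lborel \<and>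
    (\<forall>n. (AE z in lborel. cv (rho1 n) a1 z + cv (rho2 n) a2 z = cv (rho n) L z) \<and>
         (AE z in lborel. cv (rho2 n) a1 z = cv (rho1 n) a2 z))"

lemma gradlike_shift:
  assumes "gradlike a1 a2 L"
  shows "gradlike (\<lambda>x. a1 (x + h)) (\<lambda>x. a2 (x + h)) (\<lambda>x. L (x + h))"
proof -
  have [measurable]: "a1 \<in> borel_measurable borel" "a2 \<in> borel_measurable borel" "L \<in> borel_measurable borel"
    "rho n \<in> borel_measurable borel" "rho1 n \<in> borel_measurable borel" "rho2 n \<in> borel_measurable borel" for n
    using assms kern_rho[of n] by (auto simp: gradlike_def L2_def kern_def)
  show ?thesis unfolding gradlike_def
  proof (intro conjI allI)
    show "(\<lambda>x. a1 (x + h)) \<in> L2 lborel" "(\<lambda>x. a2 (x + h)) \<in> L2 lborel" "(\<lambda>x. L (x + h)) \<in> L2 lborel"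
      using assms unfolding gradlike_def by (blast intro: L2_shift)+
    fix n
    have "AE z in lborel. cv (rho1 n) a1 z + cv (rho2 n) a2 z = cv (rho n) L z"
      "AE z in lborel. cv (rho2 n) a1 z = cv (rho1 n) a2 z" using assms unfolding gradlike_def by blast+
    note this[THEN AE_shift, of h]
    then show "AE z in lborel. cv (rho1 n) (\<lambda>x. a1 (x + h)) z + cv (rho2 n) (\<lambda>x. a2 (x + h)) z = cv (rho n) (\<lambda>x. L (x + h)) z"
      "AE z in lborel. cv (rho2 n) (\<lambda>x. a1 (x + h)) z = cv (rho1 n) (\<lambda>x. a2 (x + h)) z"
      by (simp_all add: cv_shift)
  qed
qed

lemma gradlike_diff:
  assumes "gradlike a1 a2 L" "gradlike b1 b2 M"
  shows "gradlike (\<lambda>x. a1 x - b1 x) (\<lambda>x. a2 x - b2 x) (\<lambda>x. L x - M x)"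
proof -
  have l: "a1 \<in> L2 lborel" "a2 \<in> L2 lborel" "L \<in> L2 lborel" "b1 \<in> L2 lborel" "b2 \<in> L2 lborel" "M \<in> L2 lborel"
    using assms by (auto simp: gradlike_def)
  have cd: "cv k (\<lambda>x. f x - g x) z = cv k f z - cv k g z" if "f \<in> L2 lborel" "g \<in> L2 lborel" "kern k" for k f g z
    using that by (intro cv_diff cv_integrable_L2)
  show ?thesis unfolding gradlike_def
  proof (intro conjI allI L2_diff l)
    fix n
    have "AE z in lborel. cv (rho1 n) a1 z + cv (rho2 n) a2 z = cv (rho n) L z"
      "AE z in lborel. cv (rho1 n) b1 z + cv (rho2 n) b2 z = cv (rho n) M z"
      using assms by (auto simp: gradlike_def)
    then show "AE z in lborel. cv (rho1 n) (\<lambda>x. a1 x - b1 x) z + cv (rho2 n) (\<lambda>x. a2 x - b2 x) z = cv (rho n) (\<lambda>x. L x - M x) z"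
      by eventually_elim (simp add: cd l kern_rho)
    have "AE z in lborel. cv (rho2 n) a1 z = cv (rho1 n) a2 z"
      "AE z in lborel. cv (rho2 n) b1 z = cv (rho1 n) b2 z"
      using assms by (auto simp: gradlike_def)
    then show "AE z in lborel. cv (rho2 n) (\<lambda>x. a1 x - b1 x) z = cv (rho1 n) (\<lambda>x. a2 x - b2 x) z"
      by eventually_elim (simp add: cd l kern_rho)
  qed
qed

lemma plane_gradient_mollified:
  "f \<in> L2 lborel \<Longrightarrow> plane_gradient (cv (rho n) f) (cv (rho1 n) f) (cv (rho2 n) f)"
  by unfold_locales (auto intro!: cv_L2 kern_rho AC_mollified)

lemma mollified_square_le:
  assumes "f \<in> L2 lborel" shows "(LBINT z. (cv (rho n) f z)\<^sup>2) \<le> (LBINT z. (f z)\<^sup>2)"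
proof (rule integral_le_nn)
  have [measurable]: "f \<in> borel_measurable borel" "rho n \<in> borel_measurable borel"
    using assms kern_rho[of n] by (auto simp: L2_def kern_def)
  have "(\<integral>\<^sup>+v. \<bar>rho n v\<bar> \<partial>lborel) = 1"
    using mollifier_nn_integral[OF rho_mollifier[of n]] rho_mollifier[of n] by (simp add: mollifier_def)
  then show "(\<integral>\<^sup>+z. ennreal ((cv (rho n) f z)\<^sup>2) \<partial>lborel) \<le> ennreal (LBINT z. (f z)\<^sup>2)"
    using cv_nn_square_le[of f "rho n"] nn_integral_square_L2[OF assms] by simp
  show "(\<lambda>z. (cv (rho n) f z)\<^sup>2) \<in> borel_measurable lborel" by measurable
qed auto

text \<open>The scalar bound is applied to both mollified components. The sum of their gradient
  norms is controlled by the divergence through \<open>mollified_gradient_bound\<close>, and Fatou's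
  lemma removes the mollification, as the bound is uniform in \<open>n\<close>.\<close>

lemma form_bound:
  assumes gl: "gradlike a1 a2 L" and [measurable]: "V \<in> borel_measurable borel" and V0: "\<And>x. 0 \<le> V x"
    and s: "1 < s" and X: "(\<integral>\<^sup>+x. ennreal (V x powr s) \<partial>lborel) \<le> ennreal X" "0 \<le> X"
    and k: "0 < k" "real (Suc k) / real k \<le> s" and \<delta>: "0 < \<delta>" and \<Lambda>: "0 < \<Lambda>" "X \<le> \<delta> * \<Lambda> powr (s - 1)"
  shows "(\<integral>\<^sup>+x. ennreal (((a1 x)\<^sup>2 + (a2 x)\<^sup>2) * V x) \<partial>lborel)
     \<le> ennreal (\<delta> * (LBINT x. (L x)\<^sup>2)
        + (1 + (fact (Suc k))\<^sup>2 + \<delta>) * \<Lambda> * ((LBINT x. (a1 x)\<^sup>2) + (LBINT x. (a2 x)\<^sup>2)))"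
    (is "_ \<le> ennreal ?B")
proof -
  have l: "a1 \<in> L2 lborel" "a2 \<in> L2 lborel" "L \<in> L2 lborel" using gl by (auto simp: gradlike_def)
  have [measurable]: "a1 \<in> borel_measurable borel" "a2 \<in> borel_measurable borel" "L \<in> borel_measurable borel"
    "rho n \<in> borel_measurable borel" for n
    using l kern_rho[of n] by (auto simp: L2_def kern_def)
  let ?u = "\<lambda>n. cv (rho n) a1" and ?v = "\<lambda>n. cv (rho n) a2"
  define C :: real where "C = (1 + (fact (Suc k))\<^sup>2 + \<delta>) * \<Lambda>"
  have C0: "0 \<le> C" using \<delta> \<Lambda> by (auto simp: C_def)
  have bound: "(\<integral>\<^sup>+x. ennreal (((?u n x)\<^sup>2 + (?v n x)\<^sup>2) * V x) \<partial>lborel) \<le> ennreal ?B" for n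
  proof -
    interpret u: plane_gradient "?u n" "cv (rho1 n) a1" "cv (rho2 n) a1" by (rule plane_gradient_mollified[OF l(1)])
    interpret v: plane_gradient "?v n" "cv (rho1 n) a2" "cv (rho2 n) a2" by (rule plane_gradient_mollified[OF l(2)])
    have "(\<integral>\<^sup>+x. ennreal (((?u n x)\<^sup>2 + (?v n x)\<^sup>2) * V x) \<partial>lborel)
       = (\<integral>\<^sup>+x. ennreal ((?u n x)\<^sup>2 * V x) \<partial>lborel) + (\<integral>\<^sup>+x. ennreal ((?v n x)\<^sup>2 * V x) \<partial>lborel)"
      using V0 by (subst nn_integral_add[symmetric]) (auto simp: distrib_right ennreal_plus)
    also have "\<dots> \<le> ennreal (\<delta> * ((LBINT x. (cv (rho1 n) a1 x)\<^sup>2) + (LBINT x. (cv (rho2 n) a1 x)\<^sup>2)) + C * (LBINT x. (?u n x)\<^sup>2))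
      + ennreal (\<delta> * ((LBINT x. (cv (rho1 n) a2 x)\<^sup>2) + (LBINT x. (cv (rho2 n) a2 x)\<^sup>2)) + C * (LBINT x. (?v n x)\<^sup>2))"
      unfolding C_def
      by (intro add_mono u.form_bound_scalar[OF assms(2-)] v.form_bound_scalar[OF assms(2-)])
    also have "\<dots> = ennreal (\<delta> * ((LBINT x. (cv (rho1 n) a1 x)\<^sup>2) + (LBINT x. (cv (rho2 n) a1 x)\<^sup>2)) + C * (LBINT x. (?u n x)\<^sup>2)
      + (\<delta> * ((LBINT x. (cv (rho1 n) a2 x)\<^sup>2) + (LBINT x. (cv (rho2 n) a2 x)\<^sup>2)) + C * (LBINT x. (?v n x)\<^sup>2)))"
      using \<delta> C0 by (intro ennreal_plus[symmetric] add_nonneg_nonneg mult_nonneg_nonneg) auto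
    also have "\<dots> \<le> ennreal ?B"
    proof (rule ennreal_leI)
      have "(LBINT z. (cv (rho1 n) a1 z)\<^sup>2) + (LBINT z. (cv (rho2 n) a1 z)\<^sup>2)
        + (LBINT z. (cv (rho1 n) a2 z)\<^sup>2) + (LBINT z. (cv (rho2 n) a2 z)\<^sup>2) \<le> (LBINT z. (L z)\<^sup>2)"
        using gl unfolding gradlike_def by (intro mollified_gradient_bound) auto
      from mult_left_mono[OF this, of \<delta>] \<delta>
      have 1: "\<delta> * (LBINT z. (cv (rho1 n) a1 z)\<^sup>2) + \<delta> * (LBINT z. (cv (rho2 n) a1 z)\<^sup>2)
        + \<delta> * (LBINT z. (cv (rho1 n) a2 z)\<^sup>2) + \<delta> * (LBINT z. (cv (rho2 n) a2 z)\<^sup>2) \<le> \<delta> * (LBINT z. (L z)\<^sup>2)"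
        by (simp add: distrib_left)
      have 2: "C * (LBINT x. (?u n x)\<^sup>2) \<le> C * (LBINT x. (a1 x)\<^sup>2)" "C * (LBINT x. (?v n x)\<^sup>2) \<le> C * (LBINT x. (a2 x)\<^sup>2)"
        by (intro mult_left_mono mollified_square_le l C0)+
      show "\<delta> * ((LBINT x. (cv (rho1 n) a1 x)\<^sup>2) + (LBINT x. (cv (rho2 n) a1 x)\<^sup>2)) + C * (LBINT x. (?u n x)\<^sup>2)
        + (\<delta> * ((LBINT x. (cv (rho1 n) a2 x)\<^sup>2) + (LBINT x. (cv (rho2 n) a2 x)\<^sup>2)) + C * (LBINT x. (?v n x)\<^sup>2)) \<le> ?B"
        unfolding C_def[symmetric] distrib_left using 1 2 by linarith
    qed
    finally show ?thesis .
  qed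
  define D where "D n x = (?u n x - a1 x)\<^sup>2 + (?v n x - a2 x)\<^sup>2" for n x
  have iD: "integrable lborel (\<lambda>x. (?u n x - a1 x)\<^sup>2)" "integrable lborel (\<lambda>x. (?v n x - a2 x)\<^sup>2)" for n
    by (intro L2_integrable L2_diff cv_L2 kern_rho l)+
  then have D: "integrable lborel (D n)" for n unfolding D_def by auto
  have "(\<lambda>n. (LBINT x. (?u n x - a1 x)\<^sup>2) + (LBINT x. (?v n x - a2 x)\<^sup>2)) \<longlonglongrightarrow> 0 + 0"
    by (intro tendsto_add mollify_L2_tendsto[OF _ rho_mollifier rho_radius] l)
  then have "(\<lambda>n. LBINT x. norm (D n x)) \<longlonglongrightarrow> 0" unfolding D_def using iD by simp
  \<comment> \<open>The squared distances tend to 0 in mean, hence almost everywhere along a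
    subsequence; squaring lets one function handle both components.\<close>
  from tendsto_L1_AE_subseq[OF D this] obtain r where r: "strict_mono r" "AE x in lborel. (\<lambda>n. D (r n) x) \<longlonglongrightarrow> 0" by auto
  have conv: "AE x in lborel. (\<lambda>n. ((?u (r n) x)\<^sup>2 + (?v (r n) x)\<^sup>2) * V x) \<longlonglongrightarrow> ((a1 x)\<^sup>2 + (a2 x)\<^sup>2) * V x"
    using r(2)
  proof eventually_elim
    case (elim x)
    have sq: "f \<longlonglongrightarrow> 0" if "\<And>n. (f n)\<^sup>2 \<le> D (r n) x" for f :: "nat \<Rightarrow> real"
    proof -
      have "(\<lambda>n. (f n)\<^sup>2) \<longlonglongrightarrow> 0"
        by (rule tendsto_sandwich[OF _ _ tendsto_const elim]) (auto simp: that)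
      then have "(\<lambda>n. sqrt ((f n)\<^sup>2)) \<longlonglongrightarrow> sqrt 0" by (rule tendsto_real_sqrt)
      then show ?thesis by (simp add: tendsto_rabs_zero_iff)
    qed
    have "(\<lambda>n. ?u (r n) x - a1 x) \<longlonglongrightarrow> 0" "(\<lambda>n. ?v (r n) x - a2 x) \<longlonglongrightarrow> 0"
      by (intro sq; simp add: D_def)+
    then have "(\<lambda>n. ?u (r n) x) \<longlonglongrightarrow> a1 x" "(\<lambda>n. ?v (r n) x) \<longlonglongrightarrow> a2 x" by (auto intro: LIM_zero_cancel)
    then show ?case by (intro tendsto_intros)
  qed
  have "(\<integral>\<^sup>+x. ennreal (((a1 x)\<^sup>2 + (a2 x)\<^sup>2) * V x) \<partial>lborel)
     = (\<integral>\<^sup>+x. liminf (\<lambda>n. ennreal (((?u (r n) x)\<^sup>2 + (?v (r n) x)\<^sup>2) * V x)) \<partial>lborel)"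
  proof (rule nn_integral_cong_AE)
    show "AE x in lborel. ennreal (((a1 x)\<^sup>2 + (a2 x)\<^sup>2) * V x) = liminf (\<lambda>n. ennreal (((?u (r n) x)\<^sup>2 + (?v (r n) x)\<^sup>2) * V x))"
      using conv by eventually_elim (rule lim_imp_Liminf[symmetric], simp, erule tendsto_ennrealI)
  qed
  also have "\<dots> \<le> liminf (\<lambda>n. \<integral>\<^sup>+x. ennreal (((?u (r n) x)\<^sup>2 + (?v (r n) x)\<^sup>2) * V x) \<partial>lborel)"
    by (rule nn_integral_liminf) measurable
  also have "\<dots> \<le> liminf (\<lambda>n::nat. ennreal ?B)"
    by (intro Liminf_mono always_eventually allI bound)
  also have "\<dots> = ennreal ?B" by (simp add: Liminf_const)
  finally show ?thesis .
qed

section \<open>Mollified pairings\<close>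

text \<open>Infinitesimal form boundedness of the potential \<open>V\<close> on curl-free fields,
  relative to the squared divergence, with \<open>c \<delta>\<close> as the price of the relative
  bound \<open>\<delta>\<close>. Estimates use \<open>c 1\<close> alone; arbitrarily small
  \<open>\<delta>\<close> gives continuity of correlations.\<close>

definition form_bounded :: "(real^2 \<Rightarrow> real) \<Rightarrow> (real \<Rightarrow> real) \<Rightarrow> bool" where
  "form_bounded V c \<longleftrightarrow> (\<forall>a1 a2 L. gradlike a1 a2 L \<longrightarrow> (\<forall>\<delta>>0. 0 \<le> c \<delta> \<and>
     (\<integral>\<^sup>+x. ennreal (((a1 x)\<^sup>2 + (a2 x)\<^sup>2) * V x) \<partial>lborel)
     \<le> ennreal (\<delta> * (LBINT x. (L x)\<^sup>2) + c \<delta> * ((LBINT x. (a1 x)\<^sup>2) + (LBINT x. (a2 x)\<^sup>2)))))"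

lemma form_bounded_L2:
  assumes fb: "form_bounded V c" and gl: "gradlike a1 a2 L" and \<delta>: "0 < \<delta>"
    and [measurable]: "e \<in> borel_measurable borel" and e: "\<And>x. (e x)\<^sup>2 \<le> V x"
    and a: "a = a1 \<or> a = a2"
  shows "(\<lambda>x. a x * e x) \<in> L2 lborel"
    and "(LBINT x. (a x * e x)\<^sup>2) \<le> \<delta> * (LBINT x. (L x)\<^sup>2) + c \<delta> * ((LBINT x. (a1 x)\<^sup>2) + (LBINT x. (a2 x)\<^sup>2))"
    (is "_ \<le> ?B")
proof -
  have [measurable]: "a1 \<in> borel_measurable borel" "a2 \<in> borel_measurable borel"
    using gl by (auto simp: gradlike_def L2_def)
  have [measurable]: "a \<in> borel_measurable borel" using a by auto
  have c: "0 \<le> c \<delta>" and B: "(\<integral>\<^sup>+x. ennreal (((a1 x)\<^sup>2 + (a2 x)\<^sup>2) * V x) \<partial>lborel) \<le> ennreal ?B"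
    using fb gl \<delta> unfolding form_bounded_def by blast+
  have "(\<integral>\<^sup>+x. ennreal ((a x * e x)\<^sup>2) \<partial>lborel) \<le> (\<integral>\<^sup>+x. ennreal (((a1 x)\<^sup>2 + (a2 x)\<^sup>2) * V x) \<partial>lborel)"
    unfolding power_mult_distrib
    by (intro nn_integral_mono ennreal_leI mult_mono e) (use a order_trans[OF zero_le_power2 e] in auto)
  also note B
  finally have *: "(\<integral>\<^sup>+x. ennreal ((a x * e x)\<^sup>2) \<partial>lborel) \<le> ennreal ?B" .
  show "(\<lambda>x. a x * e x) \<in> L2 lborel"
    by (rule L2I_nn) (use * in \<open>auto simp: le_less_trans\<close>)
  show "(LBINT x. (a x * e x)\<^sup>2) \<le> ?B"
    by (rule integral_le_nn) (use * c \<delta> in auto)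
qed

lemma L2_product_le:
  assumes "f \<in> L2 M" "g \<in> L2 M"
  shows "(\<integral>x. \<bar>f x * g x\<bar> \<partial>M) \<le> ((\<integral>x. (f x)\<^sup>2 \<partial>M) + (\<integral>x. (g x)\<^sup>2 \<partial>M)) / 2"
proof -
  have "(\<integral>x. \<bar>f x * g x\<bar> \<partial>M) \<le> (\<integral>x. ((f x)\<^sup>2 + (g x)\<^sup>2) / 2 \<partial>M)"
    using assms by (intro integral_mono abs_mult_le_half_squares) (auto intro!: L2_mult_integrable integrable_abs L2_integrable)
  then show ?thesis using assms by (simp add: L2_integrable)
qed

lemma integral_square_shift:
  fixes f :: "'a::euclidean_space \<Rightarrow> real"
  assumes "f \<in> L2 lborel"
  shows "(LBINT x. (f (x + h))\<^sup>2) = (LBINT x. (f x)\<^sup>2)"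
  using assms by (intro integral_shift) (auto simp: L2_def)

text \<open>The factor \<open>e\<close> is always grouped with \<open>a\<close>, since a e is square
  integrable by the form bound while p e need not be. For the limit, a(y + h) is split into a(y) and
  an increment. The increment is again a curl-free field: the form bound makes the divergence part
  small through \<delta> and the rest small through continuity of translations.\<close>

lemma trilinear_correlation:
  assumes fb: "form_bounded V c" and gl: "gradlike a1 a2 L" and p: "p \<in> L2 lborel"
    and em: "e \<in> borel_measurable borel" and e: "\<And>x. (e x)\<^sup>2 \<le> V x"
    and a: "a = a1 \<or> a = a2"
  shows "integrable lborel (\<lambda>y. a (y + h) * p (y + h) * e y)"
    and "(LBINT y. \<bar>a (y + h) * p (y + h) * e y\<bar>) \<le>
      ((LBINT x. (p x)\<^sup>2) + ((LBINT x. (L x)\<^sup>2) + c 1 * ((LBINT x. (a1 x)\<^sup>2) + (LBINT x. (a2 x)\<^sup>2)))) / 2"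
    and "h' \<longlonglongrightarrow> 0 \<Longrightarrow> (\<lambda>n. LBINT y. a (y + h' n) * p (y + h' n) * e y) \<longlonglongrightarrow> (LBINT y. a y * p y * e y)"
proof -
  have l: "a1 \<in> L2 lborel" "a2 \<in> L2 lborel" "L \<in> L2 lborel" using gl by (auto simp: gradlike_def)
  note [measurable] = em
  have aL: "a \<in> L2 lborel" using a l by auto
  have sh: "(\<lambda>x. a (x + h)) = (\<lambda>x. a1 (x + h)) \<or> (\<lambda>x. a (x + h)) = (\<lambda>x. a2 (x + h))" for h using a by auto
  have ae: "(\<lambda>y. a (y + h) * e y) \<in> L2 lborel"
    and aeb: "(LBINT y. (a (y + h) * e y)\<^sup>2) \<le> 1 * (LBINT x. (L x)\<^sup>2) + c 1 * ((LBINT x. (a1 x)\<^sup>2) + (LBINT x. (a2 x)\<^sup>2))" for h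
    using form_bounded_L2[OF fb gradlike_shift[OF gl, of h] zero_less_one em e sh]
    by (simp_all add: integral_square_shift l)
  have I: "integrable lborel (\<lambda>y. a (y + h) * p (y + h') * e y)" for h h'
    using L2_mult_integrable[OF L2_shift[OF p, of h'] ae[of h]] by (simp add: ac_simps)
  show "integrable lborel (\<lambda>y. a (y + h) * p (y + h) * e y)" by (rule I)
  have "(LBINT y. \<bar>a (y + h) * p (y + h) * e y\<bar>) = (LBINT y. \<bar>p (y + h) * (a (y + h) * e y)\<bar>)" by (simp add: ac_simps)
  also have "\<dots> \<le> ((LBINT y. (p (y + h))\<^sup>2) + (LBINT y. (a (y + h) * e y)\<^sup>2)) / 2"
    by (intro L2_product_le L2_shift p ae)
  also have "\<dots> \<le> ((LBINT x. (p x)\<^sup>2) + ((LBINT x. (L x)\<^sup>2) + c 1 * ((LBINT x. (a1 x)\<^sup>2) + (LBINT x. (a2 x)\<^sup>2)))) / 2"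
    using aeb[of h] by (simp add: integral_square_shift p)
  finally show "(LBINT y. \<bar>a (y + h) * p (y + h) * e y\<bar>) \<le>
      ((LBINT x. (p x)\<^sup>2) + ((LBINT x. (L x)\<^sup>2) + c 1 * ((LBINT x. (a1 x)\<^sup>2) + (LBINT x. (a2 x)\<^sup>2)))) / 2" .
  assume h': "h' \<longlonglongrightarrow> 0"
  have diff: "(\<lambda>n. LBINT y. ((a (y + h' n) - a y) * e y)\<^sup>2) \<longlonglongrightarrow> 0"
  proof (rule LIMSEQ_I)
    fix r :: real assume r: "r > 0"
    define LL where "LL = (LBINT x. (L x)\<^sup>2)"
    have LL: "0 \<le> LL" by (simp add: LL_def)
    \<comment> \<open>The divergence of the increment has squared norm at most 4 \<open>LL\<close>,
      so its share is at most r/2 uniformly in \<open>n\<close>; the 1 keeps the denominator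
      positive.\<close>
    define \<delta> where "\<delta> = r / (2 * (4 * LL + 1))"
    have \<delta>: "0 < \<delta>" using r LL by (simp add: \<delta>_def)
    have \<delta>4: "\<delta> * (4 * LL) < r / 2 + 0 \<or> \<delta> * (4 * LL) \<le> r / 2"
      using r LL by (simp add: \<delta>_def field_simps)
    define N where "N n = (LBINT x. (a1 (x + h' n) - a1 x)\<^sup>2) + (LBINT x. (a2 (x + h' n) - a2 x)\<^sup>2)" for n
    have "(\<lambda>n. c \<delta> * N n) \<longlonglongrightarrow> c \<delta> * (0 + 0)"
      unfolding N_def by (intro tendsto_intros L2_translation_continuous l h')
    then have "(\<lambda>n. c \<delta> * N n) \<longlonglongrightarrow> 0" by simp
    from order_tendstoD(2)[OF this, of "r/2"] r have ev: "eventually (\<lambda>n. c \<delta> * N n < r / 2) sequentially" by simp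
    have bnd: "(LBINT y. ((a (y + h' n) - a y) * e y)\<^sup>2) \<le> \<delta> * (4 * LL) + c \<delta> * N n" for n
    proof -
      have aa: "(\<lambda>x. a (x + h' n) - a x) = (\<lambda>x. a1 (x + h' n) - a1 x) \<or> (\<lambda>x. a (x + h' n) - a x) = (\<lambda>x. a2 (x + h' n) - a2 x)"
        using a by auto
      have "(LBINT y. ((a (y + h' n) - a y) * e y)\<^sup>2) \<le> \<delta> * (LBINT x. (L (x + h' n) - L x)\<^sup>2) + c \<delta> * N n"
        unfolding N_def by (rule form_bounded_L2(2)[OF fb gradlike_diff[OF gradlike_shift[OF gl, of "h' n"] gl] \<delta> em e aa])
      also have "(LBINT x. (L (x + h' n) - L x)\<^sup>2) \<le> 4 * LL"
      proof -
        have "(LBINT x. (L (x + h' n) - L x)\<^sup>2) \<le> (LBINT x. 2 * (L (x + h' n))\<^sup>2 + 2 * (L x)\<^sup>2)"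
        proof (rule integral_mono)
          show "(L (x + h' n) - L x)\<^sup>2 \<le> 2 * (L (x + h' n))\<^sup>2 + 2 * (L x)\<^sup>2" for x
            using square_add_le[of "L (x + h' n)" "- L x"] by simp
        qed (intro L2_integrable L2_diff L2_shift l Bochner_Integration.integrable_add integrable_mult_right)+
        also have "\<dots> = 4 * LL" using l(3) L2_integrable[OF L2_shift[OF l(3), of "h' n"]] 
          by (simp add: LL_def integral_square_shift L2_integrable)
        finally show ?thesis .
      qed
      finally show ?thesis using \<delta> by (simp add: mult_left_mono)
    qed
    obtain N0 where N0: "\<And>n. n \<ge> N0 \<Longrightarrow> c \<delta> * N n < r / 2" using ev unfolding eventually_sequentially by blast
    show "\<exists>N0. \<forall>n\<ge>N0. norm ((LBINT y. ((a (y + h' n) - a y) * e y)\<^sup>2) - 0) < r"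
    proof (intro exI allI impI)
      fix n assume "n \<ge> N0"
      from N0[OF this] bnd[of n] \<delta>4
      have "(LBINT y. ((a (y + h' n) - a y) * e y)\<^sup>2) < r" by linarith
      then show "norm ((LBINT y. ((a (y + h' n) - a y) * e y)\<^sup>2) - 0) < r" by simp
    qed
  qed
  have ae0: "(\<lambda>y. a y * e y) \<in> L2 lborel" using ae[of 0] by simp
  have d1: "(\<lambda>y. (a (y + h) - a y) * e y) \<in> L2 lborel" for h
    using L2_diff[OF ae[of h] ae0] by (simp add: left_diff_distrib)
  have "(\<lambda>n. (LBINT y. p (y + h' n) * ((a (y + h' n) - a y) * e y))) \<longlonglongrightarrow> 0"
  proof (rule Lim_null_comparison)
    have "(\<lambda>n. sqrt (LBINT x. (p x)\<^sup>2) * sqrt (LBINT y. ((a (y + h' n) - a y) * e y)\<^sup>2)) \<longlonglongrightarrow> sqrt (LBINT x. (p x)\<^sup>2) * sqrt 0"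
      by (intro tendsto_intros diff)
    then show "(\<lambda>n. sqrt (LBINT x. (p x)\<^sup>2) * sqrt (LBINT y. ((a (y + h' n) - a y) * e y)\<^sup>2)) \<longlonglongrightarrow> 0" by simp
    show "eventually (\<lambda>n. norm (LBINT y. p (y + h' n) * ((a (y + h' n) - a y) * e y))
       \<le> sqrt (LBINT x. (p x)\<^sup>2) * sqrt (LBINT y. ((a (y + h' n) - a y) * e y)\<^sup>2)) sequentially"
    proof (intro always_eventually allI)
      fix n
      have "norm (LBINT y. p (y + h' n) * ((a (y + h' n) - a y) * e y)) \<le> (LBINT y. \<bar>p (y + h' n) * ((a (y + h' n) - a y) * e y)\<bar>)"
        using integral_abs_bound by simp
      also have "\<dots> \<le> sqrt (LBINT y. (p (y + h' n))\<^sup>2) * sqrt (LBINT y. ((a (y + h' n) - a y) * e y)\<^sup>2)"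
        by (intro L2_Cauchy_Schwarz_abs L2_shift p d1)
      finally show "norm (LBINT y. p (y + h' n) * ((a (y + h' n) - a y) * e y))
       \<le> sqrt (LBINT x. (p x)\<^sup>2) * sqrt (LBINT y. ((a (y + h' n) - a y) * e y)\<^sup>2)"
        by (simp add: integral_square_shift p)
    qed
  qed
  from tendsto_add[OF this L2_correlation(3)[OF p ae0 h']]
  have "(\<lambda>n. (LBINT y. p (y + h' n) * ((a (y + h' n) - a y) * e y)) + (LBINT y. p (y + h' n) * (a y * e y)))
     \<longlonglongrightarrow> (LBINT y. p y * (a y * e y))" by simp
  moreover have "(LBINT y. p (y + h' n) * ((a (y + h' n) - a y) * e y)) + (LBINT y. p (y + h' n) * (a y * e y))
     = (LBINT y. a (y + h' n) * p (y + h' n) * e y)" for n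
  proof -
    have "integrable lborel (\<lambda>y. p (y + h' n) * ((a (y + h' n) - a y) * e y))" "integrable lborel (\<lambda>y. p (y + h' n) * (a y * e y))"
      by (intro L2_mult_integrable L2_shift p d1 ae0)+
    from Bochner_Integration.integral_add[OF this, symmetric] show ?thesis by (simp add: algebra_simps)
  qed
  moreover have "(LBINT y. p y * (a y * e y)) = (LBINT y. a y * p y * e y)" by (simp add: ac_simps)
  ultimately show "(\<lambda>n. LBINT y. a (y + h' n) * p (y + h' n) * e y) \<longlonglongrightarrow> (LBINT y. a y * p y * e y)" by simp
qed

definition moll_inner :: "nat \<Rightarrow> (real^2 \<Rightarrow> real) \<Rightarrow> (real^2 \<Rightarrow> real) \<Rightarrow> real" where
  "moll_inner n f g = (LBINT z. cv (rho n) f z * cv (rho n) g z)"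

lemma moll_inner_L2:
  assumes "f \<in> L2 lborel" "g \<in> L2 lborel"
  shows "(\<lambda>n. moll_inner n f g) \<longlonglongrightarrow> (LBINT x. f x * g x)"
    and "\<bar>moll_inner n f g\<bar> \<le> ((LBINT x. (f x)\<^sup>2) + (LBINT x. (g x)\<^sup>2)) / 2"
proof -
  show "(\<lambda>n. moll_inner n f g) \<longlonglongrightarrow> (LBINT x. f x * g x)"
    unfolding moll_inner_def by (rule mollified_inner_tendsto[OF assms rho_mollifier rho_radius])
  have "\<bar>moll_inner n f g\<bar> \<le> sqrt (LBINT x. (f x)\<^sup>2) * sqrt (LBINT x. (g x)\<^sup>2)"
    unfolding moll_inner_def by (rule mollified_inner_bound[OF assms rho_mollifier])
  also have "\<dots> \<le> \<bar>sqrt (LBINT x. (f x)\<^sup>2) * sqrt (LBINT x. (g x)\<^sup>2)\<bar>" by (rule abs_ge_self)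
  also have "\<dots> \<le> ((LBINT x. (f x)\<^sup>2) + (LBINT x. (g x)\<^sup>2)) / 2"
    using abs_mult_le_half_squares[of "sqrt (LBINT x. (f x)\<^sup>2)" "sqrt (LBINT x. (g x)\<^sup>2)"] by simp
  finally show "\<bar>moll_inner n f g\<bar> \<le> ((LBINT x. (f x)\<^sup>2) + (LBINT x. (g x)\<^sup>2)) / 2" .
qed

text \<open>The products of a weak solution are only integrable in space; against the more regular
  solution their mollified pairing still converges, by continuity of the correlation at 0.\<close>

lemma moll_inner_rough:
  assumes fb: "form_bounded V c" and gl: "gradlike a1 a2 L" and d: "d \<in> L2 lborel" "p \<in> L2 lborel" "q \<in> L2 lborel"
    and e2: "e \<in> L2 lborel" and e: "\<And>x. (e x)\<^sup>2 \<le> V x"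
  defines "f \<equiv> \<lambda>x. d x + (a1 x * p x + a2 x * q x)"
  shows "(\<lambda>n. moll_inner n f e) \<longlonglongrightarrow> (LBINT x. f x * e x)"
    and "integrable lborel (\<lambda>x. f x * e x)"
    and "\<bar>moll_inner n f e\<bar> \<le> (LBINT x. (d x)\<^sup>2) + (LBINT x. (p x)\<^sup>2) + (LBINT x. (q x)\<^sup>2) + (LBINT x. (e x)\<^sup>2)
      + (LBINT x. (L x)\<^sup>2) + c 1 * ((LBINT x. (a1 x)\<^sup>2) + (LBINT x. (a2 x)\<^sup>2))" (is "_ \<le> ?M")
proof -
  have l: "a1 \<in> L2 lborel" "a2 \<in> L2 lborel" "L \<in> L2 lborel" using gl by (auto simp: gradlike_def)
  have [measurable]: "a1 \<in> borel_measurable borel" "a2 \<in> borel_measurable borel" "d \<in> borel_measurable borel"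
    "p \<in> borel_measurable borel" "q \<in> borel_measurable borel" "e \<in> borel_measurable borel"
    using l d e2 by (auto simp: L2_def)
  have fm: "f \<in> borel_measurable borel" unfolding f_def by measurable
  note t1 = trilinear_correlation[OF fb gl d(2) \<open>e \<in> borel_measurable borel\<close> e disjI1[OF refl]]
  note t2 = trilinear_correlation[OF fb gl d(3) \<open>e \<in> borel_measurable borel\<close> e disjI2[OF refl]]
  note t0 = L2_correlation[OF d(1) e2]
  have eq: "f (y + h) * e y = d (y + h) * e y + (a1 (y + h) * p (y + h) * e y + a2 (y + h) * q (y + h) * e y)" for y h
    by (simp add: f_def algebra_simps)
  have c1: "0 \<le> c 1" using fb gl unfolding form_bounded_def by (meson zero_less_one)
  have pos: "0 \<le> c 1 * ((LBINT x. (a1 x)\<^sup>2) + (LBINT x. (a2 x)\<^sup>2))" using c1 by simp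
  have C1: "integrable lborel (\<lambda>y. f (y + h) * e y)" for h
    unfolding eq by (intro Bochner_Integration.integrable_add t0 t1 t2)
  have C2: "(LBINT y. \<bar>f (y + h) * e y\<bar>) \<le> ?M" for h
  proof -
    have "(LBINT y. \<bar>f (y + h) * e y\<bar>) \<le>
      (LBINT y. \<bar>d (y + h) * e y\<bar> + (\<bar>a1 (y + h) * p (y + h) * e y\<bar> + \<bar>a2 (y + h) * q (y + h) * e y\<bar>))"
    proof (rule integral_mono)
      show "\<bar>f (y + h) * e y\<bar> \<le> \<bar>d (y + h) * e y\<bar> + (\<bar>a1 (y + h) * p (y + h) * e y\<bar> + \<bar>a2 (y + h) * q (y + h) * e y\<bar>)" for y
        unfolding eq by linarith
    qed (intro C1 t0 t1 t2 integrable_abs Bochner_Integration.integrable_add)+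
    also have "\<dots> = (LBINT y. \<bar>d (y + h) * e y\<bar>) + ((LBINT y. \<bar>a1 (y + h) * p (y + h) * e y\<bar>) + (LBINT y. \<bar>a2 (y + h) * q (y + h) * e y\<bar>))"
      using t0(1)[of h] t1(1)[of h] t2(1)[of h] by simp
    also have "(LBINT y. \<bar>d (y + h) * e y\<bar>) \<le> ((LBINT x. (d x)\<^sup>2) + (LBINT x. (e x)\<^sup>2)) / 2"
      using L2_product_le[OF L2_shift[OF d(1)] e2] by (simp add: integral_square_shift d)
    finally have "(LBINT y. \<bar>f (y + h) * e y\<bar>) \<le> ((LBINT x. (d x)\<^sup>2) + (LBINT x. (e x)\<^sup>2)) / 2
      + ((LBINT y. \<bar>a1 (y + h) * p (y + h) * e y\<bar>) + (LBINT y. \<bar>a2 (y + h) * q (y + h) * e y\<bar>))" by simp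
    moreover have "0 \<le> (LBINT x. (d x)\<^sup>2)" "0 \<le> (LBINT x. (p x)\<^sup>2)" "0 \<le> (LBINT x. (q x)\<^sup>2)"
      "0 \<le> (LBINT x. (e x)\<^sup>2)" "0 \<le> (LBINT x. (L x)\<^sup>2)" by auto
    moreover have "x \<le> D + P + Q + E + l + N" if "x \<le> (D + E) / 2 + (y + z)" "0 \<le> D" "0 \<le> P" "0 \<le> Q" "0 \<le> E" "0 \<le> l"
      "y \<le> (P + (l + N)) / 2" "z \<le> (Q + (l + N)) / 2" for x y z D E P Q l N :: real using that by argo
    ultimately show ?thesis using t1(2)[of h] t2(2)[of h] by blast
  qed
  have lim: "(\<lambda>n. LBINT y. f (y + h n) * e y) \<longlonglongrightarrow> (LBINT y. f y * e y)" if h: "h \<longlonglongrightarrow> 0" for h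
  proof -
    have s: "(LBINT y. f (y + h) * e y) = (LBINT y. d (y + h) * e y) + ((LBINT y. a1 (y + h) * p (y + h) * e y) + (LBINT y. a2 (y + h) * q (y + h) * e y))" for h
      unfolding eq using t0(1)[of h] t1(1)[of h] t2(1)[of h] by simp
    have "(LBINT y. f y * e y) = (LBINT y. d y * e y) + ((LBINT y. a1 y * p y * e y) + (LBINT y. a2 y * q y * e y))"
      using s[of 0] by simp
    then show ?thesis unfolding s by (simp only:) (intro tendsto_add t0(3) t1(3) t2(3) h)
  qed
  have fi: "integrable lborel (\<lambda>x. f x * rho n (z - x))" for n z
  proof -
    have "integrable lborel (\<lambda>x. a1 x * p x)" "integrable lborel (\<lambda>x. a2 x * q x)" by (intro L2_mult_integrable l d)+
    then have "integrable lborel (\<lambda>x. (a1 x * p x + a2 x * q x) * rho n (z - x))"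
      by (intro cv_integrable_L1 kern_rho Bochner_Integration.integrable_add)
    with cv_integrable_L2[OF d(1) kern_rho(1), of n z] show ?thesis
      by (simp add: f_def distrib_right)
  qed
  have ei: "integrable lborel (\<lambda>x. e x * rho n (z - x))" for n z by (intro cv_integrable_L2 e2 kern_rho)
  show "(\<lambda>n. moll_inner n f e) \<longlonglongrightarrow> (LBINT x. f x * e x)"
    unfolding moll_inner_def
    by (rule mollified_correlation_tendsto[OF fm _ rho_mollifier rho_radius fi ei C1 C2 lim]) auto
  show "integrable lborel (\<lambda>x. f x * e x)" using C1[of 0] by simp
  show "\<bar>moll_inner n f e\<bar> \<le> ?M"
    unfolding moll_inner_def by (rule mollified_correlation_bound[OF fm _ rho_mollifier fi ei C1 C2]) auto
qed

text \<open>The reverse pairing is easier: here the coefficients \<open>p\<close>, \<open>q\<close>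
  are dominated by \<open>V\<close>, which puts the whole flux \<open>f\<close> in
  \<open>L2\<close>. The factor 4 comes from (e + A + B)^2 being at most 2 e^2 + 4 A^2 + 4
  B^2.\<close>

lemma moll_inner_regular:
  assumes fb: "form_bounded V c" and gl: "gradlike a1 a2 L" and d: "d \<in> L2 lborel" "e \<in> L2 lborel"
    and m: "p \<in> borel_measurable borel" "q \<in> borel_measurable borel" and V: "\<And>x. (p x)\<^sup>2 \<le> V x" "\<And>x. (q x)\<^sup>2 \<le> V x"
  defines "f \<equiv> \<lambda>x. e x + (a1 x * p x + a2 x * q x)"
  shows "(\<lambda>n. moll_inner n d f) \<longlonglongrightarrow> (LBINT x. d x * f x)"
    and "f \<in> L2 lborel"
    and "\<bar>moll_inner n d f\<bar> \<le> (LBINT x. (d x)\<^sup>2) + 4 * ((LBINT x. (e x)\<^sup>2)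
      + (LBINT x. (L x)\<^sup>2) + c 1 * ((LBINT x. (a1 x)\<^sup>2) + (LBINT x. (a2 x)\<^sup>2)))"
proof -
  note b1 = form_bounded_L2[OF fb gl zero_less_one m(1) V(1) disjI1[OF refl]]
  note b2 = form_bounded_L2[OF fb gl zero_less_one m(2) V(2) disjI2[OF refl]]
  show f: "f \<in> L2 lborel" unfolding f_def by (intro L2_add d b1 b2)
  show "(\<lambda>n. moll_inner n d f) \<longlonglongrightarrow> (LBINT x. d x * f x)" by (rule moll_inner_L2[OF d(1) f])
  have "(LBINT x. (f x)\<^sup>2) \<le> (LBINT x. 2 * (e x)\<^sup>2 + (4 * (a1 x * p x)\<^sup>2 + 4 * (a2 x * q x)\<^sup>2))"
  proof (rule integral_mono)
    show "(f x)\<^sup>2 \<le> 2 * (e x)\<^sup>2 + (4 * (a1 x * p x)\<^sup>2 + 4 * (a2 x * q x)\<^sup>2)" for x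
      using square_add_le[of "e x" "a1 x * p x + a2 x * q x"] square_add_le[of "a1 x * p x" "a2 x * q x"]
      unfolding f_def by linarith
  qed (use L2_integrable[OF f] d b1 b2 in \<open>auto intro!: Bochner_Integration.integrable_add integrable_mult_right L2_integrable\<close>)
  also have "\<dots> = 2 * (LBINT x. (e x)\<^sup>2) + (4 * (LBINT x. (a1 x * p x)\<^sup>2) + 4 * (LBINT x. (a2 x * q x)\<^sup>2))"
    using d(2)[THEN L2_integrable] b1(1)[THEN L2_integrable] b2(1)[THEN L2_integrable] by simp
  finally have "(LBINT x. (f x)\<^sup>2) \<le> \<dots>" .
  moreover have "0 \<le> (LBINT x. (d x)\<^sup>2)" "0 \<le> (LBINT x. (e x)\<^sup>2)" by auto
  moreover have "x \<le> D + 4 * (E + l + N)" if "F \<le> 2 * E + (4 * A + 4 * B)" "0 \<le> D" "0 \<le> E" "x \<le> (D + F) / 2"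
    "A \<le> 1 * l + N" "B \<le> 1 * l + N" for x D E F A B l N :: real using that by argo
  ultimately show "\<bar>moll_inner n d f\<bar> \<le> (LBINT x. (d x)\<^sup>2) + 4 * ((LBINT x. (e x)\<^sup>2)
      + (LBINT x. (L x)\<^sup>2) + c 1 * ((LBINT x. (a1 x)\<^sup>2) + (LBINT x. (a2 x)\<^sup>2)))"
    using moll_inner_L2(2)[OF d(1) f, of n] b1(2) b2(2) by blast
qed

section \<open>Evolution in time\<close>

definition slice :: "('a \<times> 'b \<Rightarrow> 'c) \<Rightarrow> 'a \<Rightarrow> 'b \<Rightarrow> 'c" where
  "slice f t = (\<lambda>x. f (t, x))"

lemma slice_measurable[measurable]:
  "f \<in> borel_measurable borel \<Longrightarrow> slice f t \<in> borel_measurable borel"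
  for f :: "'a::euclidean_space \<times> 'b::euclidean_space \<Rightarrow> real"
proof -
  assume f: "f \<in> borel_measurable borel"
  have "(\<lambda>x::'b. (t, x)) \<in> borel_measurable borel" by (intro borel_measurable_continuous_onI continuous_intros)
  from measurable_compose[OF this f] show "slice f t \<in> borel_measurable borel" by (simp add: slice_def)
qed

lemma cv_slice_measurable'[measurable]:
  fixes f :: "'b::euclidean_space \<times> 'a::euclidean_space \<Rightarrow> real"
  assumes [measurable]: "f \<in> borel_measurable borel" "\<alpha> \<in> borel_measurable borel"
  shows "(\<lambda>w. cv \<alpha> (slice f (fst w)) (snd w)) \<in> borel_measurable (borel \<Otimes>\<^sub>M borel)"
  using cv_slice_measurable[OF assms] by (simp add: slice_def split_beta')

lemma integrable_slices:
  fixes f :: "'a::euclidean_space \<times> 'b::euclidean_space \<Rightarrow> real"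
  assumes "integrable lborel f"
  shows "AE t in lborel. integrable lborel (slice f t)"
    and "integrable lborel (\<lambda>t. LBINT x. slice f t x)"
    and "(LBINT t. \<integral>x. slice f t x \<partial>lborel) = (LBINT w. f w)"
proof -
  have "integrable (lborel \<Otimes>\<^sub>M lborel) f" using assms by (simp add: lborel_prod)
  from lborel_pair.AE_integrable_fst'[OF this] lborel_pair.integrable_fst'[OF this] lborel_pair.integral_fst'[OF this]
  show "AE t in lborel. integrable lborel (slice f t)"
    and "integrable lborel (\<lambda>t. LBINT x. slice f t x)"
    and "(LBINT t. \<integral>x. slice f t x \<partial>lborel) = (LBINT w. f w)"
    by (simp_all add: slice_def lborel_prod)
qed

lemma L2_slices:
  fixes f :: "'a::euclidean_space \<times> 'b::euclidean_space \<Rightarrow> real"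
  assumes f: "f \<in> L2 lborel"
  shows "AE t in lborel. slice f t \<in> L2 lborel"
    and "integrable lborel (\<lambda>t. LBINT x. (slice f t x)\<^sup>2)"
proof -
  have [measurable]: "f \<in> borel_measurable borel" using f by (simp add: L2_def)
  have sm: "slice f t \<in> borel_measurable borel" for t by measurable
  from integrable_slices(1)[OF L2_integrable[OF f]] show "AE t in lborel. slice f t \<in> L2 lborel"
    by (rule eventually_mono) (use sm in \<open>simp add: L2_def slice_def\<close>)
  show "integrable lborel (\<lambda>t. LBINT x. (slice f t x)\<^sup>2)"
    using integrable_slices(2)[OF L2_integrable[OF f]] by (simp add: slice_def)
qed

text \<open>Integrability against every kernel in space, uniformly integrated over all times:
  exactly what makes t \<mapsto> \<open>cv \<alpha> (slice f t) z\<close> integrable for every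
  \<open>z\<close>. It is common ground for the square integrable fields and the merely integrable
  products.\<close>

definition tame :: "(real \<times> (real^2) \<Rightarrow> real) \<Rightarrow> bool" where
  "tame f \<longleftrightarrow> f \<in> borel_measurable borel \<and> (\<forall>\<alpha> z. kern \<alpha> \<longrightarrow> integrable lborel (\<lambda>w. f w * \<alpha> (z - snd w)))"

lemma tame_L1:
  assumes "integrable lborel f" shows "tame f"
  unfolding tame_def
proof (intro conjI allI impI)
  show [measurable]: "f \<in> borel_measurable borel" using assms by auto
  fix \<alpha> :: "real^2 \<Rightarrow> real" and z assume k: "kern \<alpha>"
  have [measurable]: "\<alpha> \<in> borel_measurable borel" using k by (simp add: kern_def)
  have [measurable]: "(\<lambda>w::real \<times> (real^2). snd w) \<in> borel_measurable borel" by (simp flip: borel_prod)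
  obtain C where C: "0 \<le> C" "\<And>x. \<bar>\<alpha> x\<bar> \<le> C" using kern_bounded[OF k] by blast
  show "integrable lborel (\<lambda>w. f w * \<alpha> (z - snd w))"
    by (rule Bochner_Integration.integrable_bound[OF integrable_mult_right[OF assms, of C]])
       (auto simp: abs_mult mult.commute[of "\<bar>f _\<bar>"] C intro!: mult_right_mono)
qed

text \<open>The cut-off in time makes the kernel, constant in time on (0, T), square integrable over
  space-time.\<close>

lemma tame_L2:
  assumes f: "f \<in> L2 lborel" and z: "\<And>t x. t \<notin> {0<..<T} \<Longrightarrow> f (t, x) = 0"
  shows "tame f"
  unfolding tame_def
proof (intro conjI allI impI)
  show [measurable]: "f \<in> borel_measurable borel" using f by (simp add: L2_def)
  fix \<alpha> :: "real^2 \<Rightarrow> real" and y assume k: "kern \<alpha>"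
  have [measurable]: "\<alpha> \<in> borel_measurable borel" using k by (simp add: kern_def)
  have [measurable]: "(\<lambda>w::real \<times> (real^2). snd w) \<in> borel_measurable borel"
    "(\<lambda>w::real \<times> (real^2). fst w) \<in> borel_measurable borel" by (simp_all flip: borel_prod)
  have "integrable (lborel \<Otimes>\<^sub>M lborel) (\<lambda>w. indicat_real {0<..<T} (fst w) * (\<alpha> (y - snd w))\<^sup>2)"
  proof (rule integrable_pair_mult[of "indicat_real {0<..<T}" "\<lambda>x. (\<alpha> (y - x))\<^sup>2"])
    show "integrable lborel (indicat_real {0<..<T})"
      by (cases "0 \<le> T") (auto intro!: integrable_real_indicator)
    show "integrable lborel (\<lambda>x. (\<alpha> (y - x))\<^sup>2)" by (rule L2_integrable[OF kern_reflect_L2[OF k]])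
  qed
  then have I: "integrable lborel (\<lambda>w. indicat_real {0<..<T} (fst w) * (\<alpha> (y - snd w))\<^sup>2)"
    by (simp add: lborel_prod)
  show "integrable lborel (\<lambda>w. f w * \<alpha> (y - snd w))"
  proof (rule Bochner_Integration.integrable_bound[OF Bochner_Integration.integrable_add[OF L2_integrable[OF f] I]])
    show "AE w in lborel. norm (f w * \<alpha> (y - snd w)) \<le> norm ((f w)\<^sup>2 + indicat_real {0<..<T} (fst w) * (\<alpha> (y - snd w))\<^sup>2)"
    proof (rule AE_I2)
      fix w :: "real \<times> (real^2)"
      show "norm (f w * \<alpha> (y - snd w)) \<le> norm ((f w)\<^sup>2 + indicat_real {0<..<T} (fst w) * (\<alpha> (y - snd w))\<^sup>2)"
      proof (cases "fst w \<in> {0<..<T}")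
        case True
        have "\<bar>f w * \<alpha> (y - snd w)\<bar> \<le> ((f w)\<^sup>2 + (\<alpha> (y - snd w))\<^sup>2) / 2" by (rule abs_mult_le_half_squares)
        also have "\<dots> \<le> (f w)\<^sup>2 + (\<alpha> (y - snd w))\<^sup>2" by simp
        finally show ?thesis using True by simp
      next
        case False
        then show ?thesis using z[of "fst w" "snd w"] by simp
      qed
    qed
  qed measurable
qed

lemma tame_add: "tame f \<Longrightarrow> tame g \<Longrightarrow> tame (\<lambda>w. f w + g w)"
  by (auto simp: tame_def distrib_right)

lemma tame_zero: "tame (\<lambda>w. 0)"
  by (simp add: tame_def)

lemma tame_uminus: "tame f \<Longrightarrow> tame (\<lambda>w. - f w)"
  by (auto simp: tame_def)

lemma tame_slices:
  assumes f: "tame f" and k: "kern \<alpha>"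
  shows "AE t in lborel. integrable lborel (\<lambda>x. slice f t x * \<alpha> (z - x))"
    and "integrable lborel (\<lambda>t. cv \<alpha> (slice f t) z)"
  using integrable_slices(1,2)[of "\<lambda>w. f w * \<alpha> (z - snd w)"] f k
  by (auto simp: tame_def slice_def cv_def)

lemma tame_pairing:
  assumes f: "tame f" and k: "kern \<alpha>" and \<theta>[measurable]: "\<theta> \<in> borel_measurable borel" and C: "\<And>t. \<bar>\<theta> t\<bar> \<le> C"
  shows "integrable lborel (\<lambda>w. f w * (\<theta> (fst w) * \<alpha> (z - snd w)))"
    and "(LBINT w. f w * (\<theta> (fst w) * \<alpha> (z - snd w))) = (LBINT t. \<theta> t * cv \<alpha> (slice f t) z)"
proof -
  have [measurable]: "\<alpha> \<in> borel_measurable borel" "f \<in> borel_measurable borel" using k f by (auto simp: kern_def tame_def)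
  have [measurable]: "(\<lambda>w::real \<times> (real^2). snd w) \<in> borel_measurable borel"
    "(\<lambda>w::real \<times> (real^2). fst w) \<in> borel_measurable borel" by (simp_all flip: borel_prod)
  have fi: "integrable lborel (\<lambda>w. f w * \<alpha> (z - snd w))" using f k by (simp add: tame_def)
  show I: "integrable lborel (\<lambda>w. f w * (\<theta> (fst w) * \<alpha> (z - snd w)))"
  proof (rule Bochner_Integration.integrable_bound[OF integrable_mult_right[OF fi, of C]])
    show "AE w in lborel. norm (f w * (\<theta> (fst w) * \<alpha> (z - snd w))) \<le> norm (C * (f w * \<alpha> (z - snd w)))"
    proof (rule AE_I2)
      fix w :: "real \<times> (real^2)"
      have "\<bar>\<theta> (fst w)\<bar> * \<bar>f w * \<alpha> (z - snd w)\<bar> \<le> \<bar>C\<bar> * \<bar>f w * \<alpha> (z - snd w)\<bar>"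
        using C[of "fst w"] by (intro mult_right_mono) auto
      then show "norm (f w * (\<theta> (fst w) * \<alpha> (z - snd w))) \<le> norm (C * (f w * \<alpha> (z - snd w)))"
        by (simp add: abs_mult ac_simps)
    qed
  qed measurable
  have "(LBINT x. slice (\<lambda>w. f w * (\<theta> (fst w) * \<alpha> (z - snd w))) t x) = \<theta> t * cv \<alpha> (slice f t) z" for t
    unfolding slice_def cv_def by (simp add: mult.left_commute)
  with integrable_slices(3)[OF I]
  show "(LBINT w. f w * (\<theta> (fst w) * \<alpha> (z - snd w))) = (LBINT t. \<theta> t * cv \<alpha> (slice f t) z)" by simp
qed

section \<open>Weak equations tested with products\<close>

definition space_time_test :: "real \<Rightarrow> (real \<Rightarrow> real) \<Rightarrow> (real \<Rightarrow> real) \<Rightarrow> (real \<Rightarrow> real) \<Rightarrow> bool" where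
  "space_time_test T \<theta> \<alpha> \<beta> \<longleftrightarrow> (\<exists>a b. bump a b \<theta> \<and> 0 < a \<and> b < T) \<and> (\<exists>a b. bump a b \<alpha>) \<and> (\<exists>a b. bump a b \<beta>)"

text \<open>The distributional equation \<partial>t f = \<partial>1 g1 + \<partial>2 g2. Products
  are sufficient as test functions because the mollification kernels are products themselves; no
  density argument enters.\<close>

definition weak_evolution :: "real \<Rightarrow> (real \<times> (real^2) \<Rightarrow> real) \<Rightarrow> (real \<times> (real^2) \<Rightarrow> real) \<Rightarrow> (real \<times> (real^2) \<Rightarrow> real) \<Rightarrow> bool" where
  "weak_evolution T f g1 g2 \<longleftrightarrow> (\<forall>\<theta> \<alpha> \<beta>. space_time_test T \<theta> \<alpha> \<beta> \<longrightarrow>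
    (LBINT w. f w * tens (deriv \<theta>) \<alpha> \<beta> w) = (LBINT w. g1 w * tens \<theta> (deriv \<alpha>) \<beta> w + g2 w * tens \<theta> \<alpha> (deriv \<beta>) w))"

definition weak_divergence :: "real \<Rightarrow> (real \<times> (real^2) \<Rightarrow> real) \<Rightarrow> (real \<times> (real^2) \<Rightarrow> real) \<Rightarrow> (real \<times> (real^2) \<Rightarrow> real) \<Rightarrow> bool" where
  "weak_divergence T f1 f2 h \<longleftrightarrow> (\<forall>\<theta> \<alpha> \<beta>. space_time_test T \<theta> \<alpha> \<beta> \<longrightarrow>
    (LBINT w. f1 w * tens \<theta> (deriv \<alpha>) \<beta> w + f2 w * tens \<theta> \<alpha> (deriv \<beta>) w) = - (LBINT w. h w * tens \<theta> \<alpha> \<beta> w))"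

text \<open>The spatial factor is x \<mapsto> \<open>rho n (z - x)\<close>, so that testing
  evaluates a convolution at \<open>z\<close>; the reflection produces the minus signs in front of
  the derivative kernels.\<close>

lemma mollifier_test:
  fixes z :: "real^2" and n :: nat
  assumes \<theta>: "bump a b \<theta>" "0 < a" "b < T"
  defines "\<alpha> \<equiv> \<lambda>x. moll1 n (z $ 1 - x)" and "\<beta> \<equiv> \<lambda>x. moll1 n (z $ 2 - x)"
  shows "space_time_test T \<theta> \<alpha> \<beta>"
    and "tens \<eta> \<alpha> \<beta> w = \<eta> (fst w) * rho n (z - snd w)"
    and "tens \<theta> (deriv \<alpha>) \<beta> w = - (\<theta> (fst w) * rho1 n (z - snd w))"
    and "tens \<theta> \<alpha> (deriv \<beta>) w = - (\<theta> (fst w) * rho2 n (z - snd w))"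
  unfolding space_time_test_def tens_def \<alpha>_def \<beta>_def rho_def rho1_def rho2_def bump_affine(2)[OF moll1_bump]
  using \<theta> bump_affine(1)[OF moll1_bump[of n]] by (auto)

text \<open>For fixed \<open>n\<close> and \<open>z\<close> the test functions of
  \<open>mollifier_test\<close> reduce the equation to an ordinary differential equation in the
  sense of distributions in time, with integrable right-hand side, to which
  \<open>du_Bois_Reymond\<close> applies.\<close>

lemma evolution_representation:
  assumes we: "weak_evolution T f g1 g2" and t: "tame f" "tame g1" "tame g2"
  shows "\<exists>c. AE t in lborel. t \<in> {0<..<T} \<longrightarrow>
     cv (rho n) (slice f t) z = c + prim (\<lambda>s. cv (rho1 n) (slice g1 s) z + cv (rho2 n) (slice g2 s) z) t"
proof (rule du_Bois_Reymond)
  show "integrable lborel (\<lambda>t. cv (rho n) (slice f t) z)"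
    "integrable lborel (\<lambda>s. cv (rho1 n) (slice g1 s) z + cv (rho2 n) (slice g2 s) z)"
    by (intro Bochner_Integration.integrable_add tame_slices kern_rho t)+
  fix \<theta> a b assume \<theta>: "bump a b \<theta>" "0 < a" "b < T"
  note mt = mollifier_test[OF \<theta>, where n = n and z = z]
  obtain C' where C': "\<And>t. \<bar>deriv \<theta> t\<bar> \<le> C'"
    using kern_bounded[OF kern_bump[OF bump_deriv[OF \<theta>(1)]]] by blast
  obtain C where C: "\<And>t. \<bar>\<theta> t\<bar> \<le> C"
    using kern_bounded[OF kern_bump[OF \<theta>(1)]] by blast
  note m = bump_measurable[OF \<theta>(1)] bump_measurable[OF bump_deriv[OF \<theta>(1)]]
  note tp = tame_pairing[OF _ _ m(1) C] tame_pairing[OF _ _ m(2) C']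
  have i': "integrable lborel (\<lambda>t. \<theta> t * h t)" if h: "integrable lborel h" for h
    proof (rule Bochner_Integration.integrable_bound[OF integrable_mult_right[OF h, of C]])
      show "(\<lambda>t. \<theta> t * h t) \<in> borel_measurable lborel" using m(1) h by simp
      have "\<bar>\<theta> t\<bar> * \<bar>h t\<bar> \<le> \<bar>C\<bar> * \<bar>h t\<bar>" for t using C[of t] by (intro mult_right_mono) auto
      then show "AE t in lborel. norm (\<theta> t * h t) \<le> norm (C * h t)" by (simp add: abs_mult)
    qed
  note i = i'[OF tame_slices(2)[OF t(2) kern_rho(2)]] i'[OF tame_slices(2)[OF t(3) kern_rho(3)]]
  have "(LBINT t. deriv \<theta> t * cv (rho n) (slice f t) z) = (LBINT w. f w * (deriv \<theta> (fst w) * rho n (z - snd w)))"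
    by (rule tp(4)[OF t(1) kern_rho(1), symmetric])
  also have "\<dots> = (LBINT w. - (g1 w * (\<theta> (fst w) * rho1 n (z - snd w))) + - (g2 w * (\<theta> (fst w) * rho2 n (z - snd w))))"
    using we[unfolded weak_evolution_def, rule_format, OF mt(1)] unfolding mt(2-4) by simp
  also have "\<dots> = - (LBINT w. g1 w * (\<theta> (fst w) * rho1 n (z - snd w))) + - (LBINT w. g2 w * (\<theta> (fst w) * rho2 n (z - snd w)))"
    using tp(1)[OF t(2) kern_rho(2)] tp(1)[OF t(3) kern_rho(3)] by simp
  also have "\<dots> = - (LBINT t. \<theta> t * (cv (rho1 n) (slice g1 t) z + cv (rho2 n) (slice g2 t) z))"
    unfolding tp(2)[OF t(2) kern_rho(2)] tp(2)[OF t(3) kern_rho(3)] distrib_left using i by simp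
  finally show "(LBINT t. deriv \<theta> t * cv (rho n) (slice f t) z)
    = - (LBINT t. \<theta> t * (cv (rho1 n) (slice g1 t) z + cv (rho2 n) (slice g2 t) z))" .
qed

text \<open>For each kernel and each \<open>z\<close> the relation holds for almost every
  \<open>t\<close>, by the fundamental lemma in time. Exchanging the order of the null sets turns
  this into almost every \<open>z\<close> on almost every slice.\<close>

lemma divergence_slices:
  assumes wd: "weak_divergence T f1 f2 h" and t: "tame f1" "tame f2" "tame h"
  shows "AE t in lborel. t \<in> {0<..<T} \<longrightarrow>
    (\<forall>n. AE z in lborel. cv (rho1 n) (slice f1 t) z + cv (rho2 n) (slice f2 t) z = cv (rho n) (slice h t) z)"
proof -
  have [measurable]: "f1 \<in> borel_measurable borel" "f2 \<in> borel_measurable borel" "h \<in> borel_measurable borel"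
    "rho n \<in> borel_measurable borel" "rho1 n \<in> borel_measurable borel" "rho2 n \<in> borel_measurable borel" for n
    using t kern_rho[of n] by (auto simp: tame_def kern_def)
  have main: "AE t in lborel. t \<in> {0<..<T} \<longrightarrow>
     cv (rho1 n) (slice f1 t) z + cv (rho2 n) (slice f2 t) z - cv (rho n) (slice h t) z = 0" for n z
  proof (rule fundamental_lemma_1D)
    show "integrable lborel (\<lambda>t. cv (rho1 n) (slice f1 t) z + cv (rho2 n) (slice f2 t) z - cv (rho n) (slice h t) z)"
      by (intro Bochner_Integration.integrable_add Bochner_Integration.integrable_diff tame_slices kern_rho t)+
    fix \<theta> a b assume \<theta>: "bump a b \<theta>" "0 < a" "b < T"
    note mt = mollifier_test[OF \<theta>, where n = n and z = z]
    obtain C where C: "\<And>t. \<bar>\<theta> t\<bar> \<le> C"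
      using kern_bounded[OF kern_bump[OF \<theta>(1)]] by blast
    note m = bump_measurable[OF \<theta>(1)]
    note tp = tame_pairing[OF _ _ m(1) C]
    have i: "integrable lborel (\<lambda>t. \<theta> t * h t)" if h: "integrable lborel h" for h
    proof (rule Bochner_Integration.integrable_bound[OF integrable_mult_right[OF h, of C]])
      show "(\<lambda>t. \<theta> t * h t) \<in> borel_measurable lborel" using m(1) h by simp
      have "\<bar>\<theta> t\<bar> * \<bar>h t\<bar> \<le> \<bar>C\<bar> * \<bar>h t\<bar>" for t using C[of t] by (intro mult_right_mono) auto
      then show "AE t in lborel. norm (\<theta> t * h t) \<le> norm (C * h t)" by (simp add: abs_mult)
    qed
    note i' = i[OF tame_slices(2)[OF t(1) kern_rho(2)]] i[OF tame_slices(2)[OF t(2) kern_rho(3)]] i[OF tame_slices(2)[OF t(3) kern_rho(1)]]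
    have "(LBINT w. - (f1 w * (\<theta> (fst w) * rho1 n (z - snd w))) + - (f2 w * (\<theta> (fst w) * rho2 n (z - snd w))))
      = - (LBINT w. h w * (\<theta> (fst w) * rho n (z - snd w)))"
      using wd[unfolded weak_divergence_def, rule_format, OF mt(1)] unfolding mt(2-4) by simp
    then have "(LBINT w. f1 w * (\<theta> (fst w) * rho1 n (z - snd w))) + (LBINT w. f2 w * (\<theta> (fst w) * rho2 n (z - snd w)))
       - (LBINT w. h w * (\<theta> (fst w) * rho n (z - snd w))) = 0"
      using tp(1)[OF t(1) kern_rho(2)] tp(1)[OF t(2) kern_rho(3)] by simp
    then show "(LBINT t. \<theta> t * (cv (rho1 n) (slice f1 t) z + cv (rho2 n) (slice f2 t) z - cv (rho n) (slice h t) z)) = 0"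
      unfolding tp(2)[OF t(1) kern_rho(2)] tp(2)[OF t(2) kern_rho(3)] tp(2)[OF t(3) kern_rho(1)]
        distrib_left right_diff_distrib using i' by simp
  qed
  have "AE t in lborel. \<forall>n. AE z in lborel. t \<in> {0<..<T} \<longrightarrow>
     cv (rho1 n) (slice f1 t) z + cv (rho2 n) (slice f2 t) z - cv (rho n) (slice h t) z = 0"
    unfolding AE_all_countable
  proof
    fix n
    have "AE z in lborel. AE t in lborel. t \<in> {0<..<T} \<longrightarrow>
      cv (rho1 n) (slice f1 t) z + cv (rho2 n) (slice f2 t) z - cv (rho n) (slice h t) z = 0"
      using main by simp
    then show "AE t in lborel. AE z in lborel. t \<in> {0<..<T} \<longrightarrow>
      cv (rho1 n) (slice f1 t) z + cv (rho2 n) (slice f2 t) z - cv (rho n) (slice h t) z = 0"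
      by (subst lborel_pair.AE_commute) measurable
  qed
  then show ?thesis
    by (rule eventually_mono) (auto elim!: allE eventually_mono)
qed

text \<open>\<open>F\<close> and \<open>G\<close> agree only almost everywhere with the absolutely
  continuous functions to which \<open>AC_mult\<close> applies; the density can still be rewritten
  in terms of \<open>F\<close> and \<open>G\<close>, as it stands under an integral.\<close>

lemma product_representation:
  assumes F: "AE t in lborel. t \<in> {0<..<T} \<longrightarrow> F t = c + prim f t" and f: "integrable lborel f"
    and G: "AE t in lborel. t \<in> {0<..<T} \<longrightarrow> G t = d + prim g t" and g: "integrable lborel g"
    and Fm[measurable]: "F \<in> borel_measurable borel" "G \<in> borel_measurable borel"
  shows "\<exists>C. AE t in lborel. t \<in> {0<..<T} \<longrightarrow> F t * G t = C + prim (\<lambda>s. f s * G s + F s * g s) t"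
proof -
  have [measurable]: "f \<in> borel_measurable borel" "g \<in> borel_measurable borel" using f g by auto
  have p0: "prim h 0 = 0" for h
  proof -
    have "AE s in lborel. indicator {0..0} s * h s = 0"
      using AE_lborel_singleton[of "0::real"] by eventually_elim (auto simp: indicator_def)
    then show ?thesis unfolding prim_def by (rule integral_eq_zero_AE)
  qed
  have ac: "AC T (\<lambda>t. c + prim h t) h" if "integrable lborel h" for h c
    unfolding AC_def using that integrable_mult_indicator[of "{0..T}" lborel h] by (simp add: p0)
  from AC_mult[OF ac[OF f, of c] ac[OF g, of d]]
  have *: "(c + prim f t) * (d + prim g t) = c * d + prim (\<lambda>s. f s * (d + prim g s) + (c + prim f s) * g s) t" if "t \<in> {0..T}" for t
    using that unfolding AC_def by (simp add: p0)
  have cong: "prim (\<lambda>s. f s * (d + prim g s) + (c + prim f s) * g s) t = prim (\<lambda>s. f s * G s + F s * g s) t" if "t \<in> {0<..<T}" for t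
    unfolding prim_def[of _ t]
  proof (rule integral_cong_AE)
    have "AE s in lborel. s \<noteq> 0" by (rule AE_lborel_singleton)
    with F G show "AE s in lborel. indicator {0..t} s * (f s * (d + prim g s) + (c + prim f s) * g s) = indicator {0..t} s * (f s * G s + F s * g s)"
    proof eventually_elim
      case (elim s)
      show ?case
      proof (cases "s \<in> {0..t}")
        case True
        then have "s \<in> {0<..<T}" using elim that by auto
        then show ?thesis using elim by simp
      qed simp
    qed
  qed measurable
  show ?thesis
  proof (rule exI[of _ "c * d"])
    from F G show "AE t in lborel. t \<in> {0<..<T} \<longrightarrow> F t * G t = c * d + prim (\<lambda>s. f s * G s + F s * g s) t"
    proof eventually_elim
      case (elim t)
      show ?case
      proof
        assume t: "t \<in> {0<..<T}"
        then have "t \<in> {0..T}" by simp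
        from *[OF this] show "F t * G t = c * d + prim (\<lambda>s. f s * G s + F s * g s) t"
          using elim t unfolding cong[OF t] by simp
      qed
    qed
  qed
qed

section \<open>Integrating evolution identities over space\<close>

lemma prim_param_measurable[measurable]:
  fixes Q :: "real \<Rightarrow> 'a::euclidean_space \<Rightarrow> real"
  assumes [measurable]: "case_prod Q \<in> borel_measurable (borel \<Otimes>\<^sub>M borel)"
  shows "(\<lambda>w. prim (\<lambda>s. Q s (snd w)) (fst w)) \<in> borel_measurable (borel \<Otimes>\<^sub>M borel)"
  unfolding prim_def atLeastAtMost_def atLeast_def atMost_def Int_def mem_Collect_eq indicator_def by measurable

lemma prim_Fubini:
  fixes Q :: "real \<Rightarrow> 'a::euclidean_space \<Rightarrow> real"
  assumes Q: "integrable (lborel \<Otimes>\<^sub>M lborel) (case_prod Q)"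
  shows "integrable lborel (\<lambda>z. prim (\<lambda>s. Q s z) t)"
    and "(LBINT z. prim (\<lambda>s. Q s z) t) = prim (\<lambda>s. LBINT z. Q s z) t"
proof -
  have [measurable]: "case_prod Q \<in> borel_measurable (borel \<Otimes>\<^sub>M borel)" using Q by auto
  have I: "integrable (lborel \<Otimes>\<^sub>M lborel) (\<lambda>(s, z). indicator {0..t} s * Q s z)"
    by (rule Bochner_Integration.integrable_bound[OF Q]) (auto simp: indicator_def split_beta')
  show "integrable lborel (\<lambda>z. prim (\<lambda>s. Q s z) t)"
    using lborel_pair.integrable_snd[OF I] by (simp add: prim_def)
  show "(LBINT z. prim (\<lambda>s. Q s z) t) = prim (\<lambda>s. LBINT z. Q s z) t"
    using lborel_pair.Fubini_integral[OF I] by (simp add: prim_def)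
qed

text \<open>The identity is known for every \<open>z\<close> outside a null set of times depending
  on \<open>z\<close>. Fubini makes it hold on almost every slice for almost every \<open>z\<close>,
  where it can be integrated.\<close>

lemma integrate_representation:
  fixes P Q :: "real \<Rightarrow> 'a::euclidean_space \<Rightarrow> real"
  assumes T: "0 < T" and Pm[measurable]: "case_prod P \<in> borel_measurable (borel \<Otimes>\<^sub>M borel)"
    and Q: "integrable (lborel \<Otimes>\<^sub>M lborel) (case_prod Q)"
    and rep: "\<And>z. \<exists>C. AE t in lborel. t \<in> {0<..<T} \<longrightarrow> P t z = C + prim (\<lambda>s. Q s z) t"
    and Pi: "AE t in lborel. t \<in> {0<..<T} \<longrightarrow> integrable lborel (P t)"
  shows "\<exists>c. AE t in lborel. t \<in> {0<..<T} \<longrightarrow> (LBINT z. P t z) = c + prim (\<lambda>s. LBINT z. Q s z) t"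
proof -
  have [measurable]: "case_prod Q \<in> borel_measurable (borel \<Otimes>\<^sub>M borel)" using Q by auto
  define K where "K t z = P t z - prim (\<lambda>s. Q s z) t" for t z
  have Km[measurable]: "case_prod K \<in> borel_measurable (borel \<Otimes>\<^sub>M borel)"
    unfolding K_def split_beta' by measurable
  \<comment> \<open>The constants from \<open>rep\<close> come without measurability in
    \<open>z\<close>; the time average of \<open>K\<close> agrees with them and is
    measurable.\<close>
  define C where "C z = (LBINT t. indicator {0<..<T} t * K t z) / T" for z
  have [measurable]: "C \<in> borel_measurable borel" unfolding C_def by measurable
  have C: "AE t in lborel. t \<in> {0<..<T} \<longrightarrow> K t z = C z" for z
  proof -
    obtain D where "AE t in lborel. t \<in> {0<..<T} \<longrightarrow> P t z = D + prim (\<lambda>s. Q s z) t" using rep[of z] by blast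
    then have D: "AE t in lborel. t \<in> {0<..<T} \<longrightarrow> K t z = D" by eventually_elim (simp add: K_def)
    have "(LBINT t. indicator {0<..<T} t * K t z) = (LBINT t. indicator {0<..<T} t * D)"
    proof (rule integral_cong_AE)
      show "AE t in lborel. indicator {0<..<T} t * K t z = indicator {0<..<T} t * D"
        using D by eventually_elim (auto simp: indicator_def)
    qed measurable
    also have "\<dots> = T * D" using T by simp
    finally have "C z = D" using T by (simp add: C_def)
    with D show ?thesis by simp
  qed
  have "AE z in lborel. AE t in lborel. t \<in> {0<..<T} \<longrightarrow> K t z = C z" using C by simp
  then have "AE t in lborel. AE z in lborel. t \<in> {0<..<T} \<longrightarrow> K t z = C z"
    by (subst lborel_pair.AE_commute) measurable
  then show ?thesis using Pi
  proof (intro exI[of _ "LBINT z. C z"], eventually_elim, intro impI)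
    fix t assume t: "AE z in lborel. t \<in> {0<..<T} \<longrightarrow> K t z = C z" "t \<in> {0<..<T} \<longrightarrow> integrable lborel (P t)" "t \<in> {0<..<T}"
    then have ae: "AE z in lborel. C z = K t z" by auto
    have "(LBINT z. C z) = (LBINT z. K t z)"
      by (rule integral_cong_AE[OF _ _ ae]) measurable
    also have "\<dots> = (LBINT z. P t z) - prim (\<lambda>s. LBINT z. Q s z) t"
      unfolding K_def using t prim_Fubini[OF Q, of t] by simp
    finally show "(LBINT z. P t z) = (LBINT z. C z) + prim (\<lambda>s. LBINT z. Q s z) t" by simp
  qed
qed

section \<open>Fluxes as sums of a square integrable and an integrable function\<close>

definition L12 :: "'a measure \<Rightarrow> ('a \<Rightarrow> real) \<Rightarrow> bool" where
  "L12 M f \<longleftrightarrow> (\<exists>g h. g \<in> L2 M \<and> integrable M h \<and> f = (\<lambda>x. g x + h x))"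

lemma L12_L2: "f \<in> L2 M \<Longrightarrow> L12 M f"
  unfolding L12_def by (intro exI[of _ f] exI[of _ "\<lambda>x. 0"]) auto

lemma L12_L2_cv_integrable:
  assumes "L12 lborel f" "kern \<alpha>" shows "integrable lborel (\<lambda>x. f x * \<alpha> (z - x))"
proof -
  obtain g h where gh: "g \<in> L2 lborel" "integrable lborel h" "f = (\<lambda>x. g x + h x)" using assms(1) by (auto simp: L12_def)
  show ?thesis
    using cv_integrable_L2[OF gh(1) assms(2), of z] cv_integrable_L1[OF gh(2) assms(2), of z] by (simp add: gh(3) distrib_right)
qed

lemma L12_measurable: "L12 lborel f \<Longrightarrow> f \<in> borel_measurable borel"
  by (auto simp: L12_def L2_def)

text \<open>The two summands are handled differently: a convolved square integrable part pairs in
  \<open>L2\<close>, a convolved integrable part pairs with the bounded function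
  \<open>cv \<beta> g\<close>.\<close>

lemma L12_pairing_fin:
  assumes f: "L12 lborel f" and g: "g \<in> L2 lborel" and k: "kern \<alpha>" "kern \<beta>"
  shows "integrable lborel (\<lambda>z. cv (\<lambda>x. \<bar>\<alpha> x\<bar>) (\<lambda>x. \<bar>f x\<bar>) z * cv (\<lambda>x. \<bar>\<beta> x\<bar>) (\<lambda>x. \<bar>g x\<bar>) z)"
proof -
  obtain fa fb where fab: "fa \<in> L2 lborel" "integrable lborel fb" "f = (\<lambda>x. fa x + fb x)"
    using f by (auto simp: L12_def)
  have [measurable]: "f \<in> borel_measurable borel" "g \<in> borel_measurable borel" "\<alpha> \<in> borel_measurable borel" "\<beta> \<in> borel_measurable borel"
    using L12_measurable[OF f] g k by (auto simp: L2_def kern_def)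
  let ?c = "\<lambda>\<alpha> f. cv (\<lambda>x. \<bar>\<alpha> x\<bar>) (\<lambda>x. \<bar>f x\<bar>)"
  have pos: "0 \<le> ?c \<gamma> h z" for \<gamma> h z by (simp add: cv_def)
  have le: "?c \<alpha> f z \<le> ?c \<alpha> fa z + ?c \<alpha> fb z" for z
  proof -
    have "integrable lborel (\<lambda>x. \<bar>f x\<bar> * \<bar>\<alpha> (z - x)\<bar>)" "integrable lborel (\<lambda>x. \<bar>fa x\<bar> * \<bar>\<alpha> (z - x)\<bar>)" "integrable lborel (\<lambda>x. \<bar>fb x\<bar> * \<bar>\<alpha> (z - x)\<bar>)"
      unfolding abs_mult[symmetric]
      using L12_L2_cv_integrable[OF f k(1)] cv_integrable_L2[OF fab(1) k(1)] cv_integrable_L1[OF fab(2) k(1)]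
      by auto
    then have "?c \<alpha> f z \<le> (LBINT x. \<bar>fa x\<bar> * \<bar>\<alpha> (z - x)\<bar> + \<bar>fb x\<bar> * \<bar>\<alpha> (z - x)\<bar>)"
      unfolding cv_def
    proof (intro integral_mono)
      fix x
      show "\<bar>f x\<bar> * \<bar>\<alpha> (z - x)\<bar> \<le> \<bar>fa x\<bar> * \<bar>\<alpha> (z - x)\<bar> + \<bar>fb x\<bar> * \<bar>\<alpha> (z - x)\<bar>"
        unfolding fab(3) distrib_right[symmetric] by (intro mult_right_mono abs_triangle_ineq) simp
    qed simp_all
    also have "\<dots> = ?c \<alpha> fa z + ?c \<alpha> fb z"
      unfolding cv_def using \<open>integrable lborel (\<lambda>x. \<bar>fa x\<bar> * \<bar>\<alpha> (z - x)\<bar>)\<close> \<open>integrable lborel (\<lambda>x. \<bar>fb x\<bar> * \<bar>\<alpha> (z - x)\<bar>)\<close> by simp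
    finally show ?thesis .
  qed
  show ?thesis
  proof (rule Bochner_Integration.integrable_bound)
    show "integrable lborel (\<lambda>z. ?c \<alpha> fa z * ?c \<beta> g z + ?c \<alpha> fb z * ?c \<beta> g z)"
      by (intro Bochner_Integration.integrable_add L2_pairing_fin L1_L2_pairing_fin fab g k)
    show "AE z in lborel. norm (?c \<alpha> f z * ?c \<beta> g z) \<le> norm (?c \<alpha> fa z * ?c \<beta> g z + ?c \<alpha> fb z * ?c \<beta> g z)"
    proof (rule AE_I2)
      fix z
      have "\<bar>?c \<alpha> f z\<bar> = ?c \<alpha> f z" by (rule abs_of_nonneg[OF pos])
      also have "\<dots> \<le> \<bar>?c \<alpha> fa z + ?c \<alpha> fb z\<bar>" by (rule order_trans[OF le abs_ge_self])
      finally show "norm (?c \<alpha> f z * ?c \<beta> g z) \<le> norm (?c \<alpha> fa z * ?c \<beta> g z + ?c \<alpha> fb z * ?c \<beta> g z)"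
        unfolding distrib_right[symmetric] real_norm_def abs_mult by (rule mult_right_mono) simp
    qed
  qed measurable
qed

lemma L12_pairing_integrable:
  assumes f: "L12 lborel f" and g: "g \<in> L2 lborel" and k: "kern \<alpha>" "kern \<beta>"
  shows "integrable lborel (\<lambda>z. cv \<alpha> f z * cv \<beta> g z)"
proof (rule Bochner_Integration.integrable_bound[OF L12_pairing_fin[OF assms]])
  have [measurable]: "f \<in> borel_measurable borel" "g \<in> borel_measurable borel" "\<alpha> \<in> borel_measurable borel" "\<beta> \<in> borel_measurable borel"
    using L12_measurable[OF f] g k by (auto simp: L2_def kern_def)
  show "(\<lambda>z. cv \<alpha> f z * cv \<beta> g z) \<in> borel_measurable lborel" by measurable
  show "AE z in lborel. norm (cv \<alpha> f z * cv \<beta> g z) \<le> norm (cv (\<lambda>x. \<bar>\<alpha> x\<bar>) (\<lambda>x. \<bar>f x\<bar>) z * cv (\<lambda>x. \<bar>\<beta> x\<bar>) (\<lambda>x. \<bar>g x\<bar>) z)"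
    unfolding real_norm_def abs_mult
    by (intro AE_I2 mult_mono order_trans[OF abs_cv_le abs_ge_self]) auto
qed

text \<open>Moves a derivative from the rough factor to the regular one without differentiating
  either: \<open>cv_pairing\<close> together with the symmetry of the autocorrelation.\<close>

lemma L12_by_parts:
  assumes f: "L12 lborel f" and g: "g \<in> L2 lborel"
  shows "(LBINT z. cv (rho1 n) f z * cv (rho n) g z) = - (LBINT z. cv (rho n) f z * cv (rho1 n) g z)"
    and "(LBINT z. cv (rho2 n) f z * cv (rho n) g z) = - (LBINT z. cv (rho n) f z * cv (rho2 n) g z)"
proof -
  have m: "f \<in> borel_measurable borel" "g \<in> borel_measurable borel"
    using L12_measurable[OF f] g by (auto simp: L2_def)
  note p = cv_pairing[OF m _ _ L12_L2_cv_integrable[OF f] cv_integrable_L2[OF g] L12_pairing_fin[OF f g]]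
  show "(LBINT z. cv (rho1 n) f z * cv (rho n) g z) = - (LBINT z. cv (rho n) f z * cv (rho1 n) g z)"
    unfolding p[OF kern_rho(2,1) kern_rho(2,1) kern_rho(2,1)] p[OF kern_rho(1,2) kern_rho(1,2) kern_rho(1,2)] rho_autocorrelation(1) by simp
  show "(LBINT z. cv (rho2 n) f z * cv (rho n) g z) = - (LBINT z. cv (rho n) f z * cv (rho2 n) g z)"
    unfolding p[OF kern_rho(3,1) kern_rho(3,1) kern_rho(3,1)] p[OF kern_rho(1,3) kern_rho(1,3) kern_rho(1,3)] rho_autocorrelation(2) by simp
qed

text \<open>The part \<open>fb\<close> enters linearly, with a coefficient that depends on
  \<open>g\<close> only through \<open>S\<close>. With \<open>S\<close> the same at almost all
  times, the bound is integrable in time even when \<open>fb\<close> is only integrable over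
  space-time.\<close>

lemma L12_pairing_bound:
  assumes fa: "fa \<in> L2 lborel" and fb: "integrable lborel fb" and k: "kern \<alpha>" "kern \<beta>"
    and g: "g \<in> L2 lborel" and S: "(LBINT x. (g x)\<^sup>2) \<le> S"
  shows "(LBINT z. \<bar>cv \<alpha> (\<lambda>x. fa x + fb x) z * cv \<beta> g z\<bar>) \<le>
    (LBINT v. \<bar>\<alpha> v\<bar>)\<^sup>2 * (LBINT x. (fa x)\<^sup>2) + (LBINT v. \<bar>\<beta> v\<bar>)\<^sup>2 * (LBINT x. (g x)\<^sup>2)
    + sqrt S * sqrt (LBINT x. (\<beta> x)\<^sup>2) * ((LBINT v. \<bar>\<alpha> v\<bar>) * (LBINT x. \<bar>fb x\<bar>))"
proof -
  have [measurable]: "fa \<in> borel_measurable borel" "fb \<in> borel_measurable borel" "g \<in> borel_measurable borel"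
    "\<alpha> \<in> borel_measurable borel" "\<beta> \<in> borel_measurable borel" using fa fb g k by (auto simp: L2_def kern_def)
  have add: "cv \<alpha> (\<lambda>x. fa x + fb x) z = cv \<alpha> fa z + cv \<alpha> fb z" for z
    by (intro cv_add cv_integrable_L2 cv_integrable_L1 fa fb k)
  let ?K = "sqrt S * sqrt (LBINT x. (\<beta> x)\<^sup>2)"
  have gb: "\<bar>cv \<beta> g z\<bar> \<le> ?K" for z
    by (rule order_trans[OF cv_L2_bounded[OF g k(2)]]) (intro mult_right_mono real_sqrt_le_mono S, simp)
  have K0: "0 \<le> ?K" using abs_ge_zero[of "cv \<beta> g 0"] gb[of 0] by linarith
  have sq: "(LBINT z. (cv \<gamma> h z)\<^sup>2) \<le> (LBINT v. \<bar>\<gamma> v\<bar>)\<^sup>2 * (LBINT x. (h x)\<^sup>2)"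
    if h: "h \<in> L2 lborel" and \<gamma>: "kern \<gamma>" for \<gamma> h :: "'a \<Rightarrow> real"
  proof (rule integral_le_nn)
    have [measurable]: "h \<in> borel_measurable borel" "\<gamma> \<in> borel_measurable borel" using h \<gamma> by (auto simp: L2_def kern_def)
    have "(\<integral>\<^sup>+v. \<bar>\<gamma> v\<bar> \<partial>lborel) = ennreal (LBINT v. \<bar>\<gamma> v\<bar>)"
      using kern_integrable[OF \<gamma>] by (intro nn_integral_eq_integral) auto
    then show "(\<integral>\<^sup>+z. ennreal ((cv \<gamma> h z)\<^sup>2) \<partial>lborel) \<le> ennreal ((LBINT v. \<bar>\<gamma> v\<bar>)\<^sup>2 * (LBINT x. (h x)\<^sup>2))"
      using cv_nn_square_le[of h \<gamma>] nn_integral_square_L2[OF h] by (simp add: ennreal_mult ennreal_power)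
    show "(\<lambda>z. (cv \<gamma> h z)\<^sup>2) \<in> borel_measurable lborel" by measurable
  qed auto
  have l1: "(LBINT z. \<bar>cv \<alpha> fb z\<bar>) \<le> (LBINT v. \<bar>\<alpha> v\<bar>) * (LBINT x. \<bar>fb x\<bar>)"
  proof (rule integral_le_nn)
    have "(\<integral>\<^sup>+v. \<bar>\<alpha> v\<bar> \<partial>lborel) = ennreal (LBINT v. \<bar>\<alpha> v\<bar>)" "(\<integral>\<^sup>+v. \<bar>fb v\<bar> \<partial>lborel) = ennreal (LBINT v. \<bar>fb v\<bar>)"
      using kern_integrable[OF k(1)] fb by (auto intro!: nn_integral_eq_integral)
    then show "(\<integral>\<^sup>+z. ennreal \<bar>cv \<alpha> fb z\<bar> \<partial>lborel) \<le> ennreal ((LBINT v. \<bar>\<alpha> v\<bar>) * (LBINT x. \<bar>fb x\<bar>))"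
      using cv_nn_le[of fb \<alpha>] by (simp add: ennreal_mult)
    show "(\<lambda>z. \<bar>cv \<alpha> fb z\<bar>) \<in> borel_measurable lborel" by measurable
  qed auto
  have i1: "integrable lborel (\<lambda>z. \<bar>cv \<alpha> fa z * cv \<beta> g z\<bar>)"
    by (intro integrable_abs L2_mult_integrable cv_L2 fa g k)
  have i2: "integrable lborel (\<lambda>z. ?K * \<bar>cv \<alpha> fb z\<bar>)"
    using cv_L1[OF fb k(1)] by simp
  have "(LBINT z. \<bar>cv \<alpha> (\<lambda>x. fa x + fb x) z * cv \<beta> g z\<bar>) \<le> (LBINT z. \<bar>cv \<alpha> fa z * cv \<beta> g z\<bar> + ?K * \<bar>cv \<alpha> fb z\<bar>)"
  proof (rule integral_mono')
    show "integrable lborel (\<lambda>z. \<bar>cv \<alpha> fa z * cv \<beta> g z\<bar> + ?K * \<bar>cv \<alpha> fb z\<bar>)" using i1 i2 by simp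
    fix z
    have "\<bar>cv \<alpha> (\<lambda>x. fa x + fb x) z * cv \<beta> g z\<bar> \<le> \<bar>cv \<alpha> fa z * cv \<beta> g z\<bar> + \<bar>cv \<alpha> fb z * cv \<beta> g z\<bar>"
      unfolding add distrib_right by (rule abs_triangle_ineq)
    also have "\<bar>cv \<alpha> fb z * cv \<beta> g z\<bar> \<le> ?K * \<bar>cv \<alpha> fb z\<bar>"
      unfolding abs_mult mult.commute[of "\<bar>cv \<alpha> fb z\<bar>"] by (intro mult_right_mono gb) simp
    finally show "\<bar>cv \<alpha> (\<lambda>x. fa x + fb x) z * cv \<beta> g z\<bar> \<le> \<bar>cv \<alpha> fa z * cv \<beta> g z\<bar> + ?K * \<bar>cv \<alpha> fb z\<bar>" by simp
    show "0 \<le> \<bar>cv \<alpha> fa z * cv \<beta> g z\<bar> + ?K * \<bar>cv \<alpha> fb z\<bar>" using K0 by simp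
  qed
  also have "\<dots> = (LBINT z. \<bar>cv \<alpha> fa z * cv \<beta> g z\<bar>) + ?K * (LBINT z. \<bar>cv \<alpha> fb z\<bar>)"
    using i1 i2 by simp
  also have "\<dots> \<le> ((LBINT z. (cv \<alpha> fa z)\<^sup>2) + (LBINT z. (cv \<beta> g z)\<^sup>2)) / 2
     + ?K * ((LBINT v. \<bar>\<alpha> v\<bar>) * (LBINT x. \<bar>fb x\<bar>))"
    by (intro add_mono mult_left_mono l1 K0 L2_product_le cv_L2 fa g k)
  also have "\<dots> \<le> (LBINT v. \<bar>\<alpha> v\<bar>)\<^sup>2 * (LBINT x. (fa x)\<^sup>2) + (LBINT v. \<bar>\<beta> v\<bar>)\<^sup>2 * (LBINT x. (g x)\<^sup>2)
    + ?K * ((LBINT v. \<bar>\<alpha> v\<bar>) * (LBINT x. \<bar>fb x\<bar>))"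
  proof -
    have *: "(x + y) / 2 + k \<le> x' + y' + k" if "x \<le> x'" "y \<le> y'" "0 \<le> x'" "0 \<le> y'" for x y x' y' k :: real
      using that by argo
    show ?thesis by (rule *[OF sq[OF fa k(1)] sq[OF g k(2)]]) simp_all
  qed
  finally show ?thesis .
qed

lemma L12_slices:
  fixes f :: "'a::euclidean_space \<times> 'b::euclidean_space \<Rightarrow> real"
  assumes "L12 lborel f" shows "AE t in lborel. L12 lborel (slice f t)"
proof -
  obtain g h where gh: "g \<in> L2 lborel" "integrable lborel h" "f = (\<lambda>x. g x + h x)" using assms by (auto simp: L12_def)
  from L2_slices(1)[OF gh(1)] integrable_slices(1)[OF gh(2)] show ?thesis
  proof eventually_elim
    case (elim t)
    then show ?case unfolding L12_def gh(3) slice_def by blast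
  qed
qed

lemma L12_product_integrable:
  fixes f g :: "'b::euclidean_space \<times> 'a::euclidean_space \<Rightarrow> real"
  assumes f: "L12 lborel f" and g: "g \<in> L2 lborel" and S: "AE t in lborel. (LBINT x. (slice g t x)\<^sup>2) \<le> S"
    and k: "kern \<alpha>" "kern \<beta>"
  shows "integrable (lborel \<Otimes>\<^sub>M lborel) (\<lambda>w. cv \<alpha> (slice f (fst w)) (snd w) * cv \<beta> (slice g (fst w)) (snd w))"
proof (rule lborel_pair.Fubini_integrable)
  obtain fa fb where fab: "fa \<in> L2 lborel" "integrable lborel fb" "f = (\<lambda>x. fa x + fb x)" using f by (auto simp: L12_def)
  have [measurable]: "f \<in> borel_measurable borel" "g \<in> borel_measurable borel" "\<alpha> \<in> borel_measurable borel" "\<beta> \<in> borel_measurable borel"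
    using L12_measurable[OF f] g k by (auto simp: L2_def kern_def)
  show "(\<lambda>w. cv \<alpha> (slice f (fst w)) (snd w) * cv \<beta> (slice g (fst w)) (snd w)) \<in> borel_measurable (lborel \<Otimes>\<^sub>M lborel)"
    by measurable
  have "AE t in lborel. integrable lborel (\<lambda>z. cv \<alpha> (slice f t) z * cv \<beta> (slice g t) z)"
    using L12_slices[OF f] L2_slices(1)[OF g] by eventually_elim (intro L12_pairing_integrable k)
  then show "AE t in lborel. integrable lborel (\<lambda>z. cv \<alpha> (slice f (fst (t, z))) (snd (t, z)) * cv \<beta> (slice g (fst (t, z))) (snd (t, z)))"
    by simp
  let ?A = "LBINT v. \<bar>\<alpha> v\<bar>" and ?B = "LBINT v. \<bar>\<beta> v\<bar>"
  let ?bd = "\<lambda>t. ?A\<^sup>2 * (LBINT x. (slice fa t x)\<^sup>2) + ?B\<^sup>2 * (LBINT x. (slice g t x)\<^sup>2)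
      + sqrt S * sqrt (LBINT x. (\<beta> x)\<^sup>2) * (?A * (LBINT x. \<bar>slice fb t x\<bar>))"
  have "integrable lborel (\<lambda>t. LBINT z. \<bar>cv \<alpha> (slice f t) z * cv \<beta> (slice g t) z\<bar>)"
  proof (rule Bochner_Integration.integrable_bound)
    have "integrable lborel (\<lambda>t. LBINT x. \<bar>slice fb t x\<bar>)"
      using integrable_slices(2)[OF integrable_abs[OF fab(2)]] by (simp add: slice_def)
    then show "integrable lborel ?bd"
      by (intro Bochner_Integration.integrable_add integrable_mult_right L2_slices fab g)
    show "AE t in lborel. norm (LBINT z. \<bar>cv \<alpha> (slice f t) z * cv \<beta> (slice g t) z\<bar>) \<le> norm (?bd t)"
      using L2_slices(1)[OF fab(1)] integrable_slices(1)[OF fab(2)] L2_slices(1)[OF g] S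
    proof eventually_elim
      case (elim t)
      have "slice f t = (\<lambda>x. slice fa t x + slice fb t x)" by (simp add: slice_def fab(3))
      with L12_pairing_bound[OF elim(1,2) k elim(3,4)]
      have "(LBINT z. \<bar>cv \<alpha> (slice f t) z * cv \<beta> (slice g t) z\<bar>) \<le> ?bd t" by simp
      moreover have "0 \<le> (LBINT z. \<bar>cv \<alpha> (slice f t) z * cv \<beta> (slice g t) z\<bar>)" by simp
      ultimately show ?case unfolding real_norm_def by (subst abs_of_nonneg) (auto intro: order_trans[OF _ abs_ge_self])
    qed
    have "(\<lambda>(t, z). \<bar>cv \<alpha> (slice f t) z * cv \<beta> (slice g t) z\<bar>) \<in> borel_measurable (borel \<Otimes>\<^sub>M borel)"
      unfolding split_beta' by measurable
    then show "(\<lambda>t. LBINT z. \<bar>cv \<alpha> (slice f t) z * cv \<beta> (slice g t) z\<bar>) \<in> borel_measurable lborel"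
      by measurable
  qed
  then show "integrable lborel (\<lambda>t. LBINT z. norm (cv \<alpha> (slice f (fst (t, z))) (snd (t, z)) * cv \<beta> (slice g (fst (t, z))) (snd (t, z))))"
    by simp
qed

definition evolving :: "real \<Rightarrow> real \<Rightarrow> (real \<times> (real^2) \<Rightarrow> real) \<Rightarrow> (real \<times> (real^2) \<Rightarrow> real) \<Rightarrow> (real \<times> (real^2) \<Rightarrow> real) \<Rightarrow> bool" where
  "evolving T S f g1 g2 \<longleftrightarrow> weak_evolution T f g1 g2 \<and> tame f \<and> tame g1 \<and> tame g2 \<and>
    L12 lborel g1 \<and> L12 lborel g2 \<and> f \<in> L2 lborel \<and> (AE t in lborel. (LBINT x. (slice f t x)\<^sup>2) \<le> S)"

text \<open>At fixed \<open>z\<close> the product rule in time applies to the two mollified fields;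
  the result is integrated over \<open>z\<close>, and on almost every slice the spatial derivatives
  are moved from the fluxes to the opposite field, which gives \<open>R\<close> its overall minus
  sign.\<close>

lemma mollified_inner_evolution:
  fixes n :: nat
  assumes T: "0 < T" and e: "evolving T S f g1 g2" and e': "evolving T S f' g1' g2'"
  defines "R \<equiv> \<lambda>s. - ((LBINT z. cv (rho n) (slice g1 s) z * cv (rho1 n) (slice f' s) z)
     + (LBINT z. cv (rho n) (slice g2 s) z * cv (rho2 n) (slice f' s) z)
     + (LBINT z. cv (rho n) (slice g1' s) z * cv (rho1 n) (slice f s) z)
     + (LBINT z. cv (rho n) (slice g2' s) z * cv (rho2 n) (slice f s) z))"
  shows "\<exists>c. AE t in lborel. t \<in> {0<..<T} \<longrightarrow> moll_inner n (slice f t) (slice f' t) = c + prim R t"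
    and "integrable lborel R"
proof -
  have A: "weak_evolution T f g1 g2" "tame f" "tame g1" "tame g2" "L12 lborel g1" "L12 lborel g2" "f \<in> L2 lborel"
     "AE t in lborel. (LBINT x. (slice f t x)\<^sup>2) \<le> S" using e by (auto simp: evolving_def)
  have A': "weak_evolution T f' g1' g2'" "tame f'" "tame g1'" "tame g2'" "L12 lborel g1'" "L12 lborel g2'" "f' \<in> L2 lborel"
     "AE t in lborel. (LBINT x. (slice f' t x)\<^sup>2) \<le> S" using e' by (auto simp: evolving_def)
  have [measurable]: "f \<in> borel_measurable borel" "f' \<in> borel_measurable borel" "g1 \<in> borel_measurable borel" "g2 \<in> borel_measurable borel"
    "g1' \<in> borel_measurable borel" "g2' \<in> borel_measurable borel"
    using A(2-4) A'(2-4) by (auto simp: tame_def)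
  have [measurable]: "rho n \<in> borel_measurable borel" "rho1 n \<in> borel_measurable borel" "rho2 n \<in> borel_measurable borel"
    using kern_rho by (auto simp: kern_def)
  define u where "u t z = cv (rho n) (slice f t) z" for t z
  define u' where "u' t z = cv (rho n) (slice f' t) z" for t z
  define w where "w s z = cv (rho1 n) (slice g1 s) z + cv (rho2 n) (slice g2 s) z" for s z
  define w' where "w' s z = cv (rho1 n) (slice g1' s) z + cv (rho2 n) (slice g2' s) z" for s z
  have um: "(\<lambda>t. cv \<alpha> (slice h t) z) \<in> borel_measurable borel" if [measurable]: "h \<in> borel_measurable borel" "\<alpha> \<in> borel_measurable borel"
    for \<alpha> z and h :: "real \<times> (real^2) \<Rightarrow> real"
    using measurable_compose[OF measurable_Pair2'[of z borel borel] cv_slice_measurable'[OF that]] by simp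
  have Qi: "integrable (lborel \<Otimes>\<^sub>M lborel) (\<lambda>(s, z). w s z * u' s z + u s z * w' s z)"
  proof -
    have 1: "integrable (lborel \<Otimes>\<^sub>M lborel) (\<lambda>p. cv (rho1 n) (slice g1 (fst p)) (snd p) * cv (rho n) (slice f' (fst p)) (snd p))"
      by (rule L12_product_integrable[OF A(5) A'(7,8) kern_rho(2,1)])
    have 2: "integrable (lborel \<Otimes>\<^sub>M lborel) (\<lambda>p. cv (rho2 n) (slice g2 (fst p)) (snd p) * cv (rho n) (slice f' (fst p)) (snd p))"
      by (rule L12_product_integrable[OF A(6) A'(7,8) kern_rho(3,1)])
    have 3: "integrable (lborel \<Otimes>\<^sub>M lborel) (\<lambda>p. cv (rho1 n) (slice g1' (fst p)) (snd p) * cv (rho n) (slice f (fst p)) (snd p))"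
      by (rule L12_product_integrable[OF A'(5) A(7,8) kern_rho(2,1)])
    have 4: "integrable (lborel \<Otimes>\<^sub>M lborel) (\<lambda>p. cv (rho2 n) (slice g2' (fst p)) (snd p) * cv (rho n) (slice f (fst p)) (snd p))"
      by (rule L12_product_integrable[OF A'(6) A(7,8) kern_rho(3,1)])
    have "(\<lambda>(s, z). w s z * u' s z + u s z * w' s z) = (\<lambda>p. (cv (rho1 n) (slice g1 (fst p)) (snd p) * cv (rho n) (slice f' (fst p)) (snd p)
      + cv (rho2 n) (slice g2 (fst p)) (snd p) * cv (rho n) (slice f' (fst p)) (snd p))
      + (cv (rho1 n) (slice g1' (fst p)) (snd p) * cv (rho n) (slice f (fst p)) (snd p)
      + cv (rho2 n) (slice g2' (fst p)) (snd p) * cv (rho n) (slice f (fst p)) (snd p)))"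
      by (auto simp: u_def u'_def w_def w'_def algebra_simps)
    then show ?thesis
      using 1 2 3 4 by (simp only:) (intro Bochner_Integration.integrable_add)
  qed
  have "\<exists>c. AE t in lborel. t \<in> {0<..<T} \<longrightarrow> (LBINT z. u t z * u' t z)
     = c + prim (\<lambda>s. LBINT z. w s z * u' s z + u s z * w' s z) t"
  proof (rule integrate_representation[OF T _ Qi])
    show "(\<lambda>(t, z). u t z * u' t z) \<in> borel_measurable (borel \<Otimes>\<^sub>M borel)"
      unfolding u_def u'_def split_beta' by measurable
    show "AE t in lborel. t \<in> {0<..<T} \<longrightarrow> integrable lborel (\<lambda>z. u t z * u' t z)"
      using L2_slices(1)[OF A(7)] L2_slices(1)[OF A'(7)]
      unfolding u_def u'_def by eventually_elim (intro impI L2_mult_integrable cv_L2 kern_rho)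
    fix z
    obtain c where c: "AE t in lborel. t \<in> {0<..<T} \<longrightarrow> u t z = c + prim (\<lambda>s. w s z) t"
      using evolution_representation[OF A(1-4), of n z] unfolding u_def w_def by blast
    obtain d where d: "AE t in lborel. t \<in> {0<..<T} \<longrightarrow> u' t z = d + prim (\<lambda>s. w' s z) t"
      using evolution_representation[OF A'(1-4), of n z] unfolding u'_def w'_def by blast
    show "\<exists>C. AE t in lborel. t \<in> {0<..<T} \<longrightarrow> u t z * u' t z = C + prim (\<lambda>s. w s z * u' s z + u s z * w' s z) t"
    proof (rule product_representation[OF c _ d])
      show "integrable lborel (\<lambda>s. w s z)" "integrable lborel (\<lambda>s. w' s z)"
        unfolding w_def w'_def by (intro Bochner_Integration.integrable_add tame_slices A A' kern_rho)+
      show "(\<lambda>t. u t z) \<in> borel_measurable borel" "(\<lambda>t. u' t z) \<in> borel_measurable borel"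
        unfolding u_def u'_def by (intro um; measurable)+
    qed
  qed
  moreover have "integrable lborel R"
    and "prim (\<lambda>s. LBINT z. w s z * u' s z + u s z * w' s z) t = prim R t" for t
  proof -
    have ae: "AE s in lborel. (LBINT z. w s z * u' s z + u s z * w' s z) = R s"
      using L12_slices[OF A(5)] L12_slices[OF A(6)] L12_slices[OF A'(5)] L12_slices[OF A'(6)] L2_slices(1)[OF A(7)] L2_slices(1)[OF A'(7)]
    proof eventually_elim
      case (elim s)
      note i = L12_pairing_integrable[OF elim(1,6) kern_rho(2,1)[of n]] L12_pairing_integrable[OF elim(2,6) kern_rho(3,1)[of n]]
        L12_pairing_integrable[OF elim(3,5) kern_rho(2,1)[of n]] L12_pairing_integrable[OF elim(4,5) kern_rho(3,1)[of n]]
      have "(LBINT z. w s z * u' s z + u s z * w' s z) = (LBINT z. cv (rho1 n) (slice g1 s) z * cv (rho n) (slice f' s) z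
          + cv (rho2 n) (slice g2 s) z * cv (rho n) (slice f' s) z
          + (cv (rho1 n) (slice g1' s) z * cv (rho n) (slice f s) z
          + cv (rho2 n) (slice g2' s) z * cv (rho n) (slice f s) z))"
        by (simp add: u_def u'_def w_def w'_def algebra_simps)
      also have "\<dots> = R s"
        using i unfolding R_def by (simp add: L12_by_parts elim)
      finally show ?case .
    qed
    have m1: "(\<lambda>s. LBINT z. w s z * u' s z + u s z * w' s z) \<in> borel_measurable borel"
    proof -
      have "(\<lambda>(s, z). w s z * u' s z + u s z * w' s z) \<in> borel_measurable (borel \<Otimes>\<^sub>M borel)"
        unfolding u_def u'_def w_def w'_def split_beta' by measurable
      then show ?thesis by measurable
    qed
    have m2: "R \<in> borel_measurable borel"
    proof -
      have mm: "(\<lambda>s. LBINT z. cv \<alpha> (slice h s) z * cv \<beta> (slice k s) z) \<in> borel_measurable borel"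
        if [measurable]: "h \<in> borel_measurable borel" "k \<in> borel_measurable borel" "\<alpha> \<in> borel_measurable borel" "\<beta> \<in> borel_measurable borel"
        for h k :: "real \<times> (real^2) \<Rightarrow> real" and \<alpha> \<beta>
      proof -
        have "(\<lambda>(s, z). cv \<alpha> (slice h s) z * cv \<beta> (slice k s) z) \<in> borel_measurable (borel \<Otimes>\<^sub>M borel)"
          unfolding split_beta' by measurable
        then show ?thesis by measurable
      qed
      show ?thesis unfolding R_def by (intro borel_measurable_uminus borel_measurable_add mm; measurable)
    qed
    show "integrable lborel R"
      using lborel_pair.integrable_fst[OF Qi] integrable_cong_AE[of "\<lambda>s. LBINT z. w s z * u' s z + u s z * w' s z" lborel R] m1 m2 ae
      by simp
    show "prim (\<lambda>s. LBINT z. w s z * u' s z + u s z * w' s z) t = prim R t" unfolding prim_def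
      by (rule integral_cong_AE) (use m1 m2 ae in \<open>auto elim!: eventually_mono\<close>)
  qed
  ultimately show "\<exists>c. AE t in lborel. t \<in> {0<..<T} \<longrightarrow> moll_inner n (slice f t) (slice f' t) = c + prim R t"
    and "integrable lborel R" unfolding moll_inner_def u_def u'_def by simp_all
qed

lemma cv_zero: "cv \<alpha> (\<lambda>x. 0) z = 0"
  by (simp add: cv_def)

lemma slice_zero: "slice (\<lambda>w. 0) t = (\<lambda>x. 0)"
  by (simp add: slice_def)

lemma L2_zero: "(\<lambda>x. 0) \<in> L2 M"
  by (simp add: L2_def)

lemma L2_uminus: "f \<in> L2 M \<Longrightarrow> (\<lambda>x. - f x) \<in> L2 M"
  by (simp add: L2_def)

section \<open>Two solutions\<close>

text \<open>Here \<open>(a1, a2) = \<nabla>\<psi>\<close>, \<open>L = \<Delta>\<psi>\<close> and \<open>(Z1, Z2) = \<nabla>Z\<close>, extended by zero outside the time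
  interval; \<open>evo1\<close> and \<open>evo2\<close> are the derivatives of the equation for \<open>\<psi>\<close>, with \<open>\<Delta>\<nabla>\<psi> = \<nabla>L\<close>.\<close>

locale hall_field =
  fixes T S :: real and a1 a2 Z L Z1 Z2 :: "real \<times> (real^2) \<Rightarrow> real"
  assumes T: "0 < T"
    and l2: "a1 \<in> L2 lborel" "a2 \<in> L2 lborel" "Z \<in> L2 lborel" "L \<in> L2 lborel" "Z1 \<in> L2 lborel" "Z2 \<in> L2 lborel"
    and outside: "\<And>t x. t \<notin> {0<..<T} \<Longrightarrow> a1 (t, x) = 0 \<and> a2 (t, x) = 0 \<and> Z (t, x) = 0 \<and> L (t, x) = 0 \<and> Z1 (t, x) = 0 \<and> Z2 (t, x) = 0"
    and sup: "AE t in lborel. (LBINT x. (slice a1 t x)\<^sup>2) \<le> S"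
      "AE t in lborel. (LBINT x. (slice a2 t x)\<^sup>2) \<le> S"
      "AE t in lborel. (LBINT x. (slice Z t x)\<^sup>2) \<le> S"
    and div: "weak_divergence T a1 a2 L"
    and curl: "weak_divergence T (\<lambda>w. - a2 w) a1 (\<lambda>w. 0)"
    and gradZ: "weak_divergence T Z (\<lambda>w. 0) Z1" "weak_divergence T (\<lambda>w. 0) Z Z2"
    and evo1: "weak_evolution T a1 (\<lambda>w. L w + (a1 w * Z2 w + a2 w * - Z1 w)) (\<lambda>w. 0)"
    and evo2: "weak_evolution T a2 (\<lambda>w. 0) (\<lambda>w. L w + (a1 w * Z2 w + a2 w * - Z1 w))"
    and evo3: "weak_evolution T Z (\<lambda>w. Z1 w + (a1 w * 0 + a2 w * L w)) (\<lambda>w. Z2 w + (a1 w * - L w + a2 w * 0))"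
begin

text \<open>\<partial>t a1 = \<partial>1 \<open>flux0\<close>, \<partial>t a2 = \<partial>2
  \<open>flux0\<close> and \<partial>t Z = \<partial>1 \<open>flux1\<close> + \<partial>2
  \<open>flux2\<close>. The zero products bring all three to the shape d + (a1 p + a2 q) of
  \<open>moll_inner_rough\<close> and \<open>moll_inner_regular\<close>.\<close>

definition "flux0 w = L w + (a1 w * Z2 w + a2 w * - Z1 w)"
definition "flux1 w = Z1 w + (a1 w * 0 + a2 w * L w)"
definition "flux2 w = Z2 w + (a1 w * - L w + a2 w * 0)"

lemma measurable_fields[measurable]:
  "a1 \<in> borel_measurable borel" "a2 \<in> borel_measurable borel" "Z \<in> borel_measurable borel"
  "L \<in> borel_measurable borel" "Z1 \<in> borel_measurable borel" "Z2 \<in> borel_measurable borel"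
  using l2 by (auto simp: L2_def)

lemma measurable_flux[measurable]:
  "flux0 \<in> borel_measurable borel" "flux1 \<in> borel_measurable borel" "flux2 \<in> borel_measurable borel"
  unfolding flux0_def[abs_def] flux1_def[abs_def] flux2_def[abs_def] by measurable

lemma tame_fields: "tame a1" "tame a2" "tame Z" "tame L" "tame Z1" "tame Z2"
  by (rule tame_L2[of _ T]; use l2 outside in blast)+

lemma products_integrable:
  "integrable lborel (\<lambda>w. a1 w * Z2 w + a2 w * - Z1 w)" "integrable lborel (\<lambda>w. a1 w * 0 + a2 w * L w)"
  "integrable lborel (\<lambda>w. a1 w * - L w + a2 w * 0)"
  by (intro Bochner_Integration.integrable_add L2_mult_integrable l2 L2_uminus L2_zero)+

lemma flux_tame: "tame flux0" "tame flux1" "tame flux2"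
  unfolding flux0_def[abs_def] flux1_def[abs_def] flux2_def[abs_def]
  by (intro tame_add tame_fields tame_L1 products_integrable)+

lemma flux_L12: "L12 lborel flux0" "L12 lborel flux1" "L12 lborel flux2"
  unfolding flux0_def[abs_def] flux1_def[abs_def] flux2_def[abs_def] L12_def
  using l2 products_integrable by blast+

lemma evolving:
  "evolving T S a1 flux0 (\<lambda>w. 0)" "evolving T S a2 (\<lambda>w. 0) flux0" "evolving T S Z flux1 flux2"
  unfolding evolving_def
  using evo1 evo2 evo3 flux_tame flux_L12 tame_fields tame_zero L12_L2[OF L2_zero] l2 sup
  by (simp_all add: flux0_def[abs_def] flux1_def[abs_def] flux2_def[abs_def])

lemma AE_slices:
  "AE t in lborel. t \<in> {0<..<T} \<longrightarrow> gradlike (slice a1 t) (slice a2 t) (slice L t) \<and>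
    (\<forall>n. AE z in lborel. cv (rho1 n) (slice Z t) z = cv (rho n) (slice Z1 t) z) \<and>
    (\<forall>n. AE z in lborel. cv (rho2 n) (slice Z t) z = cv (rho n) (slice Z2 t) z)"
proof -
  note d = divergence_slices[OF div tame_fields(1,2,4)] divergence_slices[OF curl tame_uminus[OF tame_fields(2)] tame_fields(1) tame_zero]
    divergence_slices[OF gradZ(1) tame_fields(3) tame_zero tame_fields(5)] divergence_slices[OF gradZ(2) tame_zero tame_fields(3,6)]
  have neg: "cv \<alpha> (slice (\<lambda>w. - a2 w) t) z = - cv \<alpha> (slice a2 t) z" for \<alpha> t z
    by (simp add: cv_def slice_def)
  from d L2_slices(1)[OF l2(1)] L2_slices(1)[OF l2(2)] L2_slices(1)[OF l2(4)] show ?thesis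
  proof eventually_elim
    case (elim t)
    show ?case
    proof (intro impI conjI allI)
      assume t: "t \<in> {0<..<T}"
      show "gradlike (slice a1 t) (slice a2 t) (slice L t)"
        unfolding gradlike_def using elim t by (auto simp: neg slice_zero cv_zero)
      fix n
      show "AE z in lborel. cv (rho1 n) (slice Z t) z = cv (rho n) (slice Z1 t) z"
        "AE z in lborel. cv (rho2 n) (slice Z t) z = cv (rho n) (slice Z2 t) z"
        using elim t by (auto simp: slice_zero cv_zero)
    qed
  qed
qed

lemma AE_L2_slices:
  "AE t in lborel. slice a1 t \<in> L2 lborel \<and> slice a2 t \<in> L2 lborel \<and> slice Z t \<in> L2 lborel \<and>
     slice L t \<in> L2 lborel \<and> slice Z1 t \<in> L2 lborel \<and> slice Z2 t \<in> L2 lborel"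
  using l2[THEN L2_slices(1)] by eventually_elim blast

lemma AE_L12_slices:
  "AE t in lborel. L12 lborel (slice flux0 t) \<and> L12 lborel (slice flux1 t) \<and> L12 lborel (slice flux2 t)"
  using flux_L12[THEN L12_slices] by eventually_elim blast

lemma slice_flux:
  "slice flux0 t = (\<lambda>x. slice L t x + (slice a1 t x * slice Z2 t x + slice a2 t x * - slice Z1 t x))"
  "slice flux1 t = (\<lambda>x. slice Z1 t x + (slice a1 t x * 0 + slice a2 t x * slice L t x))"
  "slice flux2 t = (\<lambda>x. slice Z2 t x + (slice a1 t x * - slice L t x + slice a2 t x * 0))"
  by (simp_all add: slice_def flux0_def flux1_def flux2_def)

definition "dissipation s = (LBINT x. (slice L s x)\<^sup>2) + (LBINT x. (slice Z1 s x)\<^sup>2) + (LBINT x. (slice Z2 s x)\<^sup>2)"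

lemma dissipation_integrable: "integrable lborel dissipation"
  unfolding dissipation_def[abs_def] by (intro Bochner_Integration.integrable_add L2_slices l2)

end

section \<open>The inner product of two solutions\<close>

lemma slice_product_measurable:
  fixes f g :: "'a::euclidean_space \<times> 'b::euclidean_space \<Rightarrow> real"
  assumes [measurable]: "f \<in> borel_measurable borel" "g \<in> borel_measurable borel"
  shows "(\<lambda>s. LBINT x. slice f s x * slice g s x) \<in> borel_measurable borel"
proof -
  have "(\<lambda>(s, x). slice f s x * slice g s x) \<in> borel_measurable (borel \<Otimes>\<^sub>M borel)"
    unfolding split_beta' slice_def by (simp add: borel_prod)
  then show ?thesis by measurable
qed

text \<open>Regularity is asked of the second solution alone. The form bound may vary freely with
  time except at the parameter 1, where the integrable weight \<open>m\<close> dominates it.\<close>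

locale hall_pair = X: hall_field T S a1 a2 Z L Z1 Z2 + Y: hall_field T S b1 b2 W M W1 W2
  for T S :: real and a1 a2 Z L Z1 Z2 b1 b2 W M W1 W2 :: "real \<times> (real^2) \<Rightarrow> real" +
  fixes m :: "real \<Rightarrow> real"
  assumes m: "integrable lborel m" "\<And>t. 0 \<le> m t"
    and regular: "AE t in lborel. t \<in> {0<..<T} \<longrightarrow> (\<exists>c. c 1 \<le> m t \<and>
       form_bounded (\<lambda>x. (slice M t x)\<^sup>2 + (slice W1 t x)\<^sup>2 + (slice W2 t x)\<^sup>2) c)"
begin

text \<open>The time derivative of the mollified inner product of the two solutions: each flux is
  paired with the matching derivative of the other solution. \<open>R\<close> below is its limit
  without mollification.\<close>

definition "Rn n s = - (moll_inner n (slice X.flux0 s) (slice M s) + moll_inner n (slice X.flux1 s) (slice W1 s) + moll_inner n (slice X.flux2 s) (slice W2 s)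
   + moll_inner n (slice L s) (slice Y.flux0 s) + moll_inner n (slice Z1 s) (slice Y.flux1 s) + moll_inner n (slice Z2 s) (slice Y.flux2 s))"

definition "R s = - ((LBINT x. slice X.flux0 s x * slice M s x) + (LBINT x. slice X.flux1 s x * slice W1 s x)
   + (LBINT x. slice X.flux2 s x * slice W2 s x) + (LBINT x. slice L s x * slice Y.flux0 s x)
   + (LBINT x. slice Z1 s x * slice Y.flux1 s x) + (LBINT x. slice Z2 s x * slice Y.flux2 s x))"

text \<open>Dominates \<open>Rn\<close> for all \<open>n\<close>. The factor 30 is the coefficient
  of \<open>m s * S\<close> when six estimates are added: 3 times 2 from the rough pairings and 3
  times 4 times 2 from the regular ones, each 2 counting the two components of the gradient. The
  coefficients of the dissipation terms are smaller.\<close>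

definition "bound s = 30 * (X.dissipation s + Y.dissipation s + m s * S)"

lemma bound_integrable: "integrable lborel bound"
  unfolding bound_def[abs_def] using X.dissipation_integrable Y.dissipation_integrable m by simp

text \<open>Adding the evolution identities of the three components gives the density
  \<open>Rn'\<close>, with derivative kernels on the fields. The divergence and gradient relations
  on almost every slice turn it into \<open>Rn\<close>. The equation for \<open>Rn'\<close> serves
  as a local abbreviation, discharged by reflexivity.\<close>

lemma mollified_identity:
  "\<exists>c. AE t in lborel. t \<in> {0<..<T} \<longrightarrow>
     moll_inner n (slice a1 t) (slice b1 t) + moll_inner n (slice a2 t) (slice b2 t) + moll_inner n (slice Z t) (slice W t) = c + prim (Rn n) t"
  and "AE t in lborel. t \<in> {0<..<T} \<longrightarrow> Rn n t = Rn' t" if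
  "Rn' = (\<lambda>s. - ((LBINT z. cv (rho n) (slice X.flux0 s) z * cv (rho1 n) (slice b1 s) z)
     + (LBINT z. cv (rho n) (slice (\<lambda>w. 0) s) z * cv (rho2 n) (slice b1 s) z)
     + (LBINT z. cv (rho n) (slice Y.flux0 s) z * cv (rho1 n) (slice a1 s) z)
     + (LBINT z. cv (rho n) (slice (\<lambda>w. 0) s) z * cv (rho2 n) (slice a1 s) z))
   + - ((LBINT z. cv (rho n) (slice (\<lambda>w. 0) s) z * cv (rho1 n) (slice b2 s) z)
     + (LBINT z. cv (rho n) (slice X.flux0 s) z * cv (rho2 n) (slice b2 s) z)
     + (LBINT z. cv (rho n) (slice (\<lambda>w. 0) s) z * cv (rho1 n) (slice a2 s) z)
     + (LBINT z. cv (rho n) (slice Y.flux0 s) z * cv (rho2 n) (slice a2 s) z))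
   + - ((LBINT z. cv (rho n) (slice X.flux1 s) z * cv (rho1 n) (slice W s) z)
     + (LBINT z. cv (rho n) (slice X.flux2 s) z * cv (rho2 n) (slice W s) z)
     + (LBINT z. cv (rho n) (slice Y.flux1 s) z * cv (rho1 n) (slice Z s) z)
     + (LBINT z. cv (rho n) (slice Y.flux2 s) z * cv (rho2 n) (slice Z s) z)))"
proof -
  note R' = that
  note e1 = mollified_inner_evolution[OF X.T X.evolving(1) Y.evolving(1), of n]
  note e2 = mollified_inner_evolution[OF X.T X.evolving(2) Y.evolving(2), of n]
  note e3 = mollified_inner_evolution[OF X.T X.evolving(3) Y.evolving(3), of n]
  show eq: "AE t in lborel. t \<in> {0<..<T} \<longrightarrow> Rn n t = Rn' t"
    using X.AE_slices Y.AE_slices X.AE_L2_slices Y.AE_L2_slices X.AE_L12_slices Y.AE_L12_slices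
  proof eventually_elim
    case (elim s)
    show ?case
    proof
      assume s: "s \<in> {0<..<T}"
      have gX: "AE z in lborel. cv (rho1 n) (slice a1 s) z + cv (rho2 n) (slice a2 s) z = cv (rho n) (slice L s) z"
        and gY: "AE z in lborel. cv (rho1 n) (slice b1 s) z + cv (rho2 n) (slice b2 s) z = cv (rho n) (slice M s) z"
        using elim s by (auto simp: gradlike_def)
      \<comment> \<open>\<open>flux0\<close> drives both components of the gradient, by \<partial>1
        and by \<partial>2; after integration by parts the two contributions form a divergence,
        which the second-order field \<open>h\<close> replaces.\<close>
      have combine: "(LBINT z. cv (rho n) F z * cv (rho1 n) p z) + (LBINT z. cv (rho n) F z * cv (rho2 n) q z) = moll_inner n F h"
        if F: "L12 lborel F" and p: "p \<in> L2 lborel" "q \<in> L2 lborel" and h: "h \<in> borel_measurable borel"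
          and ae: "AE z in lborel. cv (rho1 n) p z + cv (rho2 n) q z = cv (rho n) h z" for F p q h
      proof -
        have [measurable]: "F \<in> borel_measurable borel" "p \<in> borel_measurable borel" "q \<in> borel_measurable borel" "h \<in> borel_measurable borel"
          "rho n \<in> borel_measurable borel" "rho1 n \<in> borel_measurable borel" "rho2 n \<in> borel_measurable borel"
          using L12_measurable[OF F] p h kern_rho by (auto simp: L2_def kern_def)
        have "(LBINT z. cv (rho n) F z * cv (rho1 n) p z) + (LBINT z. cv (rho n) F z * cv (rho2 n) q z)
          = (LBINT z. cv (rho n) F z * cv (rho1 n) p z + cv (rho n) F z * cv (rho2 n) q z)"
          by (intro Bochner_Integration.integral_add[symmetric] L12_pairing_integrable F p kern_rho)
        also have "\<dots> = moll_inner n F h" unfolding moll_inner_def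
        proof (rule integral_cong_AE)
          show "AE z in lborel. cv (rho n) F z * cv (rho1 n) p z + cv (rho n) F z * cv (rho2 n) q z = cv (rho n) F z * cv (rho n) h z"
            using ae by eventually_elim (simp flip: distrib_left)
        qed measurable
        finally show ?thesis .
      qed
      have single: "(LBINT z. cv (rho n) F z * cv r p z) = moll_inner n F h"
        if "F \<in> borel_measurable borel" "p \<in> borel_measurable borel" "h \<in> borel_measurable borel" "kern r"
          and ae: "AE z in lborel. cv r p z = cv (rho n) h z" for F p h r
      proof -
        have [measurable]: "F \<in> borel_measurable borel" "p \<in> borel_measurable borel" "h \<in> borel_measurable borel"
          "rho n \<in> borel_measurable borel" "r \<in> borel_measurable borel"
          using that kern_rho by (auto simp: kern_def)
        show ?thesis unfolding moll_inner_def
        proof (rule integral_cong_AE)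
          show "AE z in lborel. cv (rho n) F z * cv r p z = cv (rho n) F z * cv (rho n) h z"
            using ae by eventually_elim simp
        qed measurable
      qed
      have c1: "(LBINT z. cv (rho n) (slice X.flux0 s) z * cv (rho1 n) (slice b1 s) z)
        + (LBINT z. cv (rho n) (slice X.flux0 s) z * cv (rho2 n) (slice b2 s) z) = moll_inner n (slice X.flux0 s) (slice M s)"
        by (rule combine[OF _ _ _ _ gY]) (use elim in auto)
      have c2: "(LBINT z. cv (rho n) (slice Y.flux0 s) z * cv (rho1 n) (slice a1 s) z)
        + (LBINT z. cv (rho n) (slice Y.flux0 s) z * cv (rho2 n) (slice a2 s) z) = moll_inner n (slice Y.flux0 s) (slice L s)"
        by (rule combine[OF _ _ _ _ gX]) (use elim in auto)
      have c3: "(LBINT z. cv (rho n) (slice X.flux1 s) z * cv (rho1 n) (slice W s) z) = moll_inner n (slice X.flux1 s) (slice W1 s)"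
         "(LBINT z. cv (rho n) (slice X.flux2 s) z * cv (rho2 n) (slice W s) z) = moll_inner n (slice X.flux2 s) (slice W2 s)"
         "(LBINT z. cv (rho n) (slice Y.flux1 s) z * cv (rho1 n) (slice Z s) z) = moll_inner n (slice Y.flux1 s) (slice Z1 s)"
         "(LBINT z. cv (rho n) (slice Y.flux2 s) z * cv (rho2 n) (slice Z s) z) = moll_inner n (slice Y.flux2 s) (slice Z2 s)"
        by (rule single; use elim s kern_rho in auto)+
      have sym: "moll_inner n f g = moll_inner n g f" for f g by (simp add: moll_inner_def mult.commute)
      show "Rn n s = Rn' s"
        unfolding R' Rn_def slice_zero cv_zero c3 sym[of "slice L s"] sym[of "slice Z1 s"] sym[of "slice Z2 s"]
          c1[symmetric] c2[symmetric]
        by simp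
    qed
  qed
  obtain c1 c2 c3 where c:
    "AE t in lborel. t \<in> {0<..<T} \<longrightarrow> moll_inner n (slice a1 t) (slice b1 t) = c1 + prim (\<lambda>s. - ((LBINT z. cv (rho n) (slice X.flux0 s) z * cv (rho1 n) (slice b1 s) z)
     + (LBINT z. cv (rho n) (slice (\<lambda>w. 0) s) z * cv (rho2 n) (slice b1 s) z)
     + (LBINT z. cv (rho n) (slice Y.flux0 s) z * cv (rho1 n) (slice a1 s) z)
     + (LBINT z. cv (rho n) (slice (\<lambda>w. 0) s) z * cv (rho2 n) (slice a1 s) z))) t"
    "AE t in lborel. t \<in> {0<..<T} \<longrightarrow> moll_inner n (slice a2 t) (slice b2 t) = c2 + prim (\<lambda>s. - ((LBINT z. cv (rho n) (slice (\<lambda>w. 0) s) z * cv (rho1 n) (slice b2 s) z)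
     + (LBINT z. cv (rho n) (slice X.flux0 s) z * cv (rho2 n) (slice b2 s) z)
     + (LBINT z. cv (rho n) (slice (\<lambda>w. 0) s) z * cv (rho1 n) (slice a2 s) z)
     + (LBINT z. cv (rho n) (slice Y.flux0 s) z * cv (rho2 n) (slice a2 s) z))) t"
    "AE t in lborel. t \<in> {0<..<T} \<longrightarrow> moll_inner n (slice Z t) (slice W t) = c3 + prim (\<lambda>s. - ((LBINT z. cv (rho n) (slice X.flux1 s) z * cv (rho1 n) (slice W s) z)
     + (LBINT z. cv (rho n) (slice X.flux2 s) z * cv (rho2 n) (slice W s) z)
     + (LBINT z. cv (rho n) (slice Y.flux1 s) z * cv (rho1 n) (slice Z s) z)
     + (LBINT z. cv (rho n) (slice Y.flux2 s) z * cv (rho2 n) (slice Z s) z))) t"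
    using e1(1) e2(1) e3(1) by blast
  have ind: "integrable lborel (\<lambda>s. indicator {0..t} s * h s)" if "integrable lborel h" for h :: "real \<Rightarrow> real" and t :: real
    using integrable_mult_indicator[of "{0..t}" lborel h] that by simp
  have R'i: "integrable lborel Rn'" unfolding R' by (intro Bochner_Integration.integrable_add e1(2) e2(2) e3(2))
  have Rnm: "prim (Rn n) t = prim Rn' t" if t: "t \<in> {0<..<T}" for t
    unfolding prim_def
  proof (rule integral_cong_AE)
    show "AE s in lborel. indicator {0..t} s * Rn n s = indicator {0..t} s * Rn' s"
      using eq AE_lborel_singleton[of 0] by eventually_elim (use t in \<open>auto simp: indicator_def\<close>)
    have "(\<lambda>s. moll_inner n (slice h s) (slice k s)) \<in> borel_measurable borel"
      if [measurable]: "h \<in> borel_measurable borel" "k \<in> borel_measurable borel" for h k :: "real \<times> (real^2) \<Rightarrow> real"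
    proof -
      have [measurable]: "rho n \<in> borel_measurable borel" using kern_rho by (auto simp: kern_def)
      have "(\<lambda>(s, z). cv (rho n) (slice h s) z * cv (rho n) (slice k s) z) \<in> borel_measurable (borel \<Otimes>\<^sub>M borel)"
        unfolding split_beta' by measurable
      then show ?thesis unfolding moll_inner_def by measurable
    qed
    note [measurable] = this
    have [measurable]: "Rn n \<in> borel_measurable borel" unfolding Rn_def[abs_def] by measurable
    show "(\<lambda>s. indicator {0..t} s * Rn n s) \<in> borel_measurable lborel" by measurable
    show "(\<lambda>s. indicator {0..t} s * Rn' s) \<in> borel_measurable lborel" using R'i by simp
  qed
  show "\<exists>c. AE t in lborel. t \<in> {0<..<T} \<longrightarrow>
     moll_inner n (slice a1 t) (slice b1 t) + moll_inner n (slice a2 t) (slice b2 t) + moll_inner n (slice Z t) (slice W t) = c + prim (Rn n) t"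
  proof (rule exI[of _ "c1 + c2 + c3"])
    from c show "AE t in lborel. t \<in> {0<..<T} \<longrightarrow>
     moll_inner n (slice a1 t) (slice b1 t) + moll_inner n (slice a2 t) (slice b2 t) + moll_inner n (slice Z t) (slice W t) = c1 + c2 + c3 + prim (Rn n) t"
    proof eventually_elim
      case (elim t)
      show ?case
      proof
        assume t: "t \<in> {0<..<T}"
        note i = ind[OF e1(2), of t] ind[OF e2(2), of t] ind[OF e3(2), of t]
        have i12: "integrable lborel (\<lambda>s. indicator {0..t} s * (f s + g s))" if "integrable lborel (\<lambda>s. indicator {0..t} s * f s)"
          "integrable lborel (\<lambda>s. indicator {0..t} s * g s)" for f g :: "real \<Rightarrow> real"
          using that by (simp add: distrib_left)
        show "moll_inner n (slice a1 t) (slice b1 t) + moll_inner n (slice a2 t) (slice b2 t) + moll_inner n (slice Z t) (slice W t) = c1 + c2 + c3 + prim (Rn n) t"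
          unfolding Rnm[OF t] unfolding R' prim_add[OF i12[OF i(1,2)] i(3)] prim_add[OF i(1,2)]
          using elim t by simp
      qed
    qed
  qed
qed

text \<open>The fluxes of the first solution contain products that are only integrable, but they
  meet \<open>M\<close>, \<open>W1\<close>, \<open>W2\<close>, whose squares are dominated by the
  form-bounded potential: the rough case. In the fluxes of the second solution these same functions
  are the coefficients, which makes the fluxes square integrable: the regular case.\<close>

lemma AE_limits:
  "AE s in lborel. s \<in> {0<..<T} \<longrightarrow> (\<lambda>n. Rn n s) \<longlonglongrightarrow> R s \<and> (\<forall>n. \<bar>Rn n s\<bar> \<le> bound s) \<and>
     integrable lborel (\<lambda>x. slice X.flux0 s x * slice M s x) \<and> integrable lborel (\<lambda>x. slice X.flux1 s x * slice W1 s x) \<and>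
     integrable lborel (\<lambda>x. slice X.flux2 s x * slice W2 s x) \<and> slice Y.flux0 s \<in> L2 lborel \<and> slice Y.flux1 s \<in> L2 lborel \<and> slice Y.flux2 s \<in> L2 lborel"
  using X.AE_slices Y.AE_slices X.AE_L2_slices Y.AE_L2_slices regular X.sup Y.sup
proof eventually_elim
  case (elim s)
  show ?case
  proof
    assume s: "s \<in> {0<..<T}"
    define V where "V x = (slice M s x)\<^sup>2 + (slice W1 s x)\<^sup>2 + (slice W2 s x)\<^sup>2" for x
    obtain c where c: "c 1 \<le> m s" "form_bounded V c" using elim s by (auto simp: V_def[abs_def])
    have gX: "gradlike (slice a1 s) (slice a2 s) (slice L s)" and gY: "gradlike (slice b1 s) (slice b2 s) (slice M s)"
      using elim s by auto
    have l: "slice L s \<in> L2 lborel" "slice Z1 s \<in> L2 lborel" "slice Z2 s \<in> L2 lborel"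
      "slice M s \<in> L2 lborel" "slice W1 s \<in> L2 lborel" "slice W2 s \<in> L2 lborel" using elim by auto
    have ms: "slice M s \<in> borel_measurable borel" "slice W1 s \<in> borel_measurable borel" "slice W2 s \<in> borel_measurable borel"
      "(\<lambda>x. - slice M s x) \<in> borel_measurable borel" "(\<lambda>x. - slice W1 s x) \<in> borel_measurable borel" "(\<lambda>x::real^2. 0::real) \<in> borel_measurable borel"
      by measurable
    have V: "(slice M s x)\<^sup>2 \<le> V x" "(slice W1 s x)\<^sup>2 \<le> V x" "(slice W2 s x)\<^sup>2 \<le> V x"
      "(- slice M s x)\<^sup>2 \<le> V x" "(- slice W1 s x)\<^sup>2 \<le> V x" "(0::real)\<^sup>2 \<le> V x" for x
      by (auto simp: V_def)
    note r1 = moll_inner_rough[OF c(2) gX l(1) l(3) L2_uminus[OF l(2)] l(4) V(1)]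
    note r2 = moll_inner_rough[OF c(2) gX l(2) L2_zero l(1) l(5) V(2)]
    note r3 = moll_inner_rough[OF c(2) gX l(3) L2_uminus[OF l(1)] L2_zero l(6) V(3)]
    note q1 = moll_inner_regular[OF c(2) gY l(1) l(4) ms(3,5) V(3,5)]
    note q2 = moll_inner_regular[OF c(2) gY l(2) l(5) ms(6,1) V(6,1)]
    note q3 = moll_inner_regular[OF c(2) gY l(3) l(6) ms(4,6) V(4,6)]
    have lim: "(\<lambda>n. Rn n s) \<longlonglongrightarrow> R s"
      unfolding Rn_def R_def X.slice_flux Y.slice_flux by (intro tendsto_minus tendsto_add r1 r2 r3 q1 q2 q3)
    have S0: "0 \<le> S" using elim(6) by (rule order_trans[rotated]) simp
    have c0: "0 \<le> c 1" using c(2) gX unfolding form_bounded_def by (meson zero_less_one)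
    have cs: "c 1 * (x + y) \<le> 2 * (m s * S)" if "x \<le> S" "y \<le> S" "0 \<le> x" "0 \<le> y" for x y
    proof -
      have "c 1 * (x + y) \<le> m s * (S + S)" using that c c0 m(2)[of s] by (intro mult_mono) auto
      then show ?thesis by (simp add: algebra_simps)
    qed
    have cX: "c 1 * ((LBINT x. (slice a1 s x)\<^sup>2) + (LBINT x. (slice a2 s x)\<^sup>2)) \<le> 2 * (m s * S)"
      and cY: "c 1 * ((LBINT x. (slice b1 s x)\<^sup>2) + (LBINT x. (slice b2 s x)\<^sup>2)) \<le> 2 * (m s * S)"
      using elim by (auto intro!: cs)
    have arith0: "y1 + y2 + y3 + y4 + y5 + y6 \<le> 30 * ((l + z1 + z2) + (k + w1 + w2) + b)"
      if "y1 \<le> l + z2 + z1 + k + l + C" "y2 \<le> z1 + 0 + l + w1 + l + C" "y3 \<le> z2 + l + 0 + w2 + l + C"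
        "y4 \<le> l + 4 * (k + k + D)" "y5 \<le> z1 + 4 * (w1 + k + D)" "y6 \<le> z2 + 4 * (w2 + k + D)"
        "C \<le> 2 * b" "D \<le> 2 * b" "0 \<le> l" "0 \<le> z1" "0 \<le> z2" "0 \<le> k" "0 \<le> w1" "0 \<le> w2"
      for y1 y2 y3 y4 y5 y6 l z1 z2 k w1 w2 b C D :: real
      using that by argo
    have abs6: "\<bar>- (x1 + x2 + x3 + x4 + x5 + x6)\<bar> \<le> \<bar>x1\<bar> + \<bar>x2\<bar> + \<bar>x3\<bar> + \<bar>x4\<bar> + \<bar>x5\<bar> + \<bar>x6\<bar>"
      for x1 x2 x3 x4 x5 x6 :: real
      unfolding abs_minus_cancel by (intro order_trans[OF abs_triangle_ineq] add_mono order_refl)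
    note arith = order_trans[OF abs6 arith0]
    have bnd: "\<bar>Rn n s\<bar> \<le> bound s" for n
      unfolding Rn_def bound_def X.dissipation_def Y.dissipation_def X.slice_flux Y.slice_flux
      by (rule arith[OF _ _ _ _ _ _ cX cY]) 
         (use r1(3)[of n] r2(3)[of n] r3(3)[of n] q1(3)[of n] q2(3)[of n] q3(3)[of n] in simp_all)
    show "(\<lambda>n. Rn n s) \<longlonglongrightarrow> R s \<and> (\<forall>n. \<bar>Rn n s\<bar> \<le> bound s) \<and>
     integrable lborel (\<lambda>x. slice X.flux0 s x * slice M s x) \<and> integrable lborel (\<lambda>x. slice X.flux1 s x * slice W1 s x) \<and>
     integrable lborel (\<lambda>x. slice X.flux2 s x * slice W2 s x) \<and> slice Y.flux0 s \<in> L2 lborel \<and> slice Y.flux1 s \<in> L2 lborel \<and> slice Y.flux2 s \<in> L2 lborel"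
      using lim bnd r1(2) r2(2) r3(2) q1(2) q2(2) q3(2) unfolding X.slice_flux Y.slice_flux by blast
  qed
qed

lemma Rn_measurable[measurable]: "Rn n \<in> borel_measurable borel"
proof -
  have [measurable]: "(\<lambda>s. moll_inner n (slice h s) (slice k s)) \<in> borel_measurable borel"
    if [measurable]: "h \<in> borel_measurable borel" "k \<in> borel_measurable borel" for h k :: "real \<times> (real^2) \<Rightarrow> real"
  proof -
    have [measurable]: "rho n \<in> borel_measurable borel" using kern_rho by (auto simp: kern_def)
    have "(\<lambda>(s, z). cv (rho n) (slice h s) z * cv (rho n) (slice k s) z) \<in> borel_measurable (borel \<Otimes>\<^sub>M borel)"
      unfolding split_beta' by measurable
    then show ?thesis unfolding moll_inner_def by measurable
  qed
  show ?thesis unfolding Rn_def[abs_def] by measurable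
qed

lemma R_measurable[measurable]: "R \<in> borel_measurable borel"
  unfolding R_def[abs_def]
  by (intro borel_measurable_uminus borel_measurable_add slice_product_measurable; measurable)

text \<open>The mollified identities are passed to the limit, with \<open>bound\<close> as
  dominating function for the time integrals. Each has its own unknown constant.\<close>

lemma cross_identity:
  "\<exists>c. AE t in lborel. t \<in> {0<..<T} \<longrightarrow>
     (LBINT x. slice a1 t x * slice b1 t x) + (LBINT x. slice a2 t x * slice b2 t x) + (LBINT x. slice Z t x * slice W t x)
     = c + prim R t"
proof -
  define Hn where "Hn n t = moll_inner n (slice a1 t) (slice b1 t) + moll_inner n (slice a2 t) (slice b2 t) + moll_inner n (slice Z t) (slice W t)" for n t
  define H where "H t = (LBINT x. slice a1 t x * slice b1 t x) + (LBINT x. slice a2 t x * slice b2 t x) + (LBINT x. slice Z t x * slice W t x)" for t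
  have "\<forall>n. \<exists>c. AE t in lborel. t \<in> {0<..<T} \<longrightarrow> Hn n t = c + prim (Rn n) t"
    unfolding Hn_def using mollified_identity(1)[OF refl] by blast
  then obtain c where c: "\<And>n. AE t in lborel. t \<in> {0<..<T} \<longrightarrow> Hn n t = c n + prim (Rn n) t" by metis
  have P: "(\<lambda>n. prim (Rn n) t) \<longlonglongrightarrow> prim R t" if t: "t \<in> {0<..<T}" for t
    unfolding prim_def
  proof (rule integral_dominated_convergence[OF _ _ bound_integrable[THEN integrable_abs]])
    show "AE s in lborel. (\<lambda>n. indicator {0..t} s * Rn n s) \<longlonglongrightarrow> indicator {0..t} s * R s"
      using AE_limits AE_lborel_singleton[of 0]
    proof eventually_elim
      case (elim s)
      show ?case
      proof (cases "s \<in> {0..t}")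
        case True
        then have "s \<in> {0<..<T}" using elim t by auto
        with elim show ?thesis by (intro tendsto_mult tendsto_const) blast
      qed simp
    qed
    show "AE s in lborel. norm (indicator {0..t} s * Rn n s) \<le> \<bar>bound s\<bar>" for n
      using AE_limits AE_lborel_singleton[of 0]
    proof eventually_elim
      case (elim s)
      show ?case
      proof (cases "s \<in> {0..t}")
        case True
        then have "s \<in> {0<..<T}" using elim t by auto
        with elim have "\<bar>Rn n s\<bar> \<le> bound s" by blast
        then show ?thesis using True by simp
      qed simp
    qed
  qed measurable
  have Hlim: "AE t in lborel. (\<lambda>n. Hn n t) \<longlonglongrightarrow> H t"
    using X.AE_L2_slices Y.AE_L2_slices
    by eventually_elim (auto simp: Hn_def H_def intro!: tendsto_add moll_inner_L2)
  define good where "good t \<longleftrightarrow> t \<in> {0<..<T} \<and> (\<forall>n. Hn n t = c n + prim (Rn n) t) \<and> (\<lambda>n. Hn n t) \<longlonglongrightarrow> H t" for t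
  have "AE t in lborel. \<forall>n. t \<in> {0<..<T} \<longrightarrow> Hn n t = c n + prim (Rn n) t"
    unfolding AE_all_countable using c by blast
  with Hlim have ae: "AE t in lborel. t \<in> {0<..<T} \<longrightarrow> good t"
    by eventually_elim (unfold good_def, blast)
  \<comment> \<open>At a single good time everything else in the identity converges, so the
    constants converge too; uniqueness of their limit makes it the same for all good times.\<close>
  have cl: "c \<longlonglongrightarrow> H t - prim R t" if "good t" for t
  proof -
    have "(\<lambda>n. Hn n t - prim (Rn n) t) \<longlonglongrightarrow> H t - prim R t"
      using that P by (intro tendsto_diff) (auto simp: good_def)
    moreover have "(\<lambda>n. Hn n t - prim (Rn n) t) = c" using that by (auto simp: good_def)
    ultimately show ?thesis by simp
  qed
  have "\<exists>c0. \<forall>t. good t \<longrightarrow> H t = c0 + prim R t"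
  proof (cases "\<exists>t. good t")
    case True
    then obtain t0 where "good t0" by blast
    then have "H t = (H t0 - prim R t0) + prim R t" if "good t" for t
      using LIMSEQ_unique[OF cl[OF that] cl[of t0]] by simp
    then show ?thesis by blast
  qed blast
  then obtain c0 where c0: "\<And>t. good t \<Longrightarrow> H t = c0 + prim R t" by blast
  from ae have "AE t in lborel. t \<in> {0<..<T} \<longrightarrow> H t = c0 + prim R t"
    by eventually_elim (use c0 in blast)
  then show ?thesis unfolding H_def by blast
qed

lemma R_bound: "AE s in lborel. s \<in> {0<..<T} \<longrightarrow> \<bar>R s\<bar> \<le> bound s"
  using AE_limits
proof eventually_elim
  case (elim s)
  show ?case
  proof
    assume "s \<in> {0<..<T}"
    with elim have "(\<lambda>n. \<bar>Rn n s\<bar>) \<longlonglongrightarrow> \<bar>R s\<bar>" "\<And>n. \<bar>Rn n s\<bar> \<le> bound s" by (auto intro: tendsto_rabs)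
    then show "\<bar>R s\<bar> \<le> bound s" by (intro LIMSEQ_le_const2) auto
  qed
qed

end

text \<open>Iterating the inequality from \<open>E \<le> C\<close> gives
  \<open>E t \<le> C * prim m t ^ k / fact k\<close> almost everywhere for every \<open>k\<close>,
  and the right-hand side tends to 0. This form of the argument is compatible with functions defined
  almost everywhere.\<close>

lemma gronwall_zero:
  fixes E m :: "real \<Rightarrow> real"
  assumes Em[measurable]: "E \<in> borel_measurable borel" and m: "integrable lborel m" "\<And>t. 0 \<le> m t"
    and E: "AE t in lborel. t \<in> {0<..<T} \<longrightarrow> 0 \<le> E t \<and> E t \<le> C"
    and le: "AE t in lborel. t \<in> {0<..<T} \<longrightarrow> E t \<le> prim (\<lambda>s. m s * E s) t"
  shows "AE t in lborel. t \<in> {0<..<T} \<longrightarrow> E t = 0"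
proof -
  have [measurable]: "m \<in> borel_measurable borel" using m by auto
  have Ai: "AC T' (prim m) m" for T'
  proof -
    have "prim m 0 = 0"
    proof -
      have "AE s in lborel. indicator {0..0} s * m s = 0"
        using AE_lborel_singleton[of "0::real"] by eventually_elim (auto simp: indicator_def)
      then show ?thesis unfolding prim_def by (rule integral_eq_zero_AE)
    qed
    then show ?thesis unfolding AC_def using integrable_mult_indicator[of "{0..T'}" lborel m] m by simp
  qed
  have p0: "prim m 0 = 0" using Ai[of 0] unfolding AC_def by (metis add_cancel_left_right atLeastAtMost_iff order_refl)
  have k: "AE t in lborel. t \<in> {0<..<T} \<longrightarrow> E t \<le> C * prim m t ^ k / fact k" for k
  proof (induction k)
    case 0
    then show ?case using E by (auto elim: eventually_mono)
  next
    case (Suc k)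
    \<comment> \<open>The power rule for primitives performs the integration that raises
      \<open>k\<close> by one.\<close>
    have pw: "prim m t ^ Suc k = prim (\<lambda>s. real (Suc k) * prim m s ^ k * m s) t" 
      and pi: "integrable lborel (\<lambda>s. indicator {0..t} s * (real (Suc k) * prim m s ^ k * m s))" if "0 < t" for t
    proof -
      have "AC t (\<lambda>t. prim m t ^ Suc k) (\<lambda>t. real (Suc k) * prim m t ^ k * m t)"
        using AC_power[OF Ai, of t "Suc k"] by simp
      moreover have "t \<in> {0..t}" using that by simp
      ultimately have "prim m t ^ Suc k = prim m 0 ^ Suc k + prim (\<lambda>s. real (Suc k) * prim m s ^ k * m s) t"
        and "integrable lborel (\<lambda>s. indicator {0..t} s * (real (Suc k) * prim m s ^ k * m s))"
        unfolding AC_def by blast+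
      then show "prim m t ^ Suc k = prim (\<lambda>s. real (Suc k) * prim m s ^ k * m s) t"
        "integrable lborel (\<lambda>s. indicator {0..t} s * (real (Suc k) * prim m s ^ k * m s))" by (simp_all add: p0)
    qed
    from le show ?case
    proof eventually_elim
      case (elim t)
      show ?case
      proof
        assume t: "t \<in> {0<..<T}"
        let ?c = "C / fact (Suc k)"
        have "prim (\<lambda>s. m s * E s) t \<le> prim (\<lambda>s. ?c * (real (Suc k) * prim m s ^ k * m s)) t"
          unfolding prim_def[of _ t]
        proof (rule integral_mono_AE)
          have ae: "AE s in lborel. indicator {0..t} s * (m s * E s) \<le> indicator {0..t} s * (?c * (real (Suc k) * prim m s ^ k * m s))
            \<and> 0 \<le> indicator {0..t} s * (m s * E s)"
            using Suc E AE_lborel_singleton[of 0]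
          proof eventually_elim
            case (elim s)
            show ?case
            proof (cases "s \<in> {0..t}")
              case True
              then have s: "s \<in> {0<..<T}" using t elim by auto
              then have "m s * E s \<le> m s * (C * prim m s ^ k / fact k)" using elim m(2)[of s] by (intro mult_left_mono) auto
              also have "\<dots> = ?c * (real (Suc k) * prim m s ^ k * m s)"
                by (simp add: field_simps del: of_nat_Suc)
              finally show ?thesis using True s elim m(2)[of s] by simp
            qed simp
          qed
          then show "AE s in lborel. indicator {0..t} s * (m s * E s) \<le> indicator {0..t} s * (?c * (real (Suc k) * prim m s ^ k * m s))"
            by (auto elim: eventually_mono)
          show i: "integrable lborel (\<lambda>s. indicator {0..t} s * (?c * (real (Suc k) * prim m s ^ k * m s)))"
            using integrable_mult_right[OF pi[of t], of ?c] t by (simp add: ac_simps)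
          show "integrable lborel (\<lambda>s. indicator {0..t} s * (m s * E s))"
          proof (rule Bochner_Integration.integrable_bound[OF i])
            show "AE s in lborel. norm (indicator {0..t} s * (m s * E s)) \<le> norm (indicator {0..t} s * (?c * (real (Suc k) * prim m s ^ k * m s)))"
              using ae
            proof eventually_elim
              case (elim s)
              then have "norm (indicator {0..t} s * (m s * E s)) = indicator {0..t} s * (m s * E s)"
                unfolding real_norm_def by (intro abs_of_nonneg) blast
              also have "\<dots> \<le> indicator {0..t} s * (?c * (real (Suc k) * prim m s ^ k * m s))" using elim by blast
              also have "\<dots> \<le> norm (indicator {0..t} s * (?c * (real (Suc k) * prim m s ^ k * m s)))"
                unfolding real_norm_def by (rule abs_ge_self)
              finally show ?case .
            qed
          qed measurable
        qed
        also have "\<dots> = ?c * prim m t ^ Suc k" unfolding prim_cmult pw[of t] using t pw[of t] by simp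
        finally show "E t \<le> C * prim m t ^ Suc k / fact (Suc k)" using elim t by simp
      qed
    qed
  qed
  have "AE t in lborel. \<forall>k. t \<in> {0<..<T} \<longrightarrow> E t \<le> C * prim m t ^ k / fact k"
    unfolding AE_all_countable using k by blast
  with E show ?thesis
  proof eventually_elim
    case (elim t)
    show ?case
    proof
      assume t: "t \<in> {0<..<T}"
      have "(\<lambda>k. C * (inverse (fact k) * prim m t ^ k)) \<longlonglongrightarrow> C * 0"
        by (intro tendsto_mult tendsto_const summable_LIMSEQ_zero summable_exp)
      then have "(\<lambda>k. C * prim m t ^ k / fact k) \<longlonglongrightarrow> 0" by (simp add: field_simps)
      then have "E t \<le> 0" using elim t by (intro LIMSEQ_le_const) auto
      then show "E t = 0" using elim t by auto
    qed
  qed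
qed

section \<open>The energy of the difference\<close>

lemma AE_ex_interval:
  fixes T d :: real
  assumes "AE t in lborel. t \<in> {0<..<T} \<longrightarrow> P t" "0 < d" "0 < T"
  shows "\<exists>t. 0 < t \<and> t < d \<and> t < T \<and> P t"
proof (rule ccontr)
  assume no: "\<not> ?thesis"
  from assms(1) have "AE t in lborel. t \<notin> {0<..<min d T}"
    by eventually_elim (use no in \<open>auto simp: min_def split: if_splits\<close>)
  then have "emeasure lborel {0<..<min d T} = 0"
    by (subst (asm) AE_iff_measurable[where N = "{0<..<min d T}"]) auto
  then show False using assms by simp
qed

text \<open>Three squares complete the products with d2, d1 and l. The fourth supplies the missing
  half of Lagrange's identity, by which the squared cross product and the squared scalar product of
  (p1, p2) and (W1, W2) add up to |p|^2 |W|^2.\<close>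

lemma cubic_estimate:
  fixes p1 p2 M W1 W2 l d1 d2 :: real
  shows "2 * (M * (p1 * d2 - p2 * d1) - l * (p1 * W2 - p2 * W1))
    \<le> (p1\<^sup>2 + p2\<^sup>2) * (M\<^sup>2 + W1\<^sup>2 + W2\<^sup>2) + (l\<^sup>2 + d1\<^sup>2 + d2\<^sup>2)"
proof -
  have "0 \<le> (d2 - M * p1)\<^sup>2 + (d1 + M * p2)\<^sup>2 + (l + (p1 * W2 - p2 * W1))\<^sup>2 + (p1 * W1 + p2 * W2)\<^sup>2"
    by simp
  then show ?thesis by (simp add: power2_eq_square algebra_simps)
qed

context hall_pair
begin

definition "energy_gap t = (LBINT x. (slice a1 t x - slice b1 t x)\<^sup>2) + (LBINT x. (slice a2 t x - slice b2 t x)\<^sup>2)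
  + (LBINT x. (slice Z t x - slice W t x)\<^sup>2)"

lemma energy_gap_measurable[measurable]: "energy_gap \<in> borel_measurable borel"
proof -
  have "(\<lambda>t. LBINT x. (slice f t x - slice g t x)\<^sup>2) \<in> borel_measurable borel"
    if [measurable]: "f \<in> borel_measurable borel" "g \<in> borel_measurable borel" for f g :: "real \<times> (real^2) \<Rightarrow> real"
  proof -
    have m: "(\<lambda>w. f w - g w) \<in> borel_measurable borel" by measurable
    show ?thesis using slice_product_measurable[OF m m] by (simp add: slice_def power2_eq_square)
  qed
  note this[measurable]
  show ?thesis unfolding energy_gap_def[abs_def] by measurable
qed

text \<open>The left-hand side is minus twice the dissipation of the difference plus a cubic
  remainder. \<open>cubic_estimate\<close> absorbs the remainder into one copy of the dissipation,
  up to the integral of |a|^2 V. The form bound with \<delta> = 1 pays for that integral with the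
  Laplacian part of the second copy, and what is left is at most the weight times the gap.\<close>

lemma dissipation_inequality:
  "AE s in lborel. s \<in> {0<..<T} \<longrightarrow> - 2 * (X.dissipation s + Y.dissipation s + R s) \<le> m s * energy_gap s"
  using AE_limits X.AE_slices Y.AE_slices X.AE_L2_slices Y.AE_L2_slices regular
proof eventually_elim
  case (elim s)
  show ?case
  proof
    assume s: "s \<in> {0<..<T}"
    define V where "V x = (slice M s x)\<^sup>2 + (slice W1 s x)\<^sup>2 + (slice W2 s x)\<^sup>2" for x
    obtain c where c: "c 1 \<le> m s" "form_bounded V c" using elim s by (auto simp: V_def[abs_def])
    have gl: "gradlike (\<lambda>x. slice a1 s x - slice b1 s x) (\<lambda>x. slice a2 s x - slice b2 s x) (\<lambda>x. slice L s x - slice M s x)"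
      by (rule gradlike_diff) (use elim s in auto)
    have l: "slice L s \<in> L2 lborel" "slice Z1 s \<in> L2 lborel" "slice Z2 s \<in> L2 lborel"
      "slice M s \<in> L2 lborel" "slice W1 s \<in> L2 lborel" "slice W2 s \<in> L2 lborel" using elim by auto
    let ?p1 = "\<lambda>x. slice a1 s x - slice b1 s x" and ?p2 = "\<lambda>x. slice a2 s x - slice b2 s x"
    let ?l = "\<lambda>x. slice L s x - slice M s x" and ?d1 = "\<lambda>x. slice Z1 s x - slice W1 s x" and ?d2 = "\<lambda>x. slice Z2 s x - slice W2 s x"
    let ?P = "\<lambda>x. ((?p1 x)\<^sup>2 + (?p2 x)\<^sup>2) * V x"
    have dl: "?l \<in> L2 lborel" "?d1 \<in> L2 lborel" "?d2 \<in> L2 lborel" by (intro L2_diff l)+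
    have fb: "0 \<le> c 1" "(\<integral>\<^sup>+x. ennreal (?P x) \<partial>lborel)
      \<le> ennreal (1 * (LBINT x. (?l x)\<^sup>2) + c 1 * ((LBINT x. (?p1 x)\<^sup>2) + (LBINT x. (?p2 x)\<^sup>2)))"
      using c(2) gl zero_less_one unfolding form_bounded_def by blast+
    have [measurable]: "?P \<in> borel_measurable lborel"
      unfolding V_def by measurable
    have Pi: "integrable lborel ?P"
      using fb(2) by (intro integrableI_nonneg) (auto simp: V_def le_less_trans intro!: AE_I2 mult_nonneg_nonneg)
    have Pb: "(LBINT x. ?P x) \<le> (LBINT x. (?l x)\<^sup>2) + c 1 * ((LBINT x. (?p1 x)\<^sup>2) + (LBINT x. (?p2 x)\<^sup>2))"
      using fb by (intro integral_le_nn) (auto simp: V_def intro!: AE_I2 mult_nonneg_nonneg)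
    have cm: "c 1 * ((LBINT x. (?p1 x)\<^sup>2) + (LBINT x. (?p2 x)\<^sup>2)) \<le> m s * energy_gap s"
      unfolding energy_gap_def using c(1) m(2)[of s] by (intro mult_mono) auto
    note i = l[THEN L2_integrable] dl[THEN L2_integrable]
    have j: "integrable lborel (\<lambda>x. slice X.flux0 s x * slice M s x)" "integrable lborel (\<lambda>x. slice X.flux1 s x * slice W1 s x)"
      "integrable lborel (\<lambda>x. slice X.flux2 s x * slice W2 s x)" "integrable lborel (\<lambda>x. slice L s x * slice Y.flux0 s x)"
      "integrable lborel (\<lambda>x. slice Z1 s x * slice Y.flux1 s x)" "integrable lborel (\<lambda>x. slice Z2 s x * slice Y.flux2 s x)"
      using elim s l by (auto intro: L2_mult_integrable)
    have "- 2 * (X.dissipation s + Y.dissipation s + R s) =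
      (LBINT x. - 2 * ((slice L s x)\<^sup>2 + (slice Z1 s x)\<^sup>2 + (slice Z2 s x)\<^sup>2 + ((slice M s x)\<^sup>2 + (slice W1 s x)\<^sup>2 + (slice W2 s x)\<^sup>2)
       - (slice X.flux0 s x * slice M s x + slice X.flux1 s x * slice W1 s x + slice X.flux2 s x * slice W2 s x
       + slice L s x * slice Y.flux0 s x + slice Z1 s x * slice Y.flux1 s x + slice Z2 s x * slice Y.flux2 s x)))"
      unfolding X.dissipation_def Y.dissipation_def R_def using i j by simp
    also have "\<dots> \<le> (LBINT x. ?P x - (?l x)\<^sup>2 - (?d1 x)\<^sup>2 - (?d2 x)\<^sup>2)"
    proof (rule integral_mono)
      fix x
      \<comment> \<open>The decisive cancellation. Summed over all fluxes the cubic terms are M (p x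
        \<nabla>Z) - L (p x \<nabla>W), with p the difference of the gradients; writing \<nabla>Z =
        \<nabla>W + d and L = M + l removes M (p x \<nabla>W).\<close>
      have eq: "- 2 * ((slice L s x)\<^sup>2 + (slice Z1 s x)\<^sup>2 + (slice Z2 s x)\<^sup>2 + ((slice M s x)\<^sup>2 + (slice W1 s x)\<^sup>2 + (slice W2 s x)\<^sup>2)
       - (slice X.flux0 s x * slice M s x + slice X.flux1 s x * slice W1 s x + slice X.flux2 s x * slice W2 s x
       + slice L s x * slice Y.flux0 s x + slice Z1 s x * slice Y.flux1 s x + slice Z2 s x * slice Y.flux2 s x))
       = - 2 * ((?l x)\<^sup>2 + (?d1 x)\<^sup>2 + (?d2 x)\<^sup>2)
         + 2 * (slice M s x * (?p1 x * ?d2 x - ?p2 x * ?d1 x) - ?l x * (?p1 x * slice W2 s x - ?p2 x * slice W1 s x))"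
        unfolding X.slice_flux Y.slice_flux by (simp add: power2_eq_square algebra_simps)
      have arith: "- 2 * (u + v + w) + C \<le> Q - u - v - w" if "C \<le> Q + (u + v + w)" for u v w C Q :: real
        using that by argo
      show "- 2 * ((slice L s x)\<^sup>2 + (slice Z1 s x)\<^sup>2 + (slice Z2 s x)\<^sup>2 + ((slice M s x)\<^sup>2 + (slice W1 s x)\<^sup>2 + (slice W2 s x)\<^sup>2)
       - (slice X.flux0 s x * slice M s x + slice X.flux1 s x * slice W1 s x + slice X.flux2 s x * slice W2 s x
       + slice L s x * slice Y.flux0 s x + slice Z1 s x * slice Y.flux1 s x + slice Z2 s x * slice Y.flux2 s x))
       \<le> ?P x - (?l x)\<^sup>2 - (?d1 x)\<^sup>2 - (?d2 x)\<^sup>2"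
        unfolding eq V_def by (rule arith[OF cubic_estimate])
    next
      show "integrable lborel (\<lambda>x. ?P x - (?l x)\<^sup>2 - (?d1 x)\<^sup>2 - (?d2 x)\<^sup>2)"
        by (intro Bochner_Integration.integrable_diff Pi i)
      show "integrable lborel (\<lambda>x. - 2 * ((slice L s x)\<^sup>2 + (slice Z1 s x)\<^sup>2 + (slice Z2 s x)\<^sup>2 + ((slice M s x)\<^sup>2 + (slice W1 s x)\<^sup>2 + (slice W2 s x)\<^sup>2)
       - (slice X.flux0 s x * slice M s x + slice X.flux1 s x * slice W1 s x + slice X.flux2 s x * slice W2 s x
       + slice L s x * slice Y.flux0 s x + slice Z1 s x * slice Y.flux1 s x + slice Z2 s x * slice Y.flux2 s x)))"
        by (intro integrable_mult_right Bochner_Integration.integrable_diff Bochner_Integration.integrable_add i j)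
    qed
    also have "\<dots> = (LBINT x. ?P x) - (LBINT x. (?l x)\<^sup>2) - (LBINT x. (?d1 x)\<^sup>2) - (LBINT x. (?d2 x)\<^sup>2)"
      using Pi i by simp
    also have "\<dots> \<le> m s * energy_gap s"
    proof -
      have "0 \<le> (LBINT x. (?d1 x)\<^sup>2)" "0 \<le> (LBINT x. (?d2 x)\<^sup>2)" by simp_all
      moreover have "P - l - d - e \<le> k" if "P \<le> l + q" "q \<le> k" "0 \<le> d" "0 \<le> e" for P l d e q k :: real using that by argo
      ultimately show ?thesis using Pb cm by blast
    qed
    finally show "- 2 * (X.dissipation s + Y.dissipation s + R s) \<le> m s * energy_gap s" .
  qed
qed

text \<open>The gap is the sum of both energies minus twice the inner product. The energy
  inequalities bound the former from above, so the inner product is needed from below, that is, the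
  constant of \<open>cross_identity\<close> must be at least the initial energy.\<close>

lemma weak_strong_uniqueness:
  fixes c1 c2 Z0 :: "real^2 \<Rightarrow> real" and N :: "real set"
  assumes B0: "c1 \<in> L2 lborel" "c2 \<in> L2 lborel" "Z0 \<in> L2 lborel"
  defines "E0 \<equiv> (LBINT x. (c1 x)\<^sup>2) + (LBINT x. (c2 x)\<^sup>2) + (LBINT x. (Z0 x)\<^sup>2)"
  assumes en1: "AE t in lborel. t \<in> {0<..<T} \<longrightarrow> (LBINT x. (slice a1 t x)\<^sup>2) + (LBINT x. (slice a2 t x)\<^sup>2)
       + (LBINT x. (slice Z t x)\<^sup>2) + 2 * prim X.dissipation t \<le> E0"
    and en2: "AE t in lborel. t \<in> {0<..<T} \<longrightarrow> (LBINT x. (slice b1 t x)\<^sup>2) + (LBINT x. (slice b2 t x)\<^sup>2)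
       + (LBINT x. (slice W t x)\<^sup>2) + 2 * prim Y.dissipation t \<le> E0"
    and N: "AE t in lborel. t \<notin> N1" "AE t in lborel. t \<notin> N2"
    and in1: "((\<lambda>t. (LBINT x. slice a1 t x * c1 x) + (LBINT x. slice a2 t x * c2 x) + (LBINT x. slice Z t x * Z0 x)) \<longlongrightarrow> E0)
       (at 0 within {0<..<T} - N1)"
    and in2: "((\<lambda>t. (LBINT x. slice b1 t x * c1 x) + (LBINT x. slice b2 t x * c2 x) + (LBINT x. slice W t x * Z0 x)) \<longlongrightarrow> E0)
       (at 0 within {0<..<T} - N2)"
  shows "AE t in lborel. t \<in> {0<..<T} \<longrightarrow> energy_gap t = 0"
proof -
  define H where "H t = (LBINT x. slice a1 t x * slice b1 t x) + (LBINT x. slice a2 t x * slice b2 t x) + (LBINT x. slice Z t x * slice W t x)" for t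
  define IX where "IX t = (LBINT x. slice a1 t x * c1 x) + (LBINT x. slice a2 t x * c2 x) + (LBINT x. slice Z t x * Z0 x)" for t
  define IY where "IY t = (LBINT x. slice b1 t x * c1 x) + (LBINT x. slice b2 t x * c2 x) + (LBINT x. slice W t x * Z0 x)" for t
  define QX where "QX t = (LBINT x. (slice a1 t x)\<^sup>2) + (LBINT x. (slice a2 t x)\<^sup>2) + (LBINT x. (slice Z t x)\<^sup>2)" for t
  define QY where "QY t = (LBINT x. (slice b1 t x)\<^sup>2) + (LBINT x. (slice b2 t x)\<^sup>2) + (LBINT x. (slice W t x)\<^sup>2)" for t
  obtain c where c: "AE t in lborel. t \<in> {0<..<T} \<longrightarrow> H t = c + prim R t"
    using cross_identity unfolding H_def by blast
  have pd: "0 \<le> prim X.dissipation t" "0 \<le> prim Y.dissipation t" for t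
    unfolding prim_def by (auto intro!: integral_nonneg_AE simp: X.dissipation_def Y.dissipation_def)
  \<comment> \<open>The initial data are attained weakly only: expanding \<open>(f + g - 2k)\<^sup>2 \<ge> 0\<close> with \<open>k\<close> the initial
    datum bounds the cross term from below by quantities that converge.\<close>
  have lower: "AE t in lborel. t \<in> {0<..<T} \<longrightarrow> 2 * (IX t + IY t) - 3 * E0 \<le> H t"
    using en1 en2 X.AE_L2_slices Y.AE_L2_slices
  proof eventually_elim
    case (elim t)
    show ?case
    proof
      assume t: "t \<in> {0<..<T}"
      have one: "2 * ((LBINT x. f x * k x) + (LBINT x. g x * k x)) - 2 * (LBINT x. (k x)\<^sup>2)
          - ((LBINT x. (f x)\<^sup>2) + (LBINT x. (g x)\<^sup>2)) / 2 \<le> (LBINT x. f x * g x)"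
        if "f \<in> L2 lborel" "g \<in> L2 lborel" "k \<in> L2 lborel" for f g k :: "real^2 \<Rightarrow> real"
      proof -
        note i = that[THEN L2_integrable] L2_mult_integrable[OF that(1,2)] L2_mult_integrable[OF that(1,3)] L2_mult_integrable[OF that(2,3)]
        have "0 \<le> (LBINT x. (f x + g x - 2 * k x)\<^sup>2 / 2)" by simp
        also have "\<dots> = (LBINT x. ((f x)\<^sup>2 + (g x)\<^sup>2) / 2 + 2 * (k x)\<^sup>2 + f x * g x - 2 * (f x * k x) - 2 * (g x * k x))"
          by (intro Bochner_Integration.integral_cong refl) (simp add: power2_eq_square field_simps)
        also have "\<dots> = ((LBINT x. (f x)\<^sup>2) + (LBINT x. (g x)\<^sup>2)) / 2 + 2 * (LBINT x. (k x)\<^sup>2) + (LBINT x. f x * g x)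
          - 2 * (LBINT x. f x * k x) - 2 * (LBINT x. g x * k x)"
          using i by simp
        finally show ?thesis by simp
      qed
      have "2 * (IX t + IY t) - 2 * E0 - (QX t + QY t) / 2 \<le> H t"
        using one[of "slice a1 t" "slice b1 t" c1] one[of "slice a2 t" "slice b2 t" c2] one[of "slice Z t" "slice W t" Z0] elim B0
        unfolding IX_def IY_def H_def QX_def QY_def E0_def by argo
      moreover have "QX t \<le> E0" "QY t \<le> E0"
        using elim t pd[of t] unfolding QX_def QY_def by argo+
      ultimately show "2 * (IX t + IY t) - 3 * E0 \<le> H t" by argo
    qed
  qed
  have good: "AE t in lborel. t \<in> {0<..<T} \<longrightarrow> 2 * (IX t + IY t) - 3 * E0 \<le> c + prim R t \<and> t \<notin> N1 \<and> t \<notin> N2"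
    using lower c N by eventually_elim auto
  \<comment> \<open>Times tending to 0 that avoid all exceptional null sets; along them the weakly
    attained traces can be evaluated.\<close>
  have "\<forall>n. \<exists>t. 0 < t \<and> t < 1 / real (Suc n) \<and> t < T \<and> (2 * (IX t + IY t) - 3 * E0 \<le> c + prim R t \<and> t \<notin> N1 \<and> t \<notin> N2)"
    using AE_ex_interval[OF good _ X.T] by simp
  then obtain s where s: "\<And>n. 0 < s n" "\<And>n. s n < 1 / real (Suc n)" "\<And>n. s n < T"
    "\<And>n. 2 * (IX (s n) + IY (s n)) - 3 * E0 \<le> c + prim R (s n)" "\<And>n. s n \<notin> N1" "\<And>n. s n \<notin> N2" by metis
  have s0: "s \<longlonglongrightarrow> 0"
  proof (rule tendsto_sandwich[OF _ _ tendsto_const])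
    show "(\<lambda>n. 1 / real (Suc n)) \<longlonglongrightarrow> 0" using LIMSEQ_inverse_real_of_nat by (simp add: inverse_eq_divide)
  qed (auto intro!: always_eventually less_imp_le s simp del: of_nat_Suc)
  have f1: "filterlim s (at 0 within {0<..<T} - N1) sequentially" "filterlim s (at 0 within {0<..<T} - N2) sequentially"
    unfolding filterlim_at using s0 s by (auto intro!: always_eventually simp: less_imp_neq[symmetric])
  have iR: "AE r in lborel. \<bar>indicator {0..s n} r * R r\<bar> \<le> indicator {0..s n} r * \<bar>bound r\<bar>" for n
    using R_bound AE_lborel_singleton[of 0]
  proof eventually_elim
    case (elim r)
    show ?case
    proof (cases "r \<in> {0..s n}")
      case True
      then have "r \<in> {0<..<T}" using elim s(3)[of n] by auto
      with elim True show ?thesis by auto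
    qed simp
  qed
  have pR: "(\<lambda>n. prim R (s n)) \<longlonglongrightarrow> 0"
  proof -
    have "(\<lambda>n. LBINT r. indicator {0..s n} r * R r) \<longlonglongrightarrow> (\<integral>r. 0 \<partial>(lborel :: real measure))"
    proof (rule integral_dominated_convergence[OF _ _ bound_integrable[THEN integrable_abs]])
      show "AE r in lborel. norm (indicator {0..s n} r * R r) \<le> \<bar>bound r\<bar>" for n
        using iR[of n] by eventually_elim (auto simp: indicator_def split: if_splits)
      show "AE r in lborel. (\<lambda>n. indicator {0..s n} r * R r) \<longlonglongrightarrow> 0"
        using AE_lborel_singleton[of 0]
      proof eventually_elim
        case (elim r)
        have "eventually (\<lambda>n. indicator {0..s n} r * R r = 0) sequentially"
        proof (cases "r < 0")
          case False
          then have "r > 0" using elim by simp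
          from order_tendstoD(2)[OF s0 this] show ?thesis by eventually_elim (auto simp: indicator_def)
        qed (auto simp: indicator_def)
        then show ?case by (rule tendsto_eventually)
      qed
    qed measurable
    then show ?thesis by (simp add: prim_def)
  qed
  \<comment> \<open>Both traces tend to \<open>E0\<close>, so the lower bound tends to 4
    \<open>E0\<close> - 3 \<open>E0\<close>, while the primitive of \<open>R\<close> vanishes at 0:
    hence \<open>E0 \<le> c\<close>.\<close>
  have "(\<lambda>n. 2 * (IX (s n) + IY (s n)) - 3 * E0) \<longlonglongrightarrow> 2 * (E0 + E0) - 3 * E0"
    using filterlim_compose[OF in1 f1(1)] filterlim_compose[OF in2 f1(2)] unfolding IX_def IY_def
    by (intro tendsto_intros)
  moreover have "(\<lambda>n. c + prim R (s n)) \<longlonglongrightarrow> c + 0" by (intro tendsto_intros pR)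
  ultimately have "2 * (E0 + E0) - 3 * E0 \<le> c + 0" by (rule LIMSEQ_le) (use s(4) in auto)
  then have cE: "E0 \<le> c" by simp
  have gap_eq: "AE t in lborel. energy_gap t = QX t + QY t - 2 * H t"
    using X.AE_L2_slices Y.AE_L2_slices
  proof eventually_elim
    case (elim t)
    have one: "(LBINT x. (f x - g x)\<^sup>2) = (LBINT x. (f x)\<^sup>2) + (LBINT x. (g x)\<^sup>2) - 2 * (LBINT x. f x * g x)"
      if "f \<in> L2 lborel" "g \<in> L2 lborel" for f g :: "real^2 \<Rightarrow> real"
      unfolding power2_diff using that[THEN L2_integrable] L2_mult_integrable[OF that] by (simp add: mult.assoc)
    show ?case unfolding energy_gap_def QX_def QY_def H_def using elim by (simp add: one)
  qed
  have Ri: "integrable lborel (\<lambda>r. indicator {0..t} r * R r)" if "t \<in> {0<..<T}" for t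
  proof (rule Bochner_Integration.integrable_bound[OF bound_integrable])
    show "AE r in lborel. norm (indicator {0..t} r * R r) \<le> norm (bound r)"
      using R_bound AE_lborel_singleton[of 0]
    proof eventually_elim
      case (elim r)
      show ?case
      proof (cases "r \<in> {0..t}")
        case True
        then have "r \<in> {0<..<T}" using elim that by auto
        with elim True show ?thesis by auto
      qed simp
    qed
  qed measurable
  have ind: "integrable lborel (\<lambda>r. indicator {0..t} r * h r)" if "integrable lborel h" for h :: "real \<Rightarrow> real" and t :: real
    using integrable_mult_indicator[of "{0..t}" lborel h] that by simp
  have gap_bound: "AE t in lborel. t \<in> {0<..<T} \<longrightarrow> 0 \<le> energy_gap t \<and> energy_gap t \<le> 12 * S"
    using X.sup Y.sup X.AE_L2_slices Y.AE_L2_slices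
  proof eventually_elim
    case (elim t)
    have one: "(LBINT x. (f x - g x)\<^sup>2) \<le> 4 * S"
      if "f \<in> L2 lborel" "g \<in> L2 lborel" "(LBINT x. (f x)\<^sup>2) \<le> S" "(LBINT x. (g x)\<^sup>2) \<le> S" for f g :: "real^2 \<Rightarrow> real"
    proof -
      have "(LBINT x. (f x - g x)\<^sup>2) \<le> (LBINT x. 2 * (f x)\<^sup>2 + 2 * (g x)\<^sup>2)"
      proof (rule integral_mono)
        show "(f x - g x)\<^sup>2 \<le> 2 * (f x)\<^sup>2 + 2 * (g x)\<^sup>2" for x using square_add_le[of "f x" "- g x"] by simp
      qed (intro L2_integrable L2_diff that Bochner_Integration.integrable_add integrable_mult_right)+
      also have "\<dots> = 2 * (LBINT x. (f x)\<^sup>2) + 2 * (LBINT x. (g x)\<^sup>2)" using that by (simp add: L2_integrable)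
      finally show ?thesis using that by linarith
    qed
    have "energy_gap t \<le> 4 * S + 4 * S + 4 * S"
      unfolding energy_gap_def using elim by (intro add_mono one) auto
    then show ?case unfolding energy_gap_def by simp
  qed
  have mgi: "integrable lborel (\<lambda>r. indicator {0..t} r * (m r * energy_gap r))" if "t \<in> {0<..<T}" for t
  proof (rule Bochner_Integration.integrable_bound[OF integrable_mult_right[OF m(1), of "12 * S"]])
    have [measurable]: "m \<in> borel_measurable borel" using m by auto
    show "(\<lambda>r. indicator {0..t} r * (m r * energy_gap r)) \<in> borel_measurable lborel" by measurable
    show "AE r in lborel. norm (indicator {0..t} r * (m r * energy_gap r)) \<le> norm (12 * S * m r)"
      using gap_bound AE_lborel_singleton[of 0]
    proof eventually_elim
      case (elim r)
      show ?case
      proof (cases "r \<in> {0..t}")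
        case True
        then have "r \<in> {0<..<T}" using elim that by auto
        then have "0 \<le> energy_gap r" "energy_gap r \<le> 12 * S" using elim by auto
        then have "m r * energy_gap r \<le> 12 * S * m r" "0 \<le> m r * energy_gap r"
          using mult_left_mono[OF \<open>energy_gap r \<le> 12 * S\<close> m(2)[of r]] m(2)[of r] by (auto simp: mult.commute)
        then show ?thesis using True by simp
      qed simp
    qed
  qed
  have le: "AE t in lborel. t \<in> {0<..<T} \<longrightarrow> energy_gap t \<le> prim (\<lambda>s. m s * energy_gap s) t"
    using en1 en2 c gap_eq
  proof eventually_elim
    case (elim t)
    show ?case
    proof
      assume t: "t \<in> {0<..<T}"
      have i: "integrable lborel (\<lambda>r. indicator {0..t} r * (X.dissipation r + Y.dissipation r))"
        using ind[OF X.dissipation_integrable, of t] ind[OF Y.dissipation_integrable, of t] by (simp add: distrib_left)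
      \<comment> \<open>The initial energies contribute 2 \<open>E0\<close> and the cross identity
        -2 c, which is at most -2 \<open>E0\<close>; only the time integrals remain.\<close>
      have "energy_gap t \<le> - 2 * (prim X.dissipation t + prim Y.dissipation t + prim R t)"
      proof -
        have "energy_gap t = QX t + QY t - 2 * H t" "H t = c + prim R t" "QX t + 2 * prim X.dissipation t \<le> E0" "QY t + 2 * prim Y.dissipation t \<le> E0"
          using elim t by (auto simp: QX_def QY_def)
        with cE show ?thesis by argo
      qed
      also have "\<dots> = prim (\<lambda>s. - 2 * (X.dissipation s + Y.dissipation s + R s)) t"
        unfolding prim_cmult using prim_add[OF i Ri[OF t]] prim_add[OF ind[OF X.dissipation_integrable] ind[OF Y.dissipation_integrable], of t]
        by simp
      also have "\<dots> \<le> prim (\<lambda>s. m s * energy_gap s) t"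
        unfolding prim_def
      proof (rule integral_mono_AE)
        have "integrable lborel (\<lambda>r. - 2 * (indicator {0..t} r * (X.dissipation r + Y.dissipation r) + indicator {0..t} r * R r))"
          by (intro integrable_mult_right Bochner_Integration.integrable_add i Ri t)
        then show "integrable lborel (\<lambda>s. indicator {0..t} s * (- 2 * (X.dissipation s + Y.dissipation s + R s)))"
          by (simp add: algebra_simps)
        show "integrable lborel (\<lambda>s. indicator {0..t} s * (m s * energy_gap s))" by (rule mgi[OF t])
        show "AE s in lborel. indicator {0..t} s * (- 2 * (X.dissipation s + Y.dissipation s + R s)) \<le> indicator {0..t} s * (m s * energy_gap s)"
          using dissipation_inequality AE_lborel_singleton[of 0]
        proof eventually_elim
          case (elim s)
          show ?case
          proof (cases "s \<in> {0..t}")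
            case True
            then have "s \<in> {0<..<T}" using elim t by auto
            with elim True show ?thesis by simp
          qed simp
        qed
      qed
      finally show "energy_gap t \<le> prim (\<lambda>s. m s * energy_gap s) t" .
    qed
  qed
  show ?thesis by (rule gronwall_zero[OF energy_gap_measurable m gap_bound le])
qed

end

section \<open>Weak solutions\<close>

text \<open>The representatives chosen by \<open>weak_deriv\<close> are uncontrolled outside the
  slab and are known to be measurable only on it; the cut-off yields functions on all of
  space-time.\<close>

definition on_slab :: "real \<Rightarrow> (real \<times> (real^2) \<Rightarrow> real) \<Rightarrow> real \<times> (real^2) \<Rightarrow> real" where
  "on_slab T u w = indicator (slab T) w * u w"

lemma slice_on_slab: "slice (on_slab T u) t x = (if t \<in> {0<..<T} then u (t, x) else 0)"
  by (auto simp: slice_def on_slab_def slab_def indicator_def)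

section \<open>Squared Lebesgue norms as integrals\<close>

lemma ennreal_pow_2: "ennreal_pow a 2 = a\<^sup>2"
proof (cases a)
  case (real r)
  then show ?thesis by (simp add: ennreal_pow_def ennreal_power)
qed (simp add: ennreal_pow_def)

lemma ennreal_pow_half: "(ennreal_pow a (1 / 2))\<^sup>2 = a"
proof (cases a)
  case (real r)
  then show ?thesis by (simp add: ennreal_pow_def ennreal_power powr_half_sqrt)
qed (simp add: ennreal_pow_def)

lemma ennreal_pow_less_top: "ennreal_pow a r < \<infinity> \<Longrightarrow> a < \<infinity>"
  by (auto simp: ennreal_pow_def less_top split: if_splits)

lemma Lp_ennorm_2: "(Lp_ennorm 2 M g)\<^sup>2 = (\<integral>\<^sup>+x. (g x)\<^sup>2 \<partial>M)"
  by (simp add: Lp_ennorm_def ennreal_pow_half ennreal_pow_2)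

lemma Lp_norm_2: "(Lp_norm 2 M f)\<^sup>2 = (\<integral>\<^sup>+x. ennreal ((norm (f x))\<^sup>2) \<partial>M)"
  by (simp add: Lp_norm_def Lp_ennorm_2 ennreal_power)

lemma norm_plane_square: "(norm v)\<^sup>2 = (v $ 1)\<^sup>2 + (v $ 2)\<^sup>2" for v :: "real^2"
  by (simp add: norm_vec_def L2_set_def sum_2)

lemma Lp_norm_2_real: "f \<in> L2 M \<Longrightarrow> (Lp_norm 2 M f)\<^sup>2 = ennreal (\<integral>x. (f x)\<^sup>2 \<partial>M)"
  unfolding Lp_norm_2 by (simp add: nn_integral_eq_integral L2_integrable)

lemma Lp_norm_2_plane:
  fixes v :: "'a \<Rightarrow> real^2"
  assumes "(\<lambda>x. v x $ 1) \<in> L2 M" "(\<lambda>x. v x $ 2) \<in> L2 M"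
  shows "(Lp_norm 2 M v)\<^sup>2 = ennreal ((\<integral>x. (v x $ 1)\<^sup>2 \<partial>M) + (\<integral>x. (v x $ 2)\<^sup>2 \<partial>M))"
  unfolding Lp_norm_2 norm_plane_square
  using assms[THEN L2_integrable] by (subst nn_integral_eq_integral) auto

section \<open>Testing weak derivatives with products\<close>

lemma space_time_test:
  assumes "space_time_test T \<theta> \<alpha> \<beta>"
  shows "tens \<theta> \<alpha> \<beta> \<in> test_functions (slab T)" and "smooth \<theta>" "smooth \<alpha>" "smooth \<beta>"
    and "space_time_test T \<theta> (deriv \<alpha>) \<beta>" "space_time_test T \<theta> \<alpha> (deriv \<beta>)" "space_time_test T (deriv \<theta>) \<alpha> \<beta>"
proof -
  obtain a b c d e f where b: "bump a b \<theta>" "0 < a" "b < T" "bump c d \<alpha>" "bump e f \<beta>"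
    using assms unfolding space_time_test_def by (elim conjE exE) (rule that)
  show "tens \<theta> \<alpha> \<beta> \<in> test_functions (slab T)" by (rule tens_test_function[OF b])
  show "smooth \<theta>" "smooth \<alpha>" "smooth \<beta>" using b unfolding bump_def by simp_all
  show "space_time_test T \<theta> (deriv \<alpha>) \<beta>" "space_time_test T \<theta> \<alpha> (deriv \<beta>)" "space_time_test T (deriv \<theta>) \<alpha> \<beta>"
    unfolding space_time_test_def using b bump_deriv[OF b(1)] bump_deriv[OF b(4)] bump_deriv[OF b(5)]
    by blast+
qed

lemma tens_eq_0: "space_time_test T \<theta> \<alpha> \<beta> \<Longrightarrow> w \<notin> slab T \<Longrightarrow> tens \<theta> \<alpha> \<beta> w = 0"
  by (cases w) (auto simp: space_time_test_def bump_def tens_def slab_def)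

lemma on_slab_tens: "space_time_test T \<theta> \<alpha> \<beta> \<Longrightarrow> on_slab T u w * tens \<theta> \<alpha> \<beta> w = u w * tens \<theta> \<alpha> \<beta> w"
  by (cases "w \<in> slab T") (auto simp: on_slab_def tens_eq_0)

lemma tens_measurable[measurable]:
  assumes "space_time_test T \<theta> \<alpha> \<beta>" shows "tens \<theta> \<alpha> \<beta> \<in> borel_measurable borel"
proof -
  have "Ck 0 (tens \<theta> \<alpha> \<beta>)" by (intro Ck_tens space_time_test[OF assms])
  then show ?thesis by (simp add: borel_measurable_continuous_onI)
qed

lemma tens_bounded:
  assumes "space_time_test T \<theta> \<alpha> \<beta>"
  obtains K C where "compact K" "K \<subseteq> slab T" "\<And>w. \<bar>tens \<theta> \<alpha> \<beta> w\<bar> \<le> C * indicator K w"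
proof -
  let ?K = "closure {z. tens \<theta> \<alpha> \<beta> z \<noteq> 0}"
  have tf: "compact ?K" "?K \<subseteq> slab T" "Ck 0 (tens \<theta> \<alpha> \<beta>)"
    using space_time_test(1)[OF assms] unfolding test_functions_def by blast+
  then have "bounded (tens \<theta> \<alpha> \<beta> ` ?K)"
    by (intro compact_imp_bounded compact_continuous_image) (auto intro: continuous_on_subset)
  then obtain C where "\<forall>y\<in>tens \<theta> \<alpha> \<beta> ` ?K. norm y \<le> C" unfolding bounded_iff by blast
  then have C: "\<And>w. w \<in> ?K \<Longrightarrow> \<bar>tens \<theta> \<alpha> \<beta> w\<bar> \<le> C" by auto
  have "\<bar>tens \<theta> \<alpha> \<beta> w\<bar> \<le> C * indicator ?K w" for w
  proof (cases "w \<in> ?K")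
    case False
    then have "tens \<theta> \<alpha> \<beta> w = 0" using closure_subset[of "{z. tens \<theta> \<alpha> \<beta> z \<noteq> 0}"] by auto
    then show ?thesis using False by simp
  qed (use C in simp)
  then show ?thesis using tf that by blast
qed

text \<open>Local integrability gives measurability of \<open>u\<close> only after restriction to
  compact sets, so the integrand is first rewritten with the indicator of a compact set that carries
  the test function.\<close>

lemma loc_integrable_tens:
  fixes u :: "real \<times> (real^2) \<Rightarrow> real"
  assumes u: "loc_integrable (slab T) u" and t: "space_time_test T \<theta> \<alpha> \<beta>"
  shows "integrable lborel (\<lambda>w. u w * tens \<theta> \<alpha> \<beta> w)"
proof -
  obtain K C where K: "compact K" "K \<subseteq> slab T" and C: "\<And>w. \<bar>tens \<theta> \<alpha> \<beta> w\<bar> \<le> C * indicator K w"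
    using tens_bounded[OF t] by blast
  have I: "integrable lborel (\<lambda>w. indicator K w * u w)"
    using u K unfolding loc_integrable_def set_integrable_def by simp
  have eq: "u w * tens \<theta> \<alpha> \<beta> w = indicator K w * u w * tens \<theta> \<alpha> \<beta> w" for w
    using C[of w] by (cases "w \<in> K") auto
  show ?thesis
  proof (rule Bochner_Integration.integrable_bound[OF integrable_mult_right[OF I, of C]])
    have [measurable]: "tens \<theta> \<alpha> \<beta> \<in> borel_measurable borel" by (rule tens_measurable[OF t])
    have [measurable]: "(\<lambda>w. indicator K w * u w) \<in> borel_measurable borel" using I by auto
    show "(\<lambda>w. u w * tens \<theta> \<alpha> \<beta> w) \<in> borel_measurable lborel" unfolding eq by measurable
    show "AE w in lborel. norm (u w * tens \<theta> \<alpha> \<beta> w) \<le> norm (C * (indicator K w * u w))"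
    proof (rule AE_I2)
      fix w
      show "norm (u w * tens \<theta> \<alpha> \<beta> w) \<le> norm (C * (indicator K w * u w))"
      proof (cases "w \<in> K")
        case True
        then have "\<bar>tens \<theta> \<alpha> \<beta> w\<bar> \<le> \<bar>C\<bar>" using C[of w] by auto
        then show ?thesis using True by (simp add: abs_mult mult.commute[of "\<bar>u w\<bar>"] mult_right_mono)
      qed (simp add: eq)
    qed
  qed
qed

lemma integrable_tens:
  fixes u :: "real \<times> (real^2) \<Rightarrow> real"
  assumes u: "integrable lborel u" and t: "space_time_test T \<theta> \<alpha> \<beta>"
  shows "integrable lborel (\<lambda>w. u w * tens \<theta> \<alpha> \<beta> w)"
proof (rule loc_integrable_tens[OF _ t])
  show "loc_integrable (slab T) u"
    unfolding loc_integrable_def set_integrable_def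
    using u by (auto intro!: integrable_mult_indicator simp: compact_imp_closed borel_closed simp del: real_scaleR_def)
qed

text \<open>The existence hypothesis is what gives the chosen value \<open>weak_deriv\<close> its
  defining property.\<close>

lemma weak_deriv_tens:
  assumes "\<exists>v. has_weak_deriv (slab T) b u v" and t: "space_time_test T \<theta> \<alpha> \<beta>"
  shows "(LBINT w. u w * dir_deriv b (tens \<theta> \<alpha> \<beta>) w) = - (LBINT w. weak_deriv (slab T) b u w * tens \<theta> \<alpha> \<beta> w)"
    and "loc_integrable (slab T) u" and "loc_integrable (slab T) (weak_deriv (slab T) b u)"
proof -
  have "has_weak_deriv (slab T) b u (weak_deriv (slab T) b u)"
    using someI_ex[OF assms(1)] unfolding weak_deriv_def .
  then show "(LBINT w. u w * dir_deriv b (tens \<theta> \<alpha> \<beta>) w) = - (LBINT w. weak_deriv (slab T) b u w * tens \<theta> \<alpha> \<beta> w)"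
    and "loc_integrable (slab T) u" and "loc_integrable (slab T) (weak_deriv (slab T) b u)"
    using space_time_test(1)[OF t] unfolding has_weak_deriv_def by blast+
qed

lemma gradient_tens:
  assumes g: "has_gradient T u" and t: "space_time_test T \<theta> \<alpha> \<beta>"
  shows "(LBINT w. u w * tens \<theta> (deriv \<alpha>) \<beta> w) = - (LBINT w. gradient T u w $ 1 * tens \<theta> \<alpha> \<beta> w)"
    and "(LBINT w. u w * tens \<theta> \<alpha> (deriv \<beta>) w) = - (LBINT w. gradient T u w $ 2 * tens \<theta> \<alpha> \<beta> w)"
    and "integrable lborel (\<lambda>w. u w * tens \<theta> \<alpha> \<beta> w)"
    and "integrable lborel (\<lambda>w. gradient T u w $ i * tens \<theta> \<alpha> \<beta> w)"
proof -
  note w = g[unfolded has_gradient_def, rule_format]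
  show "(LBINT w. u w * tens \<theta> (deriv \<alpha>) \<beta> w) = - (LBINT w. gradient T u w $ 1 * tens \<theta> \<alpha> \<beta> w)"
    "(LBINT w. u w * tens \<theta> \<alpha> (deriv \<beta>) w) = - (LBINT w. gradient T u w $ 2 * tens \<theta> \<alpha> \<beta> w)"
    using weak_deriv_tens(1)[OF w[of 1] t] weak_deriv_tens(1)[OF w[of 2] t]
    by (simp_all add: gradient_def dir_deriv_tens space_time_test[OF t])
  show "integrable lborel (\<lambda>w. u w * tens \<theta> \<alpha> \<beta> w)"
    by (rule loc_integrable_tens[OF weak_deriv_tens(2)[OF w[of 1] t] t])
  show "integrable lborel (\<lambda>w. gradient T u w $ i * tens \<theta> \<alpha> \<beta> w)"
    using loc_integrable_tens[OF weak_deriv_tens(3)[OF w[of i] t] t] by (simp add: gradient_def)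
qed

lemma weak_laplacian_tens:
  assumes "\<exists>v. has_weak_laplacian T u v" and t: "space_time_test T \<theta> \<alpha> \<beta>"
  shows "(LBINT w. u w * laplacian (tens \<theta> \<alpha> \<beta>) w) = (LBINT w. weak_laplacian T u w * tens \<theta> \<alpha> \<beta> w)"
    and "integrable lborel (\<lambda>w. weak_laplacian T u w * tens \<theta> \<alpha> \<beta> w)"
proof -
  have h: "has_weak_laplacian T u (weak_laplacian T u)"
    using someI_ex[OF assms(1)] unfolding weak_laplacian_def[symmetric] .
  show "(LBINT w. u w * laplacian (tens \<theta> \<alpha> \<beta>) w) = (LBINT w. weak_laplacian T u w * tens \<theta> \<alpha> \<beta> w)"
    using h space_time_test(1)[OF t] unfolding has_weak_laplacian_def by blast
  show "integrable lborel (\<lambda>w. weak_laplacian T u w * tens \<theta> \<alpha> \<beta> w)"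
    using h unfolding has_weak_laplacian_def by (intro loc_integrable_tens[OF _ t]) blast
qed

section \<open>The fields of a weak solution\<close>

lemma nn_integral_time_slices:
  fixes f :: "real \<times> (real^2) \<Rightarrow> real"
  assumes [measurable]: "f \<in> borel_measurable borel"
  shows "(\<integral>\<^sup>+w. ennreal ((f w)\<^sup>2) \<partial>lborel) = (\<integral>\<^sup>+t. \<integral>\<^sup>+x. ennreal ((slice f t x)\<^sup>2) \<partial>lborel \<partial>lborel)"
  unfolding lborel_prod[symmetric] slice_def by (rule lborel.nn_integral_fst[symmetric]) (simp add: lborel_prod)

locale hall_solution =
  fixes T :: real and \<psi>0 Z0 :: "real^2 \<Rightarrow> real" and \<psi> Zf :: "real \<times> (real^2) \<Rightarrow> real"
  assumes T0: "0 < T" and ini: "initial_data \<psi>0 Z0" and ws: "weak_solution T \<psi>0 Z0 \<psi> Zf"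
begin

abbreviation "a1 \<equiv> on_slab T (\<lambda>w. gradient T \<psi> w $ 1)"
abbreviation "a2 \<equiv> on_slab T (\<lambda>w. gradient T \<psi> w $ 2)"
abbreviation "Z \<equiv> on_slab T Zf"
abbreviation "L \<equiv> on_slab T (weak_laplacian T \<psi>)"
abbreviation "Z1 \<equiv> on_slab T (\<lambda>w. gradient T Zf w $ 1)"
abbreviation "Z2 \<equiv> on_slab T (\<lambda>w. gradient T Zf w $ 2)"

lemma weak_solution_parts:
  "has_gradient T \<psi>" "\<exists>v. has_weak_laplacian T \<psi> v" "has_gradient T Zf"
  "in_LqLp \<infinity> 2 T (\<lambda>z. (gradient T \<psi> z, Zf z))" "in_LqLp 2 2 T (\<lambda>z. (weak_laplacian T \<psi> z, gradient T Zf z))"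
  "solves_psi_eq T \<psi> Zf" "solves_Z_eq T \<psi> Zf" "attains_initial_data T \<psi>0 Z0 \<psi> Zf" "energy_inequality T \<psi>0 Z0 \<psi> Zf"
  using ws unfolding weak_solution_def by blast+

lemma fields_measurable[measurable]:
  "a1 \<in> borel_measurable borel" "a2 \<in> borel_measurable borel" "Z \<in> borel_measurable borel"
  "L \<in> borel_measurable borel" "Z1 \<in> borel_measurable borel" "Z2 \<in> borel_measurable borel"
proof -
  have m1: "(\<lambda>w. indicator (slab T) w *\<^sub>R (gradient T \<psi> w, Zf w)) \<in> borel_measurable borel"
    using weak_solution_parts(4) unfolding in_LqLp_def set_borel_measurable_def by simp
  have m2: "(\<lambda>w. indicator (slab T) w *\<^sub>R (weak_laplacian T \<psi> w, gradient T Zf w)) \<in> borel_measurable borel"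
    using weak_solution_parts(5) unfolding in_LqLp_def set_borel_measurable_def by simp
  have f: "(\<lambda>p::(real^2) \<times> real. fst p $ i) \<in> borel_measurable borel" "(\<lambda>p::(real^2) \<times> real. snd p) \<in> borel_measurable borel"
     "(\<lambda>p::real \<times> (real^2). snd p $ i) \<in> borel_measurable borel" "(\<lambda>p::real \<times> (real^2). fst p) \<in> borel_measurable borel" for i
    by (intro borel_measurable_continuous_onI continuous_intros)+
  show "a1 \<in> borel_measurable borel" "a2 \<in> borel_measurable borel" "Z \<in> borel_measurable borel"
    "L \<in> borel_measurable borel" "Z1 \<in> borel_measurable borel" "Z2 \<in> borel_measurable borel"
    using measurable_compose[OF m1 f(1)[of 1]] measurable_compose[OF m1 f(1)[of 2]] measurable_compose[OF m1 f(2)]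
      measurable_compose[OF m2 f(3)[of 1]] measurable_compose[OF m2 f(3)[of 2]] measurable_compose[OF m2 f(4)]
    by (simp_all add: on_slab_def[abs_def])
qed

lemma sup_bound:
  obtains K :: real where "0 \<le> K"
    "AE t in lborel. (\<integral>\<^sup>+x. ennreal ((slice a1 t x)\<^sup>2 + (slice a2 t x)\<^sup>2 + (slice Z t x)\<^sup>2) \<partial>lborel) \<le> ennreal K"
proof -
  let ?N = "\<lambda>t. Lp_norm 2 lborel (\<lambda>x. (gradient T \<psi> (t, x), Zf (t, x)))"
  let ?M = "restrict_space lborel {0<..<T}"
  have fin: "esssup ?M ?N < \<infinity>" using weak_solution_parts(4) by (simp add: in_LqLp_def Lp_ennorm_def)
  have "AE t in ?M. ?N t \<le> esssup ?M ?N" by (rule esssup_AE)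
  then have ae: "AE t in lborel. t \<in> {0<..<T} \<longrightarrow> ?N t \<le> esssup ?M ?N"
    by (simp add: AE_restrict_space_iff)
  define K where "K = enn2real ((esssup ?M ?N)\<^sup>2)"
  have K: "ennreal K = (esssup ?M ?N)\<^sup>2"
    using fin unfolding K_def by (subst ennreal_enn2real) (auto simp: power_less_top_ennreal)
  from ae have "AE t in lborel. (\<integral>\<^sup>+x. ennreal ((slice a1 t x)\<^sup>2 + (slice a2 t x)\<^sup>2 + (slice Z t x)\<^sup>2) \<partial>lborel) \<le> ennreal K"
  proof eventually_elim
    case (elim t)
    show ?case
    proof (cases "t \<in> {0<..<T}")
      case True
      have "(\<integral>\<^sup>+x. ennreal ((slice a1 t x)\<^sup>2 + (slice a2 t x)\<^sup>2 + (slice Z t x)\<^sup>2) \<partial>lborel) = (?N t)\<^sup>2"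
        unfolding Lp_norm_2 using True by (intro nn_integral_cong) (simp add: slice_on_slab norm_Pair norm_plane_square)
      also have "\<dots> \<le> ennreal K" unfolding K using elim True by (intro power_mono) auto
      finally show ?thesis .
    qed (auto simp: slice_on_slab)
  qed
  then show ?thesis by (intro that[of K]) (auto simp: K_def)
qed

lemma dissipation_finite:
  "(\<integral>\<^sup>+t. \<integral>\<^sup>+x. ennreal ((slice L t x)\<^sup>2 + (slice Z1 t x)\<^sup>2 + (slice Z2 t x)\<^sup>2) \<partial>lborel \<partial>lborel) < \<infinity>"
proof -
  let ?N = "\<lambda>t. Lp_norm 2 lborel (\<lambda>x. (weak_laplacian T \<psi> (t, x), gradient T Zf (t, x)))"
  let ?M = "restrict_space lborel {0<..<T}"
  have "Lp_ennorm 2 ?M ?N < \<infinity>" using weak_solution_parts(5) by (simp add: in_LqLp_def)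
  then have "(Lp_ennorm 2 ?M ?N)\<^sup>2 < \<infinity>" by (simp add: power_less_top_ennreal)
  then have "(\<integral>\<^sup>+t. (?N t)\<^sup>2 \<partial>?M) < \<infinity>" by (simp add: Lp_ennorm_2)
  also have "(\<integral>\<^sup>+t. (?N t)\<^sup>2 \<partial>?M) = (\<integral>\<^sup>+t. (?N t)\<^sup>2 * indicator {0<..<T} t \<partial>lborel)"
    by (subst nn_integral_restrict_space) auto
  also have "\<dots> = (\<integral>\<^sup>+t. \<integral>\<^sup>+x. ennreal ((slice L t x)\<^sup>2 + (slice Z1 t x)\<^sup>2 + (slice Z2 t x)\<^sup>2) \<partial>lborel \<partial>lborel)"
  proof (intro nn_integral_cong)
    fix t
    show "(?N t)\<^sup>2 * indicator {0<..<T} t = (\<integral>\<^sup>+x. ennreal ((slice L t x)\<^sup>2 + (slice Z1 t x)\<^sup>2 + (slice Z2 t x)\<^sup>2) \<partial>lborel)"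
      by (cases "t \<in> {0<..<T}") (auto simp: Lp_norm_2 slice_on_slab norm_Pair norm_plane_square add.assoc)
  qed
  finally show ?thesis .
qed

lemma fields_L2:
  "a1 \<in> L2 lborel" "a2 \<in> L2 lborel" "Z \<in> L2 lborel" "L \<in> L2 lborel" "Z1 \<in> L2 lborel" "Z2 \<in> L2 lborel"
proof -
  obtain K where K: "0 \<le> K" "AE t in lborel. (\<integral>\<^sup>+x. ennreal ((slice a1 t x)\<^sup>2 + (slice a2 t x)\<^sup>2 + (slice Z t x)\<^sup>2) \<partial>lborel) \<le> ennreal K"
    by (rule sup_bound)
  have B: "f \<in> L2 lborel" if [measurable]: "f \<in> borel_measurable borel" and le: "\<And>t x. (slice f t x)\<^sup>2 \<le> (slice a1 t x)\<^sup>2 + (slice a2 t x)\<^sup>2 + (slice Z t x)\<^sup>2" for f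
  proof (rule L2I_nn)
    have "(\<integral>\<^sup>+w. ennreal ((f w)\<^sup>2) \<partial>lborel) = (\<integral>\<^sup>+t. \<integral>\<^sup>+x. ennreal ((slice f t x)\<^sup>2) \<partial>lborel \<partial>lborel)"
      by (rule nn_integral_time_slices) fact
    \<comment> \<open>A bound uniform in time gives integrability over space-time because the
      interval is finite and the fields vanish outside it.\<close>
    also have "\<dots> \<le> (\<integral>\<^sup>+t. ennreal K * indicator {0<..<T} t \<partial>lborel)"
    proof (rule nn_integral_mono_AE)
      show "AE t in lborel. (\<integral>\<^sup>+x. ennreal ((slice f t x)\<^sup>2) \<partial>lborel) \<le> ennreal K * indicator {0<..<T} t"
        using K(2)
      proof eventually_elim
        case (elim t)
        have "(\<integral>\<^sup>+x. ennreal ((slice f t x)\<^sup>2) \<partial>lborel) \<le> (\<integral>\<^sup>+x. ennreal ((slice a1 t x)\<^sup>2 + (slice a2 t x)\<^sup>2 + (slice Z t x)\<^sup>2) \<partial>lborel)"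
          by (intro nn_integral_mono ennreal_leI le)
        with elim show ?case
          by (cases "t \<in> {0<..<T}") (auto simp: slice_on_slab)
      qed
    qed
    also have "\<dots> < \<infinity>" using T0 by (simp add: nn_integral_cmult ennreal_mult_less_top)
    finally show "(\<integral>\<^sup>+w. ennreal ((f w)\<^sup>2) \<partial>lborel) < \<infinity>" .
  qed simp
  show "a1 \<in> L2 lborel" "a2 \<in> L2 lborel" "Z \<in> L2 lborel" by (rule B; simp)+
  have D: "f \<in> L2 lborel" if [measurable]: "f \<in> borel_measurable borel" and le: "\<And>t x. (slice f t x)\<^sup>2 \<le> (slice L t x)\<^sup>2 + (slice Z1 t x)\<^sup>2 + (slice Z2 t x)\<^sup>2" for f
  proof (rule L2I_nn)
    have "(\<integral>\<^sup>+w. ennreal ((f w)\<^sup>2) \<partial>lborel) = (\<integral>\<^sup>+t. \<integral>\<^sup>+x. ennreal ((slice f t x)\<^sup>2) \<partial>lborel \<partial>lborel)"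
      by (rule nn_integral_time_slices) fact
    also have "\<dots> \<le> (\<integral>\<^sup>+t. \<integral>\<^sup>+x. ennreal ((slice L t x)\<^sup>2 + (slice Z1 t x)\<^sup>2 + (slice Z2 t x)\<^sup>2) \<partial>lborel \<partial>lborel)"
      by (intro nn_integral_mono ennreal_leI le)
    also note dissipation_finite
    finally show "(\<integral>\<^sup>+w. ennreal ((f w)\<^sup>2) \<partial>lborel) < \<infinity>" .
  qed simp
  show "L \<in> L2 lborel" "Z1 \<in> L2 lborel" "Z2 \<in> L2 lborel" by (rule D; simp)+
qed

lemma field_integrable_tens:
  assumes "f \<in> L2 lborel" "g \<in> L2 lborel" "space_time_test T \<theta> \<alpha> \<beta>"
  shows "integrable lborel (\<lambda>w. f w * g w * tens \<theta> \<alpha> \<beta> w)"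
  by (intro integrable_tens[OF _ assms(3)] L2_mult_integrable assms)

text \<open>All relations between the fields are obtained by differentiating the test function:
  replacing a spatial factor by its derivative again gives an admissible product, so the weak
  equations can be used repeatedly.\<close>

lemma hall_field:
  assumes S: "AE t in lborel. (\<integral>\<^sup>+x. ennreal ((slice a1 t x)\<^sup>2 + (slice a2 t x)\<^sup>2 + (slice Z t x)\<^sup>2) \<partial>lborel) \<le> ennreal S" "0 \<le> S"
  shows "hall_field T S a1 a2 Z L Z1 Z2"
proof unfold_locales
  note sL = weak_solution_parts(2)
  have prodt: "on_slab T u w * on_slab T v w * tens \<theta> \<alpha> \<beta> w = u w * v w * tens \<theta> \<alpha> \<beta> w" if "space_time_test T \<theta> \<alpha> \<beta>" for u v w \<theta> \<alpha> \<beta>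
    by (cases "w \<in> slab T") (auto simp: on_slab_def tens_eq_0[OF that])
  show "0 < T" by (rule T0)
  show "a1 \<in> L2 lborel" "a2 \<in> L2 lborel" "Z \<in> L2 lborel" "L \<in> L2 lborel" "Z1 \<in> L2 lborel" "Z2 \<in> L2 lborel"
    by (fact fields_L2)+
  show "a1 (t, x) = 0 \<and> a2 (t, x) = 0 \<and> Z (t, x) = 0 \<and> L (t, x) = 0 \<and> Z1 (t, x) = 0 \<and> Z2 (t, x) = 0"
    if "t \<notin> {0<..<T}" for t x using that by (auto simp: on_slab_def slab_def)
  have sb: "AE t in lborel. (LBINT x. (slice f t x)\<^sup>2) \<le> S"
    if [measurable]: "f \<in> borel_measurable borel" and le: "\<And>t x. (slice f t x)\<^sup>2 \<le> (slice a1 t x)\<^sup>2 + (slice a2 t x)\<^sup>2 + (slice Z t x)\<^sup>2" for f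
    using S(1)
  proof eventually_elim
    case (elim t)
    have "(\<integral>\<^sup>+x. ennreal ((slice f t x)\<^sup>2) \<partial>lborel) \<le> (\<integral>\<^sup>+x. ennreal ((slice a1 t x)\<^sup>2 + (slice a2 t x)\<^sup>2 + (slice Z t x)\<^sup>2) \<partial>lborel)"
      by (intro nn_integral_mono ennreal_leI le)
    with elim have "(\<integral>\<^sup>+x. ennreal ((slice f t x)\<^sup>2) \<partial>lborel) \<le> ennreal S" by (rule order_trans[rotated])
    then show ?case using S(2) by (intro integral_le_nn) auto
  qed
  show "AE t in lborel. (LBINT x. (slice a1 t x)\<^sup>2) \<le> S" "AE t in lborel. (LBINT x. (slice a2 t x)\<^sup>2) \<le> S"
    "AE t in lborel. (LBINT x. (slice Z t x)\<^sup>2) \<le> S"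
    by (rule sb; simp)+
  show "weak_divergence T a1 a2 L"
    unfolding weak_divergence_def
  proof (intro allI impI)
    fix \<theta> \<alpha> \<beta> assume t: "space_time_test T \<theta> \<alpha> \<beta>"
    note t' = space_time_test[OF t]
    have "(LBINT w. a1 w * tens \<theta> (deriv \<alpha>) \<beta> w + a2 w * tens \<theta> \<alpha> (deriv \<beta>) w)
      = (LBINT w. gradient T \<psi> w $ 1 * tens \<theta> (deriv \<alpha>) \<beta> w) + (LBINT w. gradient T \<psi> w $ 2 * tens \<theta> \<alpha> (deriv \<beta>) w)"
      unfolding on_slab_tens[OF t'(5)] on_slab_tens[OF t'(6)]
      by (intro Bochner_Integration.integral_add gradient_tens(4) weak_solution_parts t'(5,6))
    \<comment> \<open>The gradient is traded for a second derivative on the test function, where the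
      definition of the weak Laplacian applies.\<close>
    also have "\<dots> = - (LBINT w. \<psi> w * tens \<theta> (deriv (deriv \<alpha>)) \<beta> w) - (LBINT w. \<psi> w * tens \<theta> \<alpha> (deriv (deriv \<beta>)) w)"
      using gradient_tens(1)[OF weak_solution_parts(1) t'(5)] gradient_tens(2)[OF weak_solution_parts(1) t'(6)] by simp
    also have "\<dots> = - (LBINT w. \<psi> w * laplacian (tens \<theta> \<alpha> \<beta>) w)"
      unfolding laplacian_tens[OF t'(2-4)] distrib_left
      using gradient_tens(3)[OF weak_solution_parts(1) space_time_test(5)[OF t'(5)]] gradient_tens(3)[OF weak_solution_parts(1) space_time_test(6)[OF t'(6)]]
      by simp
    also have "\<dots> = - (LBINT w. L w * tens \<theta> \<alpha> \<beta> w)"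
      unfolding on_slab_tens[OF t] weak_laplacian_tens(1)[OF sL t] ..
    finally show "(LBINT w. a1 w * tens \<theta> (deriv \<alpha>) \<beta> w + a2 w * tens \<theta> \<alpha> (deriv \<beta>) w) = - (LBINT w. L w * tens \<theta> \<alpha> \<beta> w)" .
  qed
  show "weak_divergence T (\<lambda>w. - a2 w) a1 (\<lambda>w. 0)"
    unfolding weak_divergence_def
  proof (intro allI impI)
    fix \<theta> \<alpha> \<beta> assume t: "space_time_test T \<theta> \<alpha> \<beta>"
    note t' = space_time_test[OF t]
    have "(LBINT w. - a2 w * tens \<theta> (deriv \<alpha>) \<beta> w + a1 w * tens \<theta> \<alpha> (deriv \<beta>) w)
      = - (LBINT w. gradient T \<psi> w $ 2 * tens \<theta> (deriv \<alpha>) \<beta> w) + (LBINT w. gradient T \<psi> w $ 1 * tens \<theta> \<alpha> (deriv \<beta>) w)"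
      unfolding mult_minus_left on_slab_tens[OF t'(5)] on_slab_tens[OF t'(6)]
      using gradient_tens(4)[OF weak_solution_parts(1) t'(5)] gradient_tens(4)[OF weak_solution_parts(1) t'(6)] by simp
    \<comment> \<open>Both terms reduce to the integral of \<psi> against \<theta> \<alpha>'
      \<beta>', with opposite signs: the mixed derivatives of the test function commute.\<close>
    also have "\<dots> = 0"
      using gradient_tens(2)[OF weak_solution_parts(1) t'(5)] gradient_tens(1)[OF weak_solution_parts(1) t'(6)] by simp
    finally show "(LBINT w. - a2 w * tens \<theta> (deriv \<alpha>) \<beta> w + a1 w * tens \<theta> \<alpha> (deriv \<beta>) w) = - (LBINT w. 0 * tens \<theta> \<alpha> \<beta> w)" by simp
  qed
  show "weak_divergence T Z (\<lambda>w. 0) Z1" "weak_divergence T (\<lambda>w. 0) Z Z2"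
    unfolding weak_divergence_def
    by (auto simp: on_slab_tens space_time_test(5,6) gradient_tens(1,2)[OF weak_solution_parts(3)])
  show "weak_evolution T a1 (\<lambda>w. L w + (a1 w * Z2 w + a2 w * - Z1 w)) (\<lambda>w. 0)"
    "weak_evolution T a2 (\<lambda>w. 0) (\<lambda>w. L w + (a1 w * Z2 w + a2 w * - Z1 w))"
  proof -
    \<comment> \<open>The equation for \<psi> with its Laplacian identified as \<open>L\<close>.
      Using \<open>deriv \<alpha>\<close> or \<open>deriv \<beta>\<close> as spatial factor turns it
      into the equation for \<open>a1\<close> or \<open>a2\<close>.\<close>
    have key: "- (LBINT w. \<psi> w * tens (deriv \<theta>) \<alpha> \<beta> w) = (LBINT w. (L w + (a1 w * Z2 w + a2 w * - Z1 w)) * tens \<theta> \<alpha> \<beta> w)"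
      if t: "space_time_test T \<theta> \<alpha> \<beta>" for \<theta> \<alpha> \<beta>
    proof -
      note t' = space_time_test[OF t]
      note li = gradient_tens(3)[OF weak_solution_parts(1) space_time_test(5)[OF t'(5)]] gradient_tens(3)[OF weak_solution_parts(1) space_time_test(6)[OF t'(6)]]
        gradient_tens(3)[OF weak_solution_parts(1) t'(7)]
      have "(LBINT w. \<psi> w * (- dir_deriv e_t (tens \<theta> \<alpha> \<beta>) w - laplacian (tens \<theta> \<alpha> \<beta>) w))
         = (LBINT w. bracket (gradient T \<psi> w) (gradient T Zf w) * tens \<theta> \<alpha> \<beta> w)"
        using weak_solution_parts(6) t'(1) unfolding solves_psi_eq_def by blast
      moreover have "(LBINT w. \<psi> w * (- dir_deriv e_t (tens \<theta> \<alpha> \<beta>) w - laplacian (tens \<theta> \<alpha> \<beta>) w))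
        = - (LBINT w. \<psi> w * tens (deriv \<theta>) \<alpha> \<beta> w) - (LBINT w. \<psi> w * laplacian (tens \<theta> \<alpha> \<beta>) w)"
        unfolding dir_deriv_tens[OF t'(2-4)] laplacian_tens[OF t'(2-4)] right_diff_distrib distrib_left mult_minus_right
        using li by simp
      moreover have "(LBINT w. \<psi> w * laplacian (tens \<theta> \<alpha> \<beta>) w) = (LBINT w. L w * tens \<theta> \<alpha> \<beta> w)"
        unfolding on_slab_tens[OF t] by (rule weak_laplacian_tens(1)[OF sL t])
      moreover have "(LBINT w. bracket (gradient T \<psi> w) (gradient T Zf w) * tens \<theta> \<alpha> \<beta> w)
        = (LBINT w. a1 w * Z2 w * tens \<theta> \<alpha> \<beta> w - a2 w * Z1 w * tens \<theta> \<alpha> \<beta> w)"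
        unfolding prodt[OF t] bracket_def left_diff_distrib ..
      ultimately have "- (LBINT w. \<psi> w * tens (deriv \<theta>) \<alpha> \<beta> w) = (LBINT w. L w * tens \<theta> \<alpha> \<beta> w)
        + (LBINT w. a1 w * Z2 w * tens \<theta> \<alpha> \<beta> w - a2 w * Z1 w * tens \<theta> \<alpha> \<beta> w)" by simp
      also have "\<dots> = (LBINT w. L w * tens \<theta> \<alpha> \<beta> w + (a1 w * Z2 w * tens \<theta> \<alpha> \<beta> w - a2 w * Z1 w * tens \<theta> \<alpha> \<beta> w))"
        using weak_laplacian_tens(2)[OF sL t] field_integrable_tens[OF fields_L2(1,6) t] field_integrable_tens[OF fields_L2(2,5) t]
        by (intro Bochner_Integration.integral_add[symmetric]) (simp_all add: on_slab_tens[OF t])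
      finally show ?thesis by (simp add: algebra_simps)
    qed
    show "weak_evolution T a1 (\<lambda>w. L w + (a1 w * Z2 w + a2 w * - Z1 w)) (\<lambda>w. 0)"
      unfolding weak_evolution_def
    proof (intro allI impI)
      fix \<theta> \<alpha> \<beta> assume t: "space_time_test T \<theta> \<alpha> \<beta>"
      note t' = space_time_test[OF t]
      show "(LBINT w. a1 w * tens (deriv \<theta>) \<alpha> \<beta> w) = (LBINT w. (L w + (a1 w * Z2 w + a2 w * - Z1 w)) * tens \<theta> (deriv \<alpha>) \<beta> w + 0 * tens \<theta> \<alpha> (deriv \<beta>) w)"
        using key[OF t'(5)] gradient_tens(1)[OF weak_solution_parts(1) t'(7)] by (simp add: on_slab_tens[OF t'(7)])
    qed
    show "weak_evolution T a2 (\<lambda>w. 0) (\<lambda>w. L w + (a1 w * Z2 w + a2 w * - Z1 w))"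
      unfolding weak_evolution_def
    proof (intro allI impI)
      fix \<theta> \<alpha> \<beta> assume t: "space_time_test T \<theta> \<alpha> \<beta>"
      note t' = space_time_test[OF t]
      show "(LBINT w. a2 w * tens (deriv \<theta>) \<alpha> \<beta> w) = (LBINT w. 0 * tens \<theta> (deriv \<alpha>) \<beta> w + (L w + (a1 w * Z2 w + a2 w * - Z1 w)) * tens \<theta> \<alpha> (deriv \<beta>) w)"
        using key[OF t'(6)] gradient_tens(2)[OF weak_solution_parts(1) t'(7)] by (simp add: on_slab_tens[OF t'(7)])
    qed
  qed
  show "weak_evolution T Z (\<lambda>w. Z1 w + (a1 w * 0 + a2 w * L w)) (\<lambda>w. Z2 w + (a1 w * - L w + a2 w * 0))"
    unfolding weak_evolution_def
  proof (intro allI impI)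
    fix \<theta> \<alpha> \<beta> assume t: "space_time_test T \<theta> \<alpha> \<beta>"
    note t' = space_time_test[OF t]
    note li = gradient_tens(3)[OF weak_solution_parts(3) space_time_test(5)[OF t'(5)]] gradient_tens(3)[OF weak_solution_parts(3) space_time_test(6)[OF t'(6)]]
      gradient_tens(3)[OF weak_solution_parts(3) t'(7)]
    have "integrable lborel (\<lambda>w. Z1 w * tens \<theta> (deriv \<alpha>) \<beta> w)" "integrable lborel (\<lambda>w. Z2 w * tens \<theta> \<alpha> (deriv \<beta>) w)"
      unfolding on_slab_tens[OF t'(5)] on_slab_tens[OF t'(6)] by (intro gradient_tens(4) weak_solution_parts t'(5,6))+
    note gi = this field_integrable_tens[OF fields_L2(4,2) t'(5)] field_integrable_tens[OF fields_L2(4,1) t'(6)]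
    have "(LBINT w. Zf w * (- dir_deriv e_t (tens \<theta> \<alpha> \<beta>) w - laplacian (tens \<theta> \<alpha> \<beta>) w))
       = - (LBINT w. (weak_laplacian T \<psi> w * gradient T \<psi> w $ 2) * dir_deriv (e_x 1) (tens \<theta> \<alpha> \<beta>) w)
     + (LBINT w. (weak_laplacian T \<psi> w * gradient T \<psi> w $ 1) * dir_deriv (e_x 2) (tens \<theta> \<alpha> \<beta>) w)"
      using weak_solution_parts(7) t'(1) unfolding solves_Z_eq_def by blast
    moreover have "(LBINT w. Zf w * (- dir_deriv e_t (tens \<theta> \<alpha> \<beta>) w - laplacian (tens \<theta> \<alpha> \<beta>) w))
      = - (LBINT w. Z w * tens (deriv \<theta>) \<alpha> \<beta> w) + ((LBINT w. Z1 w * tens \<theta> (deriv \<alpha>) \<beta> w) + (LBINT w. Z2 w * tens \<theta> \<alpha> (deriv \<beta>) w))"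
      unfolding dir_deriv_tens[OF t'(2-4)] laplacian_tens[OF t'(2-4)] right_diff_distrib distrib_left mult_minus_right
        on_slab_tens[OF t'(5)] on_slab_tens[OF t'(6)] on_slab_tens[OF t'(7)]
      using li gradient_tens(1)[OF weak_solution_parts(3) t'(5)] gradient_tens(2)[OF weak_solution_parts(3) t'(6)] by simp
    moreover have "(LBINT w. (weak_laplacian T \<psi> w * gradient T \<psi> w $ 2) * dir_deriv (e_x 1) (tens \<theta> \<alpha> \<beta>) w)
       = (LBINT w. L w * a2 w * tens \<theta> (deriv \<alpha>) \<beta> w)"
      unfolding dir_deriv_tens[OF t'(2-4)] prodt[OF t'(5)] ..
    moreover have "(LBINT w. (weak_laplacian T \<psi> w * gradient T \<psi> w $ 1) * dir_deriv (e_x 2) (tens \<theta> \<alpha> \<beta>) w)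
       = (LBINT w. L w * a1 w * tens \<theta> \<alpha> (deriv \<beta>) w)"
      unfolding dir_deriv_tens[OF t'(2-4)] prodt[OF t'(6)] ..
    ultimately have "(LBINT w. Z w * tens (deriv \<theta>) \<alpha> \<beta> w) = (LBINT w. Z1 w * tens \<theta> (deriv \<alpha>) \<beta> w) + (LBINT w. Z2 w * tens \<theta> \<alpha> (deriv \<beta>) w)
      + (LBINT w. L w * a2 w * tens \<theta> (deriv \<alpha>) \<beta> w) - (LBINT w. L w * a1 w * tens \<theta> \<alpha> (deriv \<beta>) w)" by simp
    also have "\<dots> = (LBINT w. Z1 w * tens \<theta> (deriv \<alpha>) \<beta> w + Z2 w * tens \<theta> \<alpha> (deriv \<beta>) w
       + L w * a2 w * tens \<theta> (deriv \<alpha>) \<beta> w - L w * a1 w * tens \<theta> \<alpha> (deriv \<beta>) w)"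
      using gi by simp
    also have "\<dots> = (LBINT w. (Z1 w + (a1 w * 0 + a2 w * L w)) * tens \<theta> (deriv \<alpha>) \<beta> w + (Z2 w + (a1 w * - L w + a2 w * 0)) * tens \<theta> \<alpha> (deriv \<beta>) w)"
      by (intro Bochner_Integration.integral_cong refl) (simp add: algebra_simps)
    finally show "(LBINT w. Z w * tens (deriv \<theta>) \<alpha> \<beta> w) = (LBINT w. (Z1 w + (a1 w * 0 + a2 w * L w)) * tens \<theta> (deriv \<alpha>) \<beta> w + (Z2 w + (a1 w * - L w + a2 w * 0)) * tens \<theta> \<alpha> (deriv \<beta>) w)" .
  qed
qed

abbreviation "c1 \<equiv> \<lambda>x. gradient0 \<psi>0 x $ 1"
abbreviation "c2 \<equiv> \<lambda>x. gradient0 \<psi>0 x $ 2"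

lemma initial_L2: "c1 \<in> L2 lborel" "c2 \<in> L2 lborel" "Z0 \<in> L2 lborel"
proof -
  have m: "(\<lambda>x. (gradient0 \<psi>0 x, Z0 x)) \<in> borel_measurable borel"
    and "Lp_norm 2 lborel (\<lambda>x. (gradient0 \<psi>0 x, Z0 x)) < \<infinity>"
    using ini unfolding initial_data_def in_Lp_def by simp_all
  then have "(Lp_norm 2 lborel (\<lambda>x. (gradient0 \<psi>0 x, Z0 x)))\<^sup>2 < \<infinity>" by (simp add: power_less_top_ennreal)
  then have fin: "(\<integral>\<^sup>+x. ennreal ((c1 x)\<^sup>2 + (c2 x)\<^sup>2 + (Z0 x)\<^sup>2) \<partial>lborel) < \<infinity>"
    by (simp add: Lp_norm_2 norm_Pair norm_plane_square)
  have f: "(\<lambda>p::(real^2) \<times> real. fst p $ i) \<in> borel_measurable borel" "(\<lambda>p::(real^2) \<times> real. snd p) \<in> borel_measurable borel" for i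
    by (intro borel_measurable_continuous_onI continuous_intros)+
  have B: "f \<in> L2 lborel" if "f \<in> borel_measurable borel" "\<And>x. (f x)\<^sup>2 \<le> (c1 x)\<^sup>2 + (c2 x)\<^sup>2 + (Z0 x)\<^sup>2" for f
  proof (rule L2I_nn)
    have "(\<integral>\<^sup>+x. ennreal ((f x)\<^sup>2) \<partial>lborel) \<le> (\<integral>\<^sup>+x. ennreal ((c1 x)\<^sup>2 + (c2 x)\<^sup>2 + (Z0 x)\<^sup>2) \<partial>lborel)"
      by (intro nn_integral_mono ennreal_leI that(2))
    also note fin
    finally show "(\<integral>\<^sup>+x. ennreal ((f x)\<^sup>2) \<partial>lborel) < \<infinity>" .
  qed (use that in simp)
  have "c1 \<in> borel_measurable borel" "c2 \<in> borel_measurable borel" "Z0 \<in> borel_measurable borel"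
    using measurable_compose[OF m f(1)[of 1]] measurable_compose[OF m f(1)[of 2]] measurable_compose[OF m f(2)] by simp_all
  note this[measurable]
  show "c1 \<in> L2 lborel" "c2 \<in> L2 lborel" "Z0 \<in> L2 lborel"
    by (rule B; simp)+
qed

lemma AE_L2_slices:
  "AE t in lborel. slice a1 t \<in> L2 lborel \<and> slice a2 t \<in> L2 lborel \<and> slice Z t \<in> L2 lborel \<and>
     slice L t \<in> L2 lborel \<and> slice Z1 t \<in> L2 lborel \<and> slice Z2 t \<in> L2 lborel"
  using fields_L2[THEN L2_slices(1)] by eventually_elim blast

text \<open>On almost every slice all fields are square integrable, so the extended real norms in
  the energy inequality are finite integrals and the inequality becomes one between real
  numbers.\<close>

lemma energy:
  "AE t in lborel. t \<in> {0<..<T} \<longrightarrow> (LBINT x. (slice a1 t x)\<^sup>2) + (LBINT x. (slice a2 t x)\<^sup>2) + (LBINT x. (slice Z t x)\<^sup>2)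
     + 2 * prim (\<lambda>s. (LBINT x. (slice L s x)\<^sup>2) + (LBINT x. (slice Z1 s x)\<^sup>2) + (LBINT x. (slice Z2 s x)\<^sup>2)) t
   \<le> (LBINT x. (c1 x)\<^sup>2) + (LBINT x. (c2 x)\<^sup>2) + (LBINT x. (Z0 x)\<^sup>2)"
  using weak_solution_parts(9)[unfolded energy_inequality_def] AE_L2_slices
proof eventually_elim
  case (elim t)
  let ?E = "\<lambda>t. (LBINT x. (slice a1 t x)\<^sup>2) + (LBINT x. (slice a2 t x)\<^sup>2) + (LBINT x. (slice Z t x)\<^sup>2)"
  let ?D = "\<lambda>s. (LBINT x. (slice L s x)\<^sup>2) + (LBINT x. (slice Z1 s x)\<^sup>2) + (LBINT x. (slice Z2 s x)\<^sup>2)"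
  let ?init = "(LBINT x. (c1 x)\<^sup>2) + (LBINT x. (c2 x)\<^sup>2) + (LBINT x. (Z0 x)\<^sup>2)"
  let ?DT = "\<lambda>s. (Lp_norm 2 lborel (\<lambda>x. weak_laplacian T \<psi> (s, x)))\<^sup>2 + (Lp_norm 2 lborel (\<lambda>x. gradient T Zf (s, x)))\<^sup>2"
  show ?case
  proof
    assume t: "t \<in> {0<..<T}"
    have D0: "0 \<le> ?D s" for s by simp
    have Di: "integrable lborel (\<lambda>s. indicator {0..t} s * ?D s)"
      using integrable_mult_indicator[of "{0..t}" lborel ?D] fields_L2[THEN L2_slices(2)] by simp
    have "(\<integral>\<^sup>+s\<in>{0..t}. ?DT s \<partial>lborel) = (\<integral>\<^sup>+s. ennreal (indicator {0..t} s * ?D s) \<partial>lborel)"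
    proof (rule nn_integral_cong_AE)
      show "AE s in lborel. ?DT s * indicator {0..t} s = ennreal (indicator {0..t} s * ?D s)"
        using AE_L2_slices AE_lborel_singleton[of 0]
      proof eventually_elim
        case (elim s)
        show ?case
        proof (cases "s \<in> {0..t}")
          case True
          with t elim have s: "s \<in> {0<..<T}" by auto
          then have "(\<lambda>x. weak_laplacian T \<psi> (s, x)) \<in> L2 lborel" "(\<lambda>x. gradient T Zf (s, x) $ 1) \<in> L2 lborel" "(\<lambda>x. gradient T Zf (s, x) $ 2) \<in> L2 lborel"
            using elim by (simp_all add: slice_on_slab[abs_def])
          then show ?thesis using True s by (simp add: Lp_norm_2_real Lp_norm_2_plane slice_on_slab add.assoc flip: ennreal_plus)
        qed simp
      qed
    qed
    also have "\<dots> = ennreal (prim ?D t)"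
      unfolding prim_def using Di by (intro nn_integral_eq_integral) (auto simp: D0)
    finally have DT: "(\<integral>\<^sup>+s\<in>{0..t}. ?DT s \<partial>lborel) = ennreal (prim ?D t)" .
    have pD: "0 \<le> prim ?D t" unfolding prim_def by (intro Bochner_Integration.integral_nonneg) auto
    have "(\<lambda>x. gradient T \<psi> (t, x) $ 1) \<in> L2 lborel" "(\<lambda>x. gradient T \<psi> (t, x) $ 2) \<in> L2 lborel" "(\<lambda>x. Zf (t, x)) \<in> L2 lborel"
      using elim t by (simp_all add: slice_on_slab[abs_def])
    then have "(Lp_norm 2 lborel (\<lambda>x. gradient T \<psi> (t, x)))\<^sup>2 + (Lp_norm 2 lborel (\<lambda>x. Zf (t, x)))\<^sup>2 = ennreal (?E t)"
      using t by (simp add: Lp_norm_2_real Lp_norm_2_plane slice_on_slab flip: ennreal_plus)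
    moreover have "(Lp_norm 2 lborel (gradient0 \<psi>0))\<^sup>2 + (Lp_norm 2 lborel Z0)\<^sup>2 = ennreal ?init"
      using initial_L2 by (simp add: Lp_norm_2_real Lp_norm_2_plane flip: ennreal_plus)
    ultimately have "ennreal (?E t) + 2 * ennreal (prim ?D t) \<le> ennreal ?init"
      using elim(1) t unfolding DT by simp
    also have "ennreal (?E t) + 2 * ennreal (prim ?D t) = ennreal (?E t + 2 * prim ?D t)"
      using pD by (simp add: ennreal_mult ennreal_plus)
    finally show "?E t + 2 * prim ?D t \<le> ?init" by (subst (asm) ennreal_le_iff) auto
  qed
qed

text \<open>The weak limit is tested with the initial datum itself, which makes its value the
  squared norm of the datum.\<close>

lemma initial_trace:
  obtains N where "AE t in lborel. t \<notin> N"
    "((\<lambda>t. (LBINT x. slice a1 t x * c1 x) + (LBINT x. slice a2 t x * c2 x) + (LBINT x. slice Z t x * Z0 x))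
      \<longlongrightarrow> (LBINT x. (c1 x)\<^sup>2) + (LBINT x. (c2 x)\<^sup>2) + (LBINT x. (Z0 x)\<^sup>2)) (at 0 within {0<..<T} - N)"
proof -
  let ?w = "\<lambda>x. (gradient0 \<psi>0 x, Z0 x)"
  let ?I = "\<lambda>t. LBINT x. (gradient T \<psi> (t, x), Zf (t, x)) \<bullet> ?w x"
  let ?good = "\<lambda>t. slice a1 t \<in> L2 lborel \<and> slice a2 t \<in> L2 lborel \<and> slice Z t \<in> L2 lborel"
  obtain N0 where N0: "N0 \<in> null_sets lborel" and
    lim: "(?I \<longlongrightarrow> (LBINT x. ?w x \<bullet> ?w x)) (at 0 within {0<..T} - N0)"
    using weak_solution_parts(8) ini unfolding attains_initial_data_def initial_data_def by blast
  have dot: "(v, a) \<bullet> (w, b) = v $ 1 * w $ 1 + v $ 2 * w $ 2 + a * b" for v w :: "real^2" and a b :: real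
    by (simp add: inner_vec_def sum_2)
  \<comment> \<open>Times whose slices are not square integrable join the exceptional set, so that
    the integral of the inner product splits into components.\<close>
  define N where "N = N0 \<union> {t. \<not> ?good t}"
  have "AE t in lborel. t \<notin> N"
    using AE_not_in[OF N0] AE_L2_slices unfolding N_def by eventually_elim auto
  moreover have "((\<lambda>t. (LBINT x. slice a1 t x * c1 x) + (LBINT x. slice a2 t x * c2 x) + (LBINT x. slice Z t x * Z0 x))
      \<longlongrightarrow> (LBINT x. (c1 x)\<^sup>2) + (LBINT x. (c2 x)\<^sup>2) + (LBINT x. (Z0 x)\<^sup>2)) (at 0 within {0<..<T} - N)"
  proof (rule Lim_transform_eventually)
    have "(LBINT x. ?w x \<bullet> ?w x) = (LBINT x. (c1 x)\<^sup>2 + (c2 x)\<^sup>2 + (Z0 x)\<^sup>2)"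
      unfolding dot by (simp add: power2_eq_square)
    also have "\<dots> = (LBINT x. (c1 x)\<^sup>2) + (LBINT x. (c2 x)\<^sup>2) + (LBINT x. (Z0 x)\<^sup>2)"
      using initial_L2[THEN L2_integrable] by simp
    finally show "(?I \<longlongrightarrow> (LBINT x. (c1 x)\<^sup>2) + (LBINT x. (c2 x)\<^sup>2) + (LBINT x. (Z0 x)\<^sup>2)) (at 0 within {0<..<T} - N)"
      using tendsto_within_subset[OF lim, of "{0<..<T} - N"] by (simp add: N_def subset_iff)
    have "?I t = (LBINT x. slice a1 t x * c1 x) + (LBINT x. slice a2 t x * c2 x) + (LBINT x. slice Z t x * Z0 x)"
      if t: "t \<in> {0<..<T} - N" for t
    proof -
      have g: "slice a1 t \<in> L2 lborel" "slice a2 t \<in> L2 lborel" "slice Z t \<in> L2 lborel" using t by (auto simp: N_def)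
      have "?I t = (LBINT x. slice a1 t x * c1 x + slice a2 t x * c2 x + slice Z t x * Z0 x)"
        unfolding dot using t by (intro Bochner_Integration.integral_cong) (auto simp: slice_on_slab)
      also have "\<dots> = (LBINT x. slice a1 t x * c1 x) + (LBINT x. slice a2 t x * c2 x) + (LBINT x. slice Z t x * Z0 x)"
        using L2_mult_integrable[OF g(1) initial_L2(1)] L2_mult_integrable[OF g(2) initial_L2(2)] L2_mult_integrable[OF g(3) initial_L2(3)] by simp
      finally show ?thesis .
    qed
    then show "\<forall>\<^sub>F t in at 0 within {0<..<T} - N. ?I t = (LBINT x. slice a1 t x * c1 x) + (LBINT x. slice a2 t x * c2 x) + (LBINT x. slice Z t x * Z0 x)"
      unfolding eventually_at_filter by (intro always_eventually) simp
  qed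
  ultimately show thesis by (rule that)
qed

end

section \<open>Form bounds from the Serrin condition\<close>

lemma form_bounded_sup:
  assumes V: "AE x in lborel. V x \<le> G" and G: "0 \<le> G"
  shows "form_bounded V (\<lambda>\<delta>. G)"
  unfolding form_bounded_def
proof (intro allI impI conjI G)
  fix a1 a2 L and \<delta> :: real assume gl: "gradlike a1 a2 L" and \<delta>: "0 < \<delta>"
  have l: "a1 \<in> L2 lborel" "a2 \<in> L2 lborel" using gl by (auto simp: gradlike_def)
  have i: "integrable lborel (\<lambda>x. G * ((a1 x)\<^sup>2 + (a2 x)\<^sup>2))" using l[THEN L2_integrable] by simp
  have "(\<integral>\<^sup>+x. ennreal (((a1 x)\<^sup>2 + (a2 x)\<^sup>2) * V x) \<partial>lborel) \<le> (\<integral>\<^sup>+x. ennreal (G * ((a1 x)\<^sup>2 + (a2 x)\<^sup>2)) \<partial>lborel)"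
    using V by (intro nn_integral_mono_AE) (auto elim!: eventually_mono simp: mult.commute[of G] intro!: ennreal_leI mult_left_mono)
  also have "\<dots> = ennreal (G * ((LBINT x. (a1 x)\<^sup>2) + (LBINT x. (a2 x)\<^sup>2)))"
    using l[THEN L2_integrable] G by (subst nn_integral_eq_integral[OF i]) auto
  also have "\<dots> \<le> ennreal (\<delta> * (LBINT x. (L x)\<^sup>2) + G * ((LBINT x. (a1 x)\<^sup>2) + (LBINT x. (a2 x)\<^sup>2)))"
    using \<delta> by (intro ennreal_leI) simp
  finally show "(\<integral>\<^sup>+x. ennreal (((a1 x)\<^sup>2 + (a2 x)\<^sup>2) * V x) \<partial>lborel)
    \<le> ennreal (\<delta> * (LBINT x. (L x)\<^sup>2) + G * ((LBINT x. (a1 x)\<^sup>2) + (LBINT x. (a2 x)\<^sup>2)))" .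
qed

text \<open>The level \<Lambda> of \<open>form_bound\<close> is chosen so that \<delta> \<Lambda>^(s
  - 1) equals \<open>X + 1\<close>; the 1 keeps \<Lambda> positive when \<open>V\<close>
  vanishes.\<close>

lemma form_bounded_Lp:
  assumes V: "V \<in> borel_measurable borel" "\<And>x. 0 \<le> V x"
    and s: "1 < s" and X: "(\<integral>\<^sup>+x. ennreal (V x powr s) \<partial>lborel) \<le> ennreal X" "0 \<le> X"
    and k: "0 < k" "real (Suc k) / real k \<le> s"
  shows "form_bounded V (\<lambda>\<delta>. (1 + (fact (Suc k))\<^sup>2 + \<delta>) * ((X + 1) / \<delta>) powr (1 / (s - 1)))"
  unfolding form_bounded_def
proof (intro allI impI conjI)
  fix a1 a2 L and \<delta> :: real assume gl: "gradlike a1 a2 L" and \<delta>: "0 < \<delta>"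
  show "0 \<le> (1 + (fact (Suc k))\<^sup>2 + \<delta>) * ((X + 1) / \<delta>) powr (1 / (s - 1))" using \<delta> by simp
  have "X \<le> \<delta> * (((X + 1) / \<delta>) powr (1 / (s - 1))) powr (s - 1)"
    using s \<delta> X(2) by (simp add: powr_powr)
  moreover have "0 < ((X + 1) / \<delta>) powr (1 / (s - 1))" using \<delta> X(2) by simp
  ultimately show "(\<integral>\<^sup>+x. ennreal (((a1 x)\<^sup>2 + (a2 x)\<^sup>2) * V x) \<partial>lborel)
     \<le> ennreal (\<delta> * (LBINT x. (L x)\<^sup>2)
        + (1 + (fact (Suc k))\<^sup>2 + \<delta>) * ((X + 1) / \<delta>) powr (1 / (s - 1)) * ((LBINT x. (a1 x)\<^sup>2) + (LBINT x. (a2 x)\<^sup>2)))"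
    by (intro form_bound[OF gl V s X k \<delta>])
qed

lemma esssup_le_iff:
  fixes f :: "'a \<Rightarrow> ennreal"
  assumes f: "f \<in> borel_measurable M"
  shows "esssup M f \<le> c \<longleftrightarrow> (AE x in M. f x \<le> c)"
proof
  assume c: "esssup M f \<le> c"
  have "AE x in M. f x \<le> esssup M f" by (rule esssup_AE)
  then show "AE x in M. f x \<le> c" by eventually_elim (rule order_trans[OF _ c])
qed (rule esssup_I[OF f])

text \<open>A sublevel set consists of the times at which the section of a fixed measurable set is
  null, and the measure of a section depends measurably on time.\<close>

lemma esssup_slice_measurable:
  fixes g :: "real \<times> (real^2) \<Rightarrow> real"
  assumes [measurable]: "g \<in> borel_measurable borel"
  shows "(\<lambda>t. esssup lborel (\<lambda>x. ennreal (slice g t x))) \<in> borel_measurable borel"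
proof (rule borel_measurableI_le)
  fix c :: ennreal
  have [measurable]: "g \<in> borel_measurable (borel \<Otimes>\<^sub>M borel)" by (simp add: borel_prod)
  have "(\<lambda>t. emeasure lborel (Pair t -` {w. \<not> ennreal (g w) \<le> c})) \<in> borel_measurable borel"
    using lborel.measurable_emeasure_Pair[of "{w. \<not> ennreal (g w) \<le> c}" borel] by (simp add: borel_prod)
  then have "{t. emeasure lborel (Pair t -` {w. \<not> ennreal (g w) \<le> c}) = 0} \<in> sets borel"
    by measurable
  moreover have "esssup lborel (\<lambda>x. ennreal (slice g t x)) \<le> c \<longleftrightarrow> emeasure lborel (Pair t -` {w. \<not> ennreal (g w) \<le> c}) = 0" for t
    by (subst esssup_le_iff, measurable, subst AE_iff_measurable[OF _ refl]) (auto simp: slice_def vimage_def)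
  ultimately show "{t \<in> space borel. esssup lborel (\<lambda>x. ennreal (slice g t x)) \<le> c} \<in> sets borel" by simp
qed

lemma ennreal_pow_measurable[measurable]:
  assumes [measurable]: "f \<in> borel_measurable M" shows "(\<lambda>x. ennreal_pow (f x) r) \<in> borel_measurable M"
  unfolding ennreal_pow_def by measurable

text \<open>The weight is a multiple of the q-th power of the spatial norm plus a constant on (0,
  T). For finite p the potential is g^2 with exponent s = p/2; for p infinite, where q = 2, the
  squared essential supremum bounds the potential directly.\<close>

lemma serrin_weight:
  fixes g :: "real \<times> (real^2) \<Rightarrow> real" and p q :: ennreal
  assumes [measurable]: "g \<in> borel_measurable borel" and g0: "\<And>w. 0 \<le> g w"
    and pq: "1 / p + 1 / q = 1 / 2" "2 \<le> q" "q < \<infinity>"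
    and fin: "Lp_ennorm q (restrict_space lborel {0<..<T}) (\<lambda>t. Lp_norm p lborel (slice g t)) < \<infinity>"
  obtains m where "integrable lborel m" "\<And>t. 0 \<le> m t"
    "AE t in lborel. t \<in> {0<..<T} \<longrightarrow> (\<exists>c. c 1 \<le> m t \<and> form_bounded (\<lambda>x. (slice g t x)\<^sup>2) c)"
proof -
  obtain q' where q': "q = ennreal q'" "2 \<le> q'"
    using pq(2,3) by (cases q) auto
  have iq: "1 / q = ennreal (1 / q')" using q' by (simp add: divide_ennreal flip: ennreal_1)
  have "(\<integral>\<^sup>+t. ennreal_pow (Lp_norm p lborel (slice g t)) q' \<partial>restrict_space lborel {0<..<T}) < \<infinity>"
    using fin q' by - (rule ennreal_pow_less_top[of _ "1 / q'"], simp add: Lp_ennorm_def)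
  then have fin': "(\<integral>\<^sup>+t. ennreal_pow (Lp_norm p lborel (slice g t)) q' * indicator {0<..<T} t \<partial>lborel) < \<infinity>"
    by (simp add: nn_integral_restrict_space)
  have int: "integrable lborel (\<lambda>t. indicator {0<..<T} t * enn2real (G t))"
      "AE t in lborel. t \<in> {0<..<T} \<longrightarrow> G t < \<infinity>"
    if [measurable]: "G \<in> borel_measurable borel" and G: "(\<integral>\<^sup>+t. G t * indicator {0<..<T} t \<partial>lborel) < \<infinity>" for G :: "real \<Rightarrow> ennreal"
  proof -
    have "AE t in lborel. G t * indicator {0<..<T} t \<noteq> \<infinity>" by (rule nn_integral_PInf_AE) (use G in auto)
    then show "AE t in lborel. t \<in> {0<..<T} \<longrightarrow> G t < \<infinity>" by eventually_elim (auto simp: less_top)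
    show "integrable lborel (\<lambda>t. indicator {0<..<T} t * enn2real (G t))"
    proof (rule integrableI_nonneg)
      have "ennreal (indicator {0<..<T} t * enn2real (G t)) \<le> G t * indicator {0<..<T} t" for t
        by (cases "G t") (auto simp: indicator_def)
      then have "(\<integral>\<^sup>+t. ennreal (indicator {0<..<T} t * enn2real (G t)) \<partial>lborel) \<le> (\<integral>\<^sup>+t. G t * indicator {0<..<T} t \<partial>lborel)"
        by (rule nn_integral_mono)
      also note G
      finally show "(\<integral>\<^sup>+t. ennreal (indicator {0<..<T} t * enn2real (G t)) \<partial>lborel) < \<infinity>" .
    qed auto
  qed
  show thesis
  proof (cases p)
    case top
    \<comment> \<open>In extended reals 1/p is 0 for infinite p, which forces q = 2.\<close>
    then have "ennreal (1 / q') = ennreal (1 / 2)" using pq(1) iq by (simp add: divide_ennreal flip: ennreal_1 ennreal_numeral)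
    then have "q' = 2" using q' by (subst (asm) ennreal_inj) auto
    define G where "G t = esssup lborel (\<lambda>x. ennreal (slice g t x))" for t
    have [measurable]: "G \<in> borel_measurable borel" unfolding G_def by (rule esssup_slice_measurable) fact
    have N: "Lp_norm p lborel (slice g t) = G t" for t
      using top g0 by (simp add: Lp_norm_def Lp_ennorm_def G_def slice_def)
    note i = int[of "\<lambda>t. (G t)\<^sup>2", OF _ fin'[unfolded N \<open>q' = 2\<close> ennreal_pow_2]]
    show thesis
    proof (rule that)
      show "integrable lborel (\<lambda>t. indicator {0<..<T} t * enn2real ((G t)\<^sup>2))" by (rule i) measurable
      have "AE t in lborel. t \<in> {0<..<T} \<longrightarrow> (G t)\<^sup>2 < \<infinity>" by (rule i) measurable
      then show "AE t in lborel. t \<in> {0<..<T} \<longrightarrow> (\<exists>c. c 1 \<le> indicator {0<..<T} t * enn2real ((G t)\<^sup>2) \<and> form_bounded (\<lambda>x. (slice g t x)\<^sup>2) c)"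
      proof eventually_elim
        case (elim t)
        show ?case
        proof
          assume t: "t \<in> {0<..<T}"
          then obtain a where a: "G t = ennreal a" "0 \<le> a" using elim by (cases "G t") auto
          have "AE x in lborel. ennreal (slice g t x) \<le> G t" unfolding G_def by (rule esssup_AE)
          then have "AE x in lborel. (slice g t x)\<^sup>2 \<le> enn2real ((G t)\<^sup>2)"
            by eventually_elim (use a g0 in \<open>auto simp: slice_def ennreal_power intro!: power_mono\<close>)
          then show "\<exists>c. c 1 \<le> indicator {0<..<T} t * enn2real ((G t)\<^sup>2) \<and> form_bounded (\<lambda>x. (slice g t x)\<^sup>2) c"
            using t by (intro exI[of _ "\<lambda>\<delta>. enn2real ((G t)\<^sup>2)"] conjI form_bounded_sup) auto
        qed
      qed
    qed simp
  next
    case (real p')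
    have p0: "0 < p'"
    proof (rule ccontr)
      assume "\<not> 0 < p'"
      then have "p = 0" using real by simp
      \<comment> \<open>Division by 0 gives infinity in extended reals, so p = 0 is incompatible
        with the relation between the exponents.\<close>
      then have "1 / p = top" by (simp add: divide_ennreal_def)
      then have "top = (1::ennreal) / 2" using pq(1) by simp
      also have "\<dots> = ennreal 1 / ennreal 2" by simp
      also have "\<dots> = ennreal (1 / 2)" by (rule divide_ennreal) auto
      finally show False using ennreal_neq_top by metis
    qed
    have "ennreal (1 / p' + 1 / q') = ennreal (1 / 2)"
      using pq(1) p0 q'(2) unfolding iq real by (simp add: divide_ennreal flip: ennreal_1 ennreal_numeral ennreal_plus)
    then have pq': "1 / p' + 1 / q' = 1 / 2" using p0 q'(2) by (subst (asm) ennreal_inj) auto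
    define s where "s = p' / 2"
    define r where "r = q' / p'"
    have p2: "2 < p'"
    proof -
      have "1 / p' < 1 / 2" using pq' q'(2) by (smt (verit) zero_less_divide_1_iff)
      then show ?thesis using p0 by (simp add: field_simps)
    qed
    have s1: "1 < s" using p2 by (simp add: s_def)
    \<comment> \<open>The relation between p and q says 2/(p - 2) = q/p. Hence the bound grows like
      \<open>X\<close> to the power q/p, where \<open>X\<close> is the p-th power of the norm: the
      q-th power of the norm.\<close>
    have rs: "1 / (s - 1) = r"
      using pq' p2 q'(2) by (simp add: s_def r_def field_simps)
    have r0: "0 < r" using p0 q'(2) by (simp add: r_def)
    \<comment> \<open>The condition 1 + 1/k \<le> s can be met because s is larger than 1; any k
      beyond 1/(s - 1) will do.\<close>
    obtain k :: nat where k: "0 < k" "real (Suc k) / real k \<le> s"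
    proof -
      obtain k :: nat where k': "1 / (s - 1) < real k" using reals_Archimedean2 by blast
      have k0: "0 < real k" using k' s1 by (smt (verit) zero_less_divide_1_iff)
      then have "1 < real k * (s - 1)" using k' s1 by (simp add: field_simps)
      then have "real (Suc k) / real k \<le> s" using k0 by (simp add: field_simps)
      then show thesis using k0 by (intro that[of k]) auto
    qed
    define X where "X t = (\<integral>\<^sup>+x. ennreal ((slice g t x)\<^sup>2 powr s) \<partial>lborel)" for t
    have [measurable]: "g \<in> borel_measurable (borel \<Otimes>\<^sub>M borel)" by (simp add: borel_prod)
    have [measurable]: "X \<in> borel_measurable borel" unfolding X_def slice_def by measurable
    have pw: "(slice g t x)\<^sup>2 powr s = (slice g t x) powr p'" for t x
    proof (cases "slice g t x = 0")
      case False
      then have "0 < slice g t x" using g0 by (simp add: slice_def order_less_le)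
      then have "(slice g t x)\<^sup>2 = (slice g t x) powr 2" using powr_realpow[of "slice g t x" 2] by simp
      then show ?thesis by (simp only: powr_powr) (simp add: s_def)
    qed simp
    have N: "ennreal_pow (Lp_norm p lborel (slice g t)) q' = ennreal_pow (X t) r" for t
    proof -
      have "Lp_norm p lborel (slice g t) = ennreal_pow (X t) (1 / p')"
        using g0 p0 unfolding X_def pw by (simp add: Lp_norm_def Lp_ennorm_def real ennreal_pow_def slice_def)
      then show ?thesis by (auto simp: ennreal_pow_def powr_powr r_def)
    qed
    note i = int[of "\<lambda>t. ennreal_pow (X t) r", OF _ fin'[unfolded N]]
    \<comment> \<open>The first factor is 1 + ((k + 1)!)^2 + \<delta> at \<delta> = 1; the second
      comes from (a + 1)^r being at most 2^r (a^r + 1).\<close>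
    define C :: real where "C = (2 + (fact (Suc k))\<^sup>2) * 2 powr r"
    have C0: "0 \<le> C" by (simp add: C_def)
    let ?m = "\<lambda>t. C * (indicator {0<..<T} t * enn2real (ennreal_pow (X t) r) + indicator {0<..<T} t)"
    show thesis
    proof (rule that)
      have "integrable lborel (indicat_real {0<..<T})" by (cases "0 \<le> T") (auto intro!: integrable_real_indicator)
      moreover have "integrable lborel (\<lambda>t. indicator {0<..<T} t * enn2real (ennreal_pow (X t) r))" by (rule i) measurable
      ultimately show "integrable lborel ?m" by simp
      show "0 \<le> ?m t" for t using C0 by simp
      have "AE t in lborel. t \<in> {0<..<T} \<longrightarrow> ennreal_pow (X t) r < \<infinity>" by (rule i) measurable
      then show "AE t in lborel. t \<in> {0<..<T} \<longrightarrow> (\<exists>c. c 1 \<le> ?m t \<and> form_bounded (\<lambda>x. (slice g t x)\<^sup>2) c)"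
      proof eventually_elim
        case (elim t)
        show ?case
        proof
          assume t: "t \<in> {0<..<T}"
          then have "X t < \<infinity>" using elim by (blast intro: ennreal_pow_less_top)
          then obtain a where a: "X t = ennreal a" "0 \<le> a" by (cases "X t") auto
          let ?c = "\<lambda>\<delta>. (1 + (fact (Suc k))\<^sup>2 + \<delta>) * ((a + 1) / \<delta>) powr (1 / (s - 1))"
          have "form_bounded (\<lambda>x. (slice g t x)\<^sup>2) ?c"
          proof (rule form_bounded_Lp[OF _ _ s1 _ a(2) k])
            show "(\<integral>\<^sup>+x. ennreal ((slice g t x)\<^sup>2 powr s) \<partial>lborel) \<le> ennreal a" using a by (simp add: X_def)
          qed auto
          moreover have "?c 1 \<le> ?m t"
          proof -
            have "(a + 1) powr r \<le> (2 * max a 1) powr r" using a r0 by (intro powr_mono2) auto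
            also have "\<dots> = 2 powr r * (max a 1) powr r" by (simp add: powr_mult)
            also have "\<dots> \<le> 2 powr r * (a powr r + 1)" by (intro mult_left_mono) (auto simp: max_def)
            finally have "(2 + (fact (Suc k))\<^sup>2) * (a + 1) powr r \<le> (2 + (fact (Suc k))\<^sup>2) * (2 powr r * (a powr r + 1))"
              by (intro mult_left_mono) auto
            then show ?thesis using t a unfolding rs by (simp add: C_def ennreal_pow_def mult.assoc del: fact_Suc)
          qed
          ultimately show "\<exists>c. c 1 \<le> ?m t \<and> form_bounded (\<lambda>x. (slice g t x)\<^sup>2) c" by (intro exI[of _ ?c] conjI)
        qed
      qed
    qed
  qed
qed

theorem theorem1p2:
  fixes T :: real and p q :: ennreal
    and \<psi>0 Z0 :: "real^2 \<Rightarrow> real"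
    and \<psi>1 Z1 \<psi>2 Z2 :: "real \<times> (real^2) \<Rightarrow> real"
  assumes "T > 0"
    and "initial_data \<psi>0 Z0"
    and "weak_solution T \<psi>0 Z0 \<psi>1 Z1"
    and "weak_solution T \<psi>0 Z0 \<psi>2 Z2"
    and "1 / p + 1 / q = 1 / 2" and "2 \<le> q" and "q < \<infinity>"
    and "in_LqLp q p T (\<lambda>z. (weak_laplacian T \<psi>2 z, gradient T Z2 z))"
  shows "AE t in lborel. t \<in> {0..T} \<longrightarrow>
    (AE x in lborel. magnetic_field T \<psi>1 Z1 (t, x) = magnetic_field T \<psi>2 Z2 (t, x))"
proof -
  interpret S1: hall_solution T \<psi>0 Z0 \<psi>1 Z1 using assms by unfold_locales
  interpret S2: hall_solution T \<psi>0 Z0 \<psi>2 Z2 using assms by unfold_locales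
  obtain K1 where K1: "0 \<le> K1" "AE t in lborel. (\<integral>\<^sup>+x. ennreal ((slice S1.a1 t x)\<^sup>2 + (slice S1.a2 t x)\<^sup>2 + (slice S1.Z t x)\<^sup>2) \<partial>lborel) \<le> ennreal K1"
    by (rule S1.sup_bound)
  obtain K2 where K2: "0 \<le> K2" "AE t in lborel. (\<integral>\<^sup>+x. ennreal ((slice S2.a1 t x)\<^sup>2 + (slice S2.a2 t x)\<^sup>2 + (slice S2.Z t x)\<^sup>2) \<partial>lborel) \<le> ennreal K2"
    by (rule S2.sup_bound)
  \<comment> \<open>Both solutions must share one bound, since \<open>hall_pair\<close> has a single
    parameter for it.\<close>
  define K where "K = max K1 K2"
  have K: "ennreal K1 \<le> ennreal K" "ennreal K2 \<le> ennreal K" "0 \<le> K" using K1 by (auto simp: K_def intro!: ennreal_leI)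
  interpret F1: hall_field T K S1.a1 S1.a2 S1.Z S1.L S1.Z1 S1.Z2
    by (rule S1.hall_field[OF _ K(3)]) (use K1(2) in eventually_elim, use K(1) order_trans in blast)
  interpret F2: hall_field T K S2.a1 S2.a2 S2.Z S2.L S2.Z1 S2.Z2
    by (rule S2.hall_field[OF _ K(3)]) (use K2(2) in eventually_elim, use K(2) order_trans in blast)
  \<comment> \<open>The modulus of the regular derivatives, cut off to be measurable on all of
    space-time; on (0, T) its square is the potential of \<open>hall_pair\<close>.\<close>
  define g where "g w = norm (indicator (slab T) w *\<^sub>R (weak_laplacian T \<psi>2 w, gradient T Z2 w))" for w
  have g: "slice g t x = norm (weak_laplacian T \<psi>2 (t, x), gradient T Z2 (t, x))" if "t \<in> {0<..<T}" for t x
    using that by (simp add: g_def slice_def slab_def)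
  obtain m where m: "integrable lborel m" "\<And>t. 0 \<le> m t"
    "AE t in lborel. t \<in> {0<..<T} \<longrightarrow> (\<exists>c. c 1 \<le> m t \<and> form_bounded (\<lambda>x. (slice g t x)\<^sup>2) c)"
  proof (rule serrin_weight[OF _ _ assms(5-7)])
    show "g \<in> borel_measurable borel"
      using measurable_compose[OF assms(8)[unfolded in_LqLp_def set_borel_measurable_def, THEN conjunct1] borel_measurable_norm]
      by (simp only: g_def[abs_def] measurable_lborel2)
    show "0 \<le> g w" for w by (simp add: g_def)
    have "(\<integral>\<^sup>+t. ennreal_pow (Lp_norm p lborel (slice g t)) (enn2real q) \<partial>restrict_space lborel {0<..<T})
      = (\<integral>\<^sup>+t. ennreal_pow (Lp_norm p lborel (\<lambda>x. (weak_laplacian T \<psi>2 (t, x), gradient T Z2 (t, x)))) (enn2real q) \<partial>restrict_space lborel {0<..<T})"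
      by (intro nn_integral_cong) (simp add: space_restrict_space Lp_norm_def g)
    then show "Lp_ennorm q (restrict_space lborel {0<..<T}) (\<lambda>t. Lp_norm p lborel (slice g t)) < \<infinity>"
      using assms(8) less_imp_neq[OF assms(7)] by (simp add: in_LqLp_def Lp_ennorm_def)
  qed (rule that)
  interpret hall_pair T K S1.a1 S1.a2 S1.Z S1.L S1.Z1 S1.Z2 S2.a1 S2.a2 S2.Z S2.L S2.Z1 S2.Z2 m
  proof unfold_locales
    have "(slice g t x)\<^sup>2 = (slice S2.L t x)\<^sup>2 + (slice S2.Z1 t x)\<^sup>2 + (slice S2.Z2 t x)\<^sup>2" if "t \<in> {0<..<T}" for t x
      using that by (simp add: g slice_on_slab norm_Pair norm_plane_square)
    with m(3) show "AE t in lborel. t \<in> {0<..<T} \<longrightarrow> (\<exists>c. c 1 \<le> m t \<and>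
       form_bounded (\<lambda>x. (slice S2.L t x)\<^sup>2 + (slice S2.Z1 t x)\<^sup>2 + (slice S2.Z2 t x)\<^sup>2) c)"
      by simp
  qed (fact m)+
  obtain N1 where N1: "AE t in lborel. t \<notin> N1"
    "((\<lambda>t. (LBINT x. slice S1.a1 t x * S1.c1 x) + (LBINT x. slice S1.a2 t x * S1.c2 x) + (LBINT x. slice S1.Z t x * Z0 x))
      \<longlongrightarrow> (LBINT x. (S1.c1 x)\<^sup>2) + (LBINT x. (S1.c2 x)\<^sup>2) + (LBINT x. (Z0 x)\<^sup>2)) (at 0 within {0<..<T} - N1)"
    by (rule S1.initial_trace)
  obtain N2 where N2: "AE t in lborel. t \<notin> N2"
    "((\<lambda>t. (LBINT x. slice S2.a1 t x * S1.c1 x) + (LBINT x. slice S2.a2 t x * S1.c2 x) + (LBINT x. slice S2.Z t x * Z0 x))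
      \<longlongrightarrow> (LBINT x. (S1.c1 x)\<^sup>2) + (LBINT x. (S1.c2 x)\<^sup>2) + (LBINT x. (Z0 x)\<^sup>2)) (at 0 within {0<..<T} - N2)"
    by (rule S2.initial_trace)
  have "AE t in lborel. t \<in> {0<..<T} \<longrightarrow> energy_gap t = 0"
    by (rule weak_strong_uniqueness[OF S1.initial_L2 S1.energy[folded F1.dissipation_def[abs_def]] S2.energy[folded F2.dissipation_def[abs_def]] N1(1) N2(1) N1(2) N2(2)])
  then show ?thesis
    using AE_lborel_singleton[of 0] AE_lborel_singleton[of T] S1.AE_L2_slices S2.AE_L2_slices
  proof eventually_elim
    case (elim t)
    show ?case
    proof
      assume "t \<in> {0..T}"
      then have t: "t \<in> {0<..<T}" using elim by auto
      have i: "integrable lborel (\<lambda>x. (slice S1.a1 t x - slice S2.a1 t x)\<^sup>2)" "integrable lborel (\<lambda>x. (slice S1.a2 t x - slice S2.a2 t x)\<^sup>2)"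
        "integrable lborel (\<lambda>x. (slice S1.Z t x - slice S2.Z t x)\<^sup>2)"
        using elim by (auto intro!: L2_integrable L2_diff)
      \<comment> \<open>The gap is a sum of nonnegative integrals, so each vanishes and the fields
        agree componentwise for almost every x.\<close>
      have "(LBINT x. (slice S1.a1 t x - slice S2.a1 t x)\<^sup>2) = 0 \<and> (LBINT x. (slice S1.a2 t x - slice S2.a2 t x)\<^sup>2) = 0
        \<and> (LBINT x. (slice S1.Z t x - slice S2.Z t x)\<^sup>2) = 0"
        using elim t unfolding energy_gap_def by (simp add: add_nonneg_eq_0_iff)
      then have "AE x in lborel. (slice S1.a1 t x - slice S2.a1 t x)\<^sup>2 = 0" "AE x in lborel. (slice S1.a2 t x - slice S2.a2 t x)\<^sup>2 = 0"
        "AE x in lborel. (slice S1.Z t x - slice S2.Z t x)\<^sup>2 = 0"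
        using i[THEN integral_nonneg_eq_0_iff_AE] by auto
      then show "AE x in lborel. magnetic_field T \<psi>1 Z1 (t, x) = magnetic_field T \<psi>2 Z2 (t, x)"
        by eventually_elim (use t in \<open>simp add: slice_on_slab magnetic_field_def perp_def\<close>)
    qed
  qed
qed

end
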